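(* Let $G$ be a compact, connected, simply connected, simple Lie group and let $\tau,\kappa\in\mathrm{Out}(G)\subset\mathrm{Aut}(G)$. Let $\mathrm{DH}_{D_\sigma(G)}$ and $\mathrm{DH}_{\mathbb D_\varphi(G)}$ denote the Duistermaat-Heckman measures of the twisted double $D_\sigma(G)$ (a $G\tau\kappa\times G\tau^{-1}\kappa^{-1}$-valued tq-Hamiltonian $G\times G$-space) and of its internal fusion, the fused double $\mathbb D_\varphi(G)$ (a $G[\tau,\kappa]$-valued tq-Hamiltonian $G$-space, $[\tau,\kappa]=\tau\kappa\tau^{-1}\kappa^{-1}$), where $\tau,\kappa$ are the values of the twists on the generators. Their Fourier coefficients are $$\langle\mathrm{DH}_{D_\sigma(G)},\tilde\chi_\lambda^{\tau\kappa}\otimes\tilde\chi_\mu^{\tau^{-1}\kappa^{-1}}\rangle=\delta_{\lambda\mu}\,\mathrm{vol}_G^2\qquad\text{for all }\lambda,\mu\in(\Lambda^*_+)^\kappa\cap(\Lambda^*_+)^\tau,$$ $$\langle\mathrm{DH}_{\mathbb D_\varphi(G)},\tilde\chi_\lambda^{[\tau,\kappa]}\rangle=(\dim V_\lambda)^{-1}\,\mathrm{vol}_G^2\qquad\text{for all }\lambda\in(\Lambda^*_+)^\kappa\cap(\Lambda^*_+)^\tau.$$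
   Context: $\mathrm{Out}(G)$ is identified with the group of Dynkin diagram automorphisms, viewed as a subgroup of $\mathrm{Aut}(G)$ (acting on Chevalley generators for simple roots by $e_{\pm\alpha}\mapsto e_{\pm\kappa(\alpha)}$). $B$ (also written $\cdot$) is an $\mathrm{Aut}(G)$-invariant inner product on $\mathfrak g$; $\mathrm{vol}_G$ is the Riemannian volume of $G$ for $B$. $\Lambda_+^*$ is the set of dominant weights, $(\Lambda^*_+)^\kappa$ its $\kappa$-fixed part. For $\lambda\in(\Lambda_+^* )^\kappa$, $(\rho_\lambda,V_\lambda)$ is the irreducible representation of highest weight $\lambda$ with highest weight vector $v_\lambda$, $\tilde\kappa_\lambda$ is the unique unitary operator with $\rho_\lambda(\kappa(g))=\tilde\kappa_\lambda\rho_\lambda(g)\tilde\kappa_\lambda^{-1}$ and $\tilde\kappa_\lambda v_\lambda=v_\lambda$, and $\tilde\chi_\lambda^\kappa(g)=\mathrm{tr}_{V_\lambda}(\tilde\kappa_\lambda\rho_\lambda(g))$. tq-Hamiltonian spaces and DH measures. Let $H$ be a compact, connected, simply connected Lie group (here $G$ or $G\times G$, with inner product $B$ or $B\oplus B$) and $\kappa\in\mathrm{Aut}(H)$. $H\kappa$ is $H$ with the action $\mathrm{Ad}^\kappa_g(h)=gh\kappa(g^{-1})$; $\theta^L,\theta^R$ are the Maurer-Cartan forms, $\eta=\frac1{12}[\theta^L,\theta^L]\cdot\theta^L$, $\xi_M(x)=\frac{d}{dt}|_{0}\exp(-t\xi)\cdot x$. An $H\kappa$-valued tq-Hamiltonian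 $H$-space is $(M,\omega,\Phi)$ with $M$ an $H$-manifold, $\omega\in\Omega^2(M)^H$, $\Phi:M\to H\kappa$ equivariant, $d\omega=\Phi^*\eta$, $\iota_{\xi_M}\omega=\frac12\Phi^*(\theta^L\cdot\kappa(\xi)+\theta^R\cdot\xi)$, and $\ker\omega_x\cap\ker(\Phi_*|_x)=0$. Let $\mathrm{Cl}(\mathfrak h)$ have relations $\xi\zeta+\zeta\xi=B(\xi,\zeta)$, $q:\wedge\mathfrak h\to\mathrm{Cl}(\mathfrak h)$ be the quantization map, $\tau_H:H\to\mathrm{Pin}(\mathfrak h)$ the lift of $\mathrm{Ad}$, $\tau_H(\kappa)\in\mathrm{Pin}(\mathfrak h)$ a lift of $\kappa\in\mathrm O(\mathfrak h)$, $\mathrm{vol}_{\mathfrak h}$ a generator of the top exterior power of $\mathfrak h$, $\star:\wedge\mathfrak h^*\to\wedge\mathfrak h$, $\phi\mapsto\iota(\phi)\mathrm{vol}_{\mathfrak h}$. With $\wedge T_g^*H\cong\wedge\mathfrak h^*$ via left-invariant forms put $(\psi_H^\kappa)_g=(q\circ\star)^{-1}(q(\mathrm{vol}_{\mathfrak h})\tau_H(\kappa)\tau_H(g))$. The Liouville form is $\Lambda_M=(e^\omega\Phi^*\psi_H^\kappa)_{[\mathrm{top}]}$ (a volume form), $\mathrm{DH}_\Phi=\Phi_*|\Lambda_M|$ is a measure on $H$, and $\langle\mathrm{DH}_\Phi,f\rangle=\int_Hf\,d\mathrm{DH}_\Phi$. The double $D_\sigma(G)$: the manifold $G\times G\ni(x,y)$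 (the twisted moduli space of the annulus with twist $\sigma_X=\tau$, $\sigma_Y=\kappa$ on two generating paths) with action $(g_1,g_2)\cdot(x,y)=(g_1x\tau(g_2^{-1}),g_2y\kappa(g_1^{-1}))$, moment map components $\Phi_1(x,y)=x\tau(y)$, $\Phi_2(x,y)=\tau^{-1}(x^{-1}\kappa^{-1}(y^{-1}))$, and 2-form $\omega_{D_\sigma}=-\frac12\big(\tau^{-1}(x^*\theta^L)\cdot y^*\theta^R+x^*\theta^R\cdot\kappa^{-1}(y^*\theta^L)\big)$. The fused double $\mathbb D_\varphi(G)$: the manifold $G\times G\ni(a,b)$ (the twisted moduli space of the one-holed torus, twist $\varphi_A=\tau$, $\varphi_B=\kappa$) with $G$ acting by the restriction to the diagonal $g_1=g_2=g$ of the $G\times G$-action $(g_1,g_2)\cdot(a,b)=(g_1a\tau(g_2^{-1}),g_2b\kappa(g_1^{-1}))$, i.e. $g\cdot(a,b)=(\mathrm{Ad}_g^\tau a,\mathrm{Ad}_g^\kappa b)$, moment map $\Phi=\Phi_1\cdot\tau\kappa(\Phi_2):G\times G\to G[\tau,\kappa]$, and 2-form $\omega_{D_\sigma}-\frac12\Phi_1^*\theta^L\cdot\Phi_2^*(\tau\kappa)^*\theta^R$ (with $x=a,y=b$). *)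

theory Defs
  imports
    "Jordan_Normal_Form.Schur_Decomposition"
    "HOL-Algebra.Group"
    "HOL-Analysis.Analysis"
begin

no_notation Matrix.scalar_prod (infix \<open>\<bullet>\<close> 70)

section \<open>Smooth manifolds\<close>

text \<open>
  A chart is a pair of an open set and a coordinate map, which is only meaningful on that set. Its
  inverse is \<^term>\<open>inv_into U \<phi>\<close>. Manifolds are whole types; Hausdorffness and second countability
  come from the type classes of the point type.
\<close>

type_synonym ('m, 'a) chart = "'m set \<times> ('m \<Rightarrow> 'a)"

definition chart_inv :: "('m, 'a) chart \<Rightarrow> 'a \<Rightarrow> 'm" where
  "chart_inv c = inv_into (fst c) (snd c)"

primrec Ck_on :: "nat \<Rightarrow> 'a::euclidean_space set \<Rightarrow> ('a \<Rightarrow> 'b::euclidean_space) \<Rightarrow> bool" where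
  "Ck_on 0 S f = continuous_on S f"
| "Ck_on (Suc k) S f =
    (f differentiable_on S \<and> (\<forall>v. Ck_on k S (\<lambda>x. frechet_derivative f (at x) v)))"

definition smooth_on :: "'a::euclidean_space set \<Rightarrow> ('a \<Rightarrow> 'b::euclidean_space) \<Rightarrow> bool" where
  "smooth_on S f \<longleftrightarrow> (\<forall>k. Ck_on k S f)"

definition smooth_map ::
    "('m::topological_space, 'a::euclidean_space) chart set \<Rightarrow>
     ('n::topological_space, 'b::euclidean_space) chart set \<Rightarrow> ('m \<Rightarrow> 'n) \<Rightarrow> bool" where
  "smooth_map A B f \<longleftrightarrow> continuous_on UNIV f \<and>
     (\<forall>c\<in>A. \<forall>d\<in>B. smooth_on (snd c ` (fst c \<inter> f -` fst d)) (snd d \<circ> f \<circ> chart_inv c))"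

definition smooth_atlas :: "('m::topological_space, 'a::euclidean_space) chart set \<Rightarrow> bool" where
  "smooth_atlas A \<longleftrightarrow>
     (\<Union>c\<in>A. fst c) = UNIV \<and>
     (\<forall>c\<in>A. open (fst c) \<and> open (snd c ` fst c) \<and>
        homeomorphism (fst c) (snd c ` fst c) (snd c) (chart_inv c)) \<and>
     (\<forall>c\<in>A. \<forall>d\<in>A. smooth_on (snd c ` (fst c \<inter> fst d)) (snd d \<circ> chart_inv c))"

definition prod_chart ::
    "('m, 'a) chart \<Rightarrow> ('n, 'b) chart \<Rightarrow> ('m \<times> 'n, 'a \<times> 'b) chart" where
  "prod_chart c d = (fst c \<times> fst d, map_prod (snd c) (snd d))"

definition prod_atlas ::
    "('m, 'a) chart set \<Rightarrow> ('n, 'b) chart set \<Rightarrow> ('m \<times> 'n, 'a \<times> 'b) chart set" where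
  "prod_atlas A B = {prod_chart c d | c d. c \<in> A \<and> d \<in> B}"

text \<open>
  The measure of a density: \<open>\<delta> c p\<close> is the value of the density at \<open>p\<close> on the coordinate frame of
  the chart \<open>c\<close>, that is, the coefficient of the density with respect to Lebesgue measure in \<open>c\<close>.
  For a top degree form \<open>\<Lambda>\<close> one takes the absolute value of its coefficient to get the
  measure \<open>|\<Lambda>|\<close>.
\<close>

definition density_measure ::
    "('m::topological_space, 'a::euclidean_space) chart set \<Rightarrow>
     (('m, 'a) chart \<Rightarrow> 'm \<Rightarrow> real) \<Rightarrow> 'm measure \<Rightarrow> bool" where
  "density_measure A \<delta> \<mu> \<longleftrightarrow> sets \<mu> = sets borel \<and>
     (\<forall>c\<in>A. \<forall>E\<in>sets borel. E \<subseteq> fst c \<longrightarrow>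
        emeasure \<mu> E = (\<integral>\<^sup>+u\<in>snd c ` E. ennreal (\<delta> c (chart_inv c u)) \<partial>lborel))"


section \<open>Lie groups\<close>

text \<open>
  Besides the smooth structure, the record contains a chart around the unit. Its differential
  identifies the Lie algebra (the tangent space at the unit) with the type \<open>'e\<close>. The inner product of
  \<open>'e\<close> plays the role of the inner product \<open>B\<close> of the Lie algebra: an arbitrary inner product
  is obtained by a linear change of this chart.
\<close>

record ('g, 'e) lie_group = "'g monoid" +
  atlas :: "('g, 'e) chart set"
  unit_chart :: "('g, 'e) chart"

definition prod_group ::
    "('g, 'e) lie_group \<Rightarrow> ('h, 'f) lie_group \<Rightarrow> ('g \<times> 'h, 'e \<times> 'f) lie_group" where
  "prod_group G H = \<lparr>partial_object.carrier = partial_object.carrier (G \<times>\<times> H), monoid.mult = monoid.mult (G \<times>\<times> H), monoid.one = monoid.one (G \<times>\<times> H),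
     atlas = prod_atlas (atlas G) (atlas H),
     unit_chart = prod_chart (unit_chart G) (unit_chart H)\<rparr>"

definition is_lie_group :: "('g::topological_space, 'e::euclidean_space) lie_group \<Rightarrow> bool" where
  "is_lie_group G \<longleftrightarrow> group G \<and> carrier G = UNIV \<and> smooth_atlas (atlas G) \<and>
     unit_chart G \<in> atlas G \<and> \<one>\<^bsub>G\<^esub> \<in> fst (unit_chart G) \<and>
     smooth_map (prod_atlas (atlas G) (atlas G)) (atlas G) (\<lambda>(x, y). x \<otimes>\<^bsub>G\<^esub> y) \<and>
     smooth_map (atlas G) (atlas G) (\<lambda>x. inv\<^bsub>G\<^esub> x)"

definition lie_Aut :: "('g::topological_space, 'e::euclidean_space) lie_group \<Rightarrow> ('g \<Rightarrow> 'g) set" where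
  "lie_Aut G = {\<alpha> \<in> iso G G. smooth_map (atlas G) (atlas G) \<alpha> \<and>
     smooth_map (atlas G) (atlas G) (inv_into UNIV \<alpha>)}"

definition lie_diff ::
    "('g, 'e::euclidean_space) lie_group \<Rightarrow> ('g \<Rightarrow> 'g) \<Rightarrow> 'e \<Rightarrow> 'e" where
  "lie_diff G \<alpha> = frechet_derivative (\<lambda>u. snd (unit_chart G) (\<alpha> (chart_inv (unit_chart G) u)))
     (at (snd (unit_chart G) \<one>\<^bsub>G\<^esub>))"

definition Ad :: "('g, 'e::euclidean_space) lie_group \<Rightarrow> 'g \<Rightarrow> 'e \<Rightarrow> 'e" where
  "Ad G g = lie_diff G (\<lambda>x. g \<otimes>\<^bsub>G\<^esub> x \<otimes>\<^bsub>G\<^esub> inv\<^bsub>G\<^esub> g)"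

definition unit_curve :: "('g, 'e::euclidean_space) lie_group \<Rightarrow> 'e \<Rightarrow> real \<Rightarrow> 'g" where
  "unit_curve G \<xi> s = chart_inv (unit_chart G) (snd (unit_chart G) \<one>\<^bsub>G\<^esub> + s *\<^sub>R \<xi>)"

definition lie_bracket :: "('g, 'e::euclidean_space) lie_group \<Rightarrow> 'e \<Rightarrow> 'e \<Rightarrow> 'e" where
  "lie_bracket G \<xi> \<zeta> = vector_derivative (\<lambda>s. Ad G (unit_curve G \<xi> s) \<zeta>) (at 0)"

definition simple_lie_algebra :: "('g, 'e::euclidean_space) lie_group \<Rightarrow> bool" where
  "simple_lie_algebra G \<longleftrightarrow> (\<exists>\<xi> \<zeta>. lie_bracket G \<xi> \<zeta> \<noteq> 0) \<and>
     (\<forall>I. subspace I \<and> (\<forall>\<xi>. \<forall>\<zeta>\<in>I. lie_bracket G \<xi> \<zeta> \<in> I) \<longrightarrow> I = {0} \<or> I = UNIV)"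

definition Aut_invariant_inner :: "('g::topological_space, 'e::euclidean_space) lie_group \<Rightarrow> bool" where
  "Aut_invariant_inner G \<longleftrightarrow>
     (\<forall>\<alpha>\<in>lie_Aut G. \<forall>\<xi> \<zeta>. lie_diff G \<alpha> \<xi> \<bullet> lie_diff G \<alpha> \<zeta> = \<xi> \<bullet> \<zeta>)"

text \<open>
  The pull-backs \<open>f\<^sup>*\<theta>\<^sup>L\<close>, \<open>f\<^sup>*\<theta>\<^sup>R\<close> of the Maurer-Cartan forms under a map \<open>f\<close> from a manifold
  to \<open>G\<close>, at the point \<open>p\<close>. Tangent vectors at \<open>p\<close> are given by their coordinates
  in a chart \<open>c\<close> around \<open>p\<close>. As \<open>f\<^sup>*\<theta>\<^sup>L\<close> is the composition of the tangent map of \<open>f\<close> with the left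
  trivialization, it is also the matrix of the tangent map of \<open>f\<close>.
\<close>

definition pull_thetaL ::
    "('g, 'e::euclidean_space) lie_group \<Rightarrow> ('m, 'a::euclidean_space) chart \<Rightarrow> ('m \<Rightarrow> 'g) \<Rightarrow>
     'm \<Rightarrow> 'a \<Rightarrow> 'e" where
  "pull_thetaL G c f p = frechet_derivative
     (\<lambda>u. snd (unit_chart G) (inv\<^bsub>G\<^esub> (f p) \<otimes>\<^bsub>G\<^esub> f (chart_inv c u))) (at (snd c p))"

definition pull_thetaR ::
    "('g, 'e::euclidean_space) lie_group \<Rightarrow> ('m, 'a::euclidean_space) chart \<Rightarrow> ('m \<Rightarrow> 'g) \<Rightarrow>
     'm \<Rightarrow> 'a \<Rightarrow> 'e" where
  "pull_thetaR G c f p = frechet_derivative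
     (\<lambda>u. snd (unit_chart G) (f (chart_inv c u) \<otimes>\<^bsub>G\<^esub> inv\<^bsub>G\<^esub> (f p))) (at (snd c p))"

definition dot_form :: "('a \<Rightarrow> 'e::euclidean_space) \<Rightarrow> ('a \<Rightarrow> 'e) \<Rightarrow> 'a \<Rightarrow> 'a \<Rightarrow> real" where
  "dot_form \<alpha> \<beta> u v = \<alpha> u \<bullet> \<beta> v - \<alpha> v \<bullet> \<beta> u"

definition basis_det :: "('a::euclidean_space \<Rightarrow> 'a \<Rightarrow> real) \<Rightarrow> real" where
  "basis_det M = (\<Sum>p | p permutes (Basis :: 'a set). of_int (sign p) * (\<Prod>b\<in>Basis. M b (p b)))"

definition riemannian_measure ::
    "('g::topological_space, 'e::euclidean_space) lie_group \<Rightarrow> 'g measure \<Rightarrow> bool" where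
  "riemannian_measure G = density_measure (atlas G)
     (\<lambda>c p. sqrt (basis_det (\<lambda>u v. pull_thetaL G c id p u \<bullet> pull_thetaL G c id p v)))"


section \<open>Dynkin diagram automorphisms and dominant weights\<close>

text \<open>
  Elements of the complexified Lie algebra are pairs: \<open>(x, y)\<close> stands for \<open>x + \<i> y\<close>. Linear forms on the
  Cartan subalgebra \<open>\<tt>\<close> are identified with elements of \<open>\<tt>\<close> through the inner product.
  Roots and weights are real, with the normalization in which the weight \<open>\<lambda>\<close> is the
  character \<open>exp h \<mapsto> exp (2 \<pi> \<i> \<langle>\<lambda>, h\<rangle>)\<close> of the maximal torus.
\<close>

definition cx_scale :: "complex \<Rightarrow> 'e::euclidean_space \<times> 'e \<Rightarrow> 'e \<times> 'e" where
  "cx_scale z e = (Re z *\<^sub>R fst e - Im z *\<^sub>R snd e, Re z *\<^sub>R snd e + Im z *\<^sub>R fst e)"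

definition cx_cnj :: "'e::euclidean_space \<times> 'e \<Rightarrow> 'e \<times> 'e" where
  "cx_cnj e = (fst e, - snd e)"

definition cx_bracket ::
    "('g, 'e::euclidean_space) lie_group \<Rightarrow> 'e \<times> 'e \<Rightarrow> 'e \<times> 'e \<Rightarrow> 'e \<times> 'e" where
  "cx_bracket G a b =
     (lie_bracket G (fst a) (fst b) - lie_bracket G (snd a) (snd b),
      lie_bracket G (fst a) (snd b) + lie_bracket G (snd a) (fst b))"

definition cartan_subalgebra :: "('g, 'e::euclidean_space) lie_group \<Rightarrow> 'e set \<Rightarrow> bool" where
  "cartan_subalgebra G \<tt> \<longleftrightarrow> subspace \<tt> \<and> (\<forall>h\<in>\<tt>. \<forall>k\<in>\<tt>. lie_bracket G h k = 0) \<and>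
     (\<forall>\<xi>. (\<forall>h\<in>\<tt>. lie_bracket G h \<xi> = 0) \<longrightarrow> \<xi> \<in> \<tt>)"

definition root_space ::
    "('g, 'e::euclidean_space) lie_group \<Rightarrow> 'e set \<Rightarrow> 'e \<Rightarrow> ('e \<times> 'e) set" where
  "root_space G \<tt> \<alpha> =
     {e. \<forall>h\<in>\<tt>. cx_bracket G (h, 0) e = cx_scale (2 * pi * \<i> * of_real (\<alpha> \<bullet> h)) e}"

definition roots :: "('g, 'e::euclidean_space) lie_group \<Rightarrow> 'e set \<Rightarrow> 'e set" where
  "roots G \<tt> = {\<alpha> \<in> \<tt>. \<alpha> \<noteq> 0 \<and> (\<exists>e. e \<noteq> 0 \<and> e \<in> root_space G \<tt> \<alpha>)}"

definition coroot :: "'e::euclidean_space \<Rightarrow> 'e" where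
  "coroot \<alpha> = (2 / (\<alpha> \<bullet> \<alpha>)) *\<^sub>R \<alpha>"

record 'e pinning =
  cartan :: "'e set"
  simple_roots :: "'e set"
  e_plus :: "'e \<Rightarrow> 'e \<times> 'e"
  e_minus :: "'e \<Rightarrow> 'e \<times> 'e"

definition positive_roots ::
    "('g, 'e::euclidean_space) lie_group \<Rightarrow> 'e pinning \<Rightarrow> 'e set" where
  "positive_roots G P = {\<alpha> \<in> roots G (cartan P).
     \<exists>n :: 'e \<Rightarrow> nat. \<alpha> = (\<Sum>\<beta>\<in>simple_roots P. real (n \<beta>) *\<^sub>R \<beta>)}"

text \<open>
  The Chevalley generators satisfy \<open>[e\<^sub>\<alpha>, e\<^sub>-\<^sub>\<alpha>] = h\<^sub>\<alpha>\<close> where \<open>[h\<^sub>\<alpha>, e\<^sub>\<alpha>] = 2 e\<^sub>\<alpha>\<close>,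
  i.e. \<open>h\<^sub>\<alpha> = \<alpha>\<^sup>\<or> / (2 \<pi> \<i>)\<close> in the present normalization of roots. They are adapted to
  the compact real form, so that the diagram automorphisms preserve the latter.
\<close>

definition is_pinning :: "('g, 'e::euclidean_space) lie_group \<Rightarrow> 'e pinning \<Rightarrow> bool" where
  "is_pinning G P \<longleftrightarrow>
     cartan_subalgebra G (cartan P) \<and>
     simple_roots P \<subseteq> roots G (cartan P) \<and> independent (simple_roots P) \<and>
     (\<forall>\<alpha>\<in>roots G (cartan P). \<alpha> \<in> positive_roots G P \<or> - \<alpha> \<in> positive_roots G P) \<and>
     (\<forall>\<alpha>\<in>simple_roots P.
        e_plus P \<alpha> \<in> root_space G (cartan P) \<alpha> \<and>
        e_minus P \<alpha> \<in> root_space G (cartan P) (- \<alpha>) \<and>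
        cx_bracket G (e_plus P \<alpha>) (e_minus P \<alpha>) =
          cx_scale (1 / (2 * pi * \<i>)) (coroot \<alpha>, 0) \<and>
        e_minus P \<alpha> = - cx_cnj (e_plus P \<alpha>))"

definition lie_Out ::
    "('g::topological_space, 'e::euclidean_space) lie_group \<Rightarrow> 'e pinning \<Rightarrow> ('g \<Rightarrow> 'g) set" where
  "lie_Out G P = {\<kappa> \<in> lie_Aut G. \<exists>\<pi>. bij_betw \<pi> (simple_roots P) (simple_roots P) \<and>
     (\<forall>\<alpha>\<in>simple_roots P. \<forall>\<beta>\<in>simple_roots P. coroot (\<pi> \<alpha>) \<bullet> \<pi> \<beta> = coroot \<alpha> \<bullet> \<beta>) \<and>
     (\<forall>\<alpha>\<in>simple_roots P.
        map_prod (lie_diff G \<kappa>) (lie_diff G \<kappa>) (e_plus P \<alpha>) = e_plus P (\<pi> \<alpha>) \<and>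
        map_prod (lie_diff G \<kappa>) (lie_diff G \<kappa>) (e_minus P \<alpha>) = e_minus P (\<pi> \<alpha>))}"

definition one_parameter_subgroup ::
    "('g::topological_space, 'e::euclidean_space) lie_group \<Rightarrow> 'e \<Rightarrow> (real \<Rightarrow> 'g) \<Rightarrow> bool" where
  "one_parameter_subgroup G \<xi> \<gamma> \<longleftrightarrow> continuous_on UNIV \<gamma> \<and>
     (\<forall>s t. \<gamma> (s + t) = \<gamma> s \<otimes>\<^bsub>G\<^esub> \<gamma> t) \<and>
     ((\<lambda>t. snd (unit_chart G) (\<gamma> t)) has_vector_derivative \<xi>) (at 0)"

definition integral_lattice ::
    "('g::topological_space, 'e::euclidean_space) lie_group \<Rightarrow> 'e set \<Rightarrow> 'e set" where
  "integral_lattice G \<tt> = {h \<in> \<tt>. \<exists>\<gamma>. one_parameter_subgroup G h \<gamma> \<and> \<gamma> 1 = \<one>\<^bsub>G\<^esub>}"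

definition dominant_weights ::
    "('g::topological_space, 'e::euclidean_space) lie_group \<Rightarrow> 'e pinning \<Rightarrow> 'e set" where
  "dominant_weights G P = {lam \<in> cartan P. (\<forall>h\<in>integral_lattice G (cartan P). lam \<bullet> h \<in> \<int>) \<and>
     (\<forall>\<alpha>\<in>simple_roots P. 0 \<le> lam \<bullet> \<alpha>)}"

definition fixed_weights ::
    "('g::topological_space, 'e::euclidean_space) lie_group \<Rightarrow> 'e pinning \<Rightarrow> ('g \<Rightarrow> 'g) \<Rightarrow> 'e set" where
  "fixed_weights G P \<kappa> = {lam \<in> dominant_weights G P. lie_diff G \<kappa> lam = lam}"


section \<open>Irreducible representations and twining characters\<close>

definition unitary_mat :: "nat \<Rightarrow> complex Matrix.mat \<Rightarrow> bool" where
  "unitary_mat n A \<longleftrightarrow> A \<in> carrier_mat n n \<and> mat_adjoint A * A = 1\<^sub>m n"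

definition unitary_rep ::
    "('g::topological_space, 'e) lie_group \<Rightarrow> nat \<Rightarrow> ('g \<Rightarrow> complex Matrix.mat) \<Rightarrow> bool" where
  "unitary_rep G n \<rho> \<longleftrightarrow> (\<forall>g. unitary_mat n (\<rho> g)) \<and>
     (\<forall>g h. \<rho> (g \<otimes>\<^bsub>G\<^esub> h) = \<rho> g * \<rho> h) \<and>
     (\<forall>i<n. \<forall>j<n. continuous_on UNIV (\<lambda>g. \<rho> g $$ (i, j)))"

definition irreducible_rep :: "nat \<Rightarrow> ('g \<Rightarrow> complex Matrix.mat) \<Rightarrow> bool" where
  "irreducible_rep n \<rho> \<longleftrightarrow> 0 < n \<and>
     (\<forall>W \<subseteq> carrier_vec n.
        0\<^sub>v n \<in> W \<and> (\<forall>v\<in>W. \<forall>w\<in>W. v + w \<in> W) \<and> (\<forall>z. \<forall>w\<in>W. z \<cdot>\<^sub>v w \<in> W) \<and>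
        (\<forall>g. \<forall>w\<in>W. \<rho> g *\<^sub>v w \<in> W) \<longrightarrow> W = {0\<^sub>v n} \<or> W = carrier_vec n)"

definition rep_diff ::
    "('g, 'e::euclidean_space) lie_group \<Rightarrow> nat \<Rightarrow> ('g \<Rightarrow> complex Matrix.mat) \<Rightarrow> 'e \<Rightarrow> complex Matrix.mat" where
  "rep_diff G n \<rho> \<xi> =
     Matrix.mat n n (\<lambda>ij. vector_derivative (\<lambda>s. \<rho> (unit_curve G \<xi> s) $$ ij) (at 0))"

definition highest_weight_vector ::
    "('g, 'e::euclidean_space) lie_group \<Rightarrow> 'e pinning \<Rightarrow> 'e \<Rightarrow> nat \<Rightarrow> ('g \<Rightarrow> complex Matrix.mat) \<Rightarrow>
     complex Matrix.vec \<Rightarrow> bool" where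
  "highest_weight_vector G P lam n \<rho> v \<longleftrightarrow> v \<in> carrier_vec n \<and> v \<noteq> 0\<^sub>v n \<and>
     (\<forall>h\<in>cartan P. rep_diff G n \<rho> h *\<^sub>v v = (2 * pi * \<i> * of_real (lam \<bullet> h)) \<cdot>\<^sub>v v) \<and>
     (\<forall>\<alpha>\<in>positive_roots G P. \<forall>e\<in>root_space G (cartan P) \<alpha>.
        rep_diff G n \<rho> (fst e) *\<^sub>v v + \<i> \<cdot>\<^sub>v (rep_diff G n \<rho> (snd e) *\<^sub>v v) = 0\<^sub>v n)"

definition twist_operator ::
    "nat \<Rightarrow> ('g \<Rightarrow> complex Matrix.mat) \<Rightarrow> complex Matrix.vec \<Rightarrow> ('g \<Rightarrow> 'g) \<Rightarrow> complex Matrix.mat \<Rightarrow> bool" where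
  "twist_operator n \<rho> v \<kappa> K \<longleftrightarrow> unitary_mat n K \<and>
     (\<forall>g. \<rho> (\<kappa> g) = K * \<rho> g * mat_adjoint K) \<and> K *\<^sub>v v = v"

text \<open>
  A choice, for each dominant weight \<open>\<lambda>\<close>, of a model of the irreducible representation with highest
  weight \<open>\<lambda>\<close> and of a highest weight vector, together with the (then uniquely determined)
  unitary operators implementing the diagram automorphisms that fix \<open>\<lambda>\<close>.
\<close>

record ('g, 'e) irreps =
  rdim :: "'e \<Rightarrow> nat"
  rep :: "'e \<Rightarrow> 'g \<Rightarrow> complex Matrix.mat"
  hvec :: "'e \<Rightarrow> complex Matrix.vec"
  twist :: "('g \<Rightarrow> 'g) \<Rightarrow> 'e \<Rightarrow> complex Matrix.mat"

definition is_irreps ::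
    "('g::topological_space, 'e::euclidean_space) lie_group \<Rightarrow> 'e pinning \<Rightarrow> ('g, 'e) irreps \<Rightarrow> bool"
  where
  "is_irreps G P R \<longleftrightarrow> (\<forall>lam\<in>dominant_weights G P.
     unitary_rep G (rdim R lam) (rep R lam) \<and> irreducible_rep (rdim R lam) (rep R lam) \<and>
     highest_weight_vector G P lam (rdim R lam) (rep R lam) (hvec R lam) \<and>
     (\<forall>\<kappa>\<in>lie_Out G P. lam \<in> fixed_weights G P \<kappa> \<longrightarrow>
        twist_operator (rdim R lam) (rep R lam) (hvec R lam) \<kappa> (twist R \<kappa> lam)))"

definition mat_trace :: "complex Matrix.mat \<Rightarrow> complex" where
  "mat_trace A = (\<Sum>i<dim_row A. A $$ (i, i))"

definition twining_character :: "('g, 'e) irreps \<Rightarrow> ('g \<Rightarrow> 'g) \<Rightarrow> 'e \<Rightarrow> 'g \<Rightarrow> complex" where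
  "twining_character R \<kappa> lam g = mat_trace (twist R \<kappa> lam * rep R lam g)"


section \<open>Exterior and Clifford algebras\<close>

text \<open>
  Elements of the exterior algebra and of the Clifford algebra of a Euclidean space are given by their
  coefficients with respect to the monomials \<open>b\<^sub>I = b\<^sub>1 \<and> \<dots> \<and> b\<^sub>k\<close>, respectively
  \<open>b\<^sub>I = b\<^sub>1 \<dots> b\<^sub>k\<close>, for the subsets \<open>I\<close> of the orthonormal basis, with factors in increasing order for an
  arbitrary but fixed linear order. The products differ only by the value
  of \<open>b \<cdot> b\<close>: it is \<open>0\<close> in the exterior algebra, and \<open>1/2\<close> in the Clifford algebra with
  relations \<open>\<xi>\<zeta> + \<zeta>\<xi> = \<langle>\<xi>, \<zeta>\<rangle>\<close>. The inner product identifies vectors with covectors,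
  so the same representation serves for the exterior algebra of the dual space, with
  the dual basis.
\<close>

type_synonym 'a mvec = "'a set \<Rightarrow> real"

definition mvecs :: "'a::euclidean_space mvec set" where
  "mvecs = {a. \<forall>I. \<not> I \<subseteq> Basis \<longrightarrow> a I = 0}"

definition basis_index :: "'a::euclidean_space \<Rightarrow> nat" where
  "basis_index = (SOME f. inj_on f (Basis :: 'a set))"

definition basis_list :: "'a::euclidean_space set \<Rightarrow> 'a list" where
  "basis_list I = sorted_key_list_of_set basis_index I"

definition reorder_sign :: "'a::euclidean_space set \<Rightarrow> 'a set \<Rightarrow> real" where
  "reorder_sign I J = (-1) ^ card {(i, j). i \<in> I \<and> j \<in> J \<and> basis_index j < basis_index i}"

definition mv_mult :: "real \<Rightarrow> 'a::euclidean_space mvec \<Rightarrow> 'a mvec \<Rightarrow> 'a mvec" where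
  "mv_mult q a b = (\<lambda>K. \<Sum>I\<in>Pow Basis. \<Sum>J\<in>Pow Basis.
     if K = (I - J) \<union> (J - I) then reorder_sign I J * q ^ card (I \<inter> J) * a I * b J else 0)"

abbreviation wedge :: "'a::euclidean_space mvec \<Rightarrow> 'a mvec \<Rightarrow> 'a mvec" where
  "wedge \<equiv> mv_mult 0"

abbreviation cl_mult :: "'a::euclidean_space mvec \<Rightarrow> 'a mvec \<Rightarrow> 'a mvec" where
  "cl_mult \<equiv> mv_mult (1 / 2)"

definition mv_one :: "'a::euclidean_space mvec" where
  "mv_one = (\<lambda>I. if I = {} then 1 else 0)"

definition of_vec :: "'a::euclidean_space \<Rightarrow> 'a mvec" where
  "of_vec v = (\<lambda>I. \<Sum>b\<in>Basis. if I = {b} then v \<bullet> b else 0)"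

text \<open>
  The quantization map from the exterior to the Clifford algebra is total antisymmetrization. As
  distinct basis vectors anticommute, it maps \<open>b\<^sub>I\<close> to \<open>b\<^sub>I\<close>.
\<close>

definition quantize :: "'a::euclidean_space mvec \<Rightarrow> 'a mvec" where
  "quantize a = a"

text \<open>
  The generator of the top exterior power. The form \<open>psi\<close> below does not depend on its scaling.
\<close>

definition top_vol :: "'a::euclidean_space mvec" where
  "top_vol = (\<lambda>I. if I = Basis then 1 else 0)"

definition contract :: "'a::euclidean_space \<Rightarrow> 'a mvec \<Rightarrow> 'a mvec" where
  "contract b a = (\<lambda>I. if b \<in> I \<or> b \<notin> Basis then 0 else reorder_sign {b} I * a (insert b I))"

text \<open>
  Contraction is extended to the exterior algebra of the dual space as an algebra homomorphism,
  \<open>\<iota>(\<phi> \<and> \<psi>) = \<iota>(\<phi>) \<circ> \<iota>(\<psi>)\<close>.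
\<close>

definition star :: "'a::euclidean_space mvec \<Rightarrow> 'a mvec" where
  "star \<phi> = (\<lambda>K. \<Sum>J\<in>Pow Basis. \<phi> J * foldr contract (basis_list J) top_vol K)"

definition Pin :: "'a::euclidean_space mvec set" where
  "Pin = {foldr cl_mult (map of_vec vs) mv_one | vs. \<forall>v\<in>set vs. cl_mult (of_vec v) (of_vec v) = mv_one}"

definition parity_aut :: "'a::euclidean_space mvec \<Rightarrow> 'a mvec" where
  "parity_aut a = (\<lambda>I. (-1) ^ card I * a I)"

definition pin_lift :: "('a::euclidean_space \<Rightarrow> 'a) \<Rightarrow> 'a mvec \<Rightarrow> bool" where
  "pin_lift A a \<longleftrightarrow> a \<in> Pin \<and>
     (\<forall>v. cl_mult (parity_aut a) (of_vec v) = cl_mult (of_vec (A v)) a)"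

definition Ad_lift ::
    "('g::topological_space, 'e::euclidean_space) lie_group \<Rightarrow> ('g \<Rightarrow> 'e mvec) \<Rightarrow> bool" where
  "Ad_lift H \<T> \<longleftrightarrow> (\<forall>g. pin_lift (Ad H g) (\<T> g)) \<and>
     (\<forall>g h. \<T> (g \<otimes>\<^bsub>H\<^esub> h) = cl_mult (\<T> g) (\<T> h)) \<and> (\<forall>I. continuous_on UNIV (\<lambda>g. \<T> g I))"

text \<open>
  Forms on a manifold are given by their values in the coordinate frames of charts: two-forms as
  bilinear maps, and general forms by coefficients as above.
\<close>

definition mv_of_form2 :: "('a::euclidean_space \<Rightarrow> 'a \<Rightarrow> real) \<Rightarrow> 'a mvec" where
  "mv_of_form2 w = (\<lambda>I. \<Sum>a\<in>Basis. \<Sum>b\<in>Basis.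
     if I = {a, b} \<and> basis_index a < basis_index b then w a b else 0)"

definition wedge_exp :: "'a::euclidean_space mvec \<Rightarrow> 'a mvec" where
  "wedge_exp w = (\<lambda>I. \<Sum>k\<le>DIM('a). ((wedge w ^^ k) mv_one) I / fact k)"

definition mv_pullback ::
    "('a::euclidean_space \<Rightarrow> 'b::euclidean_space) \<Rightarrow> 'b mvec \<Rightarrow> 'a mvec" where
  "mv_pullback A \<phi> = (\<lambda>I. \<Sum>J\<in>Pow Basis. \<phi> J *
     foldr wedge (map (\<lambda>j. of_vec (\<Sum>b\<in>Basis. (A b \<bullet> j) *\<^sub>R b)) (basis_list J)) mv_one I)"


section \<open>Duistermaat-Heckman measures\<close>

text \<open>
  \<open>\<T>\<close> is the lift \<open>\<tau>\<^sub>H\<close> of the adjoint action and \<open>k\<close> a lift of the twist. The value at \<open>g\<close> is an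
  element of the exterior algebra of the dual of the Lie algebra, which is the exterior algebra
  of the cotangent space at \<open>g\<close> by left-invariant forms.
\<close>

definition psi ::
    "('h \<Rightarrow> 'e::euclidean_space mvec) \<Rightarrow> 'e mvec \<Rightarrow> 'h \<Rightarrow> 'e mvec" where
  "psi \<T> k g = the_inv_into mvecs (quantize \<circ> star)
     (cl_mult (cl_mult (quantize top_vol) k) (\<T> g))"

record ('m, 'a, 'h) tq_space =
  manifold :: "('m, 'a) chart set"
  action :: "'h \<Rightarrow> 'm \<Rightarrow> 'm"
  form :: "('m, 'a) chart \<Rightarrow> 'm \<Rightarrow> 'a \<Rightarrow> 'a \<Rightarrow> real"
  moment :: "'m \<Rightarrow> 'h"

definition liouville_form ::
    "('h, 'e::euclidean_space) lie_group \<Rightarrow> ('h \<Rightarrow> 'e mvec) \<Rightarrow> 'e mvec \<Rightarrow>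
     ('m, 'a::euclidean_space, 'h) tq_space \<Rightarrow> ('m, 'a) chart \<Rightarrow> 'm \<Rightarrow> real" where
  "liouville_form H \<T> k X c p =
     wedge (wedge_exp (mv_of_form2 (form X c p)))
       (mv_pullback (pull_thetaL H c (moment X) p) (psi \<T> k (moment X p))) Basis"

definition DH_measure ::
    "('h::topological_space, 'e::euclidean_space) lie_group \<Rightarrow> ('h \<Rightarrow> 'h) \<Rightarrow>
     ('m::topological_space, 'a::euclidean_space, 'h) tq_space \<Rightarrow> 'h measure \<Rightarrow> bool" where
  "DH_measure H \<kappa> X \<nu> \<longleftrightarrow> (\<exists>\<T> k \<mu>. Ad_lift H \<T> \<and> pin_lift (lie_diff H \<kappa>) k \<and>
     density_measure (manifold X) (\<lambda>c p. \<bar>liouville_form H \<T> k X c p\<bar>) \<mu> \<and>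
     \<nu> = distr \<mu> borel (moment X))"


section \<open>The twisted double and its fusion\<close>

definition twisted_double ::
    "('g, 'e::euclidean_space) lie_group \<Rightarrow> ('g \<Rightarrow> 'g) \<Rightarrow> ('g \<Rightarrow> 'g) \<Rightarrow>
     ('g \<times> 'g, 'e \<times> 'e, 'g \<times> 'g) tq_space" where
  "twisted_double G \<tau> \<kappa> = \<lparr>
     manifold = prod_atlas (atlas G) (atlas G),
     action = (\<lambda>(g1, g2) (x, y).
       (g1 \<otimes>\<^bsub>G\<^esub> x \<otimes>\<^bsub>G\<^esub> \<tau> (inv\<^bsub>G\<^esub> g2), g2 \<otimes>\<^bsub>G\<^esub> y \<otimes>\<^bsub>G\<^esub> \<kappa> (inv\<^bsub>G\<^esub> g1))),
     form = (\<lambda>c p u v. - (1 / 2) *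
       (dot_form (lie_diff G (inv_into UNIV \<tau>) \<circ> pull_thetaL G c fst p) (pull_thetaR G c snd p) u v +
        dot_form (pull_thetaR G c fst p) (lie_diff G (inv_into UNIV \<kappa>) \<circ> pull_thetaL G c snd p) u v)),
     moment = (\<lambda>(x, y).
       (x \<otimes>\<^bsub>G\<^esub> \<tau> y,
        inv_into UNIV \<tau> (inv\<^bsub>G\<^esub> x \<otimes>\<^bsub>G\<^esub> inv_into UNIV \<kappa> (inv\<^bsub>G\<^esub> y))))\<rparr>"

definition fused_double ::
    "('g, 'e::euclidean_space) lie_group \<Rightarrow> ('g \<Rightarrow> 'g) \<Rightarrow> ('g \<Rightarrow> 'g) \<Rightarrow>
     ('g \<times> 'g, 'e \<times> 'e, 'g) tq_space" where
  "fused_double G \<tau> \<kappa> = (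
     let D = twisted_double G \<tau> \<kappa>; \<Phi>1 = fst \<circ> moment D; \<Phi>2 = snd \<circ> moment D
     in \<lparr>manifold = manifold D,
       action = (\<lambda>g. action D (g, g)),
       form = (\<lambda>c p u v. form D c p u v -
         (1 / 2) * dot_form (pull_thetaL G c \<Phi>1 p) (pull_thetaR G c (\<tau> \<circ> \<kappa> \<circ> \<Phi>2) p) u v),
       moment = (\<lambda>p. \<Phi>1 p \<otimes>\<^bsub>G\<^esub> \<tau> (\<kappa> (\<Phi>2 p)))\<rparr>)"

end

theory Submission
  imports Defs
begin

text \<open>
  In the left trivialisation, the moment map differential of either double is a pair of isometries applied to
  the Maurer-Cartan forms, and the two-form is such that contracting the exponential form with a basis
  turns it into right Clifford multiplication by vectors. The product of these vectors lifts a
  product of reflections which cancels the lift of \<open>Ad\<close> and of the twist occurring in \<open>\<psi>\<close>, so the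
  Liouville form is plus or minus the Riemannian density. Hence both measures are push-forwards of
  \<open>m \<otimes> m\<close> under the moment map, and the coefficients are integrals over \<open>G \<times> G\<close>.

  By Schur's lemma, the twist operators are determined by their action on the highest weight vector, hence are
  multiplicative in the automorphism. This turns the integrands into products of matrix coefficients,
  and Schur orthogonality applies. For different weights it needs that the representations are
  inequivalent, i.e. that the highest weight is unique. As the representations are only assumed continuous, they
  are first differentiated, after smoothing by convolution; on a connected group, irreducibility then passes
  to the Lie algebra.
\<close>

section \<open>Multivectors\<close>

text \<open>The normalisation v v = (v . v) / 2 of the Clifford algebra fits the two isometries per
  factor: if M and N are isometries and b is a unit vector, then (M b, N b) has squared length 2 and
  squares to one. So the moment map differential sends a suitable basis to generators of the Pin
  group. For each factor of the double these vectors span the graph of an isometry, and the product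
  of their reflections exchanges the two summands of the Lie algebra; the two factors together give
  a block diagonal isometry, which the lifts in \<psi> invert. Signs are never determined, because a
  Pin lift is only known up to sign and the measure is that of an absolute value. Fusion adds a
  two-form pulled back along the moment map differential, so the operator of the fused form factors
  through the exterior algebra of the pair. There the word of vectors may be traded for any word
  with the same product of reflections, and one is chosen that is adapted to adding the two
  summands. Inequivalence rests on adjointness of raising and lowering operators: a highest weight
  vector of another weight is orthogonal to all that the first one generates.\<close>

typedef (overloaded) 'a multivec = "mvecs :: 'a::euclidean_space mvec set"
  morphisms mv_coeff Abs_multivec
  by (rule exI[of _ "\<lambda>_. 0"]) (simp add: mvecs_def)

setup_lifting type_definition_multivec

instantiation multivec :: (euclidean_space) real_vector
begin

lift_definition zero_multivec :: "'a multivec" is "\<lambda>_. 0" by (simp add: mvecs_def)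
lift_definition plus_multivec :: "'a multivec \<Rightarrow> 'a multivec \<Rightarrow> 'a multivec" is "\<lambda>a b I. a I + b I"
  by (simp add: mvecs_def)
lift_definition minus_multivec :: "'a multivec \<Rightarrow> 'a multivec \<Rightarrow> 'a multivec" is "\<lambda>a b I. a I - b I"
  by (simp add: mvecs_def)
lift_definition uminus_multivec :: "'a multivec \<Rightarrow> 'a multivec" is "\<lambda>a I. - a I"
  by (simp add: mvecs_def)
lift_definition scaleR_multivec :: "real \<Rightarrow> 'a multivec \<Rightarrow> 'a multivec" is "\<lambda>r a I. r * a I"
  by (simp add: mvecs_def)

instance
proof
  fix a b c :: "'a multivec" and r s :: real
  show "a + b + c = a + (b + c)" by transfer (simp add: add.assoc)
  show "a + b = b + a" by transfer (simp add: add.commute)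
  show "0 + a = a" by transfer simp
  show "- a + a = 0" by transfer simp
  show "a - b = a + - b" by transfer simp
  show "r *\<^sub>R (a + b) = r *\<^sub>R a + r *\<^sub>R b" by transfer (simp add: distrib_left)
  show "(r + s) *\<^sub>R a = r *\<^sub>R a + s *\<^sub>R a" by transfer (simp add: distrib_right)
  show "r *\<^sub>R s *\<^sub>R a = (r * s) *\<^sub>R a" by transfer (simp add: mult.assoc)
  show "1 *\<^sub>R a = a" by transfer simp
qed

end

lemma mv_coeff_outside: "\<not> I \<subseteq> Basis \<Longrightarrow> mv_coeff a I = 0"
  using mv_coeff[of a] by (simp add: mvecs_def)

lemma mv_eqI: "(\<And>I. I \<subseteq> Basis \<Longrightarrow> mv_coeff a I = mv_coeff b I) \<Longrightarrow> a = b"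
  unfolding mv_coeff_inject[symmetric] fun_eq_iff by (metis mv_coeff_outside)

lemma mv_coeff_simps [simp]:
  "mv_coeff 0 I = 0" "mv_coeff (a + b) I = mv_coeff a I + mv_coeff b I"
  "mv_coeff (a - b) I = mv_coeff a I - mv_coeff b I" "mv_coeff (- a) I = - mv_coeff a I"
  "mv_coeff (r *\<^sub>R a) I = r * mv_coeff a I"
  by (transfer; simp)+

lemma mv_coeff_sum [simp]: "mv_coeff (\<Sum>x\<in>A. f x) I = (\<Sum>x\<in>A. mv_coeff (f x) I)"
  by (induction A rule: infinite_finite_induct) auto

text \<open>Subsets of the basis form a group under symmetric difference, and the product of the
  monomials of I and J is a multiple of the monomial of \<open>symd I J\<close>. Both algebras are
  twisted group algebras of this group, so associativity is a cocycle identity.\<close>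

definition symd :: "'a set \<Rightarrow> 'a set \<Rightarrow> 'a set" where
  "symd I J = (I - J) \<union> (J - I)"

lemma symd_subset: "I \<subseteq> A \<Longrightarrow> J \<subseteq> A \<Longrightarrow> symd I J \<subseteq> A"
  by (auto simp: symd_def)

text \<open>The elements common to I and J contribute a square to the right-hand side.\<close>

lemma prod_symd:
  fixes f :: "'b \<Rightarrow> real"
  assumes "finite I" "finite J" "\<And>i. f i * f i = 1"
  shows "prod f (symd I J) = prod f I * prod f J"
proof -
  have "prod f I * prod f J = prod f (I - J) * prod f (J - I) * (prod f (I \<inter> J) * prod f (I \<inter> J))"
    using prod.Int_Diff[OF assms(1), of f J] prod.Int_Diff[OF assms(2), of f I]
    by (simp add: Int_commute)
  also have "prod f (I \<inter> J) * prod f (I \<inter> J) = 1"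
    by (simp add: prod.distrib[symmetric] assms(3))
  also have "prod f (I - J) * prod f (J - I) = prod f (symd I J)"
    unfolding symd_def using assms by (intro prod.union_disjoint[symmetric]) auto
  finally show ?thesis by simp
qed

definition swap_sign :: "'a::euclidean_space \<Rightarrow> 'a \<Rightarrow> real" where
  "swap_sign i j = (if basis_index j < basis_index i then -1 else 1)"

lemma swap_sign_sq [simp]: "swap_sign i j * swap_sign i j = 1"
  by (simp add: swap_sign_def)

text \<open>The exponent in \<open>reorder_sign\<close> counts inversions between I and J. Written
  as a double product, the sign becomes multiplicative under \<open>symd\<close> in each
  argument.\<close>

lemma reorder_sign_prod:
  assumes "finite I" "finite J"
  shows "reorder_sign I J = (\<Prod>i\<in>I. \<Prod>j\<in>J. swap_sign i j)"
proof -
  have "(\<Prod>i\<in>I. \<Prod>j\<in>J. swap_sign i j) = (\<Prod>x\<in>I\<times>J. if basis_index (snd x) < basis_index (fst x) then -1 else 1)"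
    unfolding swap_sign_def by (simp add: prod.cartesian_product case_prod_beta)
  also have "\<dots> = (\<Prod>x\<in>{x\<in>I\<times>J. basis_index (snd x) < basis_index (fst x)}. -1)"
    using assms by (subst prod.inter_filter) auto
  also have "\<dots> = reorder_sign I J"
    unfolding reorder_sign_def prod_constant
    by (rule arg_cong[where f = "\<lambda>x. (-1) ^ card x"]) auto
  finally show ?thesis by simp
qed

lemma reorder_sign_sq [simp]: "reorder_sign I J * reorder_sign I J = 1"
  by (simp add: reorder_sign_def power_mult_distrib[symmetric])

lemma reorder_sign_left:
  assumes "finite I" "finite I'" "finite J"
  shows "reorder_sign (symd I I') J = reorder_sign I J * reorder_sign I' J"
proof -
  have "finite (symd I I')" using assms by (simp add: symd_def)
  then show ?thesis using assms
    by (simp add: reorder_sign_prod) (rule prod_symd, auto simp: prod.distrib[symmetric])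
qed

lemma reorder_sign_right:
  assumes "finite I" "finite J" "finite J'"
  shows "reorder_sign I (symd J J') = reorder_sign I J * reorder_sign I J'"
proof -
  have "finite (symd J J')" using assms by (simp add: symd_def)
  then show ?thesis using assms
    by (simp add: reorder_sign_prod prod_symd prod.distrib)
qed

lemma finite_subset_Basis: "I \<subseteq> Basis \<Longrightarrow> finite (I :: 'a::euclidean_space set)"
  by (rule finite_subset) auto

lemma inj_basis_index: "inj_on basis_index (Basis :: 'a::euclidean_space set)"
proof -
  have "\<exists>f :: 'a \<Rightarrow> nat. inj_on f Basis"
    using finite_imp_inj_to_nat_seg[OF finite_Basis] by blast
  then show ?thesis unfolding basis_index_def by (rule someI_ex)
qed

lemma swap_sign_flip: "b \<in> Basis \<Longrightarrow> c \<in> Basis \<Longrightarrow> b \<noteq> c \<Longrightarrow> swap_sign b c = - swap_sign c b"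
  using inj_onD[OF inj_basis_index, of b c] by (auto simp: swap_sign_def)

lemma swap_sign_same [simp]: "swap_sign b b = 1"
  by (simp add: swap_sign_def)

abbreviation "cmul q I J \<equiv> reorder_sign I J * q ^ card (I \<inter> J)"

text \<open>The signs are multiplicative in each argument. For the powers of q, the exponents on
  both sides count the elements that lie in at least two of I, J and K.\<close>

lemma cmul_cocycle:
  fixes q :: real
  assumes "finite I" "finite J" "finite K"
  shows "cmul q I J * cmul q (symd I J) K = cmul q J K * cmul q I (symd J K)"
proof -
  have fin: "finite (symd I J)" "finite (symd J K)"
    using assms by (auto simp: symd_def)
  have c1: "card (symd I J \<inter> K) + card (I \<inter> J) = card (symd I J \<inter> K \<union> (I \<inter> J))"
    using assms fin by (subst card_Un_disjoint) (auto simp: symd_def)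
  have c2: "card (I \<inter> symd J K) + card (J \<inter> K) = card (I \<inter> symd J K \<union> (J \<inter> K))"
    using assms fin by (subst card_Un_disjoint) (auto simp: symd_def)
  have "symd I J \<inter> K \<union> (I \<inter> J) = I \<inter> symd J K \<union> (J \<inter> K)"
    by (auto simp: symd_def)
  with c1 c2 have "card (I \<inter> J) + card (symd I J \<inter> K) = card (J \<inter> K) + card (I \<inter> symd J K)"
    by simp
  then have "q ^ card (I \<inter> J) * q ^ card (symd I J \<inter> K) = q ^ card (J \<inter> K) * q ^ card (I \<inter> symd J K)"
    by (simp add: power_add[symmetric])
  then show ?thesis
    using assms by (simp add: reorder_sign_left reorder_sign_right algebra_simps)
qed

lemma mv_mult_mvecs: "mv_mult q a b \<in> mvecs"
  unfolding mvecs_def mv_mult_def by (auto intro!: sum.neutral)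

lift_definition mvm :: "real \<Rightarrow> 'a::euclidean_space multivec \<Rightarrow> 'a multivec \<Rightarrow> 'a multivec" is mv_mult
  by (rule mv_mult_mvecs)

lemma symd_cancel: "symd I (symd I K) = K"
  by (auto simp: symd_def)

lemma mvm_coeff:
  assumes "K \<subseteq> Basis"
  shows "mv_coeff (mvm q a b) K = (\<Sum>I\<in>Pow Basis. cmul q I (symd I K) * mv_coeff a I * mv_coeff b (symd I K))"
proof -
  have "mv_coeff (mvm q a b) K = (\<Sum>I\<in>Pow Basis. \<Sum>J\<in>Pow Basis. if J = symd I K then cmul q I J * mv_coeff a I * mv_coeff b J else 0)"
    by (transfer, unfold mv_mult_def) (intro sum.cong refl, auto simp: symd_def)
  also have "\<dots> = (\<Sum>I\<in>Pow Basis. cmul q I (symd I K) * mv_coeff a I * mv_coeff b (symd I K))"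
    using assms by (intro sum.cong refl, subst sum.delta) (auto dest: symd_subset)
  finally show ?thesis .
qed

text \<open>For fixed I the substitution J = \<open>symd I L\<close> is an involution of the
  subsets. After it, both sides are sums of the same terms \<open>G I J\<close>, by the cocycle
  identity.\<close>

lemma mvm_assoc: "mvm q (mvm q a b) c = mvm q a (mvm q b c)"
proof (rule mv_eqI)
  fix K :: "'a set" assume K: "K \<subseteq> Basis"
  let ?P = "Pow (Basis :: 'a set)"
  define G where "G I J = cmul q I (symd I K) * cmul q J (symd J (symd I K)) * mv_coeff a I * mv_coeff b J * mv_coeff c (symd J (symd I K))" for I J
  have "mv_coeff (mvm q (mvm q a b) c) K = (\<Sum>L\<in>?P. \<Sum>I\<in>?P. G I (symd I L))"
    unfolding mvm_coeff[OF K]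
  proof (intro sum.cong refl)
    fix L assume L: "L \<in> ?P"
    have "cmul q L (symd L K) * (cmul q I (symd I L) * mv_coeff a I * mv_coeff b (symd I L)) * mv_coeff c (symd L K) = G I (symd I L)" if "I \<in> ?P" for I
    proof -
      have e: "symd (symd I L) (symd I K) = symd L K" "symd I (symd I L) = L" "symd (symd I L) (symd L K) = symd I K"
        by (auto simp: symd_def)
      have "finite I" "finite (symd I L)" "finite (symd L K)"
        using that L K by (simp_all add: finite_subset_Basis symd_subset)
      from cmul_cocycle[OF this, of q] show ?thesis
        unfolding G_def e by (simp add: mult_ac)
    qed
    then show "cmul q L (symd L K) * mv_coeff (mvm q a b) L * mv_coeff c (symd L K) = (\<Sum>I\<in>?P. G I (symd I L))"
      using L by (simp add: mvm_coeff sum_distrib_left sum_distrib_right)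
  qed
  also have "\<dots> = (\<Sum>I\<in>?P. \<Sum>L\<in>?P. G I (symd I L))" by (rule sum.swap)
  also have "\<dots> = (\<Sum>I\<in>?P. \<Sum>J\<in>?P. G I J)"
  proof (rule sum.cong[OF refl])
    fix I assume I: "I \<in> ?P"
    show "(\<Sum>L\<in>?P. G I (symd I L)) = (\<Sum>J\<in>?P. G I J)"
      by (rule sum.reindex_bij_witness[of _ "symd I" "symd I"]) (use I in \<open>simp_all add: symd_cancel symd_subset\<close>)
  qed
  also have "\<dots> = mv_coeff (mvm q a (mvm q b c)) K"
    unfolding mvm_coeff[OF K]
    by (intro sum.cong refl) (simp add: G_def mvm_coeff symd_subset K sum_distrib_left mult_ac)
  finally show "mv_coeff (mvm q (mvm q a b) c) K = mv_coeff (mvm q a (mvm q b c)) K" .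
qed

lemma mvm_add_left: "mvm q (a + b) c = mvm q a c + mvm q b c"
  and mvm_add_right: "mvm q a (b + c) = mvm q a b + mvm q a c"
  by (rule mv_eqI, simp add: mvm_coeff ring_distribs sum.distrib)+

lemma mvm_scale_left: "mvm q (r *\<^sub>R a) c = r *\<^sub>R mvm q a c"
  and mvm_scale_right: "mvm q a (r *\<^sub>R c) = r *\<^sub>R mvm q a c"
  by (rule mv_eqI, simp add: mvm_coeff sum_distrib_left mult_ac)+

lemma linear_mvm_right: "linear (mvm q a)"
  by (intro linearI) (simp_all add: mvm_add_right mvm_scale_right)
lemma linear_mvm_left: "linear (\<lambda>a. mvm q a b)"
  by (intro linearI) (simp_all add: mvm_add_left mvm_scale_left)

lift_definition mv1 :: "'a::euclidean_space multivec" is mv_one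
  by (auto simp: mvecs_def mv_one_def)
lift_definition mvv :: "'a::euclidean_space \<Rightarrow> 'a multivec" is of_vec
  by (auto simp: mvecs_def of_vec_def intro!: sum.neutral)
lift_definition mvtop :: "'a::euclidean_space multivec" is top_vol
  by (auto simp: mvecs_def top_vol_def)
lift_definition mvpar :: "'a::euclidean_space multivec \<Rightarrow> 'a multivec" is parity_aut
  by (auto simp: mvecs_def parity_aut_def)

lemma mv1_coeff: "mv_coeff mv1 I = (if I = {} then 1 else 0)"
  by transfer (simp add: mv_one_def)
lemma mvtop_coeff: "mv_coeff mvtop I = (if I = Basis then 1 else 0)"
  by transfer (simp add: top_vol_def)
lemma mvpar_coeff: "mv_coeff (mvpar a) I = (-1) ^ card I * mv_coeff a I"
  by transfer (simp add: parity_aut_def)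

section \<open>Exterior multiplication, contraction and their anticommutation relations\<close>

definition ext :: "'a::euclidean_space \<Rightarrow> 'a multivec \<Rightarrow> 'a multivec" where
  "ext v = mvm 0 (mvv v)"

lift_definition con1 :: "'a::euclidean_space \<Rightarrow> 'a multivec \<Rightarrow> 'a multivec" is
  "\<lambda>b a I. if I \<subseteq> Basis then contract b a I else 0"
  by (auto simp: mvecs_def)

text \<open>\<open>contract\<close> is meaningful for basis vectors only, whereas the contractions
  needed below are with vectors of other frames and with images under linear maps.\<close>

definition con :: "'a::euclidean_space \<Rightarrow> 'a multivec \<Rightarrow> 'a multivec" where
  "con v a = (\<Sum>b\<in>Basis. (v \<bullet> b) *\<^sub>R con1 b a)"

lemma con_coeff: "I \<subseteq> Basis \<Longrightarrow> mv_coeff (con v a) I =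
  (\<Sum>b\<in>Basis. (v \<bullet> b) * (if b \<in> I then 0 else reorder_sign {b} I * mv_coeff a (insert b I)))"
  unfolding con_def mv_coeff_sum mv_coeff_simps
  by (intro sum.cong refl, transfer) (simp add: contract_def)

lemma mvm_vec_coeff:
  assumes "K \<subseteq> Basis"
  shows "mv_coeff (mvm q (mvv v) a) K = (\<Sum>b\<in>Basis. (v \<bullet> b) * reorder_sign {b} K *
     (if b \<in> K then mv_coeff a (K - {b}) else q * mv_coeff a (insert b K)))"
proof -
  let ?P = "Pow (Basis :: 'a set)"
  have "mv_coeff (mvm q (mvv v) a) K = (\<Sum>I\<in>?P. cmul q I (symd I K) * mv_coeff (mvv v) I * mv_coeff a (symd I K))"
    by (rule mvm_coeff[OF assms])
  also have "\<dots> = (\<Sum>I\<in>?P. \<Sum>b\<in>Basis. if I = {b} then (v \<bullet> b) * (cmul q I (symd I K) * mv_coeff a (symd I K)) else 0)"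
    by (intro sum.cong refl, transfer) (auto simp: of_vec_def sum_distrib_left sum_distrib_right intro!: sum.cong)
  also have "\<dots> = (\<Sum>b\<in>Basis. \<Sum>I\<in>?P. if I = {b} then (v \<bullet> b) * (cmul q I (symd I K) * mv_coeff a (symd I K)) else 0)"
    by (rule sum.swap)
  also have "\<dots> = (\<Sum>b\<in>Basis. (v \<bullet> b) * (cmul q {b} (symd {b} K) * mv_coeff a (symd {b} K)))"
    by (intro sum.cong refl, subst sum.delta) auto
  also have "\<dots> = (\<Sum>b\<in>Basis. (v \<bullet> b) * reorder_sign {b} K *
     (if b \<in> K then mv_coeff a (K - {b}) else q * mv_coeff a (insert b K)))"
  proof (intro sum.cong refl)
    fix b :: 'a assume "b \<in> Basis"
    have fK: "finite K" using assms by (rule finite_subset_Basis)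
    have r: "reorder_sign {b} (symd {b} K) = reorder_sign {b} K"
      using fK by (simp add: reorder_sign_right) (simp add: reorder_sign_prod)
    have s: "symd {b} K = (if b \<in> K then K - {b} else insert b K)"
      by (auto simp: symd_def)
    have i: "{b} \<inter> symd {b} K = (if b \<in> K then {} else {b})"
      by (auto simp: symd_def)
    show "(v \<bullet> b) * (cmul q {b} (symd {b} K) * mv_coeff a (symd {b} K)) = (v \<bullet> b) * reorder_sign {b} K *
     (if b \<in> K then mv_coeff a (K - {b}) else q * mv_coeff a (insert b K))"
      unfolding r i by (simp add: s)
  qed
  finally show ?thesis .
qed

lemma ext_coeff: "K \<subseteq> Basis \<Longrightarrow> mv_coeff (ext v a) K = (\<Sum>b\<in>Basis. (v \<bullet> b) * (if b \<in> K then reorder_sign {b} K * mv_coeff a (K - {b}) else 0))"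
  unfolding ext_def by (subst mvm_vec_coeff) (auto intro!: sum.cong)

text \<open>A vector raises or lowers the degree by one; the parameter q, the square of a basis
  vector, enters only where a basis vector meets itself. The values 0 and 1/2 give the two algebras,
  and q = 1 is used later to read off properties of the contraction.\<close>

lemma mvm_vec: "mvm q (mvv v) a = ext v a + q *\<^sub>R con v a"
  unfolding mv_coeff_simps
proof (rule mv_eqI)
  fix I :: "'a set" assume "I \<subseteq> Basis"
  then show "mv_coeff (mvm q (mvv v) a) I = mv_coeff (ext v a + q *\<^sub>R con v a) I"
    apply (simp only: mvm_vec_coeff ext_coeff con_coeff mv_coeff_simps sum_distrib_left sum.distrib[symmetric])
    apply (rule sum.cong)
    apply simp
    apply auto
    done
qed

lemma mvv_coeff: "mv_coeff (mvv v) I = (\<Sum>b\<in>Basis. if I = {b} then v \<bullet> b else 0)"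
  by transfer (simp add: of_vec_def)
lemma mvv_add: "mvv (v + w) = mvv v + mvv w"
  by (rule mv_eqI, simp only: mvv_coeff mv_coeff_simps sum.distrib[symmetric], rule sum.cong, simp_all add: inner_add_left)
lemma mvv_scale: "mvv (r *\<^sub>R v) = r *\<^sub>R mvv v"
  by (rule mv_eqI) (auto simp: mvv_coeff sum_distrib_left intro!: sum.cong)

lemma linear_mvv: "linear mvv" by (intro linearI) (simp_all add: mvv_add mvv_scale)

lemma linear_ext: "linear (ext v)" unfolding ext_def by (rule linear_mvm_right)
lemma linear_ext_left: "linear (\<lambda>v. ext v a)" unfolding ext_def
  by (intro linearI) (simp_all add: mvv_add mvv_scale mvm_add_left mvm_scale_left)
lemma con1_add: "con1 b (x + y) = con1 b x + con1 b y"
  by transfer (auto simp: contract_def algebra_simps)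
lemma con1_scale: "con1 b (r *\<^sub>R x) = r *\<^sub>R con1 b x"
  by transfer (auto simp: contract_def algebra_simps)
lemma con_add: "con v (a + b) = con v a + con v b"
  by (simp add: con_def con1_add scaleR_add_right sum.distrib)
lemma con_scale: "con v (r *\<^sub>R a) = r *\<^sub>R con v a"
  by (simp add: con_def con1_scale scaleR_sum_right mult.commute)
lemma linear_con: "linear (con v)" by (intro linearI) (simp_all add: con_add con_scale)
lemma linear_con_left: "linear (\<lambda>v. con v a)"
  unfolding con_def by (intro linearI) (simp_all add: inner_add_left scaleR_add_left sum.distrib scaleR_sum_right)

lemma insert_sign:
  assumes "finite K" "c \<notin> K"
  shows "reorder_sign {b} (insert c K) = swap_sign b c * reorder_sign {b} K"
  using assms by (simp add: reorder_sign_prod)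

lemma con1_coeff: "I \<subseteq> Basis \<Longrightarrow> b \<in> Basis \<Longrightarrow>
    mv_coeff (con1 b a) I = (if b \<in> I then 0 else reorder_sign {b} I * mv_coeff a (insert b I))"
  by transfer (simp add: contract_def)

lemma ext1_coeff: "I \<subseteq> Basis \<Longrightarrow> b \<in> Basis \<Longrightarrow>
    mv_coeff (ext b a) I = (if b \<in> I then reorder_sign {b} I * mv_coeff a (I - {b}) else 0)"
proof -
  assume I: "I \<subseteq> Basis" and b: "b \<in> Basis"
  have "mv_coeff (ext b a) I = (\<Sum>c\<in>Basis. if c = b then (if c \<in> I then reorder_sign {c} I * mv_coeff a (I - {c}) else 0) else 0)"
    unfolding ext_coeff[OF I] using b by (intro sum.cong refl) (auto simp: inner_Basis)
  then show ?thesis using b by (simp add: sum.delta)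
qed

lemma con_Basis: "b \<in> Basis \<Longrightarrow> con b a = con1 b a"
proof -
  assume b: "b \<in> Basis"
  have "con b a = (\<Sum>c\<in>Basis. if c = b then con1 c a else 0)"
    unfolding con_def using b by (intro sum.cong refl) (auto simp: inner_Basis)
  then show ?thesis using b by (simp add: sum.delta)
qed

lemma con1_con1:
  assumes b: "b \<in> Basis" and c: "c \<in> Basis"
  shows "con1 b (con1 c a) = - con1 c (con1 b a)"
proof (rule mv_eqI)
  fix I :: "'a set" assume I: "I \<subseteq> Basis"
  have fin: "finite I" using I by (rule finite_subset_Basis)
  have i: "insert b I \<subseteq> Basis" "insert c I \<subseteq> Basis" using I b c by auto
  show "mv_coeff (con1 b (con1 c a)) I = mv_coeff (- con1 c (con1 b a)) I"
    using I b c i fin swap_sign_flip[OF b c]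
    by (auto simp: con1_coeff insert_sign insert_commute)
qed

lemma ext1_ext1:
  assumes b: "b \<in> Basis" and c: "c \<in> Basis"
  shows "ext b (ext c a) = - ext c (ext b a)"
proof (rule mv_eqI)
  fix I :: "'a set" assume I: "I \<subseteq> Basis"
  have fin: "finite I" using I by (rule finite_subset_Basis)
  have i: "I - {b} \<subseteq> Basis" "I - {c} \<subseteq> Basis" using I by auto
  have e: "c \<in> I \<Longrightarrow> b \<noteq> c \<Longrightarrow> reorder_sign {b} I = swap_sign b c * reorder_sign {b} (I - {c})" for b c
    using insert_sign[of "I - {c}" c b] fin by (simp add: insert_absorb)
  have d: "I - {b} - {c} = I - {c} - {b}" by auto
  show "mv_coeff (ext b (ext c a)) I = mv_coeff (- ext c (ext b a)) I"
    using I b c i fin swap_sign_flip[OF b c] e[of c b] e[of b c] d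
    by (auto simp: ext1_coeff)
qed

lemma con1_ext1:
  assumes b: "b \<in> Basis" and c: "c \<in> Basis"
  shows "con1 b (ext c a) = (if b = c then a else 0) - ext c (con1 b a)"
proof (rule mv_eqI)
  fix I :: "'a set" assume I: "I \<subseteq> Basis"
  have fin: "finite I" using I by (rule finite_subset_Basis)
  have i: "I - {c} \<subseteq> Basis" "insert b I \<subseteq> Basis" using I b by auto
  have e: "c \<in> I \<Longrightarrow> b \<noteq> c \<Longrightarrow> reorder_sign {b} I = swap_sign b c * reorder_sign {b} (I - {c})"
    using insert_sign[of "I - {c}" c b] fin by (simp add: insert_absorb)
  have d: "b \<noteq> c \<Longrightarrow> insert b (I - {c}) = insert b I - {c}" by auto
  have f: "b \<notin> I \<Longrightarrow> reorder_sign {c} (insert b I) = swap_sign c b * reorder_sign {c} I"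
    using insert_sign[of I b c] fin by simp
  have r: "b \<in> I \<Longrightarrow> reorder_sign {b} I = reorder_sign {b} (I - {b})"
    using insert_sign[of "I - {b}" b b] fin by (simp add: insert_absorb)
  have rr: "reorder_sign {b} I * (reorder_sign {b} I * x) = x" for x
    by (simp add: mult.assoc[symmetric])
  show "mv_coeff (con1 b (ext c a)) I = mv_coeff ((if b = c then a else 0) - ext c (con1 b a)) I"
  proof (cases "b = c")
    case True
    then show ?thesis using I b c i fin r f rr
      by (auto simp: ext1_coeff con1_coeff insert_absorb)
  next
    case False
    then show ?thesis using I b c i fin f e d swap_sign_flip[OF b c]
      by (auto simp: ext1_coeff con1_coeff)
  qed
qed

lemma bilinear_Basis_eqI:
  fixes F G :: "'a::euclidean_space \<Rightarrow> 'b::euclidean_space \<Rightarrow> 'c::real_vector"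
  assumes "\<And>v. linear (F v)" "\<And>w. linear (\<lambda>v. F v w)" "\<And>v. linear (G v)" "\<And>w. linear (\<lambda>v. G v w)"
    and "\<And>b c. b \<in> Basis \<Longrightarrow> c \<in> Basis \<Longrightarrow> F b c = G b c"
  shows "F v w = G v w"
proof -
  have "F b w = G b w" if "b \<in> Basis" for b
    using linear_eq_on_span[OF assms(1)[of b] assms(3)[of b], of Basis] assms(5)[OF that] by auto
  then show ?thesis
    using linear_eq_on_span[OF assms(2)[of w] assms(4)[of w], of Basis] by auto
qed

lemma linear_compose': "linear f \<Longrightarrow> linear g \<Longrightarrow> linear (\<lambda>x. f (g x))"
  using linear_compose[of g f] by (simp add: o_def)

lemmas ext_simps = linear_add[OF linear_ext] linear_scale[OF linear_ext] linear_add[OF linear_ext_left] linear_scale[OF linear_ext_left]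
  linear_diff[OF linear_ext] linear_neg[OF linear_ext] linear_diff[OF linear_ext_left] linear_neg[OF linear_ext_left] linear_0[OF linear_ext] linear_0[OF linear_ext_left]
lemmas con_simps = linear_add[OF linear_con] linear_scale[OF linear_con] linear_add[OF linear_con_left] linear_scale[OF linear_con_left]
  linear_diff[OF linear_con] linear_neg[OF linear_con] linear_diff[OF linear_con_left] linear_neg[OF linear_con_left] linear_0[OF linear_con] linear_0[OF linear_con_left]

lemma con_con: "con v (con w a) = - con w (con v a)"
  by (rule bilinear_Basis_eqI[where F = "\<lambda>v w. con v (con w a)" and G = "\<lambda>v w. - con w (con v a)"])
    (auto intro!: linearI con1_con1 simp: con_Basis con_simps)

lemma ext_ext: "ext v (ext w a) = - ext w (ext v a)"
  by (rule bilinear_Basis_eqI[where F = "\<lambda>v w. ext v (ext w a)" and G = "\<lambda>v w. - ext w (ext v a)"])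
    (auto intro!: linearI ext1_ext1 simp: ext_simps)

lemma con_ext: "con v (ext w a) = (v \<bullet> w) *\<^sub>R a - ext w (con v a)"
proof (rule bilinear_Basis_eqI[where F = "\<lambda>v w. con v (ext w a)" and G = "\<lambda>v w. (v \<bullet> w) *\<^sub>R a - ext w (con v a)"])
  fix b c :: 'a assume "b \<in> Basis" "c \<in> Basis"
  then show "con b (ext c a) = (b \<bullet> c) *\<^sub>R a - ext c (con b a)"
    by (simp add: con_Basis con1_ext1 inner_Basis)
qed (auto intro!: linearI simp: ext_simps con_simps inner_add_left inner_add_right algebra_simps)

section \<open>Monomials and the universal property of the exterior algebra\<close>

lemma linorder_insort_key: "linorder.insort_key ((\<le>) :: 'b::linorder \<Rightarrow> _) = (insort_key :: ('c \<Rightarrow> 'b) \<Rightarrow> _)"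
proof (intro HOL.ext)
  fix f :: "'c \<Rightarrow> 'b" and x xs
  show "linorder.insort_key (\<le>) f x xs = insort_key f x xs"
    by (induction xs) (simp_all add: linorder.insort_key.simps[OF linorder_class.linorder_axioms])
qed

text \<open>The key \<open>basis_index\<close> is injective on \<open>Basis\<close> only, so sorting
  by it is handled by the locale relative to a set. The rewrites identify the list of the locale
  with the one in \<open>basis_list\<close>.\<close>

interpretation basis_order: folding_insort_key "(\<le>) :: nat \<Rightarrow> nat \<Rightarrow> bool" "(<)" "Basis :: 'a::euclidean_space set" basis_index
  rewrites "linorder.sorted_key_list_of_set (\<le>) = (sorted_key_list_of_set :: ('a \<Rightarrow> nat) \<Rightarrow> _)"
    and "linorder.insort_key (\<le>) = (insort_key :: ('a \<Rightarrow> nat) \<Rightarrow> _)"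
proof -
  show "folding_insort_key (\<le>) (<) (Basis :: 'a::euclidean_space set) basis_index"
    by unfold_locales (rule inj_basis_index)
  show "linorder.sorted_key_list_of_set (\<le>) = (sorted_key_list_of_set :: ('a \<Rightarrow> nat) \<Rightarrow> _)"
    unfolding sorted_key_list_of_set_def linorder.sorted_key_list_of_set_def[OF linorder_class.linorder_axioms]
      linorder_insort_key ..
qed (rule linorder_insort_key)

lemma basis_list_empty [simp]: "basis_list {} = []"
  unfolding basis_list_def by simp

lemma basis_list_insert:
  "insert b J \<subseteq> (Basis :: 'a::euclidean_space set) \<Longrightarrow> b \<notin> J \<Longrightarrow>
    basis_list (insert b J) = insort_key basis_index b (basis_list J)"
  unfolding basis_list_def
  by (rule basis_order.sorted_key_list_of_set_insert) (auto intro: finite_subset_Basis)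

lemma set_basis_list: "J \<subseteq> (Basis :: 'a::euclidean_space set) \<Longrightarrow> set (basis_list J) = J"
  unfolding basis_list_def
  by (rule basis_order.set_sorted_key_list_of_set) (auto intro: finite_subset_Basis)

lemma sorted_basis_list: "J \<subseteq> (Basis :: 'a::euclidean_space set) \<Longrightarrow> sorted (map basis_index (basis_list J))"
  unfolding basis_list_def
  by (rule basis_order.sorted_sorted_key_list_of_set)

lemma distinct_basis_list: "J \<subseteq> (Basis :: 'a::euclidean_space set) \<Longrightarrow> distinct (basis_list J)"
  unfolding basis_list_def
  using basis_order.distinct_sorted_key_list_of_set[of J] by (simp add: distinct_map)

text \<open>Moving the operator of b to the front past one of smaller index costs one sign, which is
  one factor of \<open>reorder_sign {b}\<close>. The statement is for any anticommuting family
  because it serves \<open>ext\<close>, \<open>con\<close> and the operators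
  \<open>ext (transp A j)\<close> alike.\<close>

lemma foldr_insort_sign:
  fixes f :: "'a::euclidean_space \<Rightarrow> 'm::real_vector \<Rightarrow> 'm"
  assumes lin: "\<And>v. linear (f v)" and anti: "\<And>v w x. f v (f w x) = - f w (f v x)"
    and "sorted (map basis_index l)" "distinct l" "set l \<subseteq> Basis" "b \<in> Basis" "b \<notin> set l"
  shows "foldr f (insort_key basis_index b l) x = reorder_sign {b} (set l) *\<^sub>R f b (foldr f l x)"
  using assms(3-)
proof (induction l)
  case Nil
  then show ?case by (simp add: reorder_sign_prod)
next
  case (Cons a l)
  show ?case
  proof (cases "basis_index b \<le> basis_index a")
    case True
    have "(\<Prod>j\<in>set (a # l). swap_sign b j) = 1"
      using Cons.prems True by (intro prod.neutral) (auto simp: swap_sign_def)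
    then have "reorder_sign {b} (set (a # l)) = 1" by (simp add: reorder_sign_prod del: prod.insert list.set)
    then show ?thesis using True by (simp del: list.set)
  next
    case False
    have IH: "foldr f (insort_key basis_index b l) x = reorder_sign {b} (set l) *\<^sub>R f b (foldr f l x)"
      using Cons by auto
    have "foldr f (insort_key basis_index b (a # l)) x = reorder_sign {b} (set l) *\<^sub>R f a (f b (foldr f l x))"
      using False by (simp add: IH linear_scale[OF lin])
    also have "f a (f b (foldr f l x)) = - f b (f a (foldr f l x))" by (rule anti)
    also have "reorder_sign {b} (set l) *\<^sub>R - f b (f a (foldr f l x)) = (- reorder_sign {b} (set l)) *\<^sub>R f b (f a (foldr f l x))"
      by simp
    also have "- reorder_sign {b} (set l) = reorder_sign {b} (set (a # l))"
      using False Cons.prems insert_sign[of "set l" a b] by (simp add: swap_sign_def)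
    finally show ?thesis by simp
  qed
qed

lemma foldr_basis_list_insert:
  fixes f :: "'a::euclidean_space \<Rightarrow> 'm::real_vector \<Rightarrow> 'm"
  assumes "\<And>v. linear (f v)" "\<And>v w x. f v (f w x) = - f w (f v x)"
    and "insert b J \<subseteq> Basis" "b \<notin> J"
  shows "foldr f (basis_list (insert b J)) x = reorder_sign {b} J *\<^sub>R f b (foldr f (basis_list J) x)"
  using assms(3,4) foldr_insort_sign[of f "basis_list J" b x, OF assms(1,2)]
  by (simp add: basis_list_insert set_basis_list sorted_basis_list distinct_basis_list)

text \<open>The case v = w of the anticommutation relation shows that each operator squares to zero;
  the outer one is moved until it meets its equal.\<close>

lemma foldr_anti_mem:
  fixes f :: "'a \<Rightarrow> 'm::real_vector \<Rightarrow> 'm"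
  assumes lin: "\<And>v. linear (f v)" and anti: "\<And>v w x. f v (f w x) = - f w (f v x)" and "b \<in> set l"
  shows "f b (foldr f l x) = 0"
  using assms(3)
proof (induction l)
  case (Cons a l)
  have self: "f a (f a y) = 0" for y
    using anti[of a a y] by (simp add: eq_neg_iff_add_eq_0 flip: scaleR_2)
  then show ?case using Cons anti[of b a] by (auto simp: linear_0[OF lin])
qed simp

definition mvb :: "'a::euclidean_space set \<Rightarrow> 'a multivec" where
  "mvb J = foldr ext (basis_list J) mv1"

lemma mvb_coeff: "J \<subseteq> Basis \<Longrightarrow> I \<subseteq> Basis \<Longrightarrow> mv_coeff (mvb J) I = (if I = J then 1 else 0)"
proof (induction "card J" arbitrary: J I)
  case 0
  then show ?case using finite_subset_Basis[of J] by (simp add: mvb_def mv1_coeff)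
next
  case (Suc n)
  then obtain b J' where J: "J = insert b J'" "b \<notin> J'" "card J' = n"
    by (metis card_Suc_eq)
  have fin: "finite J'" using Suc J finite_subset_Basis by auto
  have e: "mvb J = reorder_sign {b} J' *\<^sub>R ext b (mvb J')"
    unfolding mvb_def J(1) using Suc J
    by (intro foldr_basis_list_insert linear_ext ext_ext) auto
  have r: "reorder_sign {b} J = reorder_sign {b} J'"
    unfolding J(1) using J(2) fin by (simp add: insert_sign)
  have "mv_coeff (mvb J') (I - {b}) = (if I - {b} = J' then 1 else 0)"
    using Suc.prems J by (intro Suc.hyps(1)) auto
  moreover have "b \<in> I \<Longrightarrow> I - {b} = J' \<longleftrightarrow> I = J" using J by auto
  moreover have "b \<notin> I \<Longrightarrow> I \<noteq> J" using J by auto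
  moreover have "b \<in> Basis" using Suc.prems J by auto
  ultimately show ?case unfolding e using Suc.prems(2) r
    by (cases "b \<in> I"; cases "I = J") (simp_all add: ext1_coeff mult.assoc[symmetric])
qed

lemma mv_decomp: "a = (\<Sum>J\<in>Pow Basis. mv_coeff a J *\<^sub>R mvb J)"
proof (rule mv_eqI)
  fix I :: "'a set" assume I: "I \<subseteq> Basis"
  have "mv_coeff (\<Sum>J\<in>Pow Basis. mv_coeff a J *\<^sub>R mvb J) I = (\<Sum>J\<in>Pow Basis. if J = I then mv_coeff a J else 0)"
    unfolding mv_coeff_sum mv_coeff_simps using I by (intro sum.cong refl) (simp add: mvb_coeff)
  then show "mv_coeff a I = mv_coeff (\<Sum>J\<in>Pow Basis. mv_coeff a J *\<^sub>R mvb J) I"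
    using I by (simp add: sum.delta)
qed

text \<open>The exterior algebra is generated from the unit by exterior multiplication. In the last
  case x does not involve b, which is recorded as \<open>con b x = 0\<close>;
  \<open>mvm_vec_right\<close> relies on this.\<close>

lemma multivec_induct [case_names one add scale ext]:
  fixes a :: "'a::euclidean_space multivec"
  assumes one: "P mv1" and add: "\<And>x y. P x \<Longrightarrow> P y \<Longrightarrow> P (x + y)"
    and scale: "\<And>r x. P x \<Longrightarrow> P (r *\<^sub>R x)"
    and ext: "\<And>b x. b \<in> Basis \<Longrightarrow> P x \<Longrightarrow> con b x = 0 \<Longrightarrow> P (ext b x)"
  shows "P a"
proof -
  have P0: "P 0" using scale[OF one, of 0] by simp
  have c0: "con b (mvb J) = 0" if "J \<subseteq> Basis" "b \<in> Basis" "b \<notin> J" for J :: "'a set" and b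
    by (rule mv_eqI) (use that in \<open>auto simp: con_Basis con1_coeff mvb_coeff\<close>)
  have mvb: "P (mvb J)" if "J \<subseteq> Basis" for J
    using finite_subset_Basis[OF that] that
  proof (induction J)
    case empty
    then show ?case by (simp add: mvb_def one)
  next
    case (insert b J)
    have "mvb (insert b J) = reorder_sign {b} J *\<^sub>R ext b (mvb J)"
      unfolding mvb_def using insert by (intro foldr_basis_list_insert linear_ext ext_ext) auto
    then show ?case using insert c0[of J b] by (auto intro!: scale ext)
  qed
  have "P (\<Sum>J\<in>S. mv_coeff a J *\<^sub>R mvb J)" if "S \<subseteq> Pow Basis" for S
    using finite_subset[OF that] that
    by (induction S) (auto intro!: P0 add scale mvb)
  from this[of "Pow Basis"] show ?thesis using mv_decomp[of a] by simp
qed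

lemma linear_eq_multivec:
  fixes F G :: "'a::euclidean_space multivec \<Rightarrow> 'm::real_vector"
  assumes "linear F" "linear G" "F mv1 = G mv1"
    "\<And>b x. b \<in> Basis \<Longrightarrow> F x = G x \<Longrightarrow> con b x = 0 \<Longrightarrow> F (ext b x) = G (ext b x)"
  shows "F a = G a"
  using assms(3,4)
  by (induction a rule: multivec_induct)
    (auto simp: linear_add[OF assms(1)] linear_add[OF assms(2)] linear_scale[OF assms(1)] linear_scale[OF assms(2)])

lemma ext_empty [simp]: "mv_coeff (ext v a) {} = 0"
  by (subst ext_coeff) auto

lemma con_mv1 [simp]: "con v mv1 = 0"
  by (rule mv_eqI) (auto simp: con_coeff mv1_coeff)

lemma linear_sum_coeff:
  "(\<And>J. J \<in> S \<Longrightarrow> linear (f J)) \<Longrightarrow> linear (\<lambda>a. \<Sum>J\<in>S. f J a)"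
  by (rule linear_compose_sum) auto

lemma linear_coeff_scale: "linear (\<lambda>a. mv_coeff a J *\<^sub>R x)"
  by (intro linearI) (simp_all add: scaleR_add_left)

section \<open>The star operator\<close>

definition starm :: "'a::euclidean_space multivec \<Rightarrow> 'a multivec" where
  "starm a = (\<Sum>J\<in>Pow Basis. mv_coeff a J *\<^sub>R foldr con (basis_list J) mvtop)"

lemma linear_starm: "linear starm"
  unfolding starm_def by (intro linear_sum_coeff linear_coeff_scale)

lemma fun_of_mvb:
  fixes h :: "'a::euclidean_space set \<Rightarrow> 'm::real_vector"
  assumes "J \<subseteq> Basis"
  shows "(\<Sum>I\<in>Pow Basis. mv_coeff (mvb J) I *\<^sub>R h I) = h J"
proof -
  have "(\<Sum>I\<in>Pow Basis. mv_coeff (mvb J) I *\<^sub>R h I) = (\<Sum>I\<in>Pow Basis. if I = J then h I else 0)"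
    by (intro sum.cong refl) (use assms in \<open>auto simp: mvb_coeff\<close>)
  then show ?thesis using assms by (simp add: sum.delta)
qed

lemma mvb_empty: "mvb {} = mv1" by (simp add: mvb_def)

text \<open>The universal property of the exterior algebra: a linear family of anticommuting
  operators makes the target a module over it, and F is the action on x0. The star operator arises
  from \<open>con\<close> and the volume element, the pull-back from \<open>ext (transp A j)\<close>
  and the unit.\<close>

lemma foldr_ext_hom:
  fixes f :: "'a::euclidean_space \<Rightarrow> 'm::real_vector \<Rightarrow> 'm" and x0 :: 'm
  assumes lin: "\<And>v. linear (f v)" and anti: "\<And>v w x. f v (f w x) = - f w (f v x)"
    and linv: "\<And>x. linear (\<lambda>v. f v x)"
  defines "F \<equiv> \<lambda>a. \<Sum>J\<in>Pow Basis. mv_coeff a J *\<^sub>R foldr f (basis_list J) x0"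
  shows "F (ext v a) = f v (F a)" and "F mv1 = x0" and "linear F"
proof -
  show linF: "linear F"
    unfolding F_def by (intro linear_sum_coeff linear_coeff_scale)
  have Fb: "F (mvb J) = foldr f (basis_list J) x0" if "J \<subseteq> Basis" for J
    unfolding F_def using that by (rule fun_of_mvb)
  show "F mv1 = x0" using Fb[of "{}"] by (simp add: mvb_empty)
  have base: "F (ext b (mvb J)) = f b (F (mvb J))" if "b \<in> Basis" "J \<subseteq> Basis" for b J
  proof (cases "b \<in> J")
    case True
    have "ext b (mvb J) = 0"
      unfolding mvb_def using True that by (intro foldr_anti_mem linear_ext ext_ext) (simp add: set_basis_list)
    moreover have "f b (foldr f (basis_list J) x0) = 0"
      using True that by (intro foldr_anti_mem lin anti) (simp add: set_basis_list)
    ultimately show ?thesis using that by (simp add: Fb linear_0[OF linF])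
  next
    case False
    have "mvb (insert b J) = reorder_sign {b} J *\<^sub>R ext b (mvb J)"
      unfolding mvb_def using False that by (intro foldr_basis_list_insert linear_ext ext_ext) auto
    then have "ext b (mvb J) = reorder_sign {b} J *\<^sub>R mvb (insert b J)"
      by simp
    moreover have "foldr f (basis_list (insert b J)) x0 = reorder_sign {b} J *\<^sub>R f b (foldr f (basis_list J) x0)"
      using False that by (intro foldr_basis_list_insert lin anti) auto
    ultimately show ?thesis using that by (simp add: Fb linear_scale[OF linF])
  qed
  have b: "F (ext b a) = f b (F a)" if "b \<in> Basis" for b
  proof -
    have "F (ext b (\<Sum>J\<in>Pow Basis. mv_coeff a J *\<^sub>R mvb J)) = f b (F (\<Sum>J\<in>Pow Basis. mv_coeff a J *\<^sub>R mvb J))"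
      using that base by (simp add: linear_sum[OF linF] linear_sum[OF linear_ext] linear_sum[OF lin]
        linear_scale[OF linF] linear_scale[OF linear_ext] linear_scale[OF lin])
    then show ?thesis using mv_decomp[of a] by simp
  qed
  have "linear (\<lambda>v. F (ext v a))" "linear (\<lambda>v. f v (F a))"
    using linear_compose'[OF linF linear_ext_left] linv by auto
  from linear_eq_on_span[OF this, of Basis] b show "F (ext v a) = f v (F a)" by auto
qed

lemma starm_ext: "starm (ext v a) = con v (starm a)"
  and starm_mv1: "starm mv1 = mvtop"
  unfolding starm_def using foldr_ext_hom[of con, OF linear_con con_con linear_con_left] by blast+

lemma ext_mvtop [simp]: "ext v mvtop = 0"
  by (rule mv_eqI) (auto simp: ext_coeff mvtop_coeff intro!: sum.neutral)

text \<open>Together with \<open>starm_ext\<close>, star interchanges contraction and exterior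
  multiplication. The induction starts because \<open>ext\<close> kills the volume element just as
  \<open>con\<close> kills the unit.\<close>

lemma starm_con: "starm (con v a) = ext v (starm a)"
proof (rule linear_eq_multivec[where F = "\<lambda>a. starm (con v a)" and G = "\<lambda>a. ext v (starm a)"])
  fix b :: 'a and x
  assume "starm (con v x) = ext v (starm x)"
  then show "starm (con v (ext b x)) = ext v (starm (ext b x))"
    using con_ext[of b v "starm x"]
    by (simp add: con_ext starm_ext linear_diff[OF linear_starm] linear_scale[OF linear_starm] inner_commute)
qed (auto intro: linear_compose' linear_starm linear_con linear_ext simp: starm_mv1 linear_0[OF linear_starm])

lemma starm_coeff_top: "mv_coeff (starm a) Basis = mv_coeff a {}"
proof (rule linear_eq_multivec[where F = "\<lambda>a. mv_coeff (starm a) Basis" and G = "\<lambda>a. mv_coeff a {}"])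
  fix b :: 'a and x assume "b \<in> Basis"
  then show "mv_coeff (starm (ext b x)) Basis = mv_coeff (ext b x) {}"
    by (simp add: starm_ext con_coeff)
qed (auto intro!: linearI simp: linear_add[OF linear_starm] linear_scale[OF linear_starm] starm_mv1 mvtop_coeff mv1_coeff)

text \<open>The star of a monomial is plus or minus the complementary monomial. Squaring the
  coefficient avoids determining the sign.\<close>

lemma foldr_con_coeff_sq:
  "J \<subseteq> Basis \<Longrightarrow> I \<subseteq> Basis \<Longrightarrow> mv_coeff (foldr con (basis_list J) mvtop) I * mv_coeff (foldr con (basis_list J) mvtop) I = (if I = Basis - J then 1 else 0)"
proof (induction "card J" arbitrary: J I)
  case 0
  then show ?case using finite_subset_Basis[of J] by (simp add: mvtop_coeff)
next
  case (Suc n)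
  then obtain b J' where J: "J = insert b J'" "b \<notin> J'" "card J' = n"
    by (metis card_Suc_eq)
  have e: "foldr con (basis_list J) mvtop = reorder_sign {b} J' *\<^sub>R con b (foldr con (basis_list J') mvtop)"
    unfolding J(1) using Suc J
    by (intro foldr_basis_list_insert linear_con con_con) auto
  define y where "y = mv_coeff (foldr con (basis_list J') mvtop) (insert b I)"
  have y: "y * y = (if insert b I = Basis - J' then 1 else 0)"
    unfolding y_def using Suc J by auto
  have "mv_coeff (foldr con (basis_list J) mvtop) I = (if b \<in> I then 0 else reorder_sign {b} J' * (reorder_sign {b} I * y))"
    unfolding e y_def using Suc.prems J by (simp add: con_Basis con1_coeff)
  moreover have "(r * (s * y)) * (r * (s * y)) = (r * r) * (s * s) * (y * y)" for r s :: real
    by (simp only: ac_simps)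
  moreover have "b \<notin> I \<Longrightarrow> insert b I = Basis - J' \<longleftrightarrow> I = Basis - J"
    using Suc.prems J by auto
  moreover have "b \<in> I \<Longrightarrow> I \<noteq> Basis - J" using J by auto
  ultimately show ?case using y by (cases "b \<in> I") (simp_all only: if_True if_False reorder_sign_sq, simp_all)
qed

text \<open>Star applied twice commutes with exterior multiplication, so it is determined by its
  value on the unit, which is a multiple of the unit. All that matters about the factor c is that it
  is invertible, for \<open>bij_starm\<close>.\<close>

lemma starm_starm: "\<exists>c. c * c = 1 \<and> (\<forall>a :: 'a::euclidean_space multivec. starm (starm a) = c *\<^sub>R a)"
proof -
  let ?t = "starm (mvtop :: 'a multivec)"
  define c where "c = mv_coeff ?t {}"
  have "mvb (Basis :: 'a set) = mvtop" by (rule mv_eqI) (simp add: mvb_coeff mvtop_coeff)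
  then have t: "?t = foldr con (basis_list Basis) mvtop"
    using fun_of_mvb[of "Basis :: 'a set" "\<lambda>J. foldr con (basis_list J) mvtop"] unfolding starm_def by simp
  have "mv_coeff ?t I * mv_coeff ?t I = (if I = {} then 1 else 0)" if "I \<subseteq> Basis" for I
    unfolding t using foldr_con_coeff_sq[of Basis I] that by simp
  from this[of "{}"] this have cc: "c * c = 1" and z: "I \<subseteq> Basis \<Longrightarrow> I \<noteq> {} \<Longrightarrow> mv_coeff ?t I = 0" for I
    unfolding c_def by (simp, metis mult_eq_0_iff)
  have t1: "?t = c *\<^sub>R mv1"
    by (rule mv_eqI) (auto simp: z mv1_coeff c_def)
  have "starm (starm a) = c *\<^sub>R a" for a :: "'a multivec"
  proof (rule linear_eq_multivec[where F = "\<lambda>a. starm (starm a)" and G = "\<lambda>a. c *\<^sub>R a"])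
    fix b :: 'a and x :: "'a multivec"
    assume "starm (starm x) = c *\<^sub>R x"
    then show "starm (starm (ext b x)) = c *\<^sub>R ext b x"
      by (simp add: starm_ext starm_con ext_simps)
  next
    show "linear (\<lambda>a :: 'a multivec. c *\<^sub>R a)" by (rule linear_scale_self)
  qed (simp_all add: linear_compose' linear_starm starm_mv1 t1)
  with cc show ?thesis by blast
qed

lemma bij_starm: "bij starm"
proof -
  obtain c where c: "c * c = 1" "\<And>a :: 'a multivec. starm (starm a) = c *\<^sub>R a"
    using starm_starm by blast
  show ?thesis
  proof (rule bijI')
    fix x y :: "'a multivec"
    have "c \<noteq> 0" using c(1) by auto
    then show "(starm x = starm y) = (x = y)" using c(2)[of x] c(2)[of y] by (metis scaleR_cancel_left)
  next
    fix y :: "'a multivec"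
    have "y = starm (c *\<^sub>R starm y)" using c by (simp add: linear_scale[OF linear_starm])
    then show "\<exists>x. y = starm x" by blast
  qed
qed

section \<open>Adjoint maps and pull-back of forms\<close>

definition transp :: "('a::euclidean_space \<Rightarrow> 'b::euclidean_space) \<Rightarrow> 'b \<Rightarrow> 'a" where
  "transp A j = (\<Sum>b\<in>Basis. (A b \<bullet> j) *\<^sub>R b)"

lemma linear_transp: "linear (transp A)"
  unfolding transp_def by (intro linearI) (simp_all add: inner_add_right scaleR_add_left sum.distrib scaleR_sum_right)

lemma transp_works: "linear A \<Longrightarrow> u \<bullet> transp A j = A u \<bullet> j"
proof -
  assume A: "linear A"
  have "A (\<Sum>b\<in>Basis. (u \<bullet> b) *\<^sub>R b) = (\<Sum>b\<in>Basis. (u \<bullet> b) *\<^sub>R A b)"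
    by (simp add: linear_sum[OF A] linear_scale[OF A])
  then have "A u = (\<Sum>b\<in>Basis. (u \<bullet> b) *\<^sub>R A b)" by (simp add: euclidean_representation)
  then show ?thesis by (simp add: transp_def inner_sum_right inner_sum_left mult.commute)
qed

definition mvpull :: "('a::euclidean_space \<Rightarrow> 'b::euclidean_space) \<Rightarrow> 'b multivec \<Rightarrow> 'a multivec" where
  "mvpull A a = (\<Sum>J\<in>Pow Basis. mv_coeff a J *\<^sub>R foldr (\<lambda>j. ext (transp A j)) (basis_list J) mv1)"

lemma mvpull_ext: "mvpull A (ext v a) = ext (transp A v) (mvpull A a)"
  and mvpull_mv1: "mvpull A mv1 = mv1"
  and linear_mvpull: "linear (mvpull A)"
  unfolding mvpull_def
  using foldr_ext_hom[where f = "\<lambda>j. ext (transp A j)" and ?x0.0 = mv1, OF linear_ext ext_ext linear_compose'[OF linear_ext_left linear_transp]]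
  by blast+

lemma con_mvpull: "linear A \<Longrightarrow> con u (mvpull A a) = mvpull A (con (A u) a)"
proof (rule linear_eq_multivec[where F = "\<lambda>a. con u (mvpull A a)" and G = "\<lambda>a. mvpull A (con (A u) a)"])
  fix b :: 'b and x
  assume "linear A" "con u (mvpull A x) = mvpull A (con (A u) x)"
  then show "con u (mvpull A (ext b x)) = mvpull A (con (A u) (ext b x))"
    by (simp add: mvpull_ext con_ext transp_works linear_diff[OF linear_mvpull] linear_scale[OF linear_mvpull])
qed (auto intro: linear_compose' linear_mvpull linear_con simp: mvpull_mv1 linear_0[OF linear_mvpull])

lemma mvpull_empty: "mv_coeff (mvpull A a) {} = mv_coeff a {}"
  by (rule linear_eq_multivec[where F = "\<lambda>a. mv_coeff (mvpull A a) {}" and G = "\<lambda>a. mv_coeff a {}"])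
    (auto intro!: linearI simp: mv1_coeff mvpull_mv1 mvpull_ext linear_add[OF linear_mvpull] linear_scale[OF linear_mvpull])

section \<open>Exponentials of two-forms\<close>

definition skew_form :: "('a::euclidean_space \<Rightarrow> 'a \<Rightarrow> real) \<Rightarrow> bool" where
  "skew_form w \<longleftrightarrow> (\<forall>u. linear (w u)) \<and> (\<forall>v. linear (\<lambda>u. w u v)) \<and> (\<forall>u v. w u v = - w v u)"

lift_definition mv2 :: "('a::euclidean_space \<Rightarrow> 'a \<Rightarrow> real) \<Rightarrow> 'a multivec" is mv_of_form2
  by (auto simp: mvecs_def mv_of_form2_def intro!: sum.neutral)

lemma mv2_coeff: "mv_coeff (mv2 w) I = (\<Sum>a\<in>Basis. \<Sum>b\<in>Basis. if I = {a, b} \<and> basis_index a < basis_index b then w a b else 0)"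
  by transfer (simp add: mv_of_form2_def)

lemma mvv_Basis_coeff: "b \<in> Basis \<Longrightarrow> mv_coeff (mvv b) I = (if I = {b} then 1 else 0)"
proof -
  assume b: "b \<in> Basis"
  have "mv_coeff (mvv b) I = (\<Sum>c\<in>Basis. if c = b then (if I = {c} then 1 else 0) else 0)"
    unfolding mvv_coeff using b by (intro sum.cong refl) (auto simp: inner_Basis)
  then show ?thesis using b by (simp add: sum.delta)
qed

lemma mvm_mv1_left [simp]: "mvm q mv1 a = a"
proof (rule mv_eqI)
  fix K :: "'a set" assume K: "K \<subseteq> Basis"
  have "mv_coeff (mvm q mv1 a) K = (\<Sum>I\<in>Pow (Basis :: 'a set). if I = {} then mv_coeff a K else 0)"
    unfolding mvm_coeff[OF K] by (intro sum.cong refl) (auto simp: mv1_coeff symd_def reorder_sign_def)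
  then show "mv_coeff (mvm q mv1 a) K = mv_coeff a K" by (simp add: sum.delta)
qed

lemma ext_mv1: "ext v mv1 = mvv v"
proof (rule linear_eq_on_span[of "\<lambda>v. ext v mv1" mvv Basis v, OF linear_ext_left linear_mvv])
  fix b :: 'a assume b: "b \<in> Basis"
  show "ext b mv1 = mvv b"
  proof (rule mv_eqI)
    fix I :: "'a set" assume I: "I \<subseteq> Basis"
    have "b \<in> I \<Longrightarrow> I - {b} = {} \<longleftrightarrow> I = {b}" by auto
    then show "mv_coeff (ext b mv1) I = mv_coeff (mvv b) I"
      using b I by (cases "I = {b}") (auto simp: ext1_coeff mv1_coeff mvv_Basis_coeff reorder_sign_prod)
  qed
qed simp

lemma mvm_mv1_right [simp]: "mvm q a mv1 = a"
proof (rule mv_eqI)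
  fix K :: "'a set" assume K: "K \<subseteq> Basis"
  have "mv_coeff (mvm q a mv1) K = (\<Sum>I\<in>Pow Basis. if I = K then mv_coeff a I else 0)"
    unfolding mvm_coeff[OF K] by (intro sum.cong refl) (auto simp: mv1_coeff symd_def reorder_sign_def)
  then show "mv_coeff (mvm q a mv1) K = mv_coeff a K" using K by (simp add: sum.delta)
qed

lemma skew_formD:
  assumes "skew_form w"
  shows "w u v = - w v u" "linear (w u)" "linear (\<lambda>u. w u v)"
  using assms unfolding skew_form_def by blast+

text \<open>Exterior multiplication by the two-form w. Summing over all pairs with the factor 1/2,
  instead of over increasing pairs as in \<open>mv_of_form2\<close>, keeps the order of the basis
  out of the computations.\<close>

definition Om :: "('a::euclidean_space \<Rightarrow> 'a \<Rightarrow> real) \<Rightarrow> 'a multivec \<Rightarrow> 'a multivec" where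
  "Om w x = (1/2) *\<^sub>R (\<Sum>a\<in>Basis. \<Sum>b\<in>Basis. w a b *\<^sub>R ext a (ext b x))"

lemma linear_Om: "linear (Om w)"
  unfolding Om_def by (intro linearI)
    (simp_all add: ext_simps scaleR_add_right sum.distrib scaleR_sum_right mult.commute mult.left_commute)

lemma ext_ext_mv1_coeff:
  assumes "a \<in> Basis" "b \<in> Basis" "basis_index a < basis_index b"
  shows "mv_coeff (ext a (ext b mv1)) I = (if I = {a, b} then 1 else 0)"
proof (cases "I \<subseteq> Basis")
  case True
  have ne: "a \<noteq> b" using assms(3) by auto
  have r: "reorder_sign {a} {a, b} = 1"
    using ne assms(3) by (simp add: reorder_sign_prod swap_sign_def)
  show ?thesis
    using True assms ne r by (auto simp: ext_mv1 ext1_coeff mvv_Basis_coeff)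
next
  case False
  then show ?thesis using assms by (auto simp: mv_coeff_outside)
qed

lemma mvm_mv2:
  assumes w: "skew_form w"
  shows "mvm 0 (mv2 w) x = Om w x"
proof -
  have sk: "w a b = - w b a" for a b by (rule skew_formD[OF w])
  have w0: "w a a = 0" for a using sk[of a a] by simp
  define g where "g a b = (if basis_index a < basis_index b then w a b *\<^sub>R ext a (ext b x) else 0)" for a b
  have "mv2 w = (\<Sum>a\<in>Basis. \<Sum>b\<in>Basis. if basis_index a < basis_index b then w a b *\<^sub>R ext a (ext b mv1) else 0)"
  proof (rule mv_eqI)
    fix I :: "'a set"
    show "mv_coeff (mv2 w) I = mv_coeff (\<Sum>a\<in>Basis. \<Sum>b\<in>Basis. if basis_index a < basis_index b then w a b *\<^sub>R ext a (ext b mv1) else 0) I"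
      unfolding mv2_coeff mv_coeff_sum by (intro sum.cong refl) (simp add: ext_ext_mv1_coeff)
  qed
  then have "mvm 0 (mv2 w) x = (\<Sum>a\<in>Basis. \<Sum>b\<in>Basis. mvm 0 (if basis_index a < basis_index b then w a b *\<^sub>R ext a (ext b mv1) else 0) x)"
    by (simp add: linear_sum[OF linear_mvm_left])
  also have "\<dots> = (\<Sum>a\<in>Basis. \<Sum>b\<in>Basis. g a b)"
    by (intro sum.cong refl) (simp add: g_def mvm_scale_left ext_def mvm_assoc linear_0[OF linear_mvm_left])
  finally have 1: "mvm 0 (mv2 w) x = (\<Sum>a\<in>Basis. \<Sum>b\<in>Basis. g a b)" .
  have "(\<Sum>a\<in>Basis. \<Sum>b\<in>Basis. w a b *\<^sub>R ext a (ext b x)) = (\<Sum>a\<in>Basis. \<Sum>b\<in>Basis. g a b + g b a)"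
  proof (intro sum.cong refl)
    fix a b :: 'a assume "a \<in> Basis" "b \<in> Basis"
    then consider "a = b" | "basis_index a < basis_index b" | "basis_index b < basis_index a"
      using inj_onD[OF inj_basis_index, of a b] by force
    then show "w a b *\<^sub>R ext a (ext b x) = g a b + g b a"
    proof cases
      case 1 then show ?thesis by (simp add: g_def w0)
    next
      case 2 then show ?thesis by (simp add: g_def)
    next
      case 3 then show ?thesis using sk[of a b] ext_ext[of a b x] by (simp add: g_def)
    qed
  qed
  also have "\<dots> = (\<Sum>a\<in>Basis. \<Sum>b\<in>Basis. g a b) + (\<Sum>a\<in>Basis. \<Sum>b\<in>Basis. g b a)"
    by (simp add: sum.distrib)
  also have "(\<Sum>a\<in>Basis. \<Sum>b\<in>Basis. g b a) = (\<Sum>a\<in>Basis. \<Sum>b\<in>Basis. g a b)"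
    by (rule sum.swap)
  finally show ?thesis unfolding Om_def 1 by (simp flip: scaleR_2)
qed

definition iform :: "('a::euclidean_space \<Rightarrow> 'a \<Rightarrow> real) \<Rightarrow> 'a \<Rightarrow> 'a" where
  "iform w u = (\<Sum>b\<in>Basis. w u b *\<^sub>R b)"

lemma iform_inner: "skew_form w \<Longrightarrow> iform w u \<bullet> v = w u v"
proof -
  assume "skew_form w"
  then have l: "linear (w u)" by (rule skew_formD)
  have "w u v = w u (\<Sum>b\<in>Basis. (v \<bullet> b) *\<^sub>R b)" by (simp add: euclidean_representation)
  also have "\<dots> = (\<Sum>b\<in>Basis. (v \<bullet> b) * w u b)" by (simp add: linear_sum[OF l] linear_scale[OF l])
  finally show ?thesis by (simp add: iform_def inner_sum_right inner_commute[of _ v] mult.commute)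
qed

text \<open>A two-form has even degree, so a contraction passes it without a sign and leaves one
  extra term, multiplication by the one-form that w assigns to u, represented by the vector
  \<open>iform w u\<close>.\<close>

lemma con_Om:
  assumes w: "skew_form w"
  shows "con u (Om w x) = Om w (con u x) + ext (iform w u) x"
proof -
  have sk: "w a b = - w b a" for a b by (rule skew_formD[OF w])
  have l: "linear (\<lambda>u. w u b)" for b by (rule skew_formD[OF w])
  have wu: "(\<Sum>a\<in>Basis. (u \<bullet> a) * w a b) = w u b" for b
  proof -
    have "w u b = w (\<Sum>a\<in>Basis. (u \<bullet> a) *\<^sub>R a) b" by (simp add: euclidean_representation)
    then show ?thesis by (simp add: linear_sum[OF l] linear_scale[OF l])
  qed
  have e: "ext (iform w u) x = (\<Sum>b\<in>Basis. w u b *\<^sub>R ext b x)"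
    by (simp add: iform_def linear_sum[OF linear_ext_left] ext_simps)
  have c: "con u (ext a (ext b x)) = (u \<bullet> a) *\<^sub>R ext b x - (u \<bullet> b) *\<^sub>R ext a x + ext a (ext b (con u x))" for a b
    by (simp add: con_ext ext_simps)
  have "con u (Om w x) = (1/2) *\<^sub>R (\<Sum>a\<in>Basis. \<Sum>b\<in>Basis. ((u \<bullet> a) * w a b) *\<^sub>R ext b x - ((u \<bullet> b) * w a b) *\<^sub>R ext a x + w a b *\<^sub>R ext a (ext b (con u x)))"
    unfolding Om_def by (simp add: linear_sum[OF linear_con] con_simps c algebra_simps)
  also have "\<dots> = (1/2) *\<^sub>R (\<Sum>a\<in>Basis. \<Sum>b\<in>Basis. ((u \<bullet> a) * w a b) *\<^sub>R ext b x) - (1/2) *\<^sub>R (\<Sum>a\<in>Basis. \<Sum>b\<in>Basis. ((u \<bullet> b) * w a b) *\<^sub>R ext a x) + Om w (con u x)"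
    by (simp add: Om_def sum.distrib sum_subtractf algebra_simps)
  also have "(\<Sum>a\<in>Basis. \<Sum>b\<in>Basis. ((u \<bullet> a) * w a b) *\<^sub>R ext b x) = (\<Sum>b\<in>Basis. \<Sum>a\<in>Basis. ((u \<bullet> a) * w a b) *\<^sub>R ext b x)"
    by (rule sum.swap)
  also have "\<dots> = ext (iform w u) x"
    unfolding e by (simp add: scaleR_left.sum[symmetric] wu)
  also have "(\<Sum>a\<in>Basis. \<Sum>b\<in>Basis. ((u \<bullet> b) * w a b) *\<^sub>R ext a x) = (\<Sum>a\<in>Basis. (\<Sum>b\<in>Basis. - ((u \<bullet> b) * w b a)) *\<^sub>R ext a x)"
  proof (intro sum.cong refl)
    fix a
    have "(\<Sum>b\<in>Basis. - ((u \<bullet> b) * w b a)) = (\<Sum>b\<in>Basis. (u \<bullet> b) * w a b)"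
      by (intro sum.cong refl) (metis sk minus_mult_right)
    then show "(\<Sum>b\<in>Basis. ((u \<bullet> b) * w a b) *\<^sub>R ext a x) = (\<Sum>b\<in>Basis. - ((u \<bullet> b) * w b a)) *\<^sub>R ext a x"
      by (simp add: scaleR_left.sum)
  qed
  also have "\<dots> = - ext (iform w u) x"
    unfolding e by (simp add: sum_negf wu)
  finally show ?thesis by (simp flip: scaleR_2 scaleR_add_left)
qed

lemma Om_ext: "Om w (ext v x) = ext v (Om w x)"
proof -
  have "ext a (ext b (ext v x)) = ext v (ext a (ext b x))" for a b
    using ext_ext[of b v x] ext_ext[of a v "ext b x"] by (simp add: ext_simps)
  then show ?thesis by (simp add: Om_def linear_sum[OF linear_ext] ext_simps)
qed

text \<open>Each \<open>Om w\<close> raises the degree by two, so the exponential series ends well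
  before this bound, which is the one in \<open>wedge_exp\<close>.\<close>

definition mvexp :: "('a::euclidean_space \<Rightarrow> 'a \<Rightarrow> real) \<Rightarrow> 'a multivec \<Rightarrow> 'a multivec" where
  "mvexp w x = (\<Sum>k\<le>DIM('a). (1 / fact k) *\<^sub>R (Om w ^^ k) x)"

lemma linear_Om_pow: "linear (Om w ^^ k)"
proof (induction k)
  case (Suc k)
  show ?case unfolding funpow.simps by (rule linear_compose[OF Suc linear_Om])
qed (simp add: linear_id[unfolded id_def] id_def)

lemma linear_mvexp: "linear (mvexp w)"
  unfolding mvexp_def by (intro linear_sum_coeff linear_compose_scale_right linear_Om_pow)

lemma con_Om_pow:
  assumes w: "skew_form w"
  shows "con u ((Om w ^^ k) x) = (Om w ^^ k) (con u x) + real k *\<^sub>R ext (iform w u) ((Om w ^^ (k - 1)) x)"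
proof (induction k)
  case (Suc k)
  have "Om w (ext v ((Om w ^^ (k - 1)) x)) = ext v ((Om w ^^ k) x)" if "k > 0" for v
    using that by (cases k) (simp_all add: Om_ext)
  then show ?case
    by (cases "k = 0") (simp_all add: con_Om[OF w] Suc linear_add[OF linear_Om] linear_scale[OF linear_Om] algebra_simps)
qed simp

lemma Om_pow_low:
  "card I < 2 * k \<Longrightarrow> mv_coeff ((Om w ^^ k) x) I = 0"
proof (induction k arbitrary: I)
  case (Suc k)
  let ?y = "(Om w ^^ k) x"
  have "mv_coeff (ext a (ext b ?y)) I = 0" if "a \<in> Basis" "b \<in> Basis" for a b
  proof (cases "I \<subseteq> Basis")
    case True
    then have fin: "finite I" by (rule finite_subset_Basis)
    have i: "I - {a} \<subseteq> Basis" using True by auto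
    show ?thesis
    proof (cases "a \<in> I \<and> b \<in> I - {a}")
      case True
      moreover have "card I \<ge> 2" using True fin by (metis DiffD1 DiffD2 card_le_Suc0_iff_eq not_less_eq_eq numeral_2_eq_2 singletonI)
      ultimately have "card (I - {a} - {b}) < 2 * k" using Suc.prems fin by simp
      then have "mv_coeff ?y (I - {a} - {b}) = 0" by (rule Suc.IH)
      then show ?thesis using \<open>I \<subseteq> Basis\<close> i that by (simp add: ext1_coeff)
    next
      case False
      then show ?thesis using \<open>I \<subseteq> Basis\<close> i that by (auto simp: ext1_coeff)
    qed
  qed (simp add: mv_coeff_outside)
  then show ?case unfolding funpow.simps o_apply Om_def[of w "(Om w ^^ k) x"] by simp
qed simp

lemma con_mvexp:
  assumes w: "skew_form w"
  shows "con u (mvexp w x) = mvexp w (con u x) + ext (iform w u) (mvexp w x)"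
proof -
  let ?N = "DIM('a)" and ?e = "ext (iform w u)"
  obtain M where M: "?N = Suc M" using DIM_positive[where 'a='a] by (metis gr0_conv_Suc)
  \<comment> \<open>The last term kept is already zero, so the shift of the index in the
    differentiated series loses nothing.\<close>
  have top0: "(Om w ^^ ?N) x = 0"
  proof (rule mv_eqI)
    fix I :: "'a set" assume "I \<subseteq> Basis"
    then have "card I < 2 * ?N" using card_mono[OF finite_Basis, of I] DIM_positive[where 'a='a] by linarith
    then show "mv_coeff ((Om w ^^ ?N) x) I = mv_coeff 0 I" by (simp add: Om_pow_low)
  qed
  have "con u (mvexp w x) = (\<Sum>k\<le>?N. (1 / fact k) *\<^sub>R (Om w ^^ k) (con u x)) + (\<Sum>k\<le>?N. (real k / fact k) *\<^sub>R ?e ((Om w ^^ (k - 1)) x))"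
    unfolding mvexp_def by (simp add: linear_sum[OF linear_con] con_simps con_Om_pow[OF w] algebra_simps sum.distrib)
  also have "(\<Sum>k\<le>?N. (real k / fact k) *\<^sub>R ?e ((Om w ^^ (k - 1)) x)) = (\<Sum>k\<le>M. (1 / fact k) *\<^sub>R ?e ((Om w ^^ k) x))"
    unfolding M by (subst sum.atMost_Suc_shift) (simp add: fact_Suc)
  also have "\<dots> = ?e (\<Sum>k\<le>?N. (1 / fact k) *\<^sub>R (Om w ^^ k) x)"
    using top0 unfolding M by (simp add: linear_sum[OF linear_ext] ext_simps)
  finally show ?thesis by (simp add: mvexp_def)
qed

lemma mvexp_empty: "mv_coeff (mvexp w x) {} = mv_coeff x {}"
proof -
  have "mv_coeff ((Om w ^^ k) x) {} = (if k = 0 then mv_coeff x {} else 0)" for k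
    using Om_pow_low[of "{}" k w x] by (cases k) simp_all
  then have "mv_coeff (mvexp w x) {} = (\<Sum>k\<le>DIM('a). if k = 0 then mv_coeff x {} else 0)"
    unfolding mvexp_def mv_coeff_sum by (intro sum.cong refl) simp
  then show ?thesis by (simp add: sum.delta)
qed

lemma mvexp_ext: "mvexp w (ext v x) = ext v (mvexp w x)"
proof -
  have "(Om w ^^ k) (ext v x) = ext v ((Om w ^^ k) x)" for k
    by (induction k) (simp_all add: Om_ext)
  then show ?thesis by (simp add: mvexp_def linear_sum[OF linear_ext] ext_simps)
qed

text \<open>The operator \<open>e\<^sup>\<omega> A\<^sup>*\<close>.\<close>

definition exp_pull :: "('a::euclidean_space \<Rightarrow> 'a \<Rightarrow> real) \<Rightarrow> ('a \<Rightarrow> 'b::euclidean_space) \<Rightarrow> 'b multivec \<Rightarrow> 'a multivec" where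
  "exp_pull w A a = mvexp w (mvpull A a)"

lemma linear_exp_pull: "linear (exp_pull w A)"
  unfolding exp_pull_def by (rule linear_compose'[OF linear_mvexp linear_mvpull])

lemma exp_pull_empty: "mv_coeff (exp_pull w A a) {} = mv_coeff a {}"
  by (simp add: exp_pull_def mvexp_empty mvpull_empty)

lemma exp_pull_ext: "exp_pull w A (ext v a) = ext (transp A v) (exp_pull w A a)"
  by (simp add: exp_pull_def mvpull_ext mvexp_ext)

lemma con_exp_pull:
  "skew_form w \<Longrightarrow> linear A \<Longrightarrow> con u (exp_pull w A a) = exp_pull w A (con (A u) a) + ext (iform w u) (exp_pull w A a)"
  by (simp add: exp_pull_def con_mvexp con_mvpull)

text \<open>Right Clifford multiplication, transported by the star operator to the exterior algebra.\<close>

definition rcl :: "'a::euclidean_space \<Rightarrow> 'a multivec \<Rightarrow> 'a multivec" where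
  "rcl v a = con v a - (1/2) *\<^sub>R ext v a"

lemma linear_rcl: "linear (rcl v)"
  unfolding rcl_def by (intro linear_compose_sub linear_compose_scale_right linear_con linear_ext)

lemma rcl_ext: "rcl v (ext g y) = (v \<bullet> g) *\<^sub>R y - ext g (rcl v y)"
  using ext_ext[of v g y] by (simp add: rcl_def con_ext ext_simps algebra_simps)

text \<open>The factor \<open>ext g\<close> moves to the front past all operators, up to sign, and
  then there is no scalar part.\<close>

lemma foldr_anti_ext_empty:
  assumes "\<And>v y. v \<in> set us \<Longrightarrow> D v (ext g y) = - ext g (D v y)" "\<And>v. linear (D v)"
  shows "mv_coeff (foldr D us (ext g y)) {} = 0"
proof -
  have "\<exists>s. foldr D us (ext g y) = s *\<^sub>R ext g (foldr D us y)"
    using assms(1)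
  proof (induction us)
    case Nil
    show ?case by (rule exI[of _ 1]) simp
  next
    case (Cons u us)
    then obtain s where "foldr D us (ext g y) = s *\<^sub>R ext g (foldr D us y)" by auto
    then show ?case using Cons.prems(1)[of u]
      by (intro exI[of _ "- s"]) (simp add: linear_scale[OF assms(2)])
  qed
  then show ?thesis by auto
qed

lemma linear_foldr: "(\<And>v. linear (D v)) \<Longrightarrow> linear (foldr D us)"
  by (induction us) (auto intro: linear_compose linear_id)

text \<open>Contracting \<open>exp_pull w A a\<close> with u gives
  \<open>exp_pull w A (rcl (A u) a)\<close> plus an exterior product with g, where g represents the
  contraction of w with u plus half of \<open>transp A (A u)\<close>. The order condition says that
  g is orthogonal to all vectors before u in the list, which are those still to be contracted with;
  hence the term with g has no scalar part in the end.\<close>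

theorem foldr_con_exp_pull:
  assumes w: "skew_form w" and A: "linear A"
    and ws: "sorted_wrt (\<lambda>x y. w y x = - (1/2) * (A x \<bullet> A y)) ws"
  shows "mv_coeff (foldr con ws (exp_pull w A a)) {} = mv_coeff (foldr rcl (map A ws) a) {}"
  using ws
proof (induction ws arbitrary: a rule: rev_induct)
  case Nil
  then show ?case by (simp add: exp_pull_empty)
next
  case (snoc u ws)
  define g where "g = iform w u + (1/2) *\<^sub>R transp A (A u)"
  have g: "g \<bullet> x = 0" if "x \<in> set ws" for x
    using snoc.prems that iform_inner[OF w, of u x] transp_works[OF A, of x "A u"]
    by (simp add: sorted_wrt_append g_def inner_add_left inner_add_right inner_commute)
  have e: "con u (exp_pull w A a) = exp_pull w A (rcl (A u) a) + ext g (exp_pull w A a)"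
    by (simp add: con_exp_pull[OF w A] rcl_def g_def linear_diff[OF linear_exp_pull] linear_scale[OF linear_exp_pull]
      exp_pull_ext ext_simps)
  have "mv_coeff (foldr con ws (ext g (exp_pull w A a))) {} = 0"
    by (rule foldr_anti_ext_empty) (use g linear_con in \<open>auto simp: con_ext inner_commute\<close>)
  then show ?case
    using snoc by (simp add: e linear_add[OF linear_foldr[OF linear_con]] sorted_wrt_append)
qed

text \<open>The same argument with \<open>rcl\<close> on both sides. The exterior part of
  \<open>rcl u\<close> changes g by half of u, which accounts for the additional inner product in
  the condition, and \<open>rcl v\<close> still anticommutes with \<open>ext g\<close> for g
  orthogonal to v.\<close>

theorem foldr_rcl_exp_pull:
  assumes w: "skew_form w" and A: "linear A"
    and ws: "sorted_wrt (\<lambda>x y. w y x = - (1/2) * (A x \<bullet> A y) + (1/2) * (x \<bullet> y)) ws"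
  shows "mv_coeff (foldr rcl ws (exp_pull w A a)) {} = mv_coeff (foldr rcl (map A ws) a) {}"
  using ws
proof (induction ws arbitrary: a rule: rev_induct)
  case Nil
  then show ?case by (simp add: exp_pull_empty)
next
  case (snoc u ws)
  define g where "g = iform w u + (1/2) *\<^sub>R transp A (A u) - (1/2) *\<^sub>R u"
  have g: "g \<bullet> x = 0" if "x \<in> set ws" for x
    using snoc.prems that iform_inner[OF w, of u x] transp_works[OF A, of x "A u"]
    by (simp add: sorted_wrt_append g_def inner_add_left inner_diff_left inner_add_right inner_diff_right inner_commute)
  have e: "rcl u (exp_pull w A a) = exp_pull w A (rcl (A u) a) + ext g (exp_pull w A a)"
    by (simp add: con_exp_pull[OF w A] rcl_def g_def linear_diff[OF linear_exp_pull] linear_scale[OF linear_exp_pull]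
      exp_pull_ext ext_simps)
  have "mv_coeff (foldr rcl ws (ext g (exp_pull w A a))) {} = 0"
    by (rule foldr_anti_ext_empty) (use g linear_rcl in \<open>auto simp: rcl_ext inner_commute\<close>)
  then show ?case
    using snoc by (simp add: e linear_add[OF linear_foldr[OF linear_rcl]] sorted_wrt_append)
qed

lemma con_determines:
  assumes "mv_coeff a {} = 0" "\<And>b. b \<in> Basis \<Longrightarrow> con b a = 0"
  shows "a = 0"
proof (rule mv_eqI)
  fix I :: "'a set" assume I: "I \<subseteq> Basis"
  show "mv_coeff a I = mv_coeff 0 I"
  proof (cases "I = {}")
    case False
    then obtain b where b: "b \<in> I" by auto
    have "mv_coeff (con b a) (I - {b}) = reorder_sign {b} (I - {b}) * mv_coeff a I"
      using I b by (subst con_Basis, blast, subst con1_coeff) (auto simp: insert_absorb)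
    moreover have "reorder_sign {b} (I - {b}) \<noteq> 0" by (metis mult_zero_left reorder_sign_sq zero_neq_one)
    ultimately show ?thesis using assms(2)[of b] I b by auto
  qed (simp add: assms)
qed

text \<open>Both sides obey the same recursion under contraction, the one in
  \<open>con_exp_pull\<close>. Their difference obeys it too and has no scalar part, so its
  coefficients vanish by induction on the degree.\<close>

lemma exp_pull_comp:
  assumes w1: "skew_form w1" and w2: "skew_form w2" and A: "linear A" and C: "linear C"
    and w: "skew_form w" and weq: "\<And>u v. w u v = w1 u v + w2 (A u) (A v)"
  shows "exp_pull w1 A (exp_pull w2 C a) = exp_pull w (C \<circ> A) a"
proof -
  let ?d = "\<lambda>a. exp_pull w1 A (exp_pull w2 C a) - exp_pull w (C \<circ> A) a"
  have CA: "linear (C \<circ> A)" using A C by (rule linear_compose)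
  have i: "iform w u = iform w1 u + transp A (iform w2 (A u))" for u
  proof (rule euclidean_eqI)
    fix b :: 'a
    show "iform w u \<bullet> b = (iform w1 u + transp A (iform w2 (A u))) \<bullet> b"
      using iform_inner[OF w] iform_inner[OF w1] iform_inner[OF w2] transp_works[OF A, of b]
      by (simp add: weq inner_add_right inner_commute)
  qed
  have cd: "con u (?d a) = ?d (con (C (A u)) a) + ext (iform w u) (?d a)" for u a
    by (simp add: con_simps con_exp_pull w1 w2 A C w CA linear_add[OF linear_exp_pull] exp_pull_ext i ext_simps)
  have "mv_coeff (?d a) I = 0" if "I \<subseteq> Basis" for I a
    using finite_subset_Basis[OF that] that
  proof (induction "card I" arbitrary: I a rule: less_induct)
    case less
    show ?case
    proof (cases "I = {}")
      case False
      then obtain b where b: "b \<in> I" by auto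
      have b': "b \<in> Basis" using b less.prems by auto
      have s: "I - {b} \<subset> I" "I - {b} \<subseteq> Basis" using b less.prems by auto
      have c: "card (I - {b}) < card I" using s less.prems by (simp add: psubset_card_mono)
      have 1: "mv_coeff (con b (?d a)) (I - {b}) = reorder_sign {b} (I - {b}) * mv_coeff (?d a) I"
        using b' s b by (subst con_Basis, blast, subst con1_coeff) (auto simp: insert_absorb)
      have 2: "mv_coeff (?d (con (C (A b)) a)) (I - {b}) = 0"
        using less.hyps[OF c] s less.prems by simp
      have 3: "mv_coeff (ext (iform w b) (?d a)) (I - {b}) = 0"
      proof -
        have "mv_coeff (?d a) (I - {b} - {x}) = 0" for x
        proof -
          have "card (I - {b} - {x}) < card I" using c card_mono[of "I - {b}" "I - {b} - {x}"] less.prems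
            by (meson Diff_subset finite_Diff le_less_trans)
          then show ?thesis using less.hyps[of "I - {b} - {x}" a] less.prems by blast
        qed
        then show ?thesis by (subst ext_coeff[OF s(2)]) (simp add: sum.neutral)
      qed
      have "reorder_sign {b} (I - {b}) * mv_coeff (?d a) I = 0"
        using 1 2 3 cd[of b a] by simp
      moreover have "reorder_sign {b} (I - {b}) \<noteq> 0" by (metis mult_zero_left reorder_sign_sq zero_neq_one)
      ultimately show ?thesis by simp
    qed (simp add: exp_pull_empty)
  qed
  then show ?thesis by (intro mv_eqI) simp
qed

section \<open>Determinants of endomorphisms of a Euclidean space\<close>

text \<open>The library has determinants and the change of variables theorem on \<open>real ^ 'n\<close> only; the following
  type indexes the standard basis of a Euclidean space.\<close>

typedef (overloaded) 'a bix = "Basis :: 'a::euclidean_space set"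
  by (rule nonempty_Basis[unfolded ex_in_conv[symmetric]])

lemma Rep_bix_Basis [simp]: "Rep_bix i \<in> Basis"
  by (rule Rep_bix)

lemma bij_Rep_bix: "bij_betw Rep_bix (UNIV :: 'a::euclidean_space bix set) Basis"
  using Rep_bix_inject Rep_bix Abs_bix_inverse
  by (intro bij_betwI[where g = Abs_bix]) (auto simp: Rep_bix_inverse)

lemma inj_basis_Rep: "basis_index (Rep_bix i) = basis_index (Rep_bix j) \<longleftrightarrow> i = j"
  by (meson Rep_bix_Basis Rep_bix_inject inj_basis_index inj_onD)

instance bix :: (euclidean_space) finite
proof
  show "finite (UNIV :: 'a bix set)" using bij_betw_finite[OF bij_Rep_bix] finite_Basis by blast
qed

text \<open>The change of variables theorem for \<open>real ^ 'n\<close> asks for a well-ordered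
  index type. The order is the one fixed by \<open>basis_index\<close>.\<close>

instantiation bix :: (euclidean_space) wellorder
begin
definition less_eq_bix :: "'a bix \<Rightarrow> 'a bix \<Rightarrow> bool" where "i \<le> j \<longleftrightarrow> basis_index (Rep_bix i) \<le> basis_index (Rep_bix j)"
definition less_bix :: "'a bix \<Rightarrow> 'a bix \<Rightarrow> bool" where "i < j \<longleftrightarrow> basis_index (Rep_bix i) < basis_index (Rep_bix j)"
instance
proof (intro_classes, goal_cases)
  case (6 Q i)
  then show ?case
    by (rule measure_induct_rule[where f = "\<lambda>i. basis_index (Rep_bix i)"]) (simp add: less_bix_def)
qed (auto simp: less_eq_bix_def less_bix_def inj_basis_Rep)
end

definition of_bix :: "real ^ 'a::euclidean_space bix \<Rightarrow> 'a" where
  "of_bix v = (\<Sum>i\<in>UNIV. vec_nth v i *\<^sub>R Rep_bix i)"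

definition to_bix :: "'a::euclidean_space \<Rightarrow> real ^ 'a bix" where
  "to_bix x = (\<chi> i. x \<bullet> Rep_bix i)"

lemma sum_bix: "(\<Sum>i\<in>UNIV. f (Rep_bix i)) = sum f (Basis :: 'a::euclidean_space set)"
  using sum.reindex_bij_betw[OF bij_Rep_bix, of f] .

lemma prod_bix: "(\<Prod>i\<in>UNIV. f (Rep_bix i)) = prod f (Basis :: 'a::euclidean_space set)"
  using prod.reindex_bij_betw[OF bij_Rep_bix, of f] .

lemma to_bix_nth: "vec_nth (to_bix x) i = x \<bullet> Rep_bix i"
  by (simp add: to_bix_def)

lemma inner_Rep_bix: "Rep_bix i \<bullet> Rep_bix j = (if i = j then 1 else 0)"
  using inner_Basis[of "Rep_bix i" "Rep_bix j"] by (simp add: Rep_bix_inject)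

lemma of_bix_inner: "of_bix v \<bullet> Rep_bix i = vec_nth v i"
  by (simp add: of_bix_def inner_sum_left inner_Rep_bix mult_delta_right)

lemma bix_inverse [simp]: "of_bix (to_bix x) = x" "to_bix (of_bix v) = v"
  using sum_bix[of "\<lambda>b. (x \<bullet> b) *\<^sub>R b"]
  by (simp_all add: of_bix_def to_bix_nth euclidean_representation of_bix_inner[unfolded of_bix_def] to_bix_def vec_eq_iff)

lemma linear_bix: "linear of_bix" "linear to_bix"
  by (intro linearI; simp add: of_bix_def to_bix_def vec_eq_iff scaleR_add_left sum.distrib scaleR_sum_right inner_add_left)+

lemma bix_continuous: "continuous_on S of_bix" "continuous_on S to_bix"
  by (intro linear_continuous_on linear_conv_bounded_linear[THEN iffD1] linear_bix)+

text \<open>Tuples of vectors indexed by \<open>Basis\<close> are represented by functions on the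
  whole space, whose values elsewhere carry no meaning; this is the reason for the axiom
  \<open>restrict\<close>.\<close>

locale alternating =
  fixes T :: "('a::euclidean_space \<Rightarrow> 'v::real_vector) \<Rightarrow> real"
  assumes add: "b \<in> Basis \<Longrightarrow> T (f(b := x + y)) = T (f(b := x)) + T (f(b := y))"
    and scale: "b \<in> Basis \<Longrightarrow> T (f(b := r *\<^sub>R x)) = r * T (f(b := x))"
    and alt: "a \<in> Basis \<Longrightarrow> b \<in> Basis \<Longrightarrow> a \<noteq> b \<Longrightarrow> f a = f b \<Longrightarrow> T f = 0"
    and restrict: "(\<And>b. b \<in> Basis \<Longrightarrow> f b = g b) \<Longrightarrow> T f = T g"
begin

lemma linear_slot: "b \<in> Basis \<Longrightarrow> linear (\<lambda>x. T (f(b := x)))"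
  by (intro linearI) (simp_all add: add scale)

lemma swap:
  assumes "a \<in> Basis" "b \<in> Basis" "a \<noteq> b"
  shows "T (f(a := y, b := x)) = - T (f(a := x, b := y))"
proof -
  have add_a: "T (f(a := x + y, b := z)) = T (f(a := x, b := z)) + T (f(a := y, b := z))" for x y z
    using add[OF assms(1), of "f(b := z)"] assms(3) by (simp add: fun_upd_twist)
  have "T (f(a := x + y, b := x + y)) = 0" "T (f(a := x, b := x)) = 0" "T (f(a := y, b := y)) = 0"
    using assms by (intro alt[of a b]; simp)+
  then show ?thesis using assms by (simp add: add add_a)
qed

end

text \<open>A tuple of basis vectors either repeats one of them or is a permutation, which is
  reached from the identity by transpositions. A general tuple is reduced to such tuples by
  expanding the slots in S one at a time.\<close>

lemma alternating_zero:
  fixes T :: "('a::euclidean_space \<Rightarrow> 'a) \<Rightarrow> real"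
  assumes T: "alternating T" and 0: "T (\<lambda>b. b) = 0"
  shows "T f = 0"
proof -
  interpret alternating T by fact
  let ?B = "Basis :: 'a set"
  have P: "T p = 0" if "p permutes ?B" for p
    using finite_Basis that
  proof (induction p rule: permutes_rev_induct)
    case (swap a b p)
    have "p \<circ> Transposition.transpose a b = p(a := p b, b := p a)"
      using swap by (auto simp: fun_eq_iff Transposition.transpose_def)
    moreover have "p = p(a := p a, b := p b)" by auto
    ultimately show ?case using alternating.swap[OF T, of a b p "p b" "p a"] swap by (simp del: fun_upd_apply)
  qed (use 0 in \<open>simp add: id_def\<close>)
  have I: "T g = 0" if g: "\<And>b. b \<in> ?B \<Longrightarrow> g b \<in> ?B" for g
  proof (cases "inj_on g ?B")
    case True
    define p where "p b = (if b \<in> ?B then g b else b)" for b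
    have "g ` ?B = ?B" using g True by (intro endo_inj_surj) auto
    then have "bij_betw p ?B ?B" using True unfolding p_def bij_betw_def by (auto simp: inj_on_def)
    then have "p permutes ?B" by (rule bij_imp_permutes) (simp add: p_def)
    moreover have "T g = T p" by (rule restrict) (simp add: p_def)
    ultimately show ?thesis using P by simp
  qed (use alt in \<open>auto simp: inj_on_def\<close>)
  have "T f = 0" if "finite S" "\<And>b. b \<in> ?B - S \<Longrightarrow> f b \<in> ?B" for S f
    using that
  proof (induction S arbitrary: f)
    case empty
    then show ?case by (intro I) simp
  next
    case (insert a S)
    show ?case
    proof (cases "a \<in> ?B")
      case True
      have "T (f(a := \<Sum>c\<in>?B. (f a \<bullet> c) *\<^sub>R c)) = (\<Sum>c\<in>?B. (f a \<bullet> c) * T (f(a := c)))"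
        using linear_sum[OF linear_slot[OF True], of f "\<lambda>c. (f a \<bullet> c) *\<^sub>R c" ?B] by (simp add: scale[OF True])
      also have "\<dots> = 0" using insert by (intro sum.neutral ballI) simp
      finally show ?thesis by (simp add: euclidean_representation)
    qed (use insert in blast)
  qed
  from this[of ?B] show ?thesis by simp
qed

definition bdet :: "('a::euclidean_space \<Rightarrow> 'a) \<Rightarrow> real" where
  "bdet A = basis_det (\<lambda>u v. A u \<bullet> v)"

definition bmat :: "('a::euclidean_space \<Rightarrow> 'a) \<Rightarrow> real ^ 'a bix ^ 'a bix" where
  "bmat f = (\<chi> i. to_bix (f (Rep_bix i)))"

lemma bdet_bmat: "bdet A = Determinants.det (bmat A)"
  unfolding bdet_def basis_det_def Determinants.det_def
proof (rule sum.reindex_bij_witness[of _ "map_permutation UNIV Rep_bix" "map_permutation Basis Abs_bix"])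
  note R = bij_Rep_bix[where 'a = 'a]
  have A: "bij_betw Abs_bix (Basis :: 'a set) UNIV"
    by (rule bij_betw_byWitness[where f' = Rep_bix]) (auto simp: Abs_bix_inverse Rep_bix_inverse)
  fix p assume p: "p \<in> {p. p permutes (Basis :: 'a set)}"
  then show "map_permutation UNIV Rep_bix (map_permutation Basis Abs_bix p) = p"
    by (intro map_permutation_compose_inv[OF A]) (simp_all add: Abs_bix_inverse)
  show "map_permutation Basis Abs_bix p \<in> {p. p permutes UNIV}"
    using map_permutation_permutes[OF A] p by simp
  have "map_permutation Basis Abs_bix p i = Abs_bix (p (Rep_bix i))" for i
    using map_permutation_apply[OF bij_betw_imp_inj_on[OF A], of "Rep_bix i" p] by (simp add: Rep_bix_inverse)
  moreover have "p (Rep_bix i) \<in> Basis" for i using p by (simp add: permutes_in_image)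
  ultimately show "of_int (sign (map_permutation Basis Abs_bix p)) * (\<Prod>i\<in>UNIV. vec_nth (vec_nth (bmat A) i) (map_permutation Basis Abs_bix p i))
    = of_int (sign p) * (\<Prod>b\<in>Basis. A b \<bullet> p b)"
    using p by (simp add: sign_map_permutation[OF bij_betw_imp_inj_on[OF A]] bmat_def to_bix_nth Abs_bix_inverse prod_bix[of "\<lambda>b. A b \<bullet> p b"])
next
  fix q :: "'a bix \<Rightarrow> 'a bix" assume "q \<in> {p. p permutes UNIV}"
  then show "map_permutation Basis Abs_bix (map_permutation UNIV Rep_bix q) = q"
    "map_permutation UNIV Rep_bix q \<in> {p. p permutes Basis}"
    using map_permutation_compose_inv[OF bij_Rep_bix, of q Abs_bix] map_permutation_permutes[OF bij_Rep_bix]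
    by (simp_all add: Rep_bix_inverse)
qed

lemma alternating_bdet: "alternating bdet"
proof -
  have e: "bmat (f(b := z)) = (\<chi> i. if i = Abs_bix b then to_bix z else to_bix (f (Rep_bix i)))" if "b \<in> Basis" for f and b z :: 'a
    using that by (auto simp: bmat_def vec_eq_iff Abs_bix_inverse Rep_bix_inverse)
  show ?thesis
  proof (unfold_locales, goal_cases)
    case (1 b f x y)
    then show ?case using det_row_add[of "Abs_bix b" "\<lambda>_. to_bix x" "\<lambda>_. to_bix y" "\<lambda>i. to_bix (f (Rep_bix i))"]
      by (simp add: bdet_bmat e linear_add[OF linear_bix(2)] cong: if_cong)
  next
    case (2 b f r x)
    then show ?case using det_row_mul[of "Abs_bix b" r "\<lambda>_. to_bix x" "\<lambda>i. to_bix (f (Rep_bix i))"]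
      by (simp add: bdet_bmat e linear_scale[OF linear_bix(2)] vector_scalar_mult_def scaleR_vec_def cong: if_cong)
  next
    case (3 a b f)
    then show ?case unfolding bdet_bmat
      by (intro det_identical_rows[of "Abs_bix a" "Abs_bix b"]) (auto simp: row_def Abs_bix_inverse Abs_bix_inject vec_eq_iff bmat_def)
  qed (simp add: bdet_bmat bmat_def)
qed

lemma bdet_id: "bdet (\<lambda>b. b) = 1"
proof -
  have "bmat (\<lambda>b :: 'a. b) = mat 1" by (auto simp: vec_eq_iff mat_def bmat_def to_bix_nth inner_Rep_bix)
  then show ?thesis by (simp add: bdet_bmat det_I)
qed

text \<open>The difference of both sides is alternating and vanishes on the identity tuple.\<close>

theorem alternating_unique:
  fixes T :: "('a::euclidean_space \<Rightarrow> 'a) \<Rightarrow> real"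
  assumes "alternating T"
  shows "T f = bdet f * T (\<lambda>b. b)"
proof -
  interpret alternating T by fact
  interpret b: alternating "bdet :: ('a \<Rightarrow> 'a) \<Rightarrow> real" by (rule alternating_bdet)
  have "alternating (\<lambda>f. T f - bdet f * T (\<lambda>b. b))"
  proof (unfold_locales, goal_cases)
    case (4 f g)
    then show ?case using restrict[of f g] b.restrict[of f g] by simp
  qed (simp_all add: add scale b.add b.scale alt b.alt algebra_simps)
  from alternating_zero[OF this, of f] show ?thesis by (simp add: bdet_id)
qed

text \<open>The rows of \<open>bmat\<close> are the images of the basis vectors, so composition
  becomes the product of the matrices in reverse order. The map f enters only through its values on
  \<open>Basis\<close>.\<close>

lemma bdet_compose:
  assumes "linear A"
  shows "bdet (\<lambda>x. A (f x)) = bdet A * bdet f"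
proof -
  have A: "A u = (\<Sum>b\<in>Basis. (u \<bullet> b) *\<^sub>R A b)" for u
    using linear_sum[OF assms, of "\<lambda>b. (u \<bullet> b) *\<^sub>R b" Basis] by (simp add: euclidean_representation linear_scale[OF assms])
  have E: "A u \<bullet> v = (\<Sum>i\<in>UNIV. (u \<bullet> Rep_bix i) * (A (Rep_bix i) \<bullet> v))" for u v
    unfolding sum_bix[of "\<lambda>b. (u \<bullet> b) * (A b \<bullet> v)"] by (subst A) (simp only: inner_sum_left inner_scaleR_left)
  have "bmat (\<lambda>x. A (f x)) = bmat f ** bmat A"
    by (simp add: bmat_def matrix_matrix_mult_def vec_eq_iff to_bix_nth) (intro allI E)
  then show ?thesis by (simp add: bdet_bmat Determinants.det_mul)
qed

lemma foldr_con_linear_slot: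
  assumes "distinct l" "b \<in> set l"
  shows "mv_coeff (foldr con (map (f(b := x + y)) l) a) I
       = mv_coeff (foldr con (map (f(b := x)) l) a) I + mv_coeff (foldr con (map (f(b := y)) l) a) I"
    and "mv_coeff (foldr con (map (f(b := r *\<^sub>R x)) l) a) I = r * mv_coeff (foldr con (map (f(b := x)) l) a) I"
proof -
  obtain l1 l2 where l: "l = l1 @ b # l2" using assms(2) by (meson split_list)
  have n: "b \<notin> set l1" "b \<notin> set l2" using assms(1) l by auto
  have m: "map (f(b := z)) l = map f l1 @ z # map f l2" for z
    unfolding l using n by (simp add: map_fun_upd)
  show "mv_coeff (foldr con (map (f(b := x + y)) l) a) I
       = mv_coeff (foldr con (map (f(b := x)) l) a) I + mv_coeff (foldr con (map (f(b := y)) l) a) I"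
    "mv_coeff (foldr con (map (f(b := r *\<^sub>R x)) l) a) I = r * mv_coeff (foldr con (map (f(b := x)) l) a) I"
    unfolding m by (simp_all add: con_simps linear_add[OF linear_foldr[OF linear_con]] linear_scale[OF linear_foldr[OF linear_con]])
qed

lemma foldr_con_repeated:
  assumes "distinct l" "a \<in> set l" "b \<in> set l" "a \<noteq> b" "f a = f b"
  shows "foldr con (map f l) y = 0"
  using assms
proof (induction l)
  case (Cons c l)
  show ?case
  proof (cases "c = a \<or> c = b")
    case True
    then have "\<exists>d\<in>set l. f d = f c" using Cons.prems by auto
    then have "f c \<in> set (map f l)" by (metis imageI list.set_map)
    then have "con (f c) (foldr con (map f l) y) = 0"
      by (intro foldr_anti_mem linear_con con_con)
    then show ?thesis by simp
  next
    case False
    then show ?thesis using Cons by (auto simp: con_simps)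
  qed
qed simp

abbreviation "bl \<equiv> basis_list Basis"

lemma set_bl: "set bl = Basis" and distinct_bl: "distinct bl"
  by (simp_all add: set_basis_list distinct_basis_list)

lemma alternating_con:
  assumes l: "distinct l" "set l = Basis"
  shows "alternating (\<lambda>f. mv_coeff (foldr con (map f l) y) I)"
proof
  fix f g :: "'a \<Rightarrow> 'b" assume "\<And>b. b \<in> Basis \<Longrightarrow> f b = g b"
  then have "map f l = map g l" by (simp add: l)
  then show "mv_coeff (foldr con (map f l) y) I = mv_coeff (foldr con (map g l) y) I" by (simp only:)
qed (simp_all add: foldr_con_linear_slot l foldr_con_repeated[OF l(1)] del: fun_upd_apply)

lemma foldr_con_basis_abs:
  "distinct l \<Longrightarrow> set l \<subseteq> Basis \<Longrightarrow> I \<subseteq> Basis \<Longrightarrow> I \<inter> set l = {} \<Longrightarrow>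
    \<bar>mv_coeff (foldr con l y) I\<bar> = \<bar>mv_coeff y (I \<union> set l)\<bar>"
proof (induction l arbitrary: I)
  case (Cons b l)
  have s: "\<bar>reorder_sign I J\<bar> = 1" for I J :: "'a set" by (simp add: reorder_sign_def power_abs)
  have "\<bar>mv_coeff (foldr con l y) (insert b I)\<bar> = \<bar>mv_coeff y (insert b I \<union> set l)\<bar>"
    using Cons.prems by (intro Cons.IH) auto
  then show ?case using Cons.prems by (simp add: con_Basis con1_coeff abs_mult s)
qed simp

text \<open>Contraction with a tuple is alternating in the tuple, so it suffices to contract with
  the basis itself. That gives the top coefficient up to a sign depending on the order of the
  list.\<close>

lemma foldr_con_bdet:
  assumes l: "distinct l" "set l = Basis"
  shows "\<bar>mv_coeff (foldr con (map f l) y) {}\<bar> = \<bar>bdet f\<bar> * \<bar>mv_coeff y Basis\<bar>"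
  using alternating_unique[OF alternating_con[OF l], of f y "{}"] foldr_con_basis_abs[of l "{}" y] l
  by (simp add: abs_mult)

lemma transp_works2: "linear A \<Longrightarrow> transp A j \<bullet> u = j \<bullet> A u"
  using transp_works[of A u j] by (simp add: inner_commute)

lemma bdet_transp:
  assumes "linear A"
  shows "bdet (transp A) = bdet A"
proof -
  have "bmat (transp A) = Finite_Cartesian_Product.transpose (bmat A)"
    by (simp add: bmat_def Finite_Cartesian_Product.transpose_def vec_eq_iff to_bix_nth transp_works2[OF assms] inner_commute[of "Rep_bix _" "A _"])
  then show ?thesis by (simp add: bdet_bmat Determinants.det_transpose)
qed

lemma basis_det_gram:
  fixes A :: "'a::euclidean_space \<Rightarrow> 'a"
  assumes "linear A"
  shows "basis_det (\<lambda>u v. A u \<bullet> A v) = (bdet A)\<^sup>2"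
proof -
  have "basis_det (\<lambda>u v. A u \<bullet> A v) = bdet (\<lambda>x. transp A (A x))"
    unfolding bdet_def
    by (rule arg_cong[where f = basis_det], intro HOL.ext) (simp add: transp_works2[OF assms])
  then show ?thesis using bdet_compose[OF linear_transp, of A A] bdet_transp[OF assms] by (simp add: power2_eq_square)
qed

text \<open>The determinant of f on a coordinate subspace, extended by the identity, is alternating
  in f with value one at the identity tuple. This yields block determinants in
  \<open>bdet_prod\<close>.\<close>

lemma bdet_embed:
  fixes j :: "'a::euclidean_space \<Rightarrow> 'b::euclidean_space"
  assumes j: "linear j" "inj j" "j ` Basis \<subseteq> Basis"
  shows "bdet (\<lambda>z. if z \<in> j ` Basis then j (f (inv_into UNIV j z)) else z) = bdet f"
proof -
  let ?F = "\<lambda>f z. if z \<in> j ` Basis then j (f (inv_into UNIV j z)) else z"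
  interpret alternating "bdet :: ('b \<Rightarrow> 'b) \<Rightarrow> real" by (rule alternating_bdet)
  have u: "?F (f(b := x)) = (?F f)(j b := j x)" if "b \<in> Basis" for f b x
    using that by (auto simp: fun_eq_iff inv_f_f[OF j(2)] inj_eq[OF j(2)])
  have "alternating (\<lambda>f. bdet (?F f))"
  proof (unfold_locales, goal_cases)
    case (3 a b f)
    then show ?case using j by (intro alt[of "j a" "j b"]) (auto simp: inv_f_f[OF j(2)] inj_eq[OF j(2)])
  next
    case (4 f g)
    then show ?case by (intro restrict) (auto simp: inv_f_f[OF j(2)])
  qed (use j(3) in \<open>simp_all add: u linear_add[OF j(1)] linear_scale[OF j(1)] add scale image_subset_iff del: fun_upd_apply\<close>)
  moreover have "?F (\<lambda>b. b) = (\<lambda>z. z)" by (auto simp: fun_eq_iff inv_f_f[OF j(2)])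
  ultimately show ?thesis using alternating_unique[of "\<lambda>f. bdet (?F f)" f] by (simp only: bdet_id mult_1_right)
qed

lemma bdet_prod:
  fixes A :: "'a::euclidean_space \<Rightarrow> 'a" and B :: "'b::euclidean_space \<Rightarrow> 'b"
  assumes A: "linear A" and B: "linear B"
  shows "bdet (map_prod A B) = bdet A * bdet B"
proof -
  let ?i = "\<lambda>a :: 'a. (a, 0 :: 'b)" and ?j = "\<lambda>b :: 'b. (0 :: 'a, b)"
  interpret alternating "bdet :: ('a \<times> 'b \<Rightarrow> _) \<Rightarrow> _" by (rule alternating_bdet)
  have ij: "linear ?i" "inj ?i" "?i ` Basis \<subseteq> Basis" "linear ?j" "inj ?j" "?j ` Basis \<subseteq> Basis"
    by (auto simp: linear_iff inj_on_def Basis_prod_def)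
  have "bdet (map_prod A (\<lambda>y :: 'b. y)) = bdet A"
    unfolding bdet_embed[OF ij(1-3), of A, symmetric]
    by (intro restrict) (auto simp: Basis_prod_def inv_f_f[OF ij(2)] linear_0[OF A] image_iff)
  moreover have "bdet (map_prod (\<lambda>x :: 'a. x) B) = bdet B"
    unfolding bdet_embed[OF ij(4-6), of B, symmetric]
    by (intro restrict) (auto simp: Basis_prod_def inv_f_f[OF ij(5)] linear_0[OF B] image_iff)
  moreover have "linear (map_prod A (\<lambda>y :: 'b. y))" using A by (auto simp: linear_iff)
  moreover have "map_prod A B = (\<lambda>z. map_prod A (\<lambda>y :: 'b. y) (map_prod (\<lambda>x :: 'a. x) B z))" by auto
  ultimately show ?thesis
    using bdet_compose[of "map_prod A (\<lambda>y :: 'b. y)" "map_prod (\<lambda>x :: 'a. x) B"] by (simp only:)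
qed

section \<open>The Clifford product and the parity automorphism\<close>

abbreviation "clm \<equiv> mvm (1/2)"

lemma linear_mvpar: "linear mvpar"
  by (intro linearI; rule mv_eqI) (simp_all add: mvpar_coeff algebra_simps)

lemma mvpar_mvm: "mvpar (mvm q a b) = mvm q (mvpar a) (mvpar b)"
proof (rule mv_eqI)
  fix K :: "'a set" assume K: "K \<subseteq> Basis"
  have s: "(-1 :: real) ^ card (symd I J) = (-1) ^ card I * (-1) ^ card J" if "finite I" "finite J" for I J :: "'a set"
    using prod_symd[of I J "\<lambda>_. -1 :: real"] that by simp
  show "mv_coeff (mvpar (mvm q a b)) K = mv_coeff (mvm q (mvpar a) (mvpar b)) K"
    unfolding mvpar_coeff mvm_coeff[OF K] sum_distrib_left
  proof (rule sum.cong[OF refl])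
    fix I :: "'a set" assume "I \<in> Pow Basis"
    then show "(-1) ^ card K * (cmul q I (symd I K) * mv_coeff a I * mv_coeff b (symd I K)) =
      cmul q I (symd I K) * ((-1) ^ card I * mv_coeff a I) * ((-1) ^ card (symd I K) * mv_coeff b (symd I K))"
      using s[of I "symd I K"] K by (simp add: finite_subset_Basis symd_subset symd_cancel)
  qed
qed

lemma mvpar_mvv: "mvpar (mvv v) = - mvv v"
  by (rule mv_eqI) (auto simp: mvpar_coeff mvv_coeff sum_negf[symmetric] sum_distrib_left intro!: sum.cong)

lemma mvpar_mv1 [simp]: "mvpar mv1 = mv1"
  by (rule mv_eqI) (simp add: mvpar_coeff mv1_coeff)

lemma mvpar_ext: "mvpar (ext v a) = - ext v (mvpar a)"
  unfolding ext_def by (simp add: mvpar_mvm mvpar_mvv linear_neg[OF linear_mvm_left])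

lemma mvpar_con: "mvpar (con v a) = - con v (mvpar a)"
proof -
  have "mvpar (mvm 1 (mvv v) a) = - mvm 1 (mvv v) (mvpar a)"
    by (simp add: mvpar_mvm mvpar_mvv linear_neg[OF linear_mvm_left])
  then show ?thesis by (simp add: mvm_vec linear_add[OF linear_mvpar] mvpar_ext)
qed

text \<open>Right multiplication by v commutes with left multiplication by b, which drives the
  induction. Compared with \<open>mvm_vec\<close> only the sign of the contraction differs;
  \<open>lifts_id\<close> exploits exactly this difference.\<close>

lemma mvm_vec_right: "mvm q (mvpar a) (mvv v) = ext v a - q *\<^sub>R con v a"
proof (induction a rule: multivec_induct)
  case (ext b x)
  have c: "con b (mvpar x) = 0" using mvpar_con[of b x] ext(2) by (simp add: linear_0[OF linear_mvpar])
  have c2: "con b (con v x) = 0" using con_con[of b v x] ext(2) by (simp add: con_simps)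
  have "mvpar (ext b x) = - mvm q (mvv b) (mvpar x)"
    by (simp add: mvpar_ext mvm_vec c)
  then have "mvm q (mvpar (ext b x)) (mvv v) = - mvm q (mvv b) (ext v x - q *\<^sub>R con v x)"
    by (simp add: linear_neg[OF linear_mvm_left] mvm_assoc ext(3))
  also have "\<dots> = ext v (ext b x) - q *\<^sub>R con v (ext b x)"
    using ext_ext[of b v x] ext(2) c2
    by (simp add: mvm_vec ext_simps con_simps con_ext inner_commute algebra_simps)
  finally show ?case .
qed (simp_all add: ext_mv1 linear_add[OF linear_mvpar] linear_scale[OF linear_mvpar] mvm_add_left mvm_scale_left
  ext_simps con_simps scaleR_diff_right scaleR_add_right mult.commute)

text \<open>Star interchanges the two terms of \<open>rcl\<close>, which then match
  \<open>mvm_vec_right\<close> at q = 1/2.\<close>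

lemma starm_rcl: "starm (rcl v a) = clm (mvpar (starm a)) (mvv v)"
  by (simp add: rcl_def linear_diff[OF linear_starm] linear_scale[OF linear_starm] starm_con starm_ext mvm_vec_right)

section \<open>Products of vectors and reflections\<close>

definition pinl :: "'a::euclidean_space list \<Rightarrow> 'a multivec" where
  "pinl vs = foldr (\<lambda>v. clm (mvv v)) vs mv1"

lemma pinl_simps [simp]: "pinl [] = mv1" "pinl (v # vs) = clm (mvv v) (pinl vs)"
  by (simp_all add: pinl_def)

lemma pinl_append: "pinl (vs @ ws) = clm (pinl vs) (pinl ws)"
  by (induction vs) (simp_all add: mvm_assoc)

lemma mvpar_pinl: "mvpar (pinl vs) = (-1) ^ length vs *\<^sub>R pinl vs"
  by (induction vs) (simp_all add: mvpar_mvm mvpar_mvv mvm_scale_right linear_neg[OF linear_mvm_left])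

text \<open>The innermost operator acts first, so the vectors appear on the right in reverse order.
  Each parity automorphism that passes a word contributes a sign; these signs are collected in
  s.\<close>

lemma starm_foldr_rcl:
  "\<exists>s. \<bar>s\<bar> = 1 \<and> starm (foldr rcl ws a) = s *\<^sub>R clm ((mvpar ^^ length ws) (starm a)) (pinl (rev ws))"
proof (induction ws)
  case Nil
  show ?case by (intro exI[of _ 1]) simp
next
  case (Cons w ws)
  then obtain s where s: "\<bar>s\<bar> = 1" "starm (foldr rcl ws a) = s *\<^sub>R clm ((mvpar ^^ length ws) (starm a)) (pinl (rev ws))"
    by blast
  show ?case
  proof (intro exI conjI)
    show "\<bar>s * (-1) ^ length ws\<bar> = 1" using s(1) by (simp add: abs_mult power_abs)
    show "starm (foldr rcl (w # ws) a) = (s * (-1) ^ length ws) *\<^sub>R clm ((mvpar ^^ length (w # ws)) (starm a)) (pinl (rev (w # ws)))"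
      using s(2) by (simp add: starm_rcl linear_scale[OF linear_mvpar] mvpar_mvm mvpar_pinl mvm_scale_left mvm_scale_right
        pinl_append mvm_assoc)
  qed
qed

text \<open>Squared length 2 means square one in the Clifford algebra; see \<open>unit_vec\<close>.
  These are the generators in \<open>Pin\<close>.\<close>

definition unitl :: "'a::euclidean_space list \<Rightarrow> bool" where
  "unitl vs \<longleftrightarrow> (\<forall>v\<in>set vs. v \<bullet> v = 2)"

lemma clm_vec_vec: "clm (mvv v) (clm (mvv w) a) = (v \<bullet> w) *\<^sub>R a - clm (mvv w) (clm (mvv v) a)"
  using ext_ext[of v w a] con_con[of v w a]
  by (simp add: mvm_vec con_simps ext_simps con_ext inner_commute algebra_simps flip: scaleR_add_left)

lemma clm_unit: "v \<bullet> v = 2 \<Longrightarrow> clm (mvv v) (clm (mvv v) a) = a"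
proof -
  assume "v \<bullet> v = 2"
  then have "2 *\<^sub>R clm (mvv v) (clm (mvv v) a) = 2 *\<^sub>R a"
    using clm_vec_vec[of v v a] by (metis add.commute diff_add_cancel scaleR_2)
  then show ?thesis by simp
qed

lemma pinl_rev: "unitl vs \<Longrightarrow> clm (pinl (rev vs)) (pinl vs) = mv1"
proof (induction vs)
  case (Cons v vs)
  then have v: "v \<bullet> v = 2" and vs: "unitl vs" by (auto simp: unitl_def)
  show ?case using Cons.IH[OF vs] by (simp add: pinl_append mvm_assoc clm_unit[OF v])
qed simp

text \<open>A reflection only for squared length 2, which absorbs the usual factor 2 / (v .
  v).\<close>

definition refl :: "'a::euclidean_space \<Rightarrow> 'a \<Rightarrow> 'a" where
  "refl v x = x - (x \<bullet> v) *\<^sub>R v"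

text \<open>The intertwining condition of \<open>pin_lift\<close>, separated from membership in the
  Pin group. The parity automorphism makes a vector lift its reflection and not the negative of
  it.\<close>

definition lifts :: "('a::euclidean_space \<Rightarrow> 'a) \<Rightarrow> 'a multivec \<Rightarrow> bool" where
  "lifts A a \<longleftrightarrow> (\<forall>v. clm (mvpar a) (mvv v) = clm (mvv (A v)) a)"

lemma lifts_mult: "lifts A a \<Longrightarrow> lifts B b \<Longrightarrow> lifts (A \<circ> B) (clm a b)"
  unfolding lifts_def by (metis mvm_assoc mvpar_mvm o_apply)

lemma lifts_vec: "v \<bullet> v = 2 \<Longrightarrow> lifts (refl v) (mvv v)"
  unfolding lifts_def
proof
  fix x assume v: "v \<bullet> v = 2"
  have "clm (mvv v) (mvv v) = mv1" using clm_unit[OF v, of mv1] by simp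
  moreover have "clm (mvv v) (mvv x) = (v \<bullet> x) *\<^sub>R mv1 - clm (mvv x) (mvv v)"
    using clm_vec_vec[of v x mv1] by simp
  ultimately show "clm (mvpar (mvv v)) (mvv x) = clm (mvv (refl v x)) (mvv v)"
    by (simp add: mvpar_mvv refl_def linear_neg[OF linear_mvm_left] linear_diff[OF linear_mvv] linear_scale[OF linear_mvv]
      linear_diff[OF linear_mvm_left] mvm_scale_left inner_commute)
qed

lemma lifts_pinl: "unitl vs \<Longrightarrow> lifts (foldr refl vs) (pinl vs)"
proof (induction vs)
  case Nil
  show ?case by (simp add: lifts_def)
next
  case (Cons v vs)
  then show ?case using lifts_mult[OF lifts_vec[of v], of "foldr refl vs" "pinl vs"]
    by (simp add: unitl_def o_def)
qed

text \<open>By \<open>mvm_vec\<close> and \<open>mvm_vec_right\<close>, the condition says that the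
  contraction of a with every vector equals its own negative. So all contractions vanish and only
  the scalar part is left.\<close>

lemma lifts_id: "lifts (\<lambda>v. v) a \<Longrightarrow> a = mv_coeff a {} *\<^sub>R mv1"
proof -
  assume a: "lifts (\<lambda>v. v) a"
  have c: "con v a = 0" for v
  proof -
    have e: "x - h = x + h \<Longrightarrow> h = 0" for h x :: "'a multivec"
    proof -
      assume "x - h = x + h"
      then have "(x - h) - (x - h) = (x + h) - (x - h)" by (rule arg_cong)
      then have "2 *\<^sub>R h = 0" by (simp add: scaleR_2)
      then show "h = 0" by simp
    qed
    have "ext v a - (1/2) *\<^sub>R con v a = ext v a + (1/2) *\<^sub>R con v a"
      using a unfolding lifts_def mvm_vec_right mvm_vec by blast
    from e[OF this] show ?thesis by simp
  qed
  have "a - mv_coeff a {} *\<^sub>R mv1 = 0"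
  proof (rule con_determines)
    show "mv_coeff (a - mv_coeff a {} *\<^sub>R mv1) {} = 0" by (simp add: mv1_coeff)
    show "con b (a - mv_coeff a {} *\<^sub>R mv1) = 0" for b by (simp add: con_simps c)
  qed
  then show ?thesis by simp
qed

text \<open>With these weights \<open>ext v\<close> is adjoint to half of \<open>con v\<close>, so
  Clifford multiplication by vectors is self-adjoint. Words of vectors of squared length 2 then have
  norm one, which fixes the scalar in \<open>pinl_id\<close> up to sign.\<close>

definition mvip :: "'a::euclidean_space multivec \<Rightarrow> 'a multivec \<Rightarrow> real" where
  "mvip a b = (\<Sum>I\<in>Pow Basis. (1/2) ^ card I * (mv_coeff a I * mv_coeff b I))"

lemma mvip_ext_Basis:
  fixes b :: "'a::euclidean_space"
  assumes b: "b \<in> Basis"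
  shows "mvip (ext b a) c = (1/2) * mvip a (con b c)"
proof -
  let ?P = "{I \<in> Pow (Basis :: 'a set). b \<in> I}" and ?Q = "{I \<in> Pow (Basis :: 'a set). b \<notin> I}"
  have 1: "mvip (ext b a) c = (\<Sum>I\<in>?P. (1/2) ^ card I * (reorder_sign {b} I * mv_coeff a (I - {b}) * mv_coeff c I))"
    unfolding mvip_def using b
    by (intro sum.mono_neutral_cong_right) (auto simp: ext1_coeff)
  have 2: "mvip a (con b c) = (\<Sum>I\<in>?Q. (1/2) ^ card I * (mv_coeff a I * (reorder_sign {b} I * mv_coeff c (insert b I))))"
    unfolding mvip_def using b
    by (intro sum.mono_neutral_cong_right) (auto simp: con_Basis con1_coeff)
  have "(\<Sum>I\<in>?P. (1/2) ^ card I * (reorder_sign {b} I * mv_coeff a (I - {b}) * mv_coeff c I))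
    = (\<Sum>I\<in>?Q. (1/2) ^ card (insert b I) * (reorder_sign {b} (insert b I) * mv_coeff a I * mv_coeff c (insert b I)))"
    using b by (intro sum.reindex_bij_witness[where i = "insert b" and j = "\<lambda>I. I - {b}"]) (auto simp: insert_absorb)
  also have "\<dots> = (1/2) * mvip a (con b c)"
    unfolding 2 sum_distrib_left
  proof (intro sum.cong refl)
    fix I assume "I \<in> ?Q"
    then have "finite I" "b \<notin> I" using finite_subset_Basis[of I] by auto
    then show "(1/2) ^ card (insert b I) * (reorder_sign {b} (insert b I) * mv_coeff a I * mv_coeff c (insert b I)) =
      (1/2) * ((1/2) ^ card I * (mv_coeff a I * (reorder_sign {b} I * mv_coeff c (insert b I))))"
      by (simp add: insert_sign)
  qed
  finally show ?thesis using 1 by simp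
qed

lemma linear_mvip_right: "linear (mvip c)"
proof -
  have "linear (\<lambda>a. (1/2) ^ card I * (mv_coeff c I * mv_coeff a I))" for I
    by (intro linearI) (simp_all add: algebra_simps)
  then show ?thesis unfolding mvip_def by (intro linear_compose_sum) blast
qed

lemma mvip_sym: "mvip a b = mvip b a" by (simp add: mvip_def mult.commute)

lemma linear_mvip_left: "linear (\<lambda>a. mvip a c)"
  using linear_mvip_right[of c] by (simp add: mvip_sym[of _ c])

lemma mvip_ext: "mvip (ext v a) c = (1/2) * mvip a (con v c)"
proof -
  have l: "linear (\<lambda>v. mvip (ext v a) c)" "linear (\<lambda>v. (1/2) * mvip a (con v c))"
    by (intro linearI; simp add: ext_simps con_simps linear_add[OF linear_mvip_left] linear_add[OF linear_mvip_right]
      linear_scale[OF linear_mvip_left] linear_scale[OF linear_mvip_right] algebra_simps)+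
  show ?thesis by (rule linear_eq_on_span[OF l, of Basis]) (simp_all add: mvip_ext_Basis)
qed

lemma mvip_clm: "mvip (clm (mvv v) a) c = mvip a (clm (mvv v) c)"
  using mvip_ext[of v a c] mvip_ext[of v c a]
  by (simp add: mvm_vec linear_add[OF linear_mvip_left] linear_add[OF linear_mvip_right]
      linear_scale[OF linear_mvip_left] linear_scale[OF linear_mvip_right] mvip_sym[of "con v a" c] mvip_sym[of "ext v c" a])

lemma mvip_mv1: "mvip mv1 (mv1 :: 'a::euclidean_space multivec) = 1"
proof -
  have "mvip mv1 (mv1 :: 'a multivec) = (\<Sum>I\<in>Pow (Basis :: 'a set). if I = {} then 1 else 0)"
    unfolding mvip_def by (intro sum.cong refl) (simp add: mv1_coeff)
  then show ?thesis by (simp add: sum.delta)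
qed

lemma mvip_pinl: "unitl vs \<Longrightarrow> mvip (pinl vs) (pinl vs) = 1"
  by (induction vs) (simp_all add: mvip_mv1 mvip_clm clm_unit unitl_def)

lemma pinl_id:
  assumes "unitl vs" "foldr refl vs = (\<lambda>v. v)"
  shows "\<exists>s. \<bar>s\<bar> = 1 \<and> pinl vs = s *\<^sub>R mv1"
proof -
  define s where "s = mv_coeff (pinl vs) {}"
  have e: "pinl vs = s *\<^sub>R mv1"
    unfolding s_def using lifts_pinl[OF assms(1)] assms(2) by (intro lifts_id) simp
  have "s * s = 1"
    using mvip_pinl[OF assms(1)] unfolding e
    by (simp add: linear_scale[OF linear_mvip_left] linear_scale[OF linear_mvip_right] mvip_mv1)
  then have "\<bar>s\<bar> = 1" by (metis abs_mult_self_eq abs_one abs_mult mult_cancel_right1 power2_eq_square power2_eq_1_iff abs_minus_cancel)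
  with e show ?thesis by blast
qed

lemma mvpar_top: "mvpar mvtop = (-1) ^ DIM('a) *\<^sub>R (mvtop :: 'a::euclidean_space multivec)"
  by (rule mv_eqI) (simp add: mvpar_coeff mvtop_coeff)

lemma mvpar_pow_eigen: "mvpar a = s *\<^sub>R a \<Longrightarrow> (mvpar ^^ n) a = s ^ n *\<^sub>R a"
  by (induction n) (simp_all add: linear_scale[OF linear_mvpar] mult.commute)

text \<open>This is \<open>psi\<close> when b is the product of the lift of the twist and the lift
  of Ad; see \<open>psi_psim\<close>.\<close>

definition psim :: "'a::euclidean_space multivec \<Rightarrow> 'a multivec" where
  "psim b = inv_into UNIV starm (clm mvtop b)"

lemma starm_psim: "starm (psim b) = clm mvtop b"
  unfolding psim_def by (rule surj_f_inv_f[OF bij_is_surj[OF bij_starm]])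

text \<open>Under star the scalar part becomes the top coefficient, and the operators
  \<open>rcl\<close> append the reversed word ws to the word bs. The combined word lifts the
  identity, so it is plus or minus one and only the volume element remains.\<close>

theorem foldr_rcl_psi:
  assumes u: "unitl (bs @ rev ws)" and r: "foldr refl (bs @ rev ws) = (\<lambda>v. v)"
  shows "\<bar>mv_coeff (foldr rcl ws (psim (pinl bs))) {}\<bar> = 1"
proof -
  let ?b = "pinl bs"
  obtain s where s: "\<bar>s\<bar> = 1" "starm (foldr rcl ws (psim ?b)) = s *\<^sub>R clm ((mvpar ^^ length ws) (starm (psim ?b))) (pinl (rev ws))"
    using starm_foldr_rcl by blast
  obtain t where t: "\<bar>t\<bar> = 1" "pinl (bs @ rev ws) = t *\<^sub>R mv1"
    using pinl_id[OF u r] by blast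
  define c where "c = ((-1) ^ DIM('a) * (-1) ^ length bs :: real) ^ length ws"
  have c: "\<bar>c\<bar> = 1" by (simp add: c_def abs_mult power_abs)
  have "mvpar (clm mvtop ?b) = ((-1) ^ DIM('a) * (-1) ^ length bs) *\<^sub>R clm mvtop ?b"
    by (simp add: mvpar_mvm mvpar_top mvpar_pinl mvm_scale_left mvm_scale_right)
  then have "(mvpar ^^ length ws) (starm (psim ?b)) = c *\<^sub>R clm mvtop ?b"
    unfolding starm_psim c_def by (rule mvpar_pow_eigen)
  then have "starm (foldr rcl ws (psim ?b)) = (s * c) *\<^sub>R clm mvtop (pinl (bs @ rev ws))"
    using s(2) by (simp add: mvm_scale_left mvm_assoc pinl_append)
  then have "starm (foldr rcl ws (psim ?b)) = (s * c * t) *\<^sub>R mvtop"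
    unfolding t(2) by (simp add: mvm_scale_right)
  then have "mv_coeff (foldr rcl ws (psim ?b)) {} = s * c * t"
    unfolding starm_coeff_top[symmetric] by (simp add: mvtop_coeff)
  then show ?thesis using s t c by (simp add: abs_mult)
qed

text \<open>Words with the same product of reflections agree up to sign in the Clifford algebra.
  Their lengths have the same parity, since a nonzero element cannot be both even and odd; so the
  powers of the parity automorphism in \<open>starm_foldr_rcl\<close> act alike.\<close>

theorem foldr_rcl_cong:
  assumes u: "unitl ws" "unitl ws'" and r: "foldr refl (rev ws) = foldr refl (rev ws')"
  shows "\<bar>mv_coeff (foldr rcl ws a) {}\<bar> = \<bar>mv_coeff (foldr rcl ws' a) {}\<bar>"
proof -
  have u': "unitl (ws @ rev ws')" "unitl (rev ws)" "unitl (rev ws')" using u by (auto simp: unitl_def)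
  have rr: "refl v (refl v x) = x" if "v \<bullet> v = 2" for v x :: 'a
    using that by (simp add: refl_def inner_diff_left algebra_simps flip: scaleR_add_left)
  have inv: "foldr refl vs (foldr refl (rev vs) x) = x" if "unitl vs" for vs and x :: 'a
    using that by (induction vs arbitrary: x) (auto simp: unitl_def rr)
  have "foldr refl (ws @ rev ws') = (\<lambda>v. v)"
    using inv[OF u(1)] r by (simp add: fun_eq_iff)
  from pinl_id[OF u'(1) this] obtain s where s: "\<bar>s\<bar> = 1" "clm (pinl ws) (pinl (rev ws')) = s *\<^sub>R mv1"
    by (auto simp: pinl_append)
  have "clm (pinl (rev ws)) (clm (pinl ws) (pinl (rev ws'))) = pinl (rev ws')"
    using pinl_rev[OF u(1)] by (simp flip: mvm_assoc)
  then have e: "pinl (rev ws') = s *\<^sub>R pinl (rev ws)"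
    unfolding s(2) by (simp add: mvm_scale_right)
  have nz: "pinl (rev ws) \<noteq> 0" using mvip_pinl[OF u'(2)] linear_0[OF linear_mvip_left, of "pinl (rev ws)"] by auto
  have "mvpar (pinl (rev ws')) = ((-1) ^ length ws' * s) *\<^sub>R pinl (rev ws)"
    unfolding mvpar_pinl by (simp add: e)
  moreover have "mvpar (pinl (rev ws')) = ((-1) ^ length ws * s) *\<^sub>R pinl (rev ws)"
    unfolding e by (simp add: mvpar_pinl linear_scale[OF linear_mvpar])
  ultimately have par: "(-1 :: real) ^ length ws' = (-1) ^ length ws"
    using nz s(1) by auto
  have pp: "(mvpar ^^ n) a = (if even n then a else mvpar a)" for n and a :: "'a multivec"
  proof (induction n)
    case (Suc n)
    have "mvpar (mvpar a) = a" by (rule mv_eqI) (simp add: mvpar_coeff flip: power_add mult_2)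
    then show ?case using Suc by simp
  qed simp
  have ev: "even (length ws) = even (length ws')"
    using par by (cases "even (length ws)"; cases "even (length ws')") auto
  obtain t where t: "\<bar>t\<bar> = 1" "starm (foldr rcl ws a) = t *\<^sub>R clm ((mvpar ^^ length ws) (starm a)) (pinl (rev ws))"
    using starm_foldr_rcl by blast
  obtain t' where t': "\<bar>t'\<bar> = 1" "starm (foldr rcl ws' a) = t' *\<^sub>R clm ((mvpar ^^ length ws') (starm a)) (pinl (rev ws'))"
    using starm_foldr_rcl by blast
  show ?thesis
    unfolding starm_coeff_top[symmetric] t(2) t'(2) e pp ev using t(1) t'(1) s(1)
    by (simp add: abs_mult mvm_scale_right)
qed

lemma foldr_refl_orthogonal:
  assumes "distinct l" "pairwise (\<lambda>a b. f a \<bullet> f b = 0) (set l)"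
  shows "foldr refl (map f l) x = x - (\<Sum>a\<in>set l. (x \<bullet> f a) *\<^sub>R f a)"
  using assms
proof (induction l)
  case (Cons a l)
  have "(\<Sum>b\<in>set l. (x \<bullet> f b) *\<^sub>R f b) \<bullet> f a = 0"
    using Cons.prems by (auto simp: inner_sum_left pairwise_def intro!: sum.neutral)
  moreover have "pairwise (\<lambda>a b. f a \<bullet> f b = 0) (set l)"
    using Cons.prems by (auto simp: pairwise_def)
  moreover from this have "foldr refl (map f l) x = x - (\<Sum>b\<in>set l. (x \<bullet> f b) *\<^sub>R f b)"
    using Cons by simp
  ultimately show ?case using Cons.prems(1)
    by (simp only: list.map foldr_Cons o_apply) (simp add: refl_def inner_diff_left algebra_simps)
qed simp

lemma orth_inner: "orthogonal_transformation M \<Longrightarrow> M x \<bullet> M y = x \<bullet> y"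
  by (simp add: orthogonal_transformation_def)

lemma orth_linear: "orthogonal_transformation M \<Longrightarrow> linear M"
  by (simp add: orthogonal_transformation_def)

lemma orth_sum:
  fixes M N :: "'a::euclidean_space \<Rightarrow> 'a"
  assumes M: "orthogonal_transformation M" and N: "orthogonal_transformation N"
  shows "(\<Sum>b\<in>Basis. (M x \<bullet> M b) *\<^sub>R N b) = N x"
proof -
  have "(\<Sum>b\<in>Basis. (M x \<bullet> M b) *\<^sub>R N b) = N (\<Sum>b\<in>Basis. (x \<bullet> b) *\<^sub>R b)"
    by (simp add: orth_inner[OF M] linear_sum[OF orth_linear[OF N]] linear_scale[OF orth_linear[OF N]])
  then show ?thesis by (simp add: euclidean_representation)
qed

text \<open>The vectors (M b, N b) are orthogonal of squared length 2 and span the graph formed by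
  the pairs (M x, N x). The product of their reflections is -1 on this graph and 1 on its
  complement, formed by the pairs (M x, - N x); hence it interchanges x and y up to sign.\<close>

lemma foldr_refl_graph:
  fixes M N :: "'a::euclidean_space \<Rightarrow> 'a"
  assumes M: "orthogonal_transformation M" and N: "orthogonal_transformation N"
    and l: "distinct l" "set l = Basis"
  shows "foldr refl (map (\<lambda>b. (M b, N b)) l) (M x, N y) = (- M y, - N x)"
proof -
  have "pairwise (\<lambda>a b. (M a, N a) \<bullet> (M b, N b) = 0) (set l)"
    by (auto simp: pairwise_def inner_prod_def orth_inner[OF M] orth_inner[OF N] l inner_Basis)
  then have "foldr refl (map (\<lambda>b. (M b, N b)) l) (M x, N y)
    = (M x, N y) - (\<Sum>b\<in>Basis. ((M x, N y) \<bullet> (M b, N b)) *\<^sub>R (M b, N b))"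
    using foldr_refl_orthogonal[OF l(1), of "\<lambda>b. (M b, N b)"] l by simp
  also have "(\<Sum>b\<in>Basis. ((M x, N y) \<bullet> (M b, N b)) *\<^sub>R (M b, N b)) = (M x + M y, N x + N y)"
    by (simp add: prod_eq_iff fst_sum snd_sum inner_prod_def scaleR_add_left sum.distrib
      orth_sum[OF M M] orth_sum[OF M N] orth_sum[OF N N] orth_sum[OF N M])
  finally show ?thesis by simp
qed

lemma skew_form_add:
  assumes a: "skew_form a" and b: "skew_form b"
  shows "skew_form (\<lambda>u v. a u v + b u v)"
  unfolding skew_form_def
proof (intro conjI allI)
  fix u v
  show "a u v + b u v = - (a v u + b v u)"
    using skew_formD(1)[OF a, of u v] skew_formD(1)[OF b, of u v] by linarith
qed (intro linear_compose_add skew_formD(2,3)[OF a] skew_formD(2,3)[OF b])+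

lemma skew_form_pull:
  assumes a: "skew_form a" and L: "linear L"
  shows "skew_form (\<lambda>u v. a (L u) (L v))"
  unfolding skew_form_def
proof (intro conjI allI)
  show "linear (\<lambda>v. a (L u) (L v))" for u by (rule linear_compose'[OF skew_formD(2)[OF a] L])
  show "linear (\<lambda>u. a (L u) (L v))" for v by (rule linear_compose'[OF skew_formD(3)[OF a] L])
  show "a (L u) (L v) = - a (L v) (L u)" for u v by (rule skew_formD(1)[OF a])
qed

lemma orth_refl:
  fixes r :: "'a::euclidean_space"
  assumes "r \<bullet> r = 2"
  shows "orthogonal_transformation (refl r)"
  unfolding orthogonal_transformation_def
proof
  show "linear (refl r)" by (intro linearI) (simp_all add: refl_def inner_add_left algebra_simps)
  show "\<forall>v w. refl r v \<bullet> refl r w = v \<bullet> w"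
    using assms by (simp add: refl_def inner_diff_left inner_diff_right inner_commute)
qed

text \<open>Cartan--Dieudonne: the reflection in \<open>A v - v\<close> enlarges the space of fixed vectors.\<close>

lemma exists_reflections:
  fixes A :: "'a::euclidean_space \<Rightarrow> 'a"
  assumes "orthogonal_transformation A"
  shows "\<exists>vs. unitl vs \<and> foldr refl vs = A"
  using assms
proof (induction "DIM('a) - dim {x. A x = x}" arbitrary: A rule: less_induct)
  case less
  note A = less.prems
  have sub: "subspace {x. B x = x}" if "linear B" for B :: "'a \<Rightarrow> 'a"
    using that by (auto simp: subspace_def linear_0 linear_add linear_scale)
  show ?case
  proof (cases "\<forall>x. A x = x")
    case True
    then show ?thesis by (intro exI[of _ "[]"]) (auto simp: unitl_def)
  next
    case False
    then obtain v where v: "A v \<noteq> v" by auto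
    define d where "d = A v - v"
    \<comment> \<open>The direction of A v - v, scaled to the squared length 2 that
      \<open>unitl\<close> demands.\<close>
    define r where "r = (sqrt 2 / norm d) *\<^sub>R d"
    have d: "d \<noteq> 0" using v by (simp add: d_def)
    have rr: "r \<bullet> r = 2" using d by (simp add: r_def power2_norm_eq_inner[symmetric] power_divide field_simps power2_eq_square)
    have reflr: "refl r x = x - (2 * (x \<bullet> d) / (d \<bullet> d)) *\<^sub>R d" for x
    proof -
      have "(x \<bullet> r) *\<^sub>R r = ((sqrt 2 * sqrt 2) * (x \<bullet> d) / (norm d * norm d)) *\<^sub>R d"
        by (simp add: r_def field_simps)
      also have "norm d * norm d = d \<bullet> d" by (simp add: power2_norm_eq_inner[symmetric] power2_eq_square)
      finally show ?thesis by (simp add: refl_def)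
    qed
    define B where "B = refl r \<circ> A"
    have B: "orthogonal_transformation B"
      unfolding B_def by (rule orthogonal_transformation_compose[OF orth_refl[OF rr] A])
    have fixB: "B x = x" if "A x = x" for x
    proof -
      have "x \<bullet> d = 0" using orth_inner[OF A, of x v] that by (simp add: d_def inner_diff_right)
      then show ?thesis using that by (simp add: B_def reflr)
    qed
    have "B v = v"
    proof -
      \<comment> \<open>As A preserves lengths, A v and v are mirror images in the hyperplane
        orthogonal to their difference d.\<close>
      have "d \<bullet> d = 2 * (A v \<bullet> d)"
        using orth_inner[OF A, of v v] by (simp add: d_def inner_diff_left inner_diff_right inner_commute)
      then have "2 * (A v \<bullet> d) / (d \<bullet> d) = 1" using d by (metis divide_self inner_eq_zero_iff)
      then have "B v = A v - d" unfolding B_def o_apply reflr[of "A v"] by (simp only: scaleR_one)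
      then show ?thesis by (simp add: d_def)
    qed
    then have "{x. A x = x} \<subset> {x. B x = x}" using fixB v by auto
    then have "dim {x. A x = x} < dim {x. B x = x}"
      using sub[OF orth_linear[OF A]] sub[OF orth_linear[OF B]] by (metis dim_psubset span_eq_iff)
    moreover have "dim {x. B x = x} \<le> DIM('a)" by (rule dim_subset_UNIV)
    ultimately have "DIM('a) - dim {x. B x = x} < DIM('a) - dim {x. A x = x}" by linarith
    from less.hyps[OF this B] obtain vs where vs: "unitl vs" "foldr refl vs = B" by blast
    have "refl r (refl r x) = x" for x
      using rr by (simp add: refl_def inner_diff_left flip: scaleR_add_left)
    then have "foldr refl (r # vs) = A" using vs(2) by (simp add: B_def fun_eq_iff)
    moreover have "unitl (r # vs)" using vs rr by (simp add: unitl_def)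
    ultimately show ?thesis by blast
  qed
qed

lemma foldr_refl_fst: "foldr refl (map (\<lambda>a. (a, 0)) vs) (x, y) = (foldr refl vs x, y)"
  by (induction vs) (simp_all add: refl_def inner_prod_def)

lemma foldr_refl_snd: "foldr refl (map (\<lambda>a. (0, a)) vs) (x, y) = (x, foldr refl vs y)"
  by (induction vs) (simp_all add: refl_def inner_prod_def)

lemma foldr_refl_conj:
  assumes "orthogonal_transformation U"
  shows "foldr refl (map U vs) (U x) = U (foldr refl vs x)"
  by (induction vs) (simp_all add: refl_def orth_inner[OF assms] linear_diff[OF orth_linear[OF assms]] linear_scale[OF orth_linear[OF assms]])

definition graph_list :: "('a::euclidean_space \<Rightarrow> 'a) \<Rightarrow> ('a \<Rightarrow> 'a) \<Rightarrow> ('a \<times> 'a) list" where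
  "graph_list M N = map (\<lambda>b. (M b, N b)) bl"

text \<open>
  The two-form and the moment map differential of a double, in coordinates in which the
  Maurer-Cartan forms of the two factors are \<open>\<theta>1\<close> and \<open>\<theta>2\<close>.
\<close>

locale double_data =
  fixes \<theta>1 \<theta>2 M1 N1 M2 N2 :: "'e::euclidean_space \<Rightarrow> 'e"
  assumes lin1: "linear \<theta>1" and lin2: "linear \<theta>2" and bij1: "bij \<theta>1" and bij2: "bij \<theta>2"
    and M1: "orthogonal_transformation M1" and N1: "orthogonal_transformation N1"
    and M2: "orthogonal_transformation M2" and N2: "orthogonal_transformation N2"
begin

definition dmom :: "'e \<times> 'e \<Rightarrow> 'e \<times> 'e" where
  "dmom z = (M1 (\<theta>1 (fst z)) + M2 (\<theta>2 (snd z)), N1 (\<theta>1 (fst z)) + N2 (\<theta>2 (snd z)))"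

definition form2 :: "'e \<times> 'e \<Rightarrow> 'e \<times> 'e \<Rightarrow> real" where
  "form2 z z' = - (1/2) * ((M1 (\<theta>1 (fst z)) \<bullet> M2 (\<theta>2 (snd z')) + N1 (\<theta>1 (fst z)) \<bullet> N2 (\<theta>2 (snd z')))
     - (M1 (\<theta>1 (fst z')) \<bullet> M2 (\<theta>2 (snd z)) + N1 (\<theta>1 (fst z')) \<bullet> N2 (\<theta>2 (snd z))))"

text \<open>The frame in which the Maurer-Cartan forms take the values in \<open>Basis\<close>.
  Vectors of the second factor come first, because \<open>form2 y x\<close> has the sign required by
  \<open>foldr_con_exp_pull\<close> when the later vector y belongs to the first factor and x to the
  second.\<close>

definition ws :: "('e \<times> 'e) list" where
  "ws = map (\<lambda>b. (0, inv_into UNIV \<theta>2 b)) bl @ map (\<lambda>b. (inv_into UNIV \<theta>1 b, 0)) bl"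

lemma invs [simp]: "\<theta>1 (inv_into UNIV \<theta>1 x) = x" "\<theta>2 (inv_into UNIV \<theta>2 x) = x"
  using bij1 bij2 by (simp_all add: bij_is_surj surj_f_inv_f)

lemma zeros [simp]: "\<theta>1 0 = 0" "\<theta>2 0 = 0" "M1 0 = 0" "M2 0 = 0" "N1 0 = 0" "N2 0 = 0"
  using lin1 lin2 M1 M2 N1 N2 by (auto simp: linear_0 orth_linear)

lemmas lins = linear_add[OF lin1] linear_add[OF lin2] linear_scale[OF lin1] linear_scale[OF lin2]
  linear_add[OF orth_linear[OF M1]] linear_add[OF orth_linear[OF M2]] linear_add[OF orth_linear[OF N1]] linear_add[OF orth_linear[OF N2]]
  linear_scale[OF orth_linear[OF M1]] linear_scale[OF orth_linear[OF M2]] linear_scale[OF orth_linear[OF N1]] linear_scale[OF orth_linear[OF N2]]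

lemma linear_dmom: "linear dmom"
  by (intro linearI) (simp_all add: dmom_def lins algebra_simps)

lemma skew_form2: "skew_form form2"
  unfolding skew_form_def form2_def
  by (intro conjI allI linearI) (simp_all add: lins inner_add_left inner_add_right algebra_simps)

lemma map_dmom_ws: "map dmom ws = graph_list M2 N2 @ graph_list M1 N1"
  by (simp add: ws_def graph_list_def dmom_def o_def)

lemma sorted_ws: "sorted_wrt (\<lambda>x y. form2 y x = - (1/2) * (dmom x \<bullet> dmom y)) ws"
proof -
  have 1: "sorted_wrt (\<lambda>x y. form2 y x = - (1/2) * (dmom x \<bullet> dmom y)) (map (\<lambda>b. (0, inv_into UNIV \<theta>2 b)) l)"
    if "distinct l" "set l \<subseteq> Basis" for l
    using that by (induction l)
      (auto simp: form2_def dmom_def inner_prod_def orth_inner[OF M2] orth_inner[OF N2] inner_Basis)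
  have 2: "sorted_wrt (\<lambda>x y. form2 y x = - (1/2) * (dmom x \<bullet> dmom y)) (map (\<lambda>b. (inv_into UNIV \<theta>1 b, 0)) l)"
    if "distinct l" "set l \<subseteq> Basis" for l
    using that by (induction l)
      (auto simp: form2_def dmom_def inner_prod_def orth_inner[OF M1] orth_inner[OF N1] inner_Basis)
  show ?thesis unfolding ws_def sorted_wrt_append
    using 1[of bl] 2[of bl] distinct_bl set_bl
    by (auto simp: form2_def dmom_def inner_prod_def inner_commute)
qed

lemma unitl_graph: "unitl (graph_list M1 N1)" "unitl (graph_list M2 N2)"
  by (auto simp: unitl_def graph_list_def set_bl inner_prod_def orth_inner[OF M1] orth_inner[OF M2] orth_inner[OF N1] orth_inner[OF N2])

text \<open>Contraction with ws evaluates a top form on the frame of the Maurer-Cartan forms.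
  Returning to the coordinate frame costs the two determinants.\<close>

lemma foldr_con_ws: "\<bar>mv_coeff y Basis\<bar> = \<bar>bdet \<theta>1\<bar> * \<bar>bdet \<theta>2\<bar> * \<bar>mv_coeff (foldr con ws y) {}\<bar>"
proof -
  let ?i1 = "inv_into UNIV \<theta>1" and ?i2 = "inv_into UNIV \<theta>2"
  let ?l = "map (\<lambda>b :: 'e. (0 :: 'e, b)) bl @ map (\<lambda>b :: 'e. (b, 0 :: 'e)) bl"
  have i1: "linear ?i1" and i2: "linear ?i2"
    using lin1 lin2 bij1 bij2 by (auto simp: bij_def inj_linear_imp_inv_linear)
  have ws: "ws = map (map_prod ?i1 ?i2) ?l"
    by (simp add: ws_def o_def linear_0[OF i1] linear_0[OF i2])
  have d: "distinct ?l" by (auto intro: distinct_bl simp: distinct_map inj_on_def set_bl nonzero_Basis)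
  have s: "set ?l = Basis" by (auto simp: set_bl Basis_prod_def)
  have b1: "bdet \<theta>1 * bdet ?i1 = 1" using bdet_compose[OF lin1, of ?i1] by (simp add: bdet_id)
  have b2: "bdet \<theta>2 * bdet ?i2 = 1" using bdet_compose[OF lin2, of ?i2] by (simp add: bdet_id)
  have "\<bar>mv_coeff (foldr con ws y) {}\<bar> = \<bar>bdet ?i1 * bdet ?i2\<bar> * \<bar>mv_coeff y Basis\<bar>"
    unfolding ws foldr_con_bdet[OF d s] bdet_prod[OF i1 i2] ..
  moreover have "\<bar>bdet \<theta>1\<bar> * \<bar>bdet \<theta>2\<bar> * \<bar>bdet ?i1 * bdet ?i2\<bar> = \<bar>(bdet \<theta>1 * bdet ?i1) * (bdet \<theta>2 * bdet ?i2)\<bar>"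
    by (simp add: abs_mult)
  ultimately show ?thesis using b1 b2 by (simp add: mult.assoc[symmetric])
qed

lemma refl_ws:
  "foldr refl (rev (map dmom ws)) (M2 x, N2 y) = foldr refl (map (\<lambda>b. (M1 b, N1 b)) (rev bl)) (- M2 y, - N2 x)"
proof -
  have "foldr refl (map (\<lambda>b. (M2 b, N2 b)) (rev bl)) (M2 x, N2 y) = (- M2 y, - N2 x)"
    by (rule foldr_refl_graph[OF M2 N2]) (simp_all add: distinct_bl set_bl)
  then show ?thesis
    by (simp add: map_dmom_ws graph_list_def rev_map)
qed

lemma unitl_ws: "unitl (map dmom ws)"
  using unitl_graph by (auto simp: map_dmom_ws unitl_def)

text \<open>Each of the two products of reflections interchanges the two summands, so together they
  preserve them. The conditions on \<open>C1\<close> and \<open>C2\<close> describe the resulting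
  diagonal blocks.\<close>

lemma refl_ws_block:
  assumes C1: "\<And>y. C1 (M2 (inv_into UNIV N2 (N1 y))) = M1 y" and C2: "\<And>x. C2 (N2 (inv_into UNIV M2 (M1 x))) = N1 x"
  shows "foldr refl (rev (map dmom ws)) (a, b) = (C1 a, C2 b)"
proof -
  have bij: "bij M1" "bij N1" "bij M2" "bij N2"
    using M1 M2 N1 N2 orthogonal_transformation_bij by auto
  define x where "x = inv_into UNIV M2 a"
  define y where "y = inv_into UNIV N2 b"
  define p where "p = inv_into UNIV M1 (M2 y)"
  define q where "q = inv_into UNIV N1 (N2 x)"
  have a: "a = M2 x" and b: "b = N2 y" and p: "M1 p = M2 y" and q: "N1 q = N2 x"
    using bij by (simp_all add: x_def y_def p_def q_def bij_is_surj surj_f_inv_f)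
  have n: "- M2 y = M1 (- p)" "- N2 x = N1 (- q)"
    using p q by (simp_all add: linear_neg[OF orth_linear[OF M1]] linear_neg[OF orth_linear[OF N1]])
  have "foldr refl (rev (map dmom ws)) (a, b) = (M1 q, N1 p)"
    unfolding a b refl_ws n
    by (subst foldr_refl_graph[OF M1 N1])
      (simp_all add: distinct_bl set_bl linear_neg[OF orth_linear[OF M1]] linear_neg[OF orth_linear[OF N1]])
  moreover have "C1 a = M1 q" using C1[of q] bij by (simp add: q a bij_is_inj)
  moreover have "C2 b = N1 p" using C2[of p] bij by (simp add: p b bij_is_inj)
  ultimately show ?thesis by simp
qed

text \<open>The word bs lifts the inverse of the block isometry of \<open>refl_ws_block\<close>. So
  bs followed by the reversed word of images of ws lifts the identity, as
  \<open>foldr_rcl_psi\<close> demands.\<close>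

theorem double_top:
  assumes u: "unitl bs"
    and C1: "\<And>y. C1 (M2 (inv_into UNIV N2 (N1 y))) = M1 y" and C2: "\<And>x. C2 (N2 (inv_into UNIV M2 (M1 x))) = N1 x"
    and r: "\<And>a b. foldr refl bs (C1 a, C2 b) = (a, b)"
  shows "\<bar>mv_coeff (exp_pull form2 dmom (psim (pinl bs))) Basis\<bar> = \<bar>bdet \<theta>1\<bar> * \<bar>bdet \<theta>2\<bar>"
proof -
  have "\<bar>mv_coeff (foldr con ws (exp_pull form2 dmom (psim (pinl bs)))) {}\<bar> = \<bar>mv_coeff (foldr rcl (map dmom ws) (psim (pinl bs))) {}\<bar>"
    by (simp only: foldr_con_exp_pull[OF skew_form2 linear_dmom sorted_ws])
  also have "\<dots> = 1"
  proof (rule foldr_rcl_psi)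
    show "unitl (bs @ rev (map dmom ws))" using u unitl_ws by (auto simp: unitl_def)
    show "foldr refl (bs @ rev (map dmom ws)) = (\<lambda>v. v)"
      using refl_ws_block[OF C1 C2] r by (auto simp: fun_eq_iff)
  qed
  finally show ?thesis unfolding foldr_con_ws[of "exp_pull form2 dmom (psim (pinl bs))"] by simp
qed

text \<open>The two-form added by fusion, before it is pulled back along the differential of the
  moment map.\<close>

definition sig :: "'e \<times> 'e \<Rightarrow> 'e \<times> 'e \<Rightarrow> real" where
  "sig z z' = - (1/2) * (fst z \<bullet> snd z' - fst z' \<bullet> snd z)"

lemma skew_sig: "skew_form sig"
  unfolding skew_form_def sig_def
  by (intro conjI allI linearI) (simp_all add: inner_add_left inner_add_right algebra_simps)

text \<open>As the fusion term is a pull-back along \<open>dmom\<close>, the operator factors into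
  the one of the double and \<open>exp_pull sig\<close>. The first factor is treated as in
  \<open>double_top\<close>, but the word it produces need not satisfy the order condition for the
  second. It is exchanged for a word ws' with letters in single summands, which does, and adding the
  summands turns ws' into a word in one copy of the Clifford algebra that lifts the U-conjugate of
  \<open>C1\<close> after \<open>C2\<close>.\<close>

theorem fused_top:
  assumes u: "unitl cs" and U: "orthogonal_transformation (U :: 'e \<Rightarrow> 'e)"
    and C1: "\<And>y. C1 (M2 (inv_into UNIV N2 (N1 y))) = M1 y" and C2: "\<And>x. C2 (N2 (inv_into UNIV M2 (M1 x))) = N1 x"
    and oC1: "orthogonal_transformation C1" and oC2: "orthogonal_transformation C2"
    and r: "\<And>v. foldr refl cs (U (C1 (C2 v))) = U v"
    and w: "\<And>z z'. w z z' = form2 z z' + sig (dmom z) (dmom z')"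
    and L: "\<And>z. L z = U (fst (dmom z) + snd (dmom z))"
  shows "\<bar>mv_coeff (exp_pull w L (psim (pinl cs))) Basis\<bar> = \<bar>bdet \<theta>1\<bar> * \<bar>bdet \<theta>2\<bar>"
proof -
  let ?m = "\<lambda>z :: 'e \<times> 'e. U (fst z + snd z)"
  let ?y = "psim (pinl cs)"
  have lm: "linear ?m"
    by (intro linearI) (simp_all add: linear_add[OF orth_linear[OF U]] linear_scale[OF orth_linear[OF U]] algebra_simps)
  have weq: "w = (\<lambda>z z'. form2 z z' + sig (dmom z) (dmom z'))" by (intro HOL.ext) (rule w)
  have skw: "skew_form w"
    using skew_form_add[OF skew_form2 skew_form_pull[OF skew_sig linear_dmom]] by (simp add: weq)
  have Leq: "L = ?m \<circ> dmom" by (simp add: fun_eq_iff L)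
  have e: "exp_pull w L ?y = exp_pull form2 dmom (exp_pull sig ?m ?y)"
    unfolding Leq exp_pull_comp[of form2 sig dmom ?m w, OF skew_form2 skew_sig linear_dmom lm skw w] ..
  obtain as where as: "unitl as" "foldr refl as = C1" using exists_reflections[OF oC1] by blast
  obtain bs where bs: "unitl bs" "foldr refl bs = C2" using exists_reflections[OF oC2] by blast
  \<comment> \<open>Within one summand \<open>sig\<close> vanishes and ?m is isometric, so the order
    condition holds. Between the summands the inner product is zero, and \<open>sig\<close> has the
    right sign when letters of the second summand precede those of the first.\<close>
  define ws' where "ws' = map (\<lambda>b. (0, b)) (rev bs) @ map (\<lambda>a. (a, 0)) (rev as)"
  have u': "unitl ws'" using as bs by (auto simp: unitl_def ws'_def inner_prod_def)
  have rws': "foldr refl (rev ws') (a, b) = (C1 a, C2 b)" for a b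
    by (simp add: ws'_def rev_map foldr_refl_fst foldr_refl_snd as bs)
  have "\<bar>mv_coeff (foldr con ws (exp_pull w L ?y)) {}\<bar> = \<bar>mv_coeff (foldr rcl (map dmom ws) (exp_pull sig ?m ?y)) {}\<bar>"
    unfolding e by (simp only: foldr_con_exp_pull[OF skew_form2 linear_dmom sorted_ws])
  also have "\<dots> = \<bar>mv_coeff (foldr rcl ws' (exp_pull sig ?m ?y)) {}\<bar>"
  proof (rule foldr_rcl_cong[OF unitl_ws u'], rule HOL.ext)
    fix z :: "'e \<times> 'e"
    show "foldr refl (rev (map dmom ws)) z = foldr refl (rev ws') z"
      using refl_ws_block[OF C1 C2, of "fst z" "snd z"] rws'[of "fst z" "snd z"] unfolding prod.collapse by (rule trans[OF _ sym])
  qed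
  also have "mv_coeff (foldr rcl ws' (exp_pull sig ?m ?y)) {} = mv_coeff (foldr rcl (map ?m ws') ?y) {}"
  proof (rule foldr_rcl_exp_pull[OF skew_sig lm])
    have 1: "sorted_wrt (\<lambda>x y. sig y x = - (1/2) * (?m x \<bullet> ?m y) + (1/2) * (x \<bullet> y)) (map (\<lambda>b. (0, b)) l)" for l
      by (induction l) (auto simp: sig_def inner_prod_def orth_inner[OF U])
    have 2: "sorted_wrt (\<lambda>x y. sig y x = - (1/2) * (?m x \<bullet> ?m y) + (1/2) * (x \<bullet> y)) (map (\<lambda>b. (b, 0)) l)" for l
      by (induction l) (auto simp: sig_def inner_prod_def orth_inner[OF U])
    show "sorted_wrt (\<lambda>x y. sig y x = - (1/2) * (?m x \<bullet> ?m y) + (1/2) * (x \<bullet> y)) ws'"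
      unfolding ws'_def sorted_wrt_append using 1 2
      by (auto simp: sig_def inner_prod_def orth_inner[OF U] inner_commute)
  qed
  also have "\<bar>mv_coeff (foldr rcl (map ?m ws') ?y) {}\<bar> = 1"
  proof (rule foldr_rcl_psi)
    have m: "rev (map ?m ws') = map U (as @ bs)"
      by (simp add: ws'_def rev_map o_def)
    show "unitl (cs @ rev (map ?m ws'))"
      unfolding m using u as bs by (auto simp: unitl_def orth_inner[OF U])
    have "foldr refl (map U (as @ bs)) v = U (C1 (C2 (inv_into UNIV U v)))" for v
    proof -
      have "v = U (inv_into UNIV U v)" using orthogonal_transformation_bij[OF U] by (simp add: bij_is_surj surj_f_inv_f)
      then show ?thesis using foldr_refl_conj[OF U, of "as @ bs" "inv_into UNIV U v"] as bs by simp
    qed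
    then show "foldr refl (cs @ rev (map ?m ws')) = (\<lambda>v. v)"
      unfolding m foldr_append using r orthogonal_transformation_bij[OF U] by (auto simp: fun_eq_iff bij_is_surj surj_f_inv_f)
  qed
  finally show ?thesis unfolding foldr_con_ws[of "exp_pull w L ?y"] by simp
qed

end

section \<open>From multivectors back to coefficient functions\<close>

lemma mv_coeff_mvecs [simp]: "mv_coeff a \<in> mvecs" by (rule mv_coeff)

lemma mv_coeff_mvm: "mv_coeff (mvm q a b) = mv_mult q (mv_coeff a) (mv_coeff b)"
  by (rule mvm.rep_eq)

lemma contract_con: "b \<in> Basis \<Longrightarrow> contract b (mv_coeff a) = mv_coeff (con b a)"
proof
  fix I assume b: "b \<in> Basis"
  show "contract b (mv_coeff a) I = mv_coeff (con b a) I"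
  proof (cases "I \<subseteq> Basis")
    case True
    then show ?thesis using b by (simp add: con_Basis con1_coeff contract_def)
  next
    case False
    then have "\<not> insert b I \<subseteq> Basis" by auto
    then show ?thesis using b False by (simp add: mv_coeff_outside contract_def)
  qed
qed

lemma star_starm: "star (mv_coeff a) = mv_coeff (starm a)"
proof
  fix K
  have f: "foldr contract l top_vol = mv_coeff (foldr con l mvtop)" if "set l \<subseteq> Basis" for l
    using that by (induction l) (simp_all add: mvtop.rep_eq contract_con)
  have "star (mv_coeff a) K = (\<Sum>J\<in>Pow Basis. mv_coeff a J * mv_coeff (foldr con (basis_list J) mvtop) K)"
    unfolding star_def by (intro sum.cong refl) (simp add: f set_basis_list)
  then show "star (mv_coeff a) K = mv_coeff (starm a) K" by (simp add: starm_def)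
qed

lemma mvecs_mv_coeff: "x \<in> mvecs \<Longrightarrow> \<exists>a. x = mv_coeff a"
  by (metis Abs_multivec_inverse)

lemma inv_star: "the_inv_into mvecs (quantize \<circ> star) (mv_coeff y) = mv_coeff (inv_into UNIV starm y)"
proof (rule the_inv_into_f_eq)
  show "inj_on (quantize \<circ> star) mvecs"
  proof (rule inj_onI)
    fix x y assume xy: "x \<in> mvecs" "y \<in> mvecs" "(quantize \<circ> star) x = (quantize \<circ> star) y"
    then obtain a b where "x = mv_coeff a" "y = mv_coeff b" using mvecs_mv_coeff by metis
    then show "x = y" using xy injD[OF bij_is_inj[OF bij_starm], of a b] by (simp add: quantize_def[abs_def] star_starm mv_coeff_inject)
  qed
  show "(quantize \<circ> star) (mv_coeff (inv_into UNIV starm y)) = mv_coeff y"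
    by (simp add: quantize_def star_starm surj_f_inv_f[OF bij_is_surj[OF bij_starm]])
qed simp

lemma pin_pinl: "foldr cl_mult (map of_vec vs) mv_one = mv_coeff (pinl vs)"
  by (induction vs) (simp_all add: mv1.rep_eq mv_coeff_mvm mvv.rep_eq)

lemma unit_vec: "cl_mult (of_vec v) (of_vec v) = mv_one \<longleftrightarrow> v \<bullet> v = 2"
proof -
  have "cl_mult (of_vec v) (of_vec v) = mv_coeff (clm (mvv v) (clm (mvv v) mv1))"
    by (simp add: mv_coeff_mvm mvv.rep_eq)
  also have "clm (mvv v) (clm (mvv v) mv1) = ((v \<bullet> v) / 2) *\<^sub>R mv1"
  proof -
    have "2 *\<^sub>R clm (mvv v) (clm (mvv v) mv1) = (v \<bullet> v) *\<^sub>R mv1"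
      using clm_vec_vec[of v v mv1] by (metis add.commute diff_add_cancel scaleR_2)
    from arg_cong[OF this, of "scaleR (1/2)"] show ?thesis by simp
  qed
  finally have e: "cl_mult (of_vec v) (of_vec v) = mv_coeff (((v \<bullet> v) / 2) *\<^sub>R mv1)" .
  have "((v \<bullet> v) / 2) *\<^sub>R (mv1 :: 'a multivec) = mv1 \<longleftrightarrow> v \<bullet> v = 2"
  proof
    assume "((v \<bullet> v) / 2) *\<^sub>R (mv1 :: 'a multivec) = mv1"
    from arg_cong[OF this, of "\<lambda>x. mv_coeff x {}"] show "v \<bullet> v = 2" by (simp add: mv1_coeff)
  qed simp
  then show ?thesis unfolding e mv1.rep_eq[symmetric] mv_coeff_inject .
qed

lemma Pin_pinl: "x \<in> Pin \<longleftrightarrow> (\<exists>vs. unitl vs \<and> x = mv_coeff (pinl vs))"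
  unfolding Pin_def pin_pinl unit_vec unitl_def by blast

lemma inj_mvv: "mvv v = mvv w \<Longrightarrow> v = w"
proof (rule euclidean_eqI)
  fix b :: 'a assume b: "b \<in> Basis" and e: "mvv v = mvv w"
  have "mv_coeff (mvv v) {b} = v \<bullet> b" for v
  proof -
    have "mv_coeff (mvv v) {b} = (\<Sum>c\<in>Basis. if c = b then v \<bullet> c else 0)"
      unfolding mvv_coeff by (intro sum.cong refl) auto
    then show ?thesis using b by (simp add: sum.delta)
  qed
  then show "v \<bullet> b = w \<bullet> b" using e by metis
qed

text \<open>Membership in \<open>Pin\<close> provides the word. Its product of reflections is A
  because the word can be cancelled from the two intertwining relations and vectors embed
  injectively.\<close>

lemma pin_lift_reflections:
  assumes "pin_lift A a"
  shows "\<exists>vs. unitl vs \<and> a = mv_coeff (pinl vs) \<and> foldr refl vs = A"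
proof -
  from assms obtain vs where vs: "unitl vs" "a = mv_coeff (pinl vs)" by (auto simp: pin_lift_def Pin_pinl)
  have "mv_coeff (clm (mvpar (pinl vs)) (mvv v)) = mv_coeff (clm (mvv (A v)) (pinl vs))" for v
    using assms vs(2) by (simp add: pin_lift_def mv_coeff_mvm mvpar.rep_eq mvv.rep_eq)
  then have "clm (mvv (A v)) (pinl vs) = clm (mvv (foldr refl vs v)) (pinl vs)" for v
    using lifts_pinl[OF vs(1)] by (metis lifts_def mv_coeff_inject)
  then have "clm (clm (mvv (A v)) (pinl vs)) (pinl (rev vs)) = clm (clm (mvv (foldr refl vs v)) (pinl vs)) (pinl (rev vs))" for v
    by simp
  moreover have "clm (pinl vs) (pinl (rev vs)) = mv1" using pinl_rev[of "rev vs"] vs(1) by (simp add: unitl_def)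
  ultimately have "mvv (A v) = mvv (foldr refl vs v)" for v by (simp add: mvm_assoc)
  then have "foldr refl vs = A" by (metis HOL.ext inj_mvv)
  with vs show ?thesis by blast
qed

lemma psi_psim:
  assumes "k = mv_coeff (pinl ks)" "\<T> g = mv_coeff (pinl ts)"
  shows "psi \<T> k g = mv_coeff (psim (pinl (ks @ ts)))"
proof -
  have "cl_mult (cl_mult (quantize top_vol) k) (\<T> g) = mv_coeff (clm mvtop (pinl (ks @ ts)))"
    unfolding quantize_def assms by (simp add: mv_coeff_mvm mvtop.rep_eq pinl_append flip: mvm_assoc)
  then show ?thesis unfolding psi_def psim_def by (simp add: inv_star)
qed

lemma mv_pullback_mvpull: "mv_pullback A (mv_coeff a) = mv_coeff (mvpull A a)"
proof
  fix I
  have f: "foldr wedge (map (\<lambda>j. of_vec (\<Sum>b\<in>Basis. (A b \<bullet> j) *\<^sub>R b)) l) mv_one = mv_coeff (foldr (\<lambda>j. ext (transp A j)) l mv1)" for l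
    by (induction l) (simp_all add: mv1.rep_eq ext_def mv_coeff_mvm mvv.rep_eq transp_def)
  show "mv_pullback A (mv_coeff a) I = mv_coeff (mvpull A a) I"
    unfolding mv_pullback_def mvpull_def mv_coeff_sum mv_coeff_simps f ..
qed

lemma wedge_exp_mvexp:
  assumes w: "skew_form w"
  shows "wedge (wedge_exp (mv_of_form2 w)) (mv_coeff y) = mv_coeff (mvexp w y)"
proof -
  have p: "((wedge (mv_of_form2 w) ^^ k) mv_one) = mv_coeff ((Om w ^^ k) mv1)" for k
    by (induction k) (simp_all add: mv1.rep_eq mvm_mv2[OF w, symmetric] mv_coeff_mvm mv2.rep_eq)
  have "wedge_exp (mv_of_form2 w) = mv_coeff (mvexp w mv1)"
    by (rule HOL.ext) (simp add: wedge_exp_def mvexp_def p)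
  then have "wedge (wedge_exp (mv_of_form2 w)) (mv_coeff y) = mv_coeff (mvm 0 (mvexp w mv1) y)"
    by (simp add: mv_coeff_mvm)
  also have "mvm 0 (mvexp w mv1) y = mvexp w y"
  proof -
    have "mvm 0 ((Om w ^^ k) mv1) y = (Om w ^^ k) y" for k
    proof (induction k)
      case (Suc k)
      have "mvm 0 (Om w ((Om w ^^ k) mv1)) y = Om w (mvm 0 ((Om w ^^ k) mv1) y)"
        by (simp add: mvm_mv2[OF w, symmetric] mvm_assoc)
      then show ?case using Suc by simp
    qed simp
    then show ?thesis by (simp add: mvexp_def linear_sum[OF linear_mvm_left] mvm_scale_left)
  qed
  finally show ?thesis .
qed

lemma liouville_exp_pull:
  assumes "skew_form (form X c p)" and "\<T> (moment X p) = mv_coeff (pinl ts)" "k = mv_coeff (pinl ks)"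
  shows "liouville_form H \<T> k X c p =
    mv_coeff (exp_pull (form X c p) (pull_thetaL H c (moment X) p) (psim (pinl (ks @ ts)))) Basis"
  using assms unfolding liouville_form_def
  by (simp add: psi_psim mv_pullback_mvpull wedge_exp_mvexp exp_pull_def)

section \<open>Smooth maps\<close>

lemma open_differentiable_on: "open S \<Longrightarrow> f differentiable_on S \<longleftrightarrow> (\<forall>x\<in>S. f differentiable (at x))"
  unfolding differentiable_on_def using at_within_open[of _ S] by (metis (no_types, lifting))

lemma frechet_has_derivative: "f differentiable (at x) \<Longrightarrow> (f has_derivative frechet_derivative f (at x)) (at x)"
  by (simp add: frechet_derivative_works)

lemma frechet_eq: "(f has_derivative f') (at x) \<Longrightarrow> frechet_derivative f (at x) = f'"
  by (metis frechet_derivative_at)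

lemma has_derivative_cong_open:
  assumes "(f has_derivative f') (at x)" "open S" "x \<in> S" "\<And>y. y \<in> S \<Longrightarrow> f y = g y"
  shows "(g has_derivative f') (at x)"
  by (rule has_derivative_transform_within_open[OF assms(1-3)]) (use assms(4) in auto)

lemma Ck_on_cong:
  assumes "open S" "\<And>x. x \<in> S \<Longrightarrow> f x = g x" "Ck_on k S f"
  shows "Ck_on k S g"
  using assms(2,3)
proof (induction k arbitrary: f g)
  case 0
  then show ?case by (simp cong: continuous_on_cong)
next
  case (Suc k)
  have d: "(g has_derivative frechet_derivative f (at x)) (at x)" if "x \<in> S" for x
    using Suc.prems that assms(1)
    by (intro has_derivative_cong_open[OF frechet_has_derivative assms(1)]) (auto simp: open_differentiable_on)
  then have "g differentiable_on S" using assms(1) by (auto simp: open_differentiable_on differentiable_def)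
  moreover have "Ck_on k S (\<lambda>x. frechet_derivative g (at x) v)" for v
    by (rule Suc.IH[of "\<lambda>x. frechet_derivative f (at x) v"]) (use Suc.prems frechet_eq[OF d] in auto)
  ultimately show ?case by simp
qed

lemma Ck_on_continuous: "Ck_on k S f \<Longrightarrow> continuous_on S f"
  by (cases k) (auto intro: differentiable_imp_continuous_on)

lemma Ck_on_SucD: "Ck_on (Suc k) S f \<Longrightarrow> Ck_on k S f"
proof (induction k arbitrary: f)
  case 0
  then show ?case using Ck_on_continuous[OF 0] by simp
qed auto

lemma Ck_on_subset: "Ck_on k S f \<Longrightarrow> U \<subseteq> S \<Longrightarrow> Ck_on k U f"
  by (induction k arbitrary: f) (auto intro: continuous_on_subset differentiable_on_subset)

lemma Ck_on_SucI:
  assumes "open S" "\<And>x. x \<in> S \<Longrightarrow> (f has_derivative f' x) (at x)" "\<And>v. Ck_on k S (\<lambda>x. f' x v)"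
  shows "Ck_on (Suc k) S f"
proof -
  have "Ck_on k S (\<lambda>x. frechet_derivative f (at x) v)" for v
    by (rule Ck_on_cong[OF assms(1) _ assms(3)[of v]]) (simp add: frechet_eq[OF assms(2)])
  then show ?thesis using assms by (auto simp: open_differentiable_on differentiable_def)
qed

lemma Ck_on_SucE:
  assumes "open S" "Ck_on (Suc k) S f"
  shows "x \<in> S \<Longrightarrow> (f has_derivative frechet_derivative f (at x)) (at x)" "Ck_on k S (\<lambda>x. frechet_derivative f (at x) v)"
  using assms by (auto simp: open_differentiable_on intro: frechet_has_derivative)

lemma Ck_on_local:
  assumes "open S" "\<And>x. x \<in> S \<Longrightarrow> \<exists>U. open U \<and> x \<in> U \<and> Ck_on k U f"
  shows "Ck_on k S f"
  using assms(2)
proof (induction k arbitrary: f)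
  case 0
  have "isCont f x" if x: "x \<in> S" for x
  proof -
    obtain U where "open U" "x \<in> U" "continuous_on U f" using 0[OF x] by auto
    then show ?thesis by (metis continuous_on_eq_continuous_at)
  qed
  then show ?case unfolding Ck_on.simps continuous_on_eq_continuous_at[OF assms(1)] by blast
next
  case (Suc k)
  show ?case
  proof (rule Ck_on_SucI[OF assms(1)])
    show "(f has_derivative frechet_derivative f (at x)) (at x)" if "x \<in> S" for x
      using Suc.prems[OF that] Ck_on_SucE(1) by blast
    show "Ck_on k S (\<lambda>x. frechet_derivative f (at x) v)" for v
    proof (rule Suc.IH)
      fix x assume "x \<in> S"
      then obtain U where U: "open U" "x \<in> U" "Ck_on (Suc k) U f" using Suc.prems by blast
      then show "\<exists>U. open U \<and> x \<in> U \<and> Ck_on k U (\<lambda>x. frechet_derivative f (at x) v)"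
        using Ck_on_SucE(2)[OF U(1,3), of v] by blast
    qed
  qed
qed

lemma Ck_on_const: "open S \<Longrightarrow> Ck_on k S (\<lambda>_. c)"
proof (induction k arbitrary: c)
  case (Suc k)
  then show ?case by (intro Ck_on_SucI[where f' = "\<lambda>_ _. 0"]) auto
qed simp

lemma Ck_on_linear:
  assumes "bounded_linear L" "open S"
  shows "Ck_on k S L"
proof (cases k)
  case 0
  then show ?thesis using assms by (simp add: linear_continuous_on)
next
  case (Suc j)
  show ?thesis unfolding Suc
    by (rule Ck_on_SucI[where f' = "\<lambda>_. L"]) (auto intro: Ck_on_const bounded_linear_imp_has_derivative assms)
qed

lemma Ck_on_add: "open S \<Longrightarrow> Ck_on k S f \<Longrightarrow> Ck_on k S g \<Longrightarrow> Ck_on k S (\<lambda>x. f x + g x)"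
proof (induction k arbitrary: f g)
  case (Suc k)
  show ?case
    by (rule Ck_on_SucI[OF Suc.prems(1)], rule has_derivative_add, erule Ck_on_SucE(1)[OF Suc.prems(1,2)], erule Ck_on_SucE(1)[OF Suc.prems(1,3)])
      (rule Suc.IH[OF Suc.prems(1) Ck_on_SucE(2)[OF Suc.prems(1,2)] Ck_on_SucE(2)[OF Suc.prems(1,3)]])
qed (simp add: continuous_on_add)

lemma Ck_on_sum: "open S \<Longrightarrow> (\<And>i. i \<in> I \<Longrightarrow> Ck_on k S (f i)) \<Longrightarrow> Ck_on k S (\<lambda>x. \<Sum>i\<in>I. f i x)"
  by (induction I rule: infinite_finite_induct) (auto intro: Ck_on_const Ck_on_add)

lemma Ck_on_scaleR:
  "open S \<Longrightarrow> Ck_on k S f \<Longrightarrow> Ck_on k S g \<Longrightarrow> Ck_on k S (\<lambda>x. f x *\<^sub>R g x)"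
proof (induction k arbitrary: f g)
  case (Suc k)
  show ?case
  proof (rule Ck_on_SucI[OF Suc.prems(1)])
    fix x assume x: "x \<in> S"
    show "((\<lambda>x. f x *\<^sub>R g x) has_derivative (\<lambda>v. f x *\<^sub>R frechet_derivative g (at x) v + frechet_derivative f (at x) v *\<^sub>R g x)) (at x)"
      using Ck_on_SucE(1)[OF Suc.prems(1,2) x] Ck_on_SucE(1)[OF Suc.prems(1,3) x] by (rule has_derivative_scaleR)
  next
    fix v
    show "Ck_on k S (\<lambda>x. f x *\<^sub>R frechet_derivative g (at x) v + frechet_derivative f (at x) v *\<^sub>R g x)"
      by (intro Ck_on_add Suc.IH Suc.prems(1) Ck_on_SucE(2)[OF Suc.prems(1,2)] Ck_on_SucE(2)[OF Suc.prems(1,3)]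
        Ck_on_SucD[OF Suc.prems(2)] Ck_on_SucD[OF Suc.prems(3)])
  qed
qed (simp add: continuous_on_scaleR)

lemma Ck_on_linear_compose:
  "bounded_linear L \<Longrightarrow> open S \<Longrightarrow> Ck_on k S f \<Longrightarrow> Ck_on k S (\<lambda>x. L (f x))"
proof (induction k arbitrary: f)
  case 0
  then show ?case by (simp add: bounded_linear.continuous_on)
next
  case (Suc k)
  show ?case
    by (rule Ck_on_SucI[OF Suc.prems(2)], rule bounded_linear.has_derivative[OF Suc.prems(1)],
        erule Ck_on_SucE(1)[OF Suc.prems(2,3)], rule Suc.IH[OF Suc.prems(1,2) Ck_on_SucE(2)[OF Suc.prems(2,3)]])
qed

lemma Ck_on_compose:
  "open S \<Longrightarrow> open T \<Longrightarrow> f ` S \<subseteq> T \<Longrightarrow> Ck_on k S f \<Longrightarrow> Ck_on k T g \<Longrightarrow> Ck_on k S (\<lambda>x. g (f x))"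
proof (induction k arbitrary: g)
  case 0
  then show ?case by (simp add: continuous_on_compose2)
next
  case (Suc k)
  note f = Ck_on_SucE[OF Suc.prems(1,4)] and g = Ck_on_SucE[OF Suc.prems(2,5)]
  show ?case
  proof (rule Ck_on_SucI[OF Suc.prems(1)])
    fix x assume x: "x \<in> S"
    then have fx: "f x \<in> T" using Suc.prems(3) by blast
    have l: "linear (frechet_derivative g (at (f x)))" using g(1)[OF fx] by (rule has_derivative_linear)
    \<comment> \<open>The derivative of g is applied to a direction that varies with x. Expanding
      that direction in the basis leaves derivatives of g in fixed directions, to which the
      induction hypothesis applies.\<close>
    have "frechet_derivative g (at (f x)) (frechet_derivative f (at x) v) =
      (\<Sum>b\<in>Basis. (frechet_derivative f (at x) v \<bullet> b) *\<^sub>R frechet_derivative g (at (f x)) b)" for v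
      by (subst euclidean_representation[symmetric, of "frechet_derivative f (at x) v"])
        (simp only: linear_sum[OF l] linear_scale[OF l])
    then show "((\<lambda>x. g (f x)) has_derivative (\<lambda>v. \<Sum>b\<in>Basis. (frechet_derivative f (at x) v \<bullet> b) *\<^sub>R frechet_derivative g (at (f x)) b)) (at x)"
      using has_derivative_compose[OF f(1)[OF x] g(1)[OF fx]] by simp
  next
    fix v
    show "Ck_on k S (\<lambda>x. \<Sum>b\<in>Basis. (frechet_derivative f (at x) v \<bullet> b) *\<^sub>R frechet_derivative g (at (f x)) b)"
    proof (intro Ck_on_sum Ck_on_scaleR Suc.prems(1))
      fix b :: 'b
      show "Ck_on k S (\<lambda>x. frechet_derivative f (at x) v \<bullet> b)"
        by (rule Ck_on_linear_compose[OF bounded_linear_inner_left Suc.prems(1) f(2)])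
      show "Ck_on k S (\<lambda>x. frechet_derivative g (at (f x)) b)"
        by (rule Suc.IH[OF Suc.prems(1-3) Ck_on_SucD[OF Suc.prems(4)] g(2)])
    qed
  qed
qed

lemma Ck_on_Pair: "open S \<Longrightarrow> Ck_on k S f \<Longrightarrow> Ck_on k S g \<Longrightarrow> Ck_on k S (\<lambda>x. (f x, g x))"
proof (induction k arbitrary: f g)
  case (Suc k)
  show ?case
    by (rule Ck_on_SucI[OF Suc.prems(1)], rule has_derivative_Pair, erule Ck_on_SucE(1)[OF Suc.prems(1,2)], erule Ck_on_SucE(1)[OF Suc.prems(1,3)])
      (rule Suc.IH[OF Suc.prems(1) Ck_on_SucE(2)[OF Suc.prems(1,2)] Ck_on_SucE(2)[OF Suc.prems(1,3)]])
qed (simp add: continuous_on_Pair)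

lemma smooth_on_compose:
  "open S \<Longrightarrow> open T \<Longrightarrow> f ` S \<subseteq> T \<Longrightarrow> smooth_on S f \<Longrightarrow> smooth_on T g \<Longrightarrow> smooth_on S (\<lambda>x. g (f x))"
  unfolding smooth_on_def using Ck_on_compose by blast
lemma smooth_on_Pair: "open S \<Longrightarrow> smooth_on S f \<Longrightarrow> smooth_on S g \<Longrightarrow> smooth_on S (\<lambda>x. (f x, g x))"
  unfolding smooth_on_def using Ck_on_Pair by blast
lemma smooth_on_linear: "bounded_linear L \<Longrightarrow> open S \<Longrightarrow> smooth_on S L"
  unfolding smooth_on_def using Ck_on_linear by blast
lemma smooth_on_const: "open S \<Longrightarrow> smooth_on S (\<lambda>_. c)"
  unfolding smooth_on_def using Ck_on_const by blast
lemma smooth_on_cong: "open S \<Longrightarrow> (\<And>x. x \<in> S \<Longrightarrow> f x = g x) \<Longrightarrow> smooth_on S f \<Longrightarrow> smooth_on S g"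
  unfolding smooth_on_def using Ck_on_cong by blast
lemma smooth_on_subset: "smooth_on S f \<Longrightarrow> U \<subseteq> S \<Longrightarrow> smooth_on U f"
  unfolding smooth_on_def using Ck_on_subset by blast
lemma smooth_on_local: "open S \<Longrightarrow> (\<And>x. x \<in> S \<Longrightarrow> \<exists>U. open U \<and> x \<in> U \<and> smooth_on U f) \<Longrightarrow> smooth_on S f"
  unfolding smooth_on_def by (meson Ck_on_local)

lemma smooth_on_D:
  assumes "open S" "smooth_on S f" "x \<in> S"
  shows "(f has_derivative frechet_derivative f (at x)) (at x)"
  using assms Ck_on_SucE(1)[of S 0 f x] by (auto simp: smooth_on_def)

lemma smooth_on_deriv:
  assumes "open S" "smooth_on S f"
  shows "smooth_on S (\<lambda>x. frechet_derivative f (at x) v)"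
  using assms(2) Ck_on_SucE(2)[OF assms(1)] unfolding smooth_on_def by blast

lemma smooth_on_continuous: "smooth_on S f \<Longrightarrow> continuous_on S f"
  unfolding smooth_on_def by (metis Ck_on.simps(1))

section \<open>Charts, products of atlases and smooth maps\<close>

lemma atlas_chart:
  assumes "smooth_atlas A" "c \<in> A"
  shows "open (fst c)" "open (snd c ` fst c)" "inj_on (snd c) (fst c)"
    "continuous_on (fst c) (snd c)" "continuous_on (snd c ` fst c) (chart_inv c)"
    "p \<in> fst c \<Longrightarrow> chart_inv c (snd c p) = p"
    "u \<in> snd c ` fst c \<Longrightarrow> chart_inv c u \<in> fst c" "u \<in> snd c ` fst c \<Longrightarrow> snd c (chart_inv c u) = u"
proof -
  have h: "homeomorphism (fst c) (snd c ` fst c) (snd c) (chart_inv c)"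
    and o: "open (fst c)" "open (snd c ` fst c)"
    using assms by (auto simp: smooth_atlas_def)
  show "open (fst c)" "open (snd c ` fst c)" by fact+
  show "inj_on (snd c) (fst c)" using h by (metis homeomorphism_def inj_on_inverseI)
  show "continuous_on (fst c) (snd c)" "continuous_on (snd c ` fst c) (chart_inv c)"
    "p \<in> fst c \<Longrightarrow> chart_inv c (snd c p) = p"
    "u \<in> snd c ` fst c \<Longrightarrow> chart_inv c u \<in> fst c" "u \<in> snd c ` fst c \<Longrightarrow> snd c (chart_inv c u) = u"
    using h by (auto simp: homeomorphism_def)
qed

lemma atlas_cover: "smooth_atlas A \<Longrightarrow> \<exists>c\<in>A. p \<in> fst c"
  unfolding smooth_atlas_def by blast

lemma chart_image_open:
  assumes "smooth_atlas A" "c \<in> A" "open W"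
  shows "open (snd c ` (fst c \<inter> W))"
proof -
  have "snd c ` (fst c \<inter> W) = snd c ` fst c \<inter> chart_inv c -` W"
    using atlas_chart[OF assms(1,2)] by (auto simp: image_iff)
  then show ?thesis
    using continuous_open_preimage[OF atlas_chart(5,2)[OF assms(1,2)] assms(3)] by simp
qed

lemma chart_image_mem:
  assumes "smooth_atlas A" "c \<in> A"
  shows "u \<in> snd c ` (fst c \<inter> W) \<longleftrightarrow> u \<in> snd c ` fst c \<and> chart_inv c u \<in> W"
  using atlas_chart[OF assms] by (auto simp: image_iff)

lemma smooth_mapD:
  assumes "smooth_map A B f"
  shows "continuous_on UNIV f"
    "c \<in> A \<Longrightarrow> d \<in> B \<Longrightarrow> smooth_on (snd c ` (fst c \<inter> f -` fst d)) (\<lambda>u. snd d (f (chart_inv c u)))"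
  using assms unfolding smooth_map_def o_def by blast+

lemma smooth_map_compose:
  assumes A: "smooth_atlas A" and B: "smooth_atlas B" and C: "smooth_atlas C"
    and f: "smooth_map A B f" and g: "smooth_map B C g"
  shows "smooth_map A C (\<lambda>x. g (f x))"
  unfolding smooth_map_def o_def
proof (intro conjI ballI)
  have cf: "continuous_on UNIV f" and cg: "continuous_on UNIV g" using f g by (auto dest: smooth_mapD(1))
  show cgf: "continuous_on UNIV (\<lambda>x. g (f x))" using continuous_on_compose2[OF cg cf] by simp
  fix c d assume c: "c \<in> A" and d: "d \<in> C"
  have o: "open ((\<lambda>x. g (f x)) -` fst d)" using cgf atlas_chart(1)[OF C d] by (metis open_vimage)
  show "smooth_on (snd c ` (fst c \<inter> (\<lambda>x. g (f x)) -` fst d)) (\<lambda>u. snd d (g (f (chart_inv c u))))"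
  proof (rule smooth_on_local[OF chart_image_open[OF A c o]])
    fix u assume "u \<in> snd c ` (fst c \<inter> (\<lambda>x. g (f x)) -` fst d)"
    then have u: "u \<in> snd c ` fst c" "g (f (chart_inv c u)) \<in> fst d"
      by (auto simp: chart_image_mem[OF A c])
    \<comment> \<open>A single chart of the middle manifold covers the image only near the given
      point, hence the localisation.\<close>
    obtain e where e: "e \<in> B" "f (chart_inv c u) \<in> fst e" using atlas_cover[OF B] by blast
    define W where "W = f -` (fst e \<inter> g -` fst d)"
    have oe: "open (fst e \<inter> g -` fst d)"
      using atlas_chart(1)[OF B e(1)] atlas_chart(1)[OF C d] cg by (metis open_Int open_vimage)
    have oW: "open W" unfolding W_def using cf oe by (metis open_vimage)
    let ?U = "snd c ` (fst c \<inter> W)" and ?V = "snd e ` (fst e \<inter> g -` fst d)"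
    have oU: "open ?U" and oV: "open ?V"
      using chart_image_open[OF A c oW] chart_image_open[OF B e(1), of "g -` fst d"] atlas_chart(1)[OF C d] cg
      by (auto simp: open_vimage)
    have U: "u \<in> ?U" using u e by (simp add: chart_image_mem[OF A c] W_def)
    have s1: "smooth_on ?U (\<lambda>u. snd e (f (chart_inv c u)))"
      by (rule smooth_on_subset[OF smooth_mapD(2)[OF f c e(1)]]) (auto simp: W_def)
    have "smooth_on ?U (\<lambda>u. snd d (g (chart_inv e (snd e (f (chart_inv c u))))))"
    proof (rule smooth_on_compose[OF oU oV _ s1 smooth_mapD(2)[OF g e(1) d]])
      show "(\<lambda>u. snd e (f (chart_inv c u))) ` ?U \<subseteq> ?V"
        by (auto simp: chart_image_mem[OF A c] W_def atlas_chart(6)[OF A c])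
    qed
    then have "smooth_on ?U (\<lambda>u. snd d (g (f (chart_inv c u))))"
      by (rule smooth_on_cong[OF oU, rotated])
        (auto simp: W_def atlas_chart(6)[OF A c] atlas_chart(6)[OF B e(1)])
    then show "\<exists>U. open U \<and> u \<in> U \<and> smooth_on U (\<lambda>u. snd d (g (f (chart_inv c u))))"
      using oU U by blast
  qed
qed

lemma smooth_map_id: "smooth_atlas A \<Longrightarrow> smooth_map A A (\<lambda>x. x)"
  unfolding smooth_map_def smooth_atlas_def by (auto simp: o_def Int_def vimage_def)

lemma smooth_map_const:
  assumes "smooth_atlas A" "smooth_atlas B"
  shows "smooth_map A B (\<lambda>_. b)"
  unfolding smooth_map_def o_def
proof (intro conjI ballI)
  fix c d assume "c \<in> A" "d \<in> B"
  then show "smooth_on (snd c ` (fst c \<inter> (\<lambda>_. b) -` fst d)) (\<lambda>x. snd d b)"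
    by (intro smooth_on_const chart_image_open[OF assms(1)]) auto
qed auto

lemma prod_chart_simps [simp]: "fst (prod_chart c d) = fst c \<times> fst d" "snd (prod_chart c d) (x, y) = (snd c x, snd d y)"
  by (auto simp: prod_chart_def)

lemma prod_chart_image: "snd (prod_chart c d) ` (S \<times> T) = snd c ` S \<times> snd d ` T"
  by (auto simp: prod_chart_def map_prod_surj_on image_iff)

lemma chart_inv_prod:
  assumes "inj_on (snd c) (fst c)" "inj_on (snd d) (fst d)" "u \<in> snd c ` fst c" "v \<in> snd d ` fst d"
  shows "chart_inv (prod_chart c d) (u, v) = (chart_inv c u, chart_inv d v)"
proof -
  obtain x y where "x \<in> fst c" "u = snd c x" "y \<in> fst d" "v = snd d y" using assms by blast
  moreover have "inj_on (snd (prod_chart c d)) (fst (prod_chart c d))"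
    using assms(1,2) by (auto simp: inj_on_def)
  ultimately show ?thesis
    using inv_into_f_f[of "snd (prod_chart c d)" "fst (prod_chart c d)" "(x, y)"] assms(1,2)
    by (simp add: chart_inv_def)
qed

lemma prod_atlas_charts:
  assumes A: "smooth_atlas A" and B: "smooth_atlas B" and c: "c \<in> A" and d: "d \<in> B"
  shows "u \<in> snd c ` fst c \<Longrightarrow> v \<in> snd d ` fst d \<Longrightarrow> chart_inv (prod_chart c d) (u, v) = (chart_inv c u, chart_inv d v)"
  by (rule chart_inv_prod[OF atlas_chart(3)[OF A c] atlas_chart(3)[OF B d]])

lemma smooth_on_fst: "open S \<Longrightarrow> smooth_on S fst" and smooth_on_snd: "open S \<Longrightarrow> smooth_on S snd"
  by (rule smooth_on_linear, auto intro: bounded_linear_fst bounded_linear_snd)+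

lemma smooth_atlas_prod:
  assumes A: "smooth_atlas A" and B: "smooth_atlas B"
  shows "smooth_atlas (prod_atlas A B)"
  unfolding smooth_atlas_def
proof (intro conjI ballI)
  show "(\<Union>c\<in>prod_atlas A B. fst c) = UNIV"
  proof (intro equalityI subsetI UNIV_I)
    fix p :: "'a \<times> 'c"
    obtain c d where "c \<in> A" "fst p \<in> fst c" "d \<in> B" "snd p \<in> fst d" using atlas_cover A B by metis
    then show "p \<in> (\<Union>c\<in>prod_atlas A B. fst c)"
      unfolding prod_atlas_def by (intro UN_I[of "prod_chart c d"]) (blast, simp add: mem_Times_iff)
  qed
next
  fix e assume "e \<in> prod_atlas A B"
  then obtain c d where e: "e = prod_chart c d" and c: "c \<in> A" and d: "d \<in> B" by (auto simp: prod_atlas_def)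
  note C = atlas_chart[OF A c] and D = atlas_chart[OF B d]
  show "open (fst e)" using C(1) D(1) by (simp add: e open_Times)
  show "open (snd e ` fst e)" using C(2) D(2) by (simp add: e prod_chart_image open_Times)
  show "homeomorphism (fst e) (snd e ` fst e) (snd e) (chart_inv e)"
    unfolding homeomorphism_def
  proof (intro conjI ballI)
    show "continuous_on (fst e) (snd e)"
      unfolding e prod_chart_def fst_conv snd_conv map_prod_def case_prod_beta
      using C(4) D(4)
      by (intro continuous_on_Pair continuous_on_compose2[OF C(4)] continuous_on_compose2[OF D(4)] continuous_intros) auto
    have "continuous_on (snd c ` fst c \<times> snd d ` fst d) (\<lambda>w. (chart_inv c (fst w), chart_inv d (snd w)))"
      by (intro continuous_on_Pair continuous_on_compose2[OF C(5)] continuous_on_compose2[OF D(5)] continuous_intros) auto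
    then show "continuous_on (snd e ` fst e) (chart_inv e)"
      unfolding e prod_chart_simps prod_chart_image
      by (rule continuous_on_eq) (auto simp: prod_atlas_charts[OF A B c d])
    show "chart_inv e (snd e x) = x" if "x \<in> fst e" for x
      using that by (cases x) (simp add: e prod_atlas_charts[OF A B c d] C(6) D(6))
    then show "chart_inv e ` snd e ` fst e = fst e" by force
    show "snd e (chart_inv e y) = y" if "y \<in> snd e ` fst e" for y
      using that C(8) D(8) by (cases y) (auto simp: e prod_chart_image prod_atlas_charts[OF A B c d])
  qed auto
next
  fix e e' assume "e \<in> prod_atlas A B" "e' \<in> prod_atlas A B"
  then obtain c d c' d' where e: "e = prod_chart c d" and c: "c \<in> A" and d: "d \<in> B"
    and e': "e' = prod_chart c' d'" and c': "c' \<in> A" and d': "d' \<in> B" by (auto simp: prod_atlas_def)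
  let ?S = "snd c ` (fst c \<inter> fst c')" and ?T = "snd d ` (fst d \<inter> fst d')"
  have oS: "open ?S" and oT: "open ?T"
    using chart_image_open[OF A c atlas_chart(1)[OF A c']] chart_image_open[OF B d atlas_chart(1)[OF B d']] by auto
  have sS: "smooth_on ?S (\<lambda>u. snd c' (chart_inv c u))" and sT: "smooth_on ?T (\<lambda>u. snd d' (chart_inv d u))"
    using A B c c' d d' by (auto simp: smooth_atlas_def o_def)
  have o: "open (?S \<times> ?T)" using oS oT by (rule open_Times)
  have "smooth_on (?S \<times> ?T) (\<lambda>w. (snd c' (chart_inv c (fst w)), snd d' (chart_inv d (snd w))))"
    by (intro smooth_on_Pair[OF o] smooth_on_compose[OF o oS _ smooth_on_fst[OF o] sS] smooth_on_compose[OF o oT _ smooth_on_snd[OF o] sT]) auto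
  then have "smooth_on (?S \<times> ?T) (\<lambda>w. snd e' (chart_inv e w))"
    by (rule smooth_on_cong[OF o, rotated]) (auto simp: e e' prod_atlas_charts[OF A B c d])
  moreover have "snd e ` (fst e \<inter> fst e') = ?S \<times> ?T"
    unfolding e e' prod_chart_simps Times_Int_Times prod_chart_image ..
  ultimately show "smooth_on (snd e ` (fst e \<inter> fst e')) (snd e' \<circ> chart_inv e)" by (simp add: o_def)
qed

lemma smooth_map_Pair:
  assumes A: "smooth_atlas A" and B: "smooth_atlas B" and C: "smooth_atlas C"
    and f: "smooth_map A B f" and g: "smooth_map A C g"
  shows "smooth_map A (prod_atlas B C) (\<lambda>x. (f x, g x))"
  unfolding smooth_map_def o_def
proof (intro conjI ballI)
  show "continuous_on UNIV (\<lambda>x. (f x, g x))"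
    using smooth_mapD(1)[OF f] smooth_mapD(1)[OF g] by (rule continuous_on_Pair)
  fix c e assume c: "c \<in> A" and "e \<in> prod_atlas B C"
  then obtain d d' where e: "e = prod_chart d d'" and d: "d \<in> B" and d': "d' \<in> C" by (auto simp: prod_atlas_def)
  let ?S = "snd c ` (fst c \<inter> (f -` fst d \<inter> g -` fst d'))"
  have "open (f -` fst d \<inter> g -` fst d')"
    using smooth_mapD(1)[OF f] smooth_mapD(1)[OF g] atlas_chart(1)[OF B d] atlas_chart(1)[OF C d'] by (metis open_Int open_vimage)
  then have o: "open ?S" by (rule chart_image_open[OF A c])
  have "smooth_on ?S (\<lambda>u. (snd d (f (chart_inv c u)), snd d' (g (chart_inv c u))))"
    by (intro smooth_on_Pair[OF o] smooth_on_subset[OF smooth_mapD(2)[OF f c d]] smooth_on_subset[OF smooth_mapD(2)[OF g c d']]) auto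
  moreover have "fst c \<inter> (\<lambda>x. (f x, g x)) -` fst e = fst c \<inter> (f -` fst d \<inter> g -` fst d')" by (auto simp: e)
  ultimately show "smooth_on (snd c ` (fst c \<inter> (\<lambda>x. (f x, g x)) -` fst e)) (\<lambda>u. snd e (f (chart_inv c u), g (chart_inv c u)))"
    by (simp add: e)
qed

lemma smooth_map_fst:
  assumes A: "smooth_atlas A" and B: "smooth_atlas B"
  shows "smooth_map (prod_atlas A B) A fst" "smooth_map (prod_atlas A B) B snd"
proof -
  have "smooth_on (snd e ` (fst e \<inter> fst -` fst c')) (\<lambda>u. snd c' (fst (chart_inv e u)))"
    "d' \<in> B \<Longrightarrow> smooth_on (snd e ` (fst e \<inter> snd -` fst d')) (\<lambda>u. snd d' (snd (chart_inv e u)))"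
    if mem: "e \<in> prod_atlas A B" "c' \<in> A" for e c' d'
  proof -
    obtain c d where e: "e = prod_chart c d" and c: "c \<in> A" and d: "d \<in> B" using mem unfolding prod_atlas_def by blast
    let ?S = "snd c ` (fst c \<inter> fst c')" and ?T = "snd d ` fst d"
    have oS: "open ?S" and oT: "open ?T" using chart_image_open[OF A c atlas_chart(1)[OF A that(2)]] atlas_chart(2)[OF B d] by auto
    have o: "open (?S \<times> ?T)" using oS oT by (rule open_Times)
    have sS: "smooth_on ?S (\<lambda>u. snd c' (chart_inv c u))" using A c that(2) by (auto simp: smooth_atlas_def o_def)
    have "smooth_on (?S \<times> ?T) (\<lambda>w. snd c' (chart_inv c (fst w)))"
      by (rule smooth_on_compose[OF o oS _ smooth_on_fst[OF o] sS]) auto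
    then have "smooth_on (?S \<times> ?T) (\<lambda>w. snd c' (fst (chart_inv e w)))"
      by (rule smooth_on_cong[OF o, rotated]) (auto simp: e prod_atlas_charts[OF A B c d])
    moreover have "fst e \<inter> fst -` fst c' = (fst c \<inter> fst c') \<times> fst d" by (auto simp: e)
    ultimately show "smooth_on (snd e ` (fst e \<inter> fst -` fst c')) (\<lambda>u. snd c' (fst (chart_inv e u)))"
      by (simp add: e prod_chart_image)
    assume d': "d' \<in> B"
    let ?S = "snd c ` fst c" and ?T = "snd d ` (fst d \<inter> fst d')"
    have oS: "open ?S" and oT: "open ?T" using chart_image_open[OF B d atlas_chart(1)[OF B d']] atlas_chart(2)[OF A c] by auto
    have o: "open (?S \<times> ?T)" using oS oT by (rule open_Times)
    have sT: "smooth_on ?T (\<lambda>u. snd d' (chart_inv d u))" using B d d' by (auto simp: smooth_atlas_def o_def)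
    have "smooth_on (?S \<times> ?T) (\<lambda>w. snd d' (chart_inv d (snd w)))"
      by (rule smooth_on_compose[OF o oT _ smooth_on_snd[OF o] sT]) auto
    then have "smooth_on (?S \<times> ?T) (\<lambda>w. snd d' (snd (chart_inv e w)))"
      by (rule smooth_on_cong[OF o, rotated]) (auto simp: e prod_atlas_charts[OF A B c d])
    moreover have "fst e \<inter> snd -` fst d' = fst c \<times> (fst d \<inter> fst d')" by (auto simp: e)
    ultimately show "smooth_on (snd e ` (fst e \<inter> snd -` fst d')) (\<lambda>u. snd d' (snd (chart_inv e u)))"
      by (simp add: e prod_chart_image)
  qed
  moreover obtain c0 where "c0 \<in> A" using atlas_cover[OF A] by blast
  ultimately show "smooth_map (prod_atlas A B) A fst" "smooth_map (prod_atlas A B) B snd"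
    unfolding smooth_map_def o_def by (auto intro!: continuous_intros)
qed

lemma smooth_map_has_derivative:
  assumes A: "smooth_atlas A" and B: "smooth_atlas B" and f: "smooth_map A B f"
    and c: "c \<in> A" and d: "d \<in> B" and p: "p \<in> fst c" "f p \<in> fst d"
  shows "((\<lambda>u. snd d (f (chart_inv c u))) has_derivative
    frechet_derivative (\<lambda>u. snd d (f (chart_inv c u))) (at (snd c p))) (at (snd c p))"
proof (rule smooth_on_D[OF chart_image_open[OF A c] smooth_mapD(2)[OF f c d]])
  show "open (f -` fst d)" using smooth_mapD(1)[OF f] atlas_chart(1)[OF B d] by (metis open_vimage)
  show "snd c p \<in> snd c ` (fst c \<inter> f -` fst d)" using p by auto
qed

section \<open>Calculus on Lie groups\<close>

locale liegroup =
  fixes G :: "('g::{t2_space, second_countable_topology}, 'e::euclidean_space) lie_group" (structure)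
  assumes lie: "is_lie_group G"
begin

abbreviation "A0 \<equiv> atlas G"
abbreviation "uc \<equiv> snd (unit_chart G)"
abbreviation "ui \<equiv> chart_inv (unit_chart G)"
abbreviation "u0 \<equiv> uc \<one>"

lemma grp: "group G" and carrierU [simp]: "carrier G = UNIV" and atl: "smooth_atlas A0"
  and uca: "unit_chart G \<in> A0" and one_uc: "\<one> \<in> fst (unit_chart G)"
  using lie by (auto simp: is_lie_group_def)

sublocale group G by (rule grp)

lemma m_simps [simp]: "x \<otimes> y \<otimes> z = x \<otimes> (y \<otimes> z)" "\<one> \<otimes> x = x" "x \<otimes> \<one> = x"
  "inv x \<otimes> x = \<one>" "x \<otimes> inv x = \<one>" "inv x \<otimes> (x \<otimes> y) = y" "x \<otimes> (inv x \<otimes> y) = y" "inv (inv x) = x" "inv \<one> = \<one>"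
  "inv (x \<otimes> y) = inv y \<otimes> inv x"
  using m_assoc[of x y z] m_assoc[of "inv x" x y, symmetric] m_assoc[of x "inv x" y, symmetric] inv_mult_group[of x y]
  by (simp_all)

lemma sm_prodmult: "smooth_map (prod_atlas A0 A0) A0 (\<lambda>(x, y). x \<otimes> y)"
  and sm_invG: "smooth_map A0 A0 (\<lambda>x. inv x)"
  using lie by (auto simp: is_lie_group_def)

lemma atl2: "smooth_atlas (prod_atlas A0 A0)" by (rule smooth_atlas_prod[OF atl atl])

lemma sm_mult:
  assumes "smooth_atlas A" "smooth_map A A0 f" "smooth_map A A0 g"
  shows "smooth_map A A0 (\<lambda>x. f x \<otimes> g x)"
  using smooth_map_compose[OF assms(1) atl2 atl smooth_map_Pair[OF assms(1) atl atl assms(2,3)] sm_prodmult] by simp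

lemma sm_inv: "smooth_atlas A \<Longrightarrow> smooth_map A A0 f \<Longrightarrow> smooth_map A A0 (\<lambda>x. inv (f x))"
  by (rule smooth_map_compose[OF _ atl atl _ sm_invG])

lemmas sm_id = smooth_map_id[OF atl]
lemmas sm_intros = sm_mult sm_inv sm_id smooth_map_const atl atl2 smooth_map_fst[OF atl atl]

lemma cont_mult: "continuous_on UNIV (\<lambda>x :: 'g \<times> 'g. fst x \<otimes> snd x)"
  using smooth_mapD(1)[OF sm_prodmult] by (simp add: case_prod_beta)

lemma cont_inv: "continuous_on UNIV (\<lambda>x. inv x)"
  using smooth_mapD(1)[OF sm_invG] .

lemma continuous_on_mult [continuous_intros]:
  "continuous_on S f \<Longrightarrow> continuous_on S g \<Longrightarrow> continuous_on S (\<lambda>x. f x \<otimes> g x)"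
  using continuous_on_compose2[OF cont_mult continuous_on_Pair] by fastforce

lemma continuous_on_minv [continuous_intros]:
  "continuous_on S f \<Longrightarrow> continuous_on S (\<lambda>x. inv (f x))"
  using continuous_on_compose2[OF cont_inv] by fastforce

lemmas unit_chart_facts = atlas_chart[OF atl uca]

lemma ui_u0 [simp]: "ui u0 = \<one>" by (rule unit_chart_facts(6)[OF one_uc])
lemma u0_mem: "u0 \<in> uc ` fst (unit_chart G)" using one_uc by blast

text \<open>Germs of maps into the group passing through the unit, with their derivative.\<close>

definition cder :: "('a::euclidean_space \<Rightarrow> 'g) \<Rightarrow> 'a \<Rightarrow> ('a \<Rightarrow> 'e) \<Rightarrow> bool" where
  "cder q a A \<longleftrightarrow> q a = \<one> \<and> isCont q a \<and> ((\<lambda>u. uc (q u)) has_derivative A) (at a)"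

lemma cder_unique: "cder q a A \<Longrightarrow> cder q a B \<Longrightarrow> A = B"
  unfolding cder_def using has_derivative_unique by blast

lemma cder_linear: "cder q a A \<Longrightarrow> linear A"
  unfolding cder_def using has_derivative_linear by blast

lemma cder_near: "cder q a A \<Longrightarrow> \<forall>\<^sub>F u in nhds a. q u \<in> fst (unit_chart G)"
proof -
  assume q: "cder q a A"
  then have "(q \<longlongrightarrow> \<one>) (nhds a)"
    using tendsto_at_iff_tendsto_nhds[of q a] unfolding cder_def isCont_def by metis
  then show ?thesis using unit_chart_facts(1) one_uc by (rule topological_tendstoD)
qed

lemma cder_const: "cder (\<lambda>_. \<one>) a (\<lambda>_. 0)"
  by (simp add: cder_def)

lemma cder_ui: "cder ui u0 (\<lambda>v. v)"
proof -
  have "continuous (at u0) ui"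
    using unit_chart_facts(2,5) u0_mem continuous_on_eq_continuous_at by blast
  moreover have "((\<lambda>u. uc (ui u)) has_derivative (\<lambda>v. v)) (at u0)"
    by (rule has_derivative_cong_open[OF has_derivative_ident unit_chart_facts(2) u0_mem]) (simp add: unit_chart_facts(8))
  ultimately show ?thesis by (simp add: cder_def)
qed

lemma lie_diff_derivative:
  assumes h: "smooth_map A0 A0 h" and e: "h \<one> = \<one>"
  shows "((\<lambda>u. uc (h (ui u))) has_derivative lie_diff G h) (at u0)"
  unfolding lie_diff_def
  by (rule smooth_map_has_derivative[OF atl atl h uca uca]) (simp_all add: e one_uc)

lemma cder_hom:
  assumes h: "smooth_map A0 A0 h" and e: "h \<one> = \<one>" and q: "cder q a A"
  shows "cder (\<lambda>u. h (q u)) a (\<lambda>v. lie_diff G h (A v))"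
  unfolding cder_def
proof (intro conjI)
  have qa: "q a = \<one>" using q by (simp add: cder_def)
  show "h (q a) = \<one>" using q e by (simp add: cder_def)
  have "isCont h (q a)" using smooth_mapD(1)[OF h] continuous_on_eq_continuous_at open_UNIV by blast
  then show "isCont (\<lambda>u. h (q u)) a" using q isCont_o2[of a q h] by (simp add: cder_def)
  have "((\<lambda>u. uc (h (ui (uc (q u))))) has_derivative (\<lambda>v. lie_diff G h (A v))) (at a)"
    using has_derivative_compose[of "\<lambda>u. uc (q u)" A a UNIV "\<lambda>w. uc (h (ui w))"] q lie_diff_derivative[OF h e]
    by (simp add: cder_def qa)
  moreover have "\<forall>\<^sub>F u in at a. uc (h (ui (uc (q u)))) = uc (h (q u))"
    using cder_near[OF q] unit_chart_facts(6) unfolding eventually_nhds_conv_at by (auto elim: eventually_mono)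
  ultimately show "((\<lambda>u. uc (h (q u))) has_derivative (\<lambda>v. lie_diff G h (A v))) (at a)"
    by (rule has_derivative_transform_eventually) (simp_all add: qa)
qed

text \<open>A linear map on a product is determined on the two axes. There one factor is the unit
  and the product is the other factor.\<close>

lemma mult_derivative:
  "((\<lambda>w. uc (ui (fst w) \<otimes> ui (snd w))) has_derivative (\<lambda>v. fst v + snd v)) (at (u0, u0))"
proof -
  let ?m = "\<lambda>w. uc (ui (fst w) \<otimes> ui (snd w))"
  have sm: "smooth_map (prod_atlas A0 A0) A0 (\<lambda>x. fst x \<otimes> snd x)" by (intro sm_intros)
  let ?c = "prod_chart (unit_chart G) (unit_chart G)"
  have c: "?c \<in> prod_atlas A0 A0" using uca unfolding prod_atlas_def by blast
  define D where "D = frechet_derivative (\<lambda>u. uc (fst (chart_inv ?c u) \<otimes> snd (chart_inv ?c u))) (at (snd ?c (\<one>, \<one>)))"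
  have "((\<lambda>u. uc (fst (chart_inv ?c u) \<otimes> snd (chart_inv ?c u))) has_derivative D) (at (u0, u0))"
    unfolding D_def using smooth_map_has_derivative[OF atl2 atl sm c uca, of "(\<one>, \<one>)"] one_uc by simp
  then have D: "(?m has_derivative D) (at (u0, u0))"
    by (rule has_derivative_cong_open[OF _ open_Times[OF unit_chart_facts(2) unit_chart_facts(2)]])
      (use u0_mem in \<open>auto simp: prod_atlas_charts[OF atl atl uca uca]\<close>)
  have lD: "linear D" using D by (rule has_derivative_linear)
  have "((\<lambda>u. ?m (u, u0)) has_derivative (\<lambda>v. D (v, 0))) (at u0)"
    by (rule has_derivative_compose[of "\<lambda>u. (u, u0)" "\<lambda>v. (v, 0)" u0 UNIV ?m D, OF _ D]) (auto intro!: derivative_eq_intros)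
  moreover have "((\<lambda>u. ?m (u, u0)) has_derivative (\<lambda>v. v)) (at u0)" using cder_ui by (simp add: cder_def)
  ultimately have 1: "D (v, 0) = v" for v using has_derivative_unique by (metis (no_types, lifting))
  have "((\<lambda>u. ?m (u0, u)) has_derivative (\<lambda>v. D (0, v))) (at u0)"
    by (rule has_derivative_compose[of "\<lambda>u. (u0, u)" "\<lambda>v. (0, v)" u0 UNIV ?m D, OF _ D]) (auto intro!: derivative_eq_intros)
  moreover have "((\<lambda>u. ?m (u0, u)) has_derivative (\<lambda>v. v)) (at u0)" using cder_ui by (simp add: cder_def)
  ultimately have 2: "D (0, v) = v" for v using has_derivative_unique by (metis (no_types, lifting))
  have "D v = fst v + snd v" for v
    using linear_add[OF lD, of "(fst v, 0)" "(0, snd v)"] 1 2 by simp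
  then have "D = (\<lambda>v. fst v + snd v)" by blast
  with D show ?thesis by simp
qed

lemma cder_mult:
  assumes q: "cder q a A" and r: "cder r a B"
  shows "cder (\<lambda>u. q u \<otimes> r u) a (\<lambda>v. A v + B v)"
  unfolding cder_def
proof (intro conjI)
  have qa: "q a = \<one>" "r a = \<one>" using q r by (simp_all add: cder_def)
  then show "q a \<otimes> r a = \<one>" by simp
  have "isCont (\<lambda>x :: 'g \<times> 'g. fst x \<otimes> snd x) (q a, r a)" using cont_mult continuous_on_eq_continuous_at open_UNIV by blast
  moreover have "isCont (\<lambda>u. (q u, r u)) a" using q r by (auto simp: cder_def intro: continuous_Pair)
  ultimately show "isCont (\<lambda>u. q u \<otimes> r u) a" using isCont_o2[of a "\<lambda>u. (q u, r u)" "\<lambda>x. fst x \<otimes> snd x"] by simp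
  have "((\<lambda>u. (uc (q u), uc (r u))) has_derivative (\<lambda>v. (A v, B v))) (at a)"
    using q r by (auto simp: cder_def intro: has_derivative_Pair)
  from has_derivative_compose[OF this, of "\<lambda>w. uc (ui (fst w) \<otimes> ui (snd w))" "\<lambda>v. fst v + snd v"] mult_derivative
  have "((\<lambda>u. uc (ui (uc (q u)) \<otimes> ui (uc (r u)))) has_derivative (\<lambda>v. A v + B v)) (at a)" by (simp add: qa)
  moreover have "\<forall>\<^sub>F u in at a. uc (ui (uc (q u)) \<otimes> ui (uc (r u))) = uc (q u \<otimes> r u)"
  proof -
    have "\<forall>\<^sub>F u in at a. q u \<in> fst (unit_chart G)" "\<forall>\<^sub>F u in at a. r u \<in> fst (unit_chart G)"
      using cder_near[OF q] cder_near[OF r] unfolding eventually_nhds_conv_at by auto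
    then show ?thesis by eventually_elim (simp add: unit_chart_facts(6))
  qed
  ultimately show "((\<lambda>u. uc (q u \<otimes> r u)) has_derivative (\<lambda>v. A v + B v)) (at a)"
    by (rule has_derivative_transform_eventually) (simp_all add: qa)
qed

text \<open>Differentiability comes from smoothness of the inversion; the value of the derivative
  comes from differentiating the constant product of q with its inverse.\<close>

lemma cder_inv:
  assumes q: "cder q a A"
  shows "cder (\<lambda>u. inv (q u)) a (\<lambda>v. - A v)"
proof -
  define B where "B = (\<lambda>v. lie_diff G (\<lambda>x. inv x) (A v))"
  have B: "cder (\<lambda>u. inv (q u)) a B" unfolding B_def using cder_hom[OF sm_invG _ q] by simp
  have "(\<lambda>v. A v + B v) = (\<lambda>_. 0)"
  proof (rule cder_unique[OF cder_mult[OF q B]])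
    show "cder (\<lambda>u. q u \<otimes> inv (q u)) a (\<lambda>_. 0)" by (simp add: cder_const)
  qed
  then have "B = (\<lambda>v. - A v)" by (metis (no_types, lifting) add.commute eq_neg_iff_add_eq_0)
  with B show ?thesis by simp
qed

section \<open>Automorphisms and the adjoint representation\<close>

definition conj :: "'g \<Rightarrow> 'g \<Rightarrow> 'g" where
  "conj g x = g \<otimes> x \<otimes> inv g"

lemma conj_mult: "conj g (x \<otimes> y) = conj g x \<otimes> conj g y"
  by (simp add: conj_def)

lemma sm_conj: "smooth_map A0 A0 (conj g)"
  unfolding conj_def[abs_def] by (intro sm_intros)

lemma conj_conj: "conj g (conj h x) = conj (g \<otimes> h) x"
  by (simp add: conj_def)

lemma conj_one [simp]: "conj \<one> x = x" "conj g \<one> = \<one>" by (simp_all add: conj_def)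

lemma lie_AutI:
  assumes "\<And>x y. \<alpha> (x \<otimes> y) = \<alpha> x \<otimes> \<alpha> y" "smooth_map A0 A0 \<alpha>" "smooth_map A0 A0 \<beta>"
    "\<And>x. \<beta> (\<alpha> x) = x" "\<And>x. \<alpha> (\<beta> x) = x"
  shows "\<alpha> \<in> lie_Aut G"
proof -
  have b: "bij \<alpha>" using assms(4,5) by (metis bijI')
  have i: "inv_into UNIV \<alpha> = \<beta>" using assms(4,5) by (metis HOL.ext b bij_inv_eq_iff)
  show ?thesis unfolding lie_Aut_def iso_def hom_def using assms b i by simp
qed

lemma lie_AutD:
  assumes "\<alpha> \<in> lie_Aut G"
  shows "\<alpha> (x \<otimes> y) = \<alpha> x \<otimes> \<alpha> y" "smooth_map A0 A0 \<alpha>" "smooth_map A0 A0 (inv_into UNIV \<alpha>)"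
    "inv_into UNIV \<alpha> (\<alpha> x) = x" "\<alpha> (inv_into UNIV \<alpha> x) = x" "\<alpha> \<one> = \<one>" "\<alpha> (inv x) = inv (\<alpha> x)" "bij \<alpha>"
proof -
  have b: "bij \<alpha>" and h: "\<alpha> \<in> hom G G" using assms by (auto simp: lie_Aut_def iso_def)
  show "\<alpha> (x \<otimes> y) = \<alpha> x \<otimes> \<alpha> y" "smooth_map A0 A0 \<alpha>" "smooth_map A0 A0 (inv_into UNIV \<alpha>)"
    using assms h by (auto simp: lie_Aut_def hom_def)
  show "inv_into UNIV \<alpha> (\<alpha> x) = x" "\<alpha> (inv_into UNIV \<alpha> x) = x" "bij \<alpha>"
    using b by (simp_all add: bij_is_inj bij_is_surj surj_f_inv_f)
  interpret group_hom G G \<alpha> using h by unfold_locales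
  show "\<alpha> \<one> = \<one>" "\<alpha> (inv x) = inv (\<alpha> x)" using hom_one hom_inv[of x] by simp_all
qed

lemma lie_Aut_inv:
  assumes "\<alpha> \<in> lie_Aut G"
  shows "inv_into UNIV \<alpha> \<in> lie_Aut G"
proof (rule lie_AutI[where \<beta> = \<alpha>])
  note a = lie_AutD[OF assms]
  show "inv_into UNIV \<alpha> (x \<otimes> y) = inv_into UNIV \<alpha> x \<otimes> inv_into UNIV \<alpha> y" for x y
    using a(1)[of "inv_into UNIV \<alpha> x" "inv_into UNIV \<alpha> y"] a(4,5) by metis
qed (use lie_AutD[OF assms] in auto)

lemma lie_Aut_comp:
  assumes a: "\<alpha> \<in> lie_Aut G" and b: "\<beta> \<in> lie_Aut G"
  shows "\<alpha> \<circ> \<beta> \<in> lie_Aut G"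
  by (rule lie_AutI[where \<beta> = "\<lambda>x. inv_into UNIV \<beta> (inv_into UNIV \<alpha> x)"])
    (simp_all add: lie_AutD[OF a] lie_AutD[OF b] o_def smooth_map_compose[OF atl atl atl lie_AutD(2)[OF b] lie_AutD(2)[OF a]]
      smooth_map_compose[OF atl atl atl lie_AutD(3)[OF a] lie_AutD(3)[OF b]])

lemma lie_Aut_conj: "conj g \<in> lie_Aut G"
  by (rule lie_AutI[where \<beta> = "conj (inv g)"]) (simp_all add: conj_mult sm_conj conj_conj)

lemma Ad_conj: "Ad G g = lie_diff G (conj g)"
  unfolding Ad_def conj_def[abs_def] ..

lemma lie_diff_eqI:
  assumes "cder (\<lambda>u. h (ui u)) u0 A"
  shows "lie_diff G h = A"
  using assms unfolding cder_def lie_diff_def by (auto intro: frechet_eq)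

lemma lie_diff_comp:
  assumes "smooth_map A0 A0 g" "smooth_map A0 A0 h" "g \<one> = \<one>" "h \<one> = \<one>"
  shows "lie_diff G (\<lambda>x. g (h x)) = (\<lambda>v. lie_diff G g (lie_diff G h v))"
  by (rule lie_diff_eqI) (use cder_hom[OF assms(1,3) cder_hom[OF assms(2,4) cder_ui]] in simp)

lemma lie_diff_id: "lie_diff G (\<lambda>x. x) = (\<lambda>v. v)"
  by (rule lie_diff_eqI) (rule cder_ui)

lemma lie_diff_linear: "\<alpha> \<in> lie_Aut G \<Longrightarrow> linear (lie_diff G \<alpha>)"
  using lie_diff_derivative[of \<alpha>] lie_AutD[of \<alpha>] has_derivative_linear by blast

lemma lie_diff_Aut_comp:
  assumes "\<alpha> \<in> lie_Aut G" "\<beta> \<in> lie_Aut G"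
  shows "lie_diff G (\<alpha> \<circ> \<beta>) = lie_diff G \<alpha> \<circ> lie_diff G \<beta>"
  unfolding o_def by (rule lie_diff_comp) (use lie_AutD[OF assms(1)] lie_AutD[OF assms(2)] in auto)

lemma lie_diff_inv:
  assumes "\<alpha> \<in> lie_Aut G"
  shows "lie_diff G (inv_into UNIV \<alpha>) (lie_diff G \<alpha> v) = v" "lie_diff G \<alpha> (lie_diff G (inv_into UNIV \<alpha>) v) = v"
proof -
  note a = lie_AutD[OF assms] and ai = lie_AutD[OF lie_Aut_inv[OF assms]]
  have "lie_diff G (\<lambda>x. inv_into UNIV \<alpha> (\<alpha> x)) v = v" "lie_diff G (\<lambda>x. \<alpha> (inv_into UNIV \<alpha> x)) v = v"
    using a(4,5) lie_diff_id by simp_all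
  then show "lie_diff G (inv_into UNIV \<alpha>) (lie_diff G \<alpha> v) = v" "lie_diff G \<alpha> (lie_diff G (inv_into UNIV \<alpha>) v) = v"
    using lie_diff_comp[OF ai(2) a(2) ai(6) a(6)] lie_diff_comp[OF a(2) ai(2) a(6) ai(6)] by simp_all
qed

lemma Ad_mult: "Ad G (g \<otimes> h) v = Ad G g (Ad G h v)"
proof -
  have "lie_diff G (\<lambda>x. conj g (conj h x)) = (\<lambda>v. lie_diff G (conj g) (lie_diff G (conj h) v))"
    by (rule lie_diff_comp) (simp_all add: sm_conj)
  then show ?thesis by (simp add: Ad_conj conj_conj)
qed

lemma Ad_one [simp]: "Ad G \<one> v = v"
proof -
  have "conj \<one> = (\<lambda>x. x)" by (simp add: fun_eq_iff)
  then show ?thesis using lie_diff_id by (simp add: Ad_conj)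
qed

lemma Ad_inv [simp]: "Ad G (inv g) (Ad G g v) = v" "Ad G g (Ad G (inv g) v) = v"
  by (simp_all flip: Ad_mult)

lemma Ad_linear: "linear (Ad G g)"
  unfolding Ad_conj by (rule lie_diff_linear[OF lie_Aut_conj])

lemma Ad_Aut:
  assumes "\<alpha> \<in> lie_Aut G"
  shows "lie_diff G \<alpha> (Ad G g v) = Ad G (\<alpha> g) (lie_diff G \<alpha> v)"
proof -
  note a = lie_AutD[OF assms]
  have "(\<lambda>x. \<alpha> (conj g x)) = (\<lambda>x. conj (\<alpha> g) (\<alpha> x))" by (simp add: conj_def a)
  then show ?thesis
    using lie_diff_comp[OF a(2) sm_conj a(6), of g] lie_diff_comp[OF sm_conj a(2) _ a(6), of "\<alpha> g"]
    by (simp add: Ad_conj) metis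
qed

section \<open>Pull-backs of the Maurer-Cartan forms\<close>

lemma pull_thetaL_cder:
  assumes A: "smooth_atlas A" and f: "smooth_map A A0 f" and c: "c \<in> A" and p: "p \<in> fst c"
  shows "cder (\<lambda>u. inv (f p) \<otimes> f (chart_inv c u)) (snd c p) (pull_thetaL G c f p)"
proof -
  have sm: "smooth_map A A0 (\<lambda>x. inv (f p) \<otimes> f x)" by (intro sm_mult A f smooth_map_const[OF A atl])
  have "continuous_on (snd c ` fst c) (\<lambda>u. inv (f p) \<otimes> f (chart_inv c u))"
    by (rule continuous_on_compose2[OF smooth_mapD(1)[OF sm] atlas_chart(5)[OF A c]]) simp
  then have "isCont (\<lambda>u. inv (f p) \<otimes> f (chart_inv c u)) (snd c p)"
    using atlas_chart(2)[OF A c] p continuous_on_eq_continuous_at by blast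
  then show ?thesis
    unfolding cder_def pull_thetaL_def
    using smooth_map_has_derivative[OF A atl sm c uca p] one_uc atlas_chart(6)[OF A c p] by simp
qed

lemma pull_thetaL_eqI: "cder (\<lambda>u. inv (f p) \<otimes> f (chart_inv c u)) (snd c p) B \<Longrightarrow> pull_thetaL G c f p = B"
  unfolding cder_def pull_thetaL_def by (auto intro: frechet_eq)

context
  fixes A :: "('m::topological_space, 'a::euclidean_space) chart set" and c p
  assumes A: "smooth_atlas A" and c: "c \<in> A" and p: "p \<in> fst c"
begin

lemma pull_thetaL_linear: "smooth_map A A0 f \<Longrightarrow> linear (pull_thetaL G c f p)"
  using cder_linear[OF pull_thetaL_cder[OF A _ c p]] .

text \<open>The translated product splits into the translated germ of f, conjugated by the inverse
  of g p, times the translated germ of g. Both pass through the unit, so \<open>cder_mult\<close>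
  applies, and the conjugation is the source of Ad.\<close>

lemma pull_thetaL_mult:
  assumes f: "smooth_map A A0 f" and g: "smooth_map A A0 g"
  shows "pull_thetaL G c (\<lambda>x. f x \<otimes> g x) p = (\<lambda>v. Ad G (inv (g p)) (pull_thetaL G c f p v) + pull_thetaL G c g p v)"
proof (rule pull_thetaL_eqI)
  have "cder (\<lambda>u. conj (inv (g p)) (inv (f p) \<otimes> f (chart_inv c u)) \<otimes> (inv (g p) \<otimes> g (chart_inv c u))) (snd c p)
    (\<lambda>v. Ad G (inv (g p)) (pull_thetaL G c f p v) + pull_thetaL G c g p v)"
    unfolding Ad_conj
    by (intro cder_mult cder_hom sm_conj pull_thetaL_cder[OF A _ c p] f g) simp
  then show "cder (\<lambda>u. inv (f p \<otimes> g p) \<otimes> (f (chart_inv c u) \<otimes> g (chart_inv c u))) (snd c p)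
    (\<lambda>v. Ad G (inv (g p)) (pull_thetaL G c f p v) + pull_thetaL G c g p v)"
    by (simp add: conj_def)
qed

lemma pull_thetaL_hom:
  assumes f: "smooth_map A A0 f" and \<alpha>: "\<alpha> \<in> lie_Aut G"
  shows "pull_thetaL G c (\<lambda>x. \<alpha> (f x)) p = (\<lambda>v. lie_diff G \<alpha> (pull_thetaL G c f p v))"
proof (rule pull_thetaL_eqI)
  note a = lie_AutD[OF \<alpha>]
  have "cder (\<lambda>u. \<alpha> (inv (f p) \<otimes> f (chart_inv c u))) (snd c p) (\<lambda>v. lie_diff G \<alpha> (pull_thetaL G c f p v))"
    by (rule cder_hom[OF a(2) a(6) pull_thetaL_cder[OF A f c p]])
  then show "cder (\<lambda>u. inv (\<alpha> (f p)) \<otimes> \<alpha> (f (chart_inv c u))) (snd c p) (\<lambda>v. lie_diff G \<alpha> (pull_thetaL G c f p v))"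
    by (simp add: a(1) a(7))
qed

lemma pull_thetaL_inv:
  assumes f: "smooth_map A A0 f"
  shows "pull_thetaL G c (\<lambda>x. inv (f x)) p = (\<lambda>v. - Ad G (f p) (pull_thetaL G c f p v))"
proof (rule pull_thetaL_eqI)
  have "cder (\<lambda>u. inv (conj (f p) (inv (f p) \<otimes> f (chart_inv c u)))) (snd c p) (\<lambda>v. - Ad G (f p) (pull_thetaL G c f p v))"
    unfolding Ad_conj by (intro cder_inv cder_hom sm_conj pull_thetaL_cder[OF A f c p]) simp
  then show "cder (\<lambda>u. inv (inv (f p)) \<otimes> inv (f (chart_inv c u))) (snd c p) (\<lambda>v. - Ad G (f p) (pull_thetaL G c f p v))"
    by (simp add: conj_def)
qed

lemma pull_thetaR:
  assumes f: "smooth_map A A0 f"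
  shows "pull_thetaR G c f p = (\<lambda>v. Ad G (f p) (pull_thetaL G c f p v))"
proof -
  have "cder (\<lambda>u. conj (f p) (inv (f p) \<otimes> f (chart_inv c u))) (snd c p) (\<lambda>v. Ad G (f p) (pull_thetaL G c f p v))"
    unfolding Ad_conj by (intro cder_hom sm_conj pull_thetaL_cder[OF A f c p]) simp
  then have "((\<lambda>u. uc (f (chart_inv c u) \<otimes> inv (f p))) has_derivative (\<lambda>v. Ad G (f p) (pull_thetaL G c f p v))) (at (snd c p))"
    by (simp add: cder_def conj_def)
  then show ?thesis unfolding pull_thetaR_def by (rule frechet_eq)
qed

end

text \<open>A left inverse is the derivative of left translation by p, from the unit chart to c.
  Injectivity suffices, since the dimensions agree.\<close>

lemma pull_thetaL_bij:
  assumes c: "c \<in> A0" and p: "p \<in> fst c"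
  shows "bij (pull_thetaL G c id p)"
proof -
  let ?B = "pull_thetaL G c id p"
  have "cder (\<lambda>u. inv (id p) \<otimes> id (chart_inv c u)) (snd c p) ?B"
    by (rule pull_thetaL_cder[OF atl _ c p]) (use sm_id in \<open>simp add: id_def\<close>)
  then have q: "cder (\<lambda>u. inv p \<otimes> chart_inv c u) (snd c p) ?B" by simp
  have sm: "smooth_map A0 A0 (\<lambda>x. p \<otimes> x)" by (intro sm_intros)
  define C where "C = frechet_derivative (\<lambda>u. snd c (p \<otimes> ui u)) (at u0)"
  have C: "((\<lambda>u. snd c (p \<otimes> ui u)) has_derivative C) (at u0)"
    unfolding C_def by (rule smooth_map_has_derivative[OF atl atl sm uca c one_uc]) (simp add: p)
  have qd: "((\<lambda>u. uc (inv p \<otimes> chart_inv c u)) has_derivative ?B) (at (snd c p))" using q by (simp add: cder_def)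
  have cp: "chart_inv c (snd c p) = p" by (rule atlas_chart(6)[OF atl c p])
  have "((\<lambda>u. snd c (p \<otimes> ui (uc (inv p \<otimes> chart_inv c u)))) has_derivative (\<lambda>v. C (?B v))) (at (snd c p))"
    using has_derivative_compose[OF qd, of "\<lambda>u. snd c (p \<otimes> ui u)" C] C by (simp add: cp)
  moreover have "((\<lambda>u. snd c (p \<otimes> ui (uc (inv p \<otimes> chart_inv c u)))) has_derivative (\<lambda>v. v)) (at (snd c p))"
  proof (rule has_derivative_transform_eventually[OF has_derivative_ident])
    have "\<forall>\<^sub>F u in at (snd c p). inv p \<otimes> chart_inv c u \<in> fst (unit_chart G)"
      using cder_near[OF q] unfolding eventually_nhds_conv_at by simp
    moreover have "\<forall>\<^sub>F u in at (snd c p). u \<in> snd c ` fst c"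
      using atlas_chart(2)[OF atl c] p eventually_at_in_open'[of "snd c ` fst c" "snd c p"] by blast
    ultimately show "\<forall>\<^sub>F u in at (snd c p). u = snd c (p \<otimes> ui (uc (inv p \<otimes> chart_inv c u)))"
      by eventually_elim (simp add: unit_chart_facts(6) atlas_chart(8)[OF atl c])
  qed (simp_all add: cp)
  ultimately have "(\<lambda>v. C (?B v)) = (\<lambda>v. v)" by (rule has_derivative_unique)
  then have CB: "C (?B v) = v" for v by metis
  then have "inj ?B" by (metis injI)
  moreover have "linear ?B" using cder_linear[OF q] .
  ultimately show ?thesis using linear_injective_imp_surjective by (auto simp: bij_def)
qed

end

section \<open>Liouville forms of the doubles\<close>

lemma (in liegroup) inv_prod_group: "inv\<^bsub>prod_group G G\<^esub> (x, y) = (inv x, inv y)"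
proof -
  have "inv\<^bsub>prod_group G G\<^esub> (x, y) = inv\<^bsub>G \<times>\<times> G\<^esub> (x, y)"
    by (simp add: m_inv_def prod_group_def)
  also have "\<dots> = (inv x, inv y)" by (rule inv_DirProd[OF grp grp]) simp_all
  finally show ?thesis .
qed

lemma (in liegroup) prod_group_simps:
  "monoid.mult (prod_group G G) (x, y) (x', y') = (x \<otimes> x', y \<otimes> y')" "monoid.one (prod_group G G) = (\<one>, \<one>)"
  "unit_chart (prod_group G G) = prod_chart (unit_chart G) (unit_chart G)"
  by (simp_all add: prod_group_def DirProd_def)

lemma has_derivative_map_prod:
  assumes "(f has_derivative f') (at a)" "(g has_derivative g') (at b)"
  shows "((\<lambda>u. (f (fst u), g (snd u))) has_derivative map_prod f' g') (at (a, b))"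
proof -
  have "((\<lambda>u. f (fst u)) has_derivative (\<lambda>v. f' (fst v))) (at (a, b))"
    by (rule has_derivative_compose[of fst fst _ UNIV f f']) (use assms(1) in \<open>auto intro!: derivative_eq_intros\<close>)
  moreover have "((\<lambda>u. g (snd u)) has_derivative (\<lambda>v. g' (snd v))) (at (a, b))"
    by (rule has_derivative_compose[of snd snd _ UNIV g g']) (use assms(2) in \<open>auto intro!: derivative_eq_intros\<close>)
  ultimately show ?thesis unfolding map_prod_def case_prod_beta by (rule has_derivative_Pair)
qed

lemma (in liegroup) lie_diff_prod:
  assumes f: "smooth_map A0 A0 f" "f \<one> = \<one>" and g: "smooth_map A0 A0 g" "g \<one> = \<one>"
  shows "lie_diff (prod_group G G) (map_prod f g) = map_prod (lie_diff G f) (lie_diff G g)"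
proof -
  let ?c = "prod_chart (unit_chart G) (unit_chart G)"
  have "((\<lambda>u. (uc (f (ui (fst u))), uc (g (ui (snd u))))) has_derivative map_prod (lie_diff G f) (lie_diff G g)) (at (u0, u0))"
    by (intro has_derivative_map_prod lie_diff_derivative f g)
  then have "((\<lambda>u. snd ?c (map_prod f g (chart_inv ?c u))) has_derivative map_prod (lie_diff G f) (lie_diff G g)) (at (u0, u0))"
    by (rule has_derivative_cong_open[OF _ open_Times[OF unit_chart_facts(2) unit_chart_facts(2)]])
      (use u0_mem in \<open>auto simp: prod_atlas_charts[OF atl atl uca uca]\<close>)
  then show ?thesis
    unfolding lie_diff_def[of "prod_group G G"] prod_group_simps by (simp add: frechet_eq)
qed

lemma (in liegroup) Ad_prod: "Ad (prod_group G G) (x, y) = map_prod (Ad G x) (Ad G y)"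
proof -
  have "(\<lambda>z. (x, y) \<otimes>\<^bsub>prod_group G G\<^esub> z \<otimes>\<^bsub>prod_group G G\<^esub> inv\<^bsub>prod_group G G\<^esub> (x, y)) = map_prod (conj x) (conj y)"
    by (auto simp: fun_eq_iff inv_prod_group prod_group_simps conj_def)
  then show ?thesis
    unfolding Ad_def[of "prod_group G G"] Ad_conj by (simp add: lie_diff_prod sm_conj)
qed

locale metric_liegroup = liegroup +
  assumes inner: "Aut_invariant_inner G"
begin

lemma orth_Aut: "\<alpha> \<in> lie_Aut G \<Longrightarrow> orthogonal_transformation (lie_diff G \<alpha>)"
  using inner lie_diff_linear by (auto simp: orthogonal_transformation_def Aut_invariant_inner_def)

lemma orth_Ad: "orthogonal_transformation (Ad G g)"
  unfolding Ad_conj by (rule orth_Aut[OF lie_Aut_conj])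

lemma Ad_inner: "Ad G g v \<bullet> Ad G g w = v \<bullet> w"
  using orth_Ad by (rule orth_inner)

end

lemma orth_compose: "orthogonal_transformation f \<Longrightarrow> orthogonal_transformation g \<Longrightarrow> orthogonal_transformation (\<lambda>x. f (g x))"
  using orthogonal_transformation_compose[of f g] by (simp add: o_def)

lemma orth_neg: "orthogonal_transformation f \<Longrightarrow> orthogonal_transformation (\<lambda>x. - f x)"
  by (simp add: orthogonal_transformation_def linear_compose_neg)

lemma orth_inv_eq:
  fixes f :: "'a::euclidean_space \<Rightarrow> 'a"
  shows "orthogonal_transformation f \<Longrightarrow> f y = x \<Longrightarrow> inv_into UNIV f x = y"
  using orthogonal_transformation_bij[of f] by (simp add: bij_is_inj inv_f_eq)

section \<open>The doubles in the left trivialisation\<close>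

locale twists = metric_liegroup +
  fixes \<tau> \<kappa> :: "'a \<Rightarrow> 'a"
  assumes tau: "\<tau> \<in> lie_Aut G" and kappa: "\<kappa> \<in> lie_Aut G"
begin

abbreviation "\<tau>' \<equiv> inv_into UNIV \<tau>"
abbreviation "\<kappa>' \<equiv> inv_into UNIV \<kappa>"
abbreviation "dT \<equiv> lie_diff G \<tau>"
abbreviation "dK \<equiv> lie_diff G \<kappa>"
abbreviation "dT' \<equiv> lie_diff G \<tau>'"
abbreviation "dK' \<equiv> lie_diff G \<kappa>'"

lemmas tau' = lie_Aut_inv[OF tau] and kappa' = lie_Aut_inv[OF kappa]
lemmas aut_simps = lie_AutD(4,5)[OF tau] lie_AutD(4,5)[OF kappa] lie_diff_inv[OF tau] lie_diff_inv[OF kappa]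
lemmas hom_simps = lie_AutD(1,6,7)[OF tau] lie_AutD(1,6,7)[OF kappa] lie_AutD(1,6,7)[OF tau'] lie_AutD(1,6,7)[OF kappa']
lemmas Ad_simps = Ad_Aut[OF tau] Ad_Aut[OF kappa] Ad_Aut[OF tau'] Ad_Aut[OF kappa']
lemmas neg_simps = linear_neg[OF Ad_linear] linear_neg[OF lie_diff_linear[OF tau]] linear_neg[OF lie_diff_linear[OF kappa]]
  linear_neg[OF lie_diff_linear[OF tau']] linear_neg[OF lie_diff_linear[OF kappa']]
lemmas add_simps = linear_add[OF Ad_linear] linear_add[OF lie_diff_linear[OF tau]] linear_add[OF lie_diff_linear[OF kappa]]
  linear_add[OF lie_diff_linear[OF tau']] linear_add[OF lie_diff_linear[OF kappa']]
lemmas diff_simps = linear_diff[OF Ad_linear] linear_diff[OF lie_diff_linear[OF tau]] linear_diff[OF lie_diff_linear[OF kappa]]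
  linear_diff[OF lie_diff_linear[OF tau']] linear_diff[OF lie_diff_linear[OF kappa']]
lemmas inner_simps' = Ad_inner orth_inner[OF orth_Aut[OF tau]] orth_inner[OF orth_Aut[OF kappa]]
  orth_inner[OF orth_Aut[OF tau']] orth_inner[OF orth_Aut[OF kappa']]

definition Phi1 :: "'a \<times> 'a \<Rightarrow> 'a" where "Phi1 z = fst z \<otimes> \<tau> (snd z)"
definition Phi2 :: "'a \<times> 'a \<Rightarrow> 'a" where "Phi2 z = \<tau>' (inv (fst z) \<otimes> \<kappa>' (inv (snd z)))"

lemma moment_double: "moment (twisted_double G \<tau> \<kappa>) = (\<lambda>z. (Phi1 z, Phi2 z))"
  by (auto simp: twisted_double_def Phi1_def Phi2_def fun_eq_iff)

lemma moment_fused: "moment (fused_double G \<tau> \<kappa>) = (\<lambda>z. Phi1 z \<otimes> \<tau> (\<kappa> (Phi2 z)))"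
  by (simp add: fused_double_def Let_def moment_double o_def)

lemma sm_aut: "\<alpha> \<in> lie_Aut G \<Longrightarrow> smooth_atlas A \<Longrightarrow> smooth_map A A0 f \<Longrightarrow> smooth_map A A0 (\<lambda>x. \<alpha> (f x))"
  by (rule smooth_map_compose[OF _ atl atl _ lie_AutD(2)])

lemmas sm_fst = smooth_map_fst(1)[OF atl atl] and sm_snd = smooth_map_fst(2)[OF atl atl]

lemma sm_Phi: "smooth_map (prod_atlas A0 A0) A0 Phi1" "smooth_map (prod_atlas A0 A0) A0 Phi2"
  unfolding Phi1_def[abs_def] Phi2_def[abs_def]
  by (rule sm_mult[OF atl2 sm_fst sm_aut[OF tau atl2 sm_snd]],
      rule sm_aut[OF tau' atl2 sm_mult[OF atl2 sm_inv[OF atl2 sm_fst] sm_aut[OF kappa' atl2 sm_inv[OF atl2 sm_snd]]]])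

end

locale double_point = twists +
  fixes c1 c2 x y
  assumes c1: "c1 \<in> A0" and c2: "c2 \<in> A0" and x: "x \<in> fst c1" and y: "y \<in> fst c2"
begin

abbreviation "cc \<equiv> prod_chart c1 c2"
abbreviation "th1 \<equiv> pull_thetaL G c1 id x"
abbreviation "th2 \<equiv> pull_thetaL G c2 id y"

lemma cc: "cc \<in> prod_atlas A0 A0" and xy: "(x, y) \<in> fst cc"
proof -
  show "cc \<in> prod_atlas A0 A0" using c1 c2 unfolding prod_atlas_def by blast
  show "(x, y) \<in> fst cc" using x y by simp
qed

lemma th_fst: "pull_thetaL G cc fst (x, y) = (\<lambda>v. th1 (fst v))"
  and th_snd: "pull_thetaL G cc snd (x, y) = (\<lambda>v. th2 (snd v))"
proof -
  have "((\<lambda>u. uc (inv x \<otimes> chart_inv c1 u)) has_derivative th1) (at (snd c1 x))"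
    "((\<lambda>u. uc (inv y \<otimes> chart_inv c2 u)) has_derivative th2) (at (snd c2 y))"
    using pull_thetaL_cder[OF atl _ c1 x, of id] pull_thetaL_cder[OF atl _ c2 y, of id] sm_id by (simp_all add: cder_def id_def)
  from has_derivative_map_prod[OF this]
  have d: "((\<lambda>u. (uc (inv x \<otimes> chart_inv c1 (fst u)), uc (inv y \<otimes> chart_inv c2 (snd u)))) has_derivative map_prod th1 th2) (at (snd cc (x, y)))"
    by simp
  have o: "open (snd c1 ` fst c1 \<times> snd c2 ` fst c2)"
    by (intro open_Times atlas_chart(2)[OF atl] c1 c2)
  have "((\<lambda>u. (uc (inv x \<otimes> fst (chart_inv cc u)), uc (inv y \<otimes> snd (chart_inv cc u)))) has_derivative map_prod th1 th2) (at (snd cc (x, y)))"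
    by (rule has_derivative_cong_open[OF d o]) (use x y in \<open>auto simp: prod_atlas_charts[OF atl atl c1 c2]\<close>)
  from has_derivative_fst[OF this] has_derivative_snd[OF this]
  show "pull_thetaL G cc fst (x, y) = (\<lambda>v. th1 (fst v))" "pull_thetaL G cc snd (x, y) = (\<lambda>v. th2 (snd v))"
    unfolding pull_thetaL_def[of G cc] by (simp_all add: frechet_eq)
qed

text \<open>The coefficients of the two Maurer-Cartan forms in the differentials of
  \<open>Phi1\<close> and \<open>Phi2\<close>; see \<open>th_Phi1\<close> and
  \<open>th_Phi2\<close>. They are isometries because the inner product is invariant, as
  \<open>double_data\<close> demands.\<close>

definition "M1 = (\<lambda>v. Ad G (inv (\<tau> y)) v)"
definition "M2 = (\<lambda>v. dT v)"
definition "N1 = (\<lambda>v. - dT' (Ad G (\<kappa>' y) (Ad G x v)))"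
definition "N2 = (\<lambda>v. - dT' (dK' (Ad G y v)))"

lemmas pt = atl2 cc xy

lemma th_Phi1: "pull_thetaL G cc Phi1 (x, y) = (\<lambda>v. M1 (th1 (fst v)) + M2 (th2 (snd v)))"
  unfolding Phi1_def[abs_def]
  unfolding pull_thetaL_mult[OF pt sm_fst sm_aut[OF tau atl2 sm_snd]] pull_thetaL_hom[OF pt sm_snd tau]
  by (simp add: th_fst th_snd M1_def M2_def)

lemma th_Phi2: "pull_thetaL G cc Phi2 (x, y) = (\<lambda>v. N1 (th1 (fst v)) + N2 (th2 (snd v)))"
proof -
  have s: "smooth_map (prod_atlas A0 A0) A0 (\<lambda>z. inv (fst z))" "smooth_map (prod_atlas A0 A0) A0 (\<lambda>z. inv (snd z))"
    "smooth_map (prod_atlas A0 A0) A0 (\<lambda>z. \<kappa>' (inv (snd z)))"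
    by (rule sm_inv[OF atl2 sm_fst], rule sm_inv[OF atl2 sm_snd], rule sm_aut[OF kappa' atl2 sm_inv[OF atl2 sm_snd]])
  have i: "pull_thetaL G cc (\<lambda>z. inv (fst z)) (x, y) = (\<lambda>v. - Ad G x (th1 (fst v)))"
    "pull_thetaL G cc (\<lambda>z. inv (snd z)) (x, y) = (\<lambda>v. - Ad G y (th2 (snd v)))"
    using pull_thetaL_inv[OF pt sm_fst] pull_thetaL_inv[OF pt sm_snd]
    by (simp_all add: th_fst th_snd)
  show ?thesis
    unfolding Phi2_def[abs_def] pull_thetaL_hom[OF pt sm_mult[OF atl2 s(1,3)] tau']
      pull_thetaL_mult[OF pt s(1,3)] pull_thetaL_hom[OF pt s(2) kappa'] i
    by (simp add: N1_def N2_def add_simps diff_simps neg_simps hom_simps)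
qed

lemma orths: "orthogonal_transformation M1" "orthogonal_transformation M2" "orthogonal_transformation N1" "orthogonal_transformation N2"
  unfolding M1_def M2_def N1_def N2_def
  by (rule orth_Ad, rule orth_Aut[OF tau], rule orth_neg[OF orth_compose[OF orth_Aut[OF tau'] orth_compose[OF orth_Ad orth_Ad]]],
      rule orth_neg[OF orth_compose[OF orth_Aut[OF tau'] orth_compose[OF orth_Aut[OF kappa'] orth_Ad]]])

lemma th_linbij: "linear th1" "linear th2" "bij th1" "bij th2"
  using pull_thetaL_bij c1 c2 x y pull_thetaL_linear[OF atl c1 x, of id] pull_thetaL_linear[OF atl c2 y, of id] sm_id
  by (auto simp: id_def)

sublocale D: double_data th1 th2 M1 N1 M2 N2
  by (rule double_data.intro[OF th_linbij orths(1,3,2,4)])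

text \<open>The inner products in \<open>form2\<close> are transported by isometries: the pairing of
  the first components becomes the summand with \<tau> inverse, that of the second components the
  summand with \<kappa> inverse.\<close>

lemma form_double: "form (twisted_double G \<tau> \<kappa>) cc (x, y) = D.form2"
proof (intro HOL.ext)
  fix u v
  have 1: "M1 a \<bullet> M2 b = dT' a \<bullet> Ad G y b" for a b
  proof -
    have "M1 a \<bullet> M2 b = Ad G (\<tau> y) (M1 a) \<bullet> Ad G (\<tau> y) (M2 b)" by (simp add: Ad_inner)
    also have "\<dots> = a \<bullet> dT (Ad G y b)" by (simp add: M1_def M2_def Ad_simps)
    also have "\<dots> = dT (dT' a) \<bullet> dT (Ad G y b)" by (simp add: aut_simps)
    finally show ?thesis by (simp only: inner_simps')
  qed
  have 2: "N1 a \<bullet> N2 b = Ad G x a \<bullet> dK' b" for a b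
    by (simp add: N1_def N2_def inner_simps' Ad_simps(4))
  show "form (twisted_double G \<tau> \<kappa>) cc (x, y) u v = D.form2 u v"
    by (simp add: twisted_double_def dot_form_def D.form2_def 1 2 pull_thetaR[OF pt sm_fst]
      pull_thetaR[OF pt sm_snd] th_fst th_snd)
qed

lemma pull_prod: "pull_thetaL (prod_group G G) cc (\<lambda>z. (Phi1 z, Phi2 z)) (x, y) = D.dmom"
proof -
  note q = pull_thetaL_cder[OF atl2 sm_Phi(1) cc xy] pull_thetaL_cder[OF atl2 sm_Phi(2) cc xy]
  have "((\<lambda>u. (uc (inv (Phi1 (x, y)) \<otimes> Phi1 (chart_inv cc u)), uc (inv (Phi2 (x, y)) \<otimes> Phi2 (chart_inv cc u))))
    has_derivative D.dmom) (at (snd cc (x, y)))"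
  proof -
    have 1: "((\<lambda>u. uc (inv (Phi1 (x, y)) \<otimes> Phi1 (chart_inv cc u))) has_derivative (\<lambda>v. M1 (th1 (fst v)) + M2 (th2 (snd v)))) (at (snd cc (x, y)))"
      and 2: "((\<lambda>u. uc (inv (Phi2 (x, y)) \<otimes> Phi2 (chart_inv cc u))) has_derivative (\<lambda>v. N1 (th1 (fst v)) + N2 (th2 (snd v)))) (at (snd cc (x, y)))"
      using q unfolding cder_def th_Phi1 th_Phi2 by blast+
    show ?thesis using has_derivative_Pair[OF 1 2] by (simp add: D.dmom_def[abs_def])
  qed
  then show ?thesis
    unfolding pull_thetaL_def inv_prod_group prod_group_simps by (simp add: frechet_eq)
qed

text \<open>The inverses of the isometries lifted in \<psi>, namely the twist after Ad of the moment
  map, for the two components; see \<open>C1_inv\<close> and \<open>C2_inv\<close>. That they are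
  also the blocks described in \<open>refl_ws_block\<close> is the cancellation on which the
  computation rests.\<close>

definition "C1 = (\<lambda>v. Ad G (inv (\<tau> y)) (Ad G (inv x) (dK' (dT' v))))"
definition "C2 = (\<lambda>v. dT' (Ad G (\<kappa>' y) (Ad G x (dT (dK (dT v))))))"

lemma C1: "C1 (M2 (inv_into UNIV N2 (N1 v))) = M1 v"
proof -
  have "inv_into UNIV N2 (N1 v) = dK (Ad G x v)"
    by (rule orth_inv_eq[OF orths(4)]) (simp add: N1_def N2_def aut_simps Ad_simps(4))
  then show ?thesis by (simp add: C1_def M1_def M2_def aut_simps)
qed

lemma C2: "C2 (N2 (inv_into UNIV M2 (M1 v))) = N1 v"
proof -
  have "inv_into UNIV M2 (M1 v) = dT' (M1 v)"
    by (rule orth_inv_eq[OF orths(2)]) (simp add: M2_def aut_simps)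
  moreover have "Ad G y (dT' (M1 v)) = dT' v"
  proof -
    have "dT (Ad G y (dT' (M1 v))) = dT (dT' v)" by (simp only: Ad_simps aut_simps) (simp add: M1_def)
    then show ?thesis by (metis aut_simps(5))
  qed
  ultimately show ?thesis by (simp add: C2_def N2_def N1_def aut_simps neg_simps)
qed

lemma orth_C: "orthogonal_transformation C1" "orthogonal_transformation C2"
  unfolding C1_def C2_def
  by (rule orth_compose[OF orth_Ad orth_compose[OF orth_Ad orth_compose[OF orth_Aut[OF kappa'] orth_Aut[OF tau']]]],
      rule orth_compose[OF orth_Aut[OF tau'] orth_compose[OF orth_Ad orth_compose[OF orth_Ad
        orth_compose[OF orth_Aut[OF tau] orth_compose[OF orth_Aut[OF kappa] orth_Aut[OF tau]]]]]])

lemma C1_inv: "dT (dK (Ad G (Phi1 (x, y)) (C1 v))) = v"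
  by (simp add: C1_def Phi1_def Ad_mult aut_simps del: m_simps)

lemma C2_inv: "dT' (dK' (Ad G (Phi2 (x, y)) (C2 v))) = v"
proof -
  have "Ad G (Phi2 (x, y)) (C2 v) = dT' (Ad G (inv x) (Ad G (inv (\<kappa>' y)) (Ad G (\<kappa>' y) (Ad G x (dT (dK (dT v)))))))"
    by (simp add: C2_def Phi2_def Ad_simps(3)[symmetric] Ad_mult hom_simps(10-12) del: m_simps Ad_inv)
  then show ?thesis by (simp add: aut_simps)
qed

theorem liouville_double:
  assumes \<T>: "Ad_lift (prod_group G G) \<T>" and k: "pin_lift (lie_diff (prod_group G G) (map_prod (\<tau> \<circ> \<kappa>) (\<tau>' \<circ> \<kappa>'))) k"
  shows "\<bar>liouville_form (prod_group G G) \<T> k (twisted_double G \<tau> \<kappa>) cc (x, y)\<bar> = \<bar>bdet th1\<bar> * \<bar>bdet th2\<bar>"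
proof -
  let ?m = "(Phi1 (x, y), Phi2 (x, y))"
  obtain ks where ks: "unitl ks" "k = mv_coeff (pinl ks)" "foldr refl ks = lie_diff (prod_group G G) (map_prod (\<tau> \<circ> \<kappa>) (\<tau>' \<circ> \<kappa>'))"
    using pin_lift_reflections[OF k] by blast
  obtain ts where ts: "unitl ts" "\<T> ?m = mv_coeff (pinl ts)" "foldr refl ts = Ad (prod_group G G) ?m"
    using \<T> pin_lift_reflections[of "Ad (prod_group G G) ?m" "\<T> ?m"] unfolding Ad_lift_def by blast
  have kk: "lie_diff (prod_group G G) (map_prod (\<tau> \<circ> \<kappa>) (\<tau>' \<circ> \<kappa>')) = map_prod (dT \<circ> dK) (dT' \<circ> dK')"
    using lie_diff_prod[of "\<tau> \<circ> \<kappa>" "\<tau>' \<circ> \<kappa>'"] lie_AutD(2,6)[OF lie_Aut_comp[OF tau kappa]] lie_AutD(2,6)[OF lie_Aut_comp[OF tau' kappa']]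
    by (simp add: lie_diff_Aut_comp tau kappa tau' kappa')
  have e: "liouville_form (prod_group G G) \<T> k (twisted_double G \<tau> \<kappa>) cc (x, y) = mv_coeff (exp_pull D.form2 D.dmom (psim (pinl (ks @ ts)))) Basis"
    by (subst liouville_exp_pull[where ts = ts and ks = ks])
      (simp_all add: form_double D.skew_form2 moment_double ts(2) ks(2) pull_prod)
  show ?thesis
    unfolding e
  proof (rule D.double_top[where ?C1.0 = C1 and ?C2.0 = C2])
    show "unitl (ks @ ts)" using ks ts by (auto simp: unitl_def)
    show "foldr refl (ks @ ts) (C1 a, C2 b) = (a, b)" for a b
      by (simp add: ks(3) ts(3) kk Ad_prod C1_inv C2_inv)
  qed (rule C1 C2)+
qed

text \<open>The fusion term involves the right-invariant form of the twisted second moment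
  component, so the differential of that component replaces the one of \<open>Phi2\<close>. This
  composes with the isometry Z, which leaves \<open>form2\<close> unchanged and conjugates the
  second block.\<close>

definition "Z = (\<lambda>v. Ad G (\<tau> (\<kappa> (Phi2 (x, y)))) (dT (dK v)))"
definition "N1F = (\<lambda>v. Z (N1 v))"
definition "N2F = (\<lambda>v. Z (N2 v))"

lemmas NF = fun_cong[OF N1F_def] fun_cong[OF N2F_def]

lemma orth_Z: "orthogonal_transformation Z" "orthogonal_transformation N1F" "orthogonal_transformation N2F"
proof -
  show Z: "orthogonal_transformation Z"
    unfolding Z_def by (rule orth_compose[OF orth_Ad orth_compose[OF orth_Aut[OF tau] orth_Aut[OF kappa]]])
  show "orthogonal_transformation N1F" "orthogonal_transformation N2F"
    unfolding N1F_def N2F_def by (rule orth_compose[OF Z orths(3)], rule orth_compose[OF Z orths(4)])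
qed

sublocale F: double_data th1 th2 M1 N1F M2 N2F
  by (rule double_data.intro[OF th_linbij orths(1) orth_Z(2) orths(2) orth_Z(3)])

text \<open>The left form of a product p q is Ad of the inverse of q applied to the left form of p
  plus the right form of q. This explains U and the sum in \<open>pull_fused\<close>.\<close>

definition "U = (\<lambda>v. Ad G (inv (\<tau> (\<kappa> (Phi2 (x, y))))) v)"
definition "Z' = (\<lambda>v. dK' (dT' (Ad G (inv (\<tau> (\<kappa> (Phi2 (x, y))))) v)))"
definition "C2F = (\<lambda>v. Z (C2 (Z' v)))"

lemma ZZ': "Z (Z' v) = v" "Z' (Z v) = v"
  by (simp_all add: Z_def Z'_def aut_simps)

lemma orth_U: "orthogonal_transformation U" "orthogonal_transformation C2F"
  unfolding U_def C2F_def Z'_def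
  by (rule orth_Ad, rule orth_compose[OF orth_Z(1) orth_compose[OF orth_C(2) orth_compose[OF orth_Aut[OF kappa'] orth_compose[OF orth_Aut[OF tau'] orth_Ad]]]])

lemma sm_tkPhi2: "smooth_map (prod_atlas A0 A0) A0 (\<lambda>z. \<tau> (\<kappa> (Phi2 z)))"
  by (rule sm_aut[OF tau atl2 sm_aut[OF kappa atl2 sm_Phi(2)]])

lemma th_tkPhi2: "pull_thetaL G cc (\<lambda>z. \<tau> (\<kappa> (Phi2 z))) (x, y) = (\<lambda>v. dT (dK (N1 (th1 (fst v)) + N2 (th2 (snd v)))))"
  unfolding pull_thetaL_hom[OF pt sm_aut[OF kappa atl2 sm_Phi(2)] tau] pull_thetaL_hom[OF pt sm_Phi(2) kappa] th_Phi2 ..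

lemma thR_tkPhi2: "pull_thetaR G cc (\<lambda>z. \<tau> (\<kappa> (Phi2 z))) (x, y) = (\<lambda>v. N1F (th1 (fst v)) + N2F (th2 (snd v)))"
  unfolding pull_thetaR[OF pt sm_tkPhi2] th_tkPhi2 by (simp add: N1F_def N2F_def Z_def add_simps)

lemma form_fused: "form (fused_double G \<tau> \<kappa>) cc (x, y) u v = F.form2 u v + F.sig (F.dmom u) (F.dmom v)"
proof -
  have F_inner: "N1F a \<bullet> N2F b = N1 a \<bullet> N2 b" for a b
    by (simp add: NF orth_inner[OF orth_Z(1)])
  have f: "F.form2 = D.form2"
    by (intro HOL.ext) (simp add: F.form2_def D.form2_def F_inner)
  have m: "snd \<circ> (\<lambda>z. (Phi1 z, Phi2 z)) = Phi2" "fst \<circ> (\<lambda>z. (Phi1 z, Phi2 z)) = Phi1" by auto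
  have t: "pull_thetaR G cc (\<tau> \<circ> \<kappa> \<circ> Phi2) (x, y) = (\<lambda>v. N1F (th1 (fst v)) + N2F (th2 (snd v)))"
    using thR_tkPhi2 by (simp add: o_def)
  show ?thesis
    by (simp add: fused_double_def Let_def moment_double m t th_Phi1 form_double f dot_form_def F.sig_def F.dmom_def)
qed

lemma pull_fused: "pull_thetaL G cc (moment (fused_double G \<tau> \<kappa>)) (x, y) v = U (fst (F.dmom v) + snd (F.dmom v))"
proof -
  have uz: "U (Z w) = dT (dK w)" for w by (simp add: U_def Z_def)
  then show ?thesis
    unfolding moment_fused pull_thetaL_mult[OF pt sm_Phi(1) sm_tkPhi2] th_tkPhi2 th_Phi1
    by (simp add: F.dmom_def NF linear_add[OF orth_linear[OF orth_U(1)]] add_simps) (simp add: fun_cong[OF U_def])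
qed

lemma C1F: "C1 (M2 (inv_into UNIV N2F (N1F v))) = M1 v"
proof -
  have "inv_into UNIV N2F (N1F v) = inv_into UNIV N2 (N1 v)"
    using orthogonal_transformation_bij[OF orths(4)]
    by (intro orth_inv_eq[OF orth_Z(3)]) (simp add: N1F_def N2F_def bij_is_surj surj_f_inv_f)
  then show ?thesis using C1 by simp
qed

lemma C2F: "C2F (N2F (inv_into UNIV M2 (M1 v))) = N1F v"
  by (simp add: C2F_def N2F_def N1F_def ZZ' C2)

text \<open>The lift in \<psi> must invert the U-conjugate of \<open>C1\<close> after
  \<open>C2F\<close>. Ad of the second factor of the moment map cancels U, Ad of \<open>Phi1\<close>
  cancels \<open>C1\<close> up to the twists, and after removing Z the remaining factor is handled
  by \<open>C2_inv\<close>.\<close>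

theorem liouville_fused:
  assumes \<T>: "Ad_lift G \<T>" and k: "pin_lift (lie_diff G (\<tau> \<circ> \<kappa> \<circ> \<tau>' \<circ> \<kappa>')) k"
  shows "\<bar>liouville_form G \<T> k (fused_double G \<tau> \<kappa>) cc (x, y)\<bar> = \<bar>bdet th1\<bar> * \<bar>bdet th2\<bar>"
proof -
  let ?m = "moment (fused_double G \<tau> \<kappa>) (x, y)"
  obtain ks where ks: "unitl ks" "k = mv_coeff (pinl ks)" "foldr refl ks = lie_diff G (\<tau> \<circ> \<kappa> \<circ> \<tau>' \<circ> \<kappa>')"
    using pin_lift_reflections[OF k] by blast
  obtain ts where ts: "unitl ts" "\<T> ?m = mv_coeff (pinl ts)" "foldr refl ts = Ad G ?m"
    using \<T> pin_lift_reflections[of "Ad G ?m" "\<T> ?m"] unfolding Ad_lift_def by blast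
  have kk: "lie_diff G (\<tau> \<circ> \<kappa> \<circ> \<tau>' \<circ> \<kappa>') = dT \<circ> dK \<circ> dT' \<circ> dK'"
    by (simp add: lie_diff_Aut_comp lie_Aut_comp tau kappa tau' kappa')
  have skew: "skew_form (form (fused_double G \<tau> \<kappa>) cc (x, y))"
    using skew_form_add[OF F.skew_form2 skew_form_pull[OF F.skew_sig F.linear_dmom]] by (simp flip: form_fused)
  have e: "liouville_form G \<T> k (fused_double G \<tau> \<kappa>) cc (x, y) =
    mv_coeff (exp_pull (form (fused_double G \<tau> \<kappa>) cc (x, y)) (pull_thetaL G cc (moment (fused_double G \<tau> \<kappa>)) (x, y)) (psim (pinl (ks @ ts)))) Basis"
    by (rule liouville_exp_pull) (rule skew ts(2) ks(2))+
  show ?thesis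
    unfolding e
  proof (rule F.fused_top[where ?C1.0 = C1 and ?C2.0 = C2F and U = U])
    show "unitl (ks @ ts)" using ks ts by (auto simp: unitl_def)
    fix v
    let ?g = "\<tau> (\<kappa> (Phi2 (x, y)))"
    have "foldr refl (ks @ ts) (U (C1 (C2F v))) = dT (dK (dT' (dK' (Ad G (Phi1 (x, y)) (Ad G ?g (U (C1 (C2F v))))))))"
      by (simp add: ks(3) ts(3) kk moment_fused Ad_mult)
    also have "Ad G ?g (U (C1 (C2F v))) = C1 (C2F v)" by (simp add: U_def)
    also have "Ad G (Phi1 (x, y)) (C1 (C2F v)) = dK' (dT' (C2F v))"
      using C1_inv[of "C2F v"] by (metis aut_simps(5) aut_simps(7))
    also have "dT' (C2F v) = dK (Ad G (Phi2 (x, y)) (C2 (Z' v)))"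
      unfolding C2F_def Z_def by (simp flip: Ad_simps(1,2) add: aut_simps)
    also have "dT (dK (dT' (dK' (dK' (dK (Ad G (Phi2 (x, y)) (C2 (Z' v)))))))) = dT (dK (Z' v))"
      by (simp add: aut_simps C2_inv)
    also have "\<dots> = U v" by (simp add: Z'_def U_def aut_simps)
    finally show "foldr refl (ks @ ts) (U (C1 (C2F v))) = U v" .
  qed (rule C1F C2F orth_U orth_C form_fused pull_fused)+
qed

end

section \<open>Change of variables\<close>

lemma of_bix_axis: "of_bix (axis i 1) = Rep_bix i"
  by (simp add: of_bix_def axis_def if_distrib[of "\<lambda>r. r *\<^sub>R _"] cong: if_cong)

text \<open>Preimages of boxes are boxes with the same side lengths, and Lebesgue measure is
  determined by boxes.\<close>

lemma lborel_bix: "distr lborel borel of_bix = (lborel :: 'a::euclidean_space measure)"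
proof (rule lborel_eqI[symmetric])
  fix l u :: 'a assume le: "\<And>b. b \<in> Basis \<Longrightarrow> l \<bullet> b \<le> u \<bullet> b"
  have "of_bix -` box l u = box (to_bix l) (to_bix u)"
  proof -
    have "of_bix v \<in> box l u \<longleftrightarrow> (\<forall>i. l \<bullet> Rep_bix i < vec_nth v i \<and> vec_nth v i < u \<bullet> Rep_bix i)" for v
      unfolding mem_box of_bix_inner[symmetric] by (metis Abs_bix_inverse Rep_bix_Basis)
    then show ?thesis by (auto simp: mem_box_cart to_bix_nth)
  qed
  then have "emeasure (distr lborel borel of_bix) (box l u) = emeasure lborel (box (to_bix l) (to_bix u))"
    by (subst emeasure_distr) (auto intro!: borel_measurable_continuous_onI bix_continuous)
  also have "\<dots> = ennreal (\<Prod>b\<in>Basis. (to_bix u - to_bix l) \<bullet> b)"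
    by (rule emeasure_lborel_box) (auto simp: Basis_vec_def inner_axis to_bix_nth le)
  also have "(\<Prod>b\<in>Basis. (to_bix u - to_bix l) \<bullet> b) = (\<Prod>i\<in>UNIV. (u - l) \<bullet> Rep_bix i)"
  proof -
    have "bij_betw (\<lambda>i. axis i (1::real)) (UNIV :: 'a bix set) Basis"
      by (auto simp: bij_betw_def inj_on_def axis_eq_axis Basis_vec_def)
    from prod.reindex_bij_betw[OF this, of "\<lambda>b. (to_bix u - to_bix l) \<bullet> b", symmetric]
    show ?thesis by (simp add: inner_axis to_bix_nth inner_diff_left)
  qed
  also have "\<dots> = (\<Prod>b\<in>Basis. (u - l) \<bullet> b)" by (rule prod_bix)
  finally show "emeasure (distr lborel borel of_bix) (box l u) = ennreal (\<Prod>b\<in>Basis. (u - l) \<bullet> b)" .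
qed simp

lemma det_bix: "Determinants.det (matrix (\<lambda>v. to_bix (A (of_bix v)))) = bdet A"
  unfolding bdet_bmat
  by (subst Determinants.det_transpose[symmetric], rule arg_cong[where f = Determinants.det])
    (simp add: matrix_def Finite_Cartesian_Product.transpose_def of_bix_axis to_bix_nth bmat_def vec_eq_iff)

text \<open>The change of variables theorem speaks of absolutely integrable functions with a given
  integral; for nonnegative functions this is a finite value of the nonnegative integral, which is
  what \<open>density_measure\<close> uses.\<close>

lemma absolutely_integrable_nn_integral:
  fixes h :: "'a::euclidean_space \<Rightarrow> real"
  assumes "\<And>x. x \<in> A \<Longrightarrow> 0 \<le> h x" "(\<lambda>x. h x * indicator A x) \<in> borel_measurable lebesgue"
  shows "h absolutely_integrable_on A \<and> integral A h = b \<longleftrightarrow> 0 \<le> b \<and> (\<integral>\<^sup>+x\<in>A. ennreal (h x) \<partial>lborel) = ennreal b"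
proof -
  have "(\<integral>\<^sup>+x\<in>A. ennreal (h x) \<partial>lborel) = (\<integral>\<^sup>+x. ennreal (h x * indicator A x) \<partial>lebesgue)"
    unfolding nn_integral_completion by (intro nn_integral_cong) (auto simp: indicator_def)
  moreover have "(h has_integral b) A \<longleftrightarrow> ((\<lambda>x. h x * indicator A x) has_integral b) UNIV"
    by (subst has_integral_restrict_UNIV[symmetric], intro has_integral_cong) (simp add: indicator_def)
  moreover have "0 \<le> h x * indicator A x" for x using assms(1) by (simp add: indicator_def)
  ultimately show ?thesis
    using assms by (subst absolutely_integrable_on_iff_nonneg) (auto simp: has_integral_iff_nn_integral_lebesgue simp flip: has_integral_iff)
qed

lemma nn_integral_image_cart:
  fixes f :: "real^'n::{finite,wellorder} \<Rightarrow> real^'n::_"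
  assumes S: "S \<in> sets lebesgue"
    and der: "\<And>x. x \<in> S \<Longrightarrow> (f has_derivative f' x) (at x within S)" and inj: "inj_on f S"
    and w: "\<And>y. y \<in> f ` S \<Longrightarrow> 0 \<le> w y" "(\<lambda>y. w y * indicator (f ` S) y) \<in> borel_measurable lebesgue"
      "(\<lambda>x. (\<bar>Determinants.det (matrix (f' x))\<bar> * w (f x)) * indicator S x) \<in> borel_measurable lebesgue"
  shows "(\<integral>\<^sup>+y\<in>f ` S. ennreal (w y) \<partial>lborel) = (\<integral>\<^sup>+x\<in>S. ennreal (\<bar>Determinants.det (matrix (f' x))\<bar> * w (f x)) \<partial>lborel)"
    (is "?X = ?Y")
proof -
  have "(w absolutely_integrable_on f ` S \<and> integral (f ` S) w = b) \<longleftrightarrow>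
    ((\<lambda>x. \<bar>Determinants.det (matrix (f' x))\<bar> * w (f x)) absolutely_integrable_on S \<and>
      integral S (\<lambda>x. \<bar>Determinants.det (matrix (f' x))\<bar> * w (f x)) = b)" for b
    using has_absolute_integral_change_of_variables[OF S der inj, of "\<lambda>y. vec (w y) :: real^1" "vec b"]
    by (simp add: absolutely_integrable_on_1_iff integral_on_1_eq vec_eq_iff)
  then have b: "0 \<le> b \<and> ?X = ennreal b \<longleftrightarrow> 0 \<le> b \<and> ?Y = ennreal b" for b
    using absolutely_integrable_nn_integral[OF w(1,2)] absolutely_integrable_nn_integral[OF _ w(3)] w(1) by simp
  \<comment> \<open>Infinite values are covered as well: if both sides equal the same finite numbers
    b, then a side that equals none is infinite, and so is the other.\<close>
  have e: "X = Y" if "\<And>b. 0 \<le> b \<and> X = ennreal b \<longleftrightarrow> 0 \<le> b \<and> Y = ennreal b" for X Y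
    using that by (cases X; cases Y) force+
  show ?thesis by (rule e) (rule b)
qed

lemma homeomorphism_image_borel:
  fixes f :: "'a::topological_space \<Rightarrow> 'b::topological_space"
  assumes "homeomorphism S T f g" "open S" "open T" "A \<in> sets borel" "A \<subseteq> S"
  shows "f ` A \<in> sets borel"
proof -
  have "f ` A = g -` A \<inter> T" using assms(1,5) unfolding homeomorphism_def by force
  moreover have "g -` A \<inter> T \<in> sets borel"
  proof -
    have "g \<in> borel_measurable (restrict_space borel T)"
      using assms(1) by (intro borel_measurable_continuous_on_restrict) (auto simp: homeomorphism_def)
    from measurable_sets[OF this assms(4)] have "g -` A \<inter> T \<in> sets (restrict_space borel T)" by (simp add: space_restrict_space)
    then show ?thesis using assms(3) by (subst (asm) sets_restrict_space_iff) auto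
  qed
  ultimately show ?thesis by simp
qed

lemma borel_restrict_continuous:
  fixes h :: "'a::topological_space \<Rightarrow> real"
  assumes "continuous_on S h" "A \<in> sets borel" "A \<subseteq> S"
  shows "(\<lambda>x. h x * indicator A x) \<in> borel_measurable borel"
proof -
  have "h \<in> borel_measurable (restrict_space borel A)"
    using continuous_on_subset[OF assms(1,3)] by (rule borel_measurable_continuous_on_restrict)
  then have "(\<lambda>x. indicator A x *\<^sub>R h x) \<in> borel_measurable borel"
    using assms(2) borel_measurable_restrict_space_iff[of A borel h] by simp
  then show ?thesis by (simp add: mult.commute)
qed

lemma borel_restrict_ennreal:
  fixes h :: "'a::topological_space \<Rightarrow> real"
  assumes "continuous_on S h" "A \<in> sets borel" "A \<subseteq> S"
  shows "(\<lambda>x. ennreal (h x) * indicator A x) \<in> borel_measurable borel"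
proof -
  have "(\<lambda>x. ennreal (h x * indicator A x)) \<in> borel_measurable borel"
    using borel_restrict_continuous[OF assms] by measurable
  also have "(\<lambda>x. ennreal (h x * indicator A x)) = (\<lambda>x. ennreal (h x) * indicator A x)"
    by (auto simp: indicator_def)
  finally show ?thesis .
qed

text \<open>Conjugation with \<open>of_bix\<close> moves everything to \<open>real ^ 'n\<close>; it
  preserves Lebesgue measure, and the Jacobian turns into \<open>bdet\<close> by
  \<open>det_bix\<close>.\<close>

theorem nn_integral_diffeo_image:
  fixes f :: "'a::euclidean_space \<Rightarrow> 'a"
  assumes hom: "homeomorphism S T f g" and S: "open S" and T: "open T"
    and A: "A \<in> sets borel" "A \<subseteq> S"
    and der: "\<And>x. x \<in> S \<Longrightarrow> (f has_derivative f' x) (at x)"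
    and cont: "continuous_on S (\<lambda>x. \<bar>bdet (f' x)\<bar>)" and w: "continuous_on T w" "\<And>y. y \<in> T \<Longrightarrow> 0 \<le> w y"
  shows "(\<integral>\<^sup>+y\<in>f ` A. ennreal (w y) \<partial>lborel) = (\<integral>\<^sup>+x\<in>A. ennreal (\<bar>bdet (f' x)\<bar> * w (f x)) \<partial>lborel)"
proof -
  define F where "F v = to_bix (f (of_bix v))" for v
  define F' where "F' v = (\<lambda>w. to_bix (f' (of_bix v) (of_bix w)))" for v
  define A' where "A' = of_bix -` A"
  have fA: "f ` A \<in> sets borel" "f ` A \<subseteq> T" using homeomorphism_image_borel[OF hom S T A] hom A(2) by (auto simp: homeomorphism_def)
  have inj: "inj_on f A" using hom A(2) unfolding homeomorphism_def by (intro inj_on_inverseI[where g = g]) blast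
  have ofm: "of_bix \<in> borel_measurable borel" by (intro borel_measurable_continuous_onI bix_continuous)
  have im: "F ` A' = of_bix -` (f ` A)"
  proof (intro Set.set_eqI iffI)
    fix v assume "v \<in> of_bix -` (f ` A)"
    then obtain x where "x \<in> A" "of_bix v = f x" by auto
    then have "v = F (to_bix x)" "to_bix x \<in> A'" using bix_inverse(2)[of v] by (simp_all add: F_def A'_def)
    then show "v \<in> F ` A'" by blast
  qed (auto simp: F_def A'_def)
  have D: "Determinants.det (matrix (F' v)) = bdet (f' (of_bix v))" for v
    unfolding F'_def by (rule det_bix)
  have bl: "bounded_linear of_bix" "bounded_linear to_bix" using linear_bix by (simp_all add: linear_conv_bounded_linear)
  have derF: "(F has_derivative F' v) (at v within A')" if v: "v \<in> A'" for v
  proof -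
    have "(f has_derivative f' (of_bix v)) (at (of_bix v))" using v A(2) der by (auto simp: A'_def)
    from has_derivative_compose[OF bounded_linear_imp_has_derivative[OF bl(1)] this]
    have "((\<lambda>v. f (of_bix v)) has_derivative (\<lambda>w. f' (of_bix v) (of_bix w))) (at v)" .
    from bounded_linear.has_derivative[OF bl(2) this] show ?thesis
      unfolding F_def F'_def by (rule has_derivative_at_withinI)
  qed
  have cf: "continuous_on S (\<lambda>x. \<bar>bdet (f' x)\<bar> * w (f x))"
    using hom by (intro continuous_intros cont continuous_on_compose2[OF w(1)]) (auto simp: homeomorphism_def)
  have F: "of_bix (F v) = f (of_bix v)" for v by (simp add: F_def)
  have "(\<integral>\<^sup>+y\<in>f ` A. ennreal (w y) \<partial>lborel) = (\<integral>\<^sup>+y\<in>f ` A. ennreal (w y) \<partial>distr lborel borel of_bix)" by (simp only: lborel_bix)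
  also have "\<dots> = (\<integral>\<^sup>+v\<in>F ` A'. ennreal (w (of_bix v)) \<partial>lborel)"
    using ofm borel_restrict_ennreal[OF w(1) fA] by (subst nn_integral_distr) (auto simp: im indicator_vimage)
  also have "\<dots> = (\<integral>\<^sup>+v\<in>A'. ennreal (\<bar>Determinants.det (matrix (F' v))\<bar> * w (of_bix (F v))) \<partial>lborel)"
  proof (rule nn_integral_image_cart[OF _ derF])
    show "A' \<in> sets lebesgue" using measurable_sets[OF ofm A(1)] by (simp add: A'_def sets_completionI_sets)
    show "inj_on F A'" using inj unfolding F_def A'_def inj_on_def by (metis bix_inverse vimage_eq)
    show "0 \<le> w (of_bix v)" if "v \<in> F ` A'" for v using that w(2) fA(2) by (auto simp: im)
    show "(\<lambda>v. w (of_bix v) * indicator (F ` A') v) \<in> borel_measurable lebesgue"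
      using measurable_compose[OF ofm borel_restrict_continuous[OF w(1) fA]] by (simp add: im indicator_vimage o_def measurable_completion)
    show "(\<lambda>v. (\<bar>Determinants.det (matrix (F' v))\<bar> * w (of_bix (F v))) * indicator A' v) \<in> borel_measurable lebesgue"
      using measurable_compose[OF ofm borel_restrict_continuous[OF cf A]] by (simp add: D F A'_def indicator_vimage o_def measurable_completion)
  qed
  also have "\<dots> = (\<integral>\<^sup>+x\<in>A. ennreal (\<bar>bdet (f' x)\<bar> * w (f x)) \<partial>distr lborel borel of_bix)"
    using ofm borel_restrict_ennreal[OF cf A] by (subst nn_integral_distr) (auto simp: D F A'_def indicator_vimage)
  finally show ?thesis by (simp only: lborel_bix)
qed

section \<open>Measures of densities\<close>

text \<open>By Lindelof, countably many of the open sets cover the space. Made disjoint, they cut E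
  into countably many pieces on which the measures agree.\<close>

lemma measure_eq_local:
  fixes M N :: "'m::second_countable_topology measure"
  assumes sM: "sets M = sets borel" and sN: "sets N = sets borel"
    and loc: "\<And>p. \<exists>U. open U \<and> p \<in> U \<and> (\<forall>E\<in>sets borel. E \<subseteq> U \<longrightarrow> emeasure M E = emeasure N E)"
  shows "M = N"
proof (rule measure_eqI)
  show "sets M = sets N" using sM sN by simp
  fix E assume "E \<in> sets M"
  then have E: "E \<in> sets borel" using sM by simp
  obtain U where U: "\<And>p. open (U p)" "\<And>p. p \<in> U p" "\<And>p E. E \<in> sets borel \<Longrightarrow> E \<subseteq> U p \<Longrightarrow> emeasure M E = emeasure N E"
    using loc by metis
  obtain F' where F': "F' \<subseteq> range U" "countable F'" "\<Union>F' = \<Union>(range U)"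
    using Lindelof[of "range U"] U(1) by auto
  define V where "V = from_nat_into F'"
  have ne: "F' \<noteq> {}" using F'(3) U(2) by auto
  have V: "\<exists>p. V n = U p" for n using from_nat_into[OF ne] F'(1) unfolding V_def by blast
  have "range V = F'" unfolding V_def by (rule range_from_nat_into[OF ne F'(2)])
  then have "(\<Union>n. V n) = \<Union>F'" by simp
  moreover have "\<Union>(range U) = UNIV" using U(2) by (intro equalityI subsetI UNIV_I UN_I[OF UNIV_I])
  ultimately have cov: "(\<Union>n. V n) = UNIV" using F'(3) by simp
  have Vb: "V n \<in> sets borel" for n using V[of n] U(1) by auto
  let ?D = "\<lambda>n. disjointed V n \<inter> E"
  have D: "?D n \<in> sets borel" for n using sets.range_disjointed_sets[of V borel] Vb E by (intro sets.Int) auto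
  have dis: "disjoint_family ?D" using disjoint_family_disjointed[of V] by (auto simp: disjoint_family_on_def)
  have un: "(\<Union>n. ?D n) = E" using cov UN_disjointed_eq[of V] by (simp flip: UN_extend_simps(4))
  have "emeasure M (?D n) = emeasure N (?D n)" for n
    using V[of n] disjointed_subset[of V n] D[of n] U(3) by (metis le_infI1)
  then have "(\<Sum>n. emeasure M (?D n)) = (\<Sum>n. emeasure N (?D n))" by simp
  moreover have "(\<Sum>n. emeasure M (?D n)) = emeasure M E"
    using suminf_emeasure[of ?D M] D dis by (simp only: sM un image_subset_iff UNIV_I simp_thms ball_simps)
  moreover have "(\<Sum>n. emeasure N (?D n)) = emeasure N E"
    using suminf_emeasure[of ?D N] D dis by (simp only: sN un image_subset_iff UNIV_I simp_thms ball_simps)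
  ultimately show "emeasure M E = emeasure N E" by simp
qed

lemma chart_homeo:
  assumes "smooth_atlas A" "c \<in> A"
  shows "homeomorphism (fst c) (snd c ` fst c) (snd c) (chart_inv c)"
  using assms by (auto simp: smooth_atlas_def)

lemma chart_image_borel:
  assumes "smooth_atlas A" "c \<in> A" "E \<in> sets borel" "E \<subseteq> fst c"
  shows "snd c ` E \<in> sets borel"
  using homeomorphism_image_borel[OF chart_homeo[OF assms(1,2)] atlas_chart(1,2)[OF assms(1,2)] assms(3,4)] .

context
  fixes A \<delta> and \<mu> :: "'m::topological_space measure" and c :: "('m, 'a::euclidean_space) chart"
  assumes \<mu>: "density_measure A \<delta> \<mu>" and A: "smooth_atlas A" and c: "c \<in> A"
    and cont: "continuous_on (snd c ` fst c) (\<lambda>u. \<delta> c (chart_inv c u))"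
begin

text \<open>The measure on a chart domain is a push-forward of a density for Lebesgue measure. The
  map q extends the inverse chart by a constant value, so that it is Borel on the whole coordinate
  space.\<close>

lemma density_measure_chart:
  defines "q \<equiv> \<lambda>u. if u \<in> snd c ` fst c then chart_inv c u else undefined"
  shows "q \<in> borel_measurable borel"
    "(\<lambda>u. ennreal (\<delta> c (chart_inv c u)) * indicator (snd c ` fst c) u) \<in> borel_measurable lborel"
    "density \<mu> (indicator (fst c)) = distr (density lborel (\<lambda>u. ennreal (\<delta> c (chart_inv c u)) * indicator (snd c ` fst c) u)) borel q"
proof -
  note ch = atlas_chart[OF A c]
  let ?I = "snd c ` fst c"
  let ?d = "\<lambda>u. ennreal (\<delta> c (chart_inv c u)) * indicator ?I u"
  have sm: "sets \<mu> = sets borel" using \<mu> by (simp add: density_measure_def)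
  show q: "q \<in> borel_measurable borel"
    unfolding q_def using ch(2)
    by (intro measurable_If_restrict_space_iff[THEN iffD2]) (auto intro!: borel_measurable_continuous_on_restrict ch(5))
  show d: "?d \<in> borel_measurable lborel" using borel_restrict_ennreal[OF cont, of ?I] ch(2) by simp
  have fc: "fst c \<in> sets borel" using ch(1) by simp
  show "density \<mu> (indicator (fst c)) = distr (density lborel ?d) borel q"
  proof (rule measure_eqI)
    fix B assume "B \<in> sets (density \<mu> (indicator (fst c)))"
    then have B: "B \<in> sets borel" by (simp add: sm)
    have im: "snd c ` (fst c \<inter> B) = ?I \<inter> q -` B" using ch(6,7) by (force simp: q_def)
    have "emeasure (density \<mu> (indicator (fst c))) B = emeasure \<mu> (fst c \<inter> B)"
      using fc B sm by (subst emeasure_density) (auto simp: indicator_inter_arith[symmetric])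
    also have "\<dots> = (\<integral>\<^sup>+u\<in>snd c ` (fst c \<inter> B). ennreal (\<delta> c (chart_inv c u)) \<partial>lborel)"
      using \<mu> c fc B unfolding density_measure_def by blast
    also have "\<dots> = (\<integral>\<^sup>+u. ?d u * indicator (q -` B) u \<partial>lborel)"
      unfolding im by (intro nn_integral_cong) (auto simp: indicator_def)
    also have "\<dots> = emeasure (distr (density lborel ?d) borel q) B"
      using q B d measurable_sets[OF q B] by (subst emeasure_distr) (auto simp: emeasure_density)
    finally show "emeasure (density \<mu> (indicator (fst c))) B = emeasure (distr (density lborel ?d) borel q) B" .
  qed (simp add: sm)
qed

lemma measurable_density_measure:
  "F \<in> borel_measurable borel \<Longrightarrow> F \<in> borel_measurable \<mu>"
  using measurable_cong_sets[of \<mu> borel borel borel] \<mu> unfolding density_measure_def by blast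

lemma measurable_chart_domain:
  "(indicator (fst c) :: _ \<Rightarrow> ennreal) \<in> borel_measurable \<mu>" "(indicator (fst c) :: _ \<Rightarrow> real) \<in> borel_measurable \<mu>"
  by (rule measurable_density_measure borel_measurable_indicator borel_open atlas_chart(1)[OF A c])+

lemma integral_density_measure:
  fixes F :: "'m \<Rightarrow> 'b::{banach, second_countable_topology}"
  assumes F: "F \<in> borel_measurable borel" and 0: "\<And>p. p \<notin> fst c \<Longrightarrow> F p = 0"
    and nn: "\<And>p. p \<in> fst c \<Longrightarrow> 0 \<le> \<delta> c p"
  shows "(\<integral>p. F p \<partial>\<mu>) = (\<integral>u. indicator (snd c ` fst c) u *\<^sub>R (\<delta> c (chart_inv c u) *\<^sub>R F (chart_inv c u)) \<partial>lborel)"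
proof -
  let ?I = "snd c ` fst c"
  note q = density_measure_chart(1) and eq = density_measure_chart(3)
  have d: "(\<lambda>u. \<delta> c (chart_inv c u) * indicator ?I u) \<in> borel_measurable lborel"
    using borel_restrict_continuous[OF cont] atlas_chart(2)[OF A c] by simp
  have dd: "(\<lambda>u. ennreal (\<delta> c (chart_inv c u)) * indicator ?I u) = (\<lambda>u. ennreal (\<delta> c (chart_inv c u) * indicator ?I u))"
    by (auto simp: indicator_def)
  have pos: "0 \<le> \<delta> c (chart_inv c u) * indicator ?I u" for u
    using nn[OF atlas_chart(7)[OF A c]] by (auto simp: indicator_def)
  have "(\<integral>p. F p \<partial>\<mu>) = (\<integral>p. indicator (fst c) p *\<^sub>R F p \<partial>\<mu>)"
    by (intro Bochner_Integration.integral_cong) (auto simp: indicator_def 0)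
  also have "\<dots> = (\<integral>p. F p \<partial>density \<mu> (\<lambda>p. ennreal (indicator (fst c) p)))"
    by (intro integral_density[symmetric] measurable_density_measure F measurable_chart_domain) simp
  also have "\<dots> = (\<integral>p. F p \<partial>density \<mu> (indicator (fst c)))" by (simp add: ennreal_indicator)
  also have "\<dots> = (\<integral>u. (\<delta> c (chart_inv c u) * indicator ?I u) *\<^sub>R F (if u \<in> ?I then chart_inv c u else undefined) \<partial>lborel)"
    unfolding eq dd using d measurable_compose[OF q F] q F pos
    by (simp add: integral_distr integral_density)
  also have "\<dots> = (\<integral>u. indicator ?I u *\<^sub>R (\<delta> c (chart_inv c u) *\<^sub>R F (chart_inv c u)) \<partial>lborel)"
    by (intro Bochner_Integration.integral_cong) (auto simp: indicator_def)
  finally show ?thesis .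
qed

end

text \<open>Each point has a neighbourhood of finite measure, the preimage of a ball in whose
  closure the continuous density is bounded; by compactness finitely many suffice.\<close>

lemma density_measure_finite:
  fixes \<mu> :: "'m::t2_space measure"
  assumes \<mu>: "density_measure A \<delta> \<mu>" and A: "smooth_atlas A" and K: "compact (UNIV :: 'm set)"
    and cont: "\<And>c. c \<in> A \<Longrightarrow> continuous_on (snd c ` fst c) (\<lambda>u. \<delta> c (chart_inv c u))"
  shows "finite_measure \<mu>"
proof
  have sm: "sets \<mu> = sets borel" using \<mu> by (simp add: density_measure_def)
  have spm: "space \<mu> = UNIV" using sets_eq_imp_space_eq[OF sm] by simp
  have "\<exists>U. open U \<and> p \<in> U \<and> emeasure \<mu> U < \<infinity>" for p
  proof -
    obtain c where c: "c \<in> A" "p \<in> fst c" using atlas_cover[OF A] by blast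
    note ch = atlas_chart[OF A c(1)]
    obtain r where r: "r > 0" "cball (snd c p) r \<subseteq> snd c ` fst c"
      using ch(2) c(2) open_contains_cball by blast
    let ?B = "ball (snd c p) r"
    have B: "?B \<subseteq> snd c ` fst c" using r by (meson ball_subset_cball subset_trans)
    define U where "U = fst c \<inter> snd c -` ?B"
    have oU: "open U" unfolding U_def by (rule continuous_open_preimage[OF ch(4,1)]) simp
    have "bounded ((\<lambda>u. \<delta> c (chart_inv c u)) ` cball (snd c p) r)"
      by (intro compact_imp_bounded compact_continuous_image continuous_on_subset[OF cont[OF c(1)] r(2)]) simp
    then obtain b where b: "\<And>u. u \<in> cball (snd c p) r \<Longrightarrow> \<bar>\<delta> c (chart_inv c u)\<bar> \<le> b"
      unfolding bounded_iff by (metis imageI real_norm_def)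
    have im: "snd c ` U = ?B" unfolding U_def using B by auto
    have "emeasure \<mu> U = (\<integral>\<^sup>+u\<in>?B. ennreal (\<delta> c (chart_inv c u)) \<partial>lborel)"
      using \<mu> c(1) oU im unfolding density_measure_def U_def by (metis borel_open Int_lower1)
    also have "\<dots> \<le> (\<integral>\<^sup>+u. ennreal b * indicator ?B u \<partial>lborel)"
    proof (intro nn_integral_mono)
      fix u
      have "ennreal (\<delta> c (chart_inv c u)) \<le> ennreal b" if "u \<in> ?B"
        using b[of u] that by (intro ennreal_leI) auto
      then show "ennreal (\<delta> c (chart_inv c u)) * indicator ?B u \<le> ennreal b * indicator ?B u"
        by (auto simp: indicator_def)
    qed
    also have "\<dots> = ennreal b * emeasure lborel ?B" by (intro nn_integral_cmult_indicator) simp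
    also have "\<dots> < \<infinity>" using emeasure_bounded_finite[OF bounded_ball, of "snd c p" r] by (simp add: ennreal_mult_less_top)
    finally show ?thesis using oU c(2) r(1) by (auto simp: U_def)
  qed
  then obtain U where U: "\<And>p. open (U p)" "\<And>p. p \<in> U p" "\<And>p. emeasure \<mu> (U p) < \<infinity>" by metis
  obtain D where D: "finite D" "UNIV \<subseteq> (\<Union>p\<in>D. U p)"
    using compactE_image[OF K, of UNIV U] U by (metis UNIV_I UN_I subsetI)
  have "emeasure \<mu> (space \<mu>) \<le> emeasure \<mu> (\<Union>p\<in>D. U p)"
    using D U(1) by (intro emeasure_mono) (auto simp: sm intro!: borel_open)
  also have "\<dots> \<le> (\<Sum>p\<in>D. emeasure \<mu> (U p))"
    using D U(1) by (intro emeasure_subadditive_finite) (auto simp: sm)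
  also have "\<dots> < \<infinity>" using D(1) U(3) by (simp add: less_top[symmetric])
  finally show "emeasure \<mu> (space \<mu>) \<noteq> \<infinity>" by simp
qed

text \<open>On a product chart both measures have the same coordinate density, and measures are
  determined locally. Finiteness of m provides the sigma-finiteness used when products of densities
  are formed.\<close>

lemma density_measure_prod:
  fixes m :: "'m::second_countable_topology measure"
  assumes m: "density_measure A \<delta> m" and A: "smooth_atlas A" and fin: "finite_measure m"
    and cont: "\<And>c. c \<in> A \<Longrightarrow> continuous_on (snd c ` fst c) (\<lambda>u. \<delta> c (chart_inv c u))"
    and nn: "\<And>c p. c \<in> A \<Longrightarrow> p \<in> fst c \<Longrightarrow> 0 \<le> \<delta> c p"
    and \<mu>: "density_measure (prod_atlas A A) \<epsilon> \<mu>"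
    and prod: "\<And>c d x y. c \<in> A \<Longrightarrow> d \<in> A \<Longrightarrow> x \<in> fst c \<Longrightarrow> y \<in> fst d \<Longrightarrow> \<epsilon> (prod_chart c d) (x, y) = \<delta> c x * \<delta> d y"
  shows "\<mu> = m \<Otimes>\<^sub>M m"
proof (rule measure_eq_local)
  have sm: "sets m = sets borel" using m by (simp add: density_measure_def)
  interpret finite_measure m by fact
  show "sets \<mu> = sets borel" using \<mu> by (simp add: density_measure_def)
  show s2: "sets (m \<Otimes>\<^sub>M m) = sets borel"
    using sets_pair_measure_cong[OF sm sm] borel_prod by metis
  define w q where "w c u = ennreal (\<delta> c (chart_inv c u)) * indicator (snd c ` fst c) u"
    and "q c u = (if u \<in> snd c ` fst c then chart_inv c u else undefined)" for c u
  have chart: "q c \<in> borel_measurable borel" "w c \<in> borel_measurable lborel"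
    "density m (indicator (fst c)) = distr (density lborel (w c)) borel (q c)" if "c \<in> A" for c
    using density_measure_chart[OF m A that cont[OF that]] unfolding w_def[abs_def] q_def[abs_def] by auto
  have ind: "(indicator (fst c) :: _ \<Rightarrow> ennreal) \<in> borel_measurable m" if "c \<in> A" for c
    by (rule measurable_chart_domain[OF m A that cont[OF that]])
  have sf: "sigma_finite_measure (density m (indicator (fst c)))" "sigma_finite_measure (density lborel (w c))" if c: "c \<in> A" for c
  proof -
    have "emeasure (density m (indicator (fst c))) UNIV = emeasure m (fst c)"
      using emeasure_restricted[of "fst c" m UNIV] atlas_chart(1)[OF A c] sm by simp
    then have fin: "emeasure (density m (indicator (fst c))) UNIV \<noteq> \<infinity>" by simp
    have "emeasure (density m (indicator (fst c))) UNIV = emeasure (density lborel (w c)) UNIV"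
      unfolding chart(3)[OF c] using chart(1)[OF c] by (subst emeasure_distr) auto
    with fin have fin': "emeasure (density lborel (w c)) UNIV \<noteq> \<infinity>" by simp
    interpret F: finite_measure "density m (indicator (fst c))"
      by (rule finite_measureI) (use fin sets_eq_imp_space_eq[OF sm] in simp)
    interpret F': finite_measure "density lborel (w c)" by (rule finite_measureI) (use fin' in simp)
    show "sigma_finite_measure (density m (indicator (fst c)))" "sigma_finite_measure (density lborel (w c))"
      by (rule F.sigma_finite_measure_axioms F'.sigma_finite_measure_axioms)+
  qed
  fix p :: "'m \<times> 'm"
  obtain c d where c: "c \<in> A" "fst p \<in> fst c" and d: "d \<in> A" "snd p \<in> fst d" using atlas_cover[OF A] by metis
  note cc = atlas_chart[OF A c(1)] and dd = atlas_chart[OF A d(1)]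
  let ?q = "prod_chart c d" and ?Q = "\<lambda>(u, v). (q c u, q d v)"
  have qA: "?q \<in> prod_atlas A A" using c d unfolding prod_atlas_def by blast
  note AA = smooth_atlas_prod[OF A A]
  have "emeasure \<mu> E = emeasure (m \<Otimes>\<^sub>M m) E" if E: "E \<in> sets borel" "E \<subseteq> fst c \<times> fst d" for E
  proof -
    have Eb: "E \<in> sets (borel \<Otimes>\<^sub>M borel)" using E(1) by (simp only: borel_prod)
    have "density (m \<Otimes>\<^sub>M m) (\<lambda>(x, y). indicator (fst c) x * indicator (fst d) y) =
      density m (indicator (fst c)) \<Otimes>\<^sub>M density m (indicator (fst d))"
      using ind c d sf sigma_finite_measure_axioms by (intro pair_measure_density[symmetric]) auto
    also have "\<dots> = distr (density lborel (w c) \<Otimes>\<^sub>M density lborel (w d)) (borel \<Otimes>\<^sub>M borel) ?Q"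
      unfolding chart(3)[OF c(1)] chart(3)[OF d(1)]
      using chart c d sf(1)[OF d(1)] by (intro pair_measure_distr) auto
    also have "density lborel (w c) \<Otimes>\<^sub>M density lborel (w d) = density lborel (\<lambda>(u, v). w c u * w d v)"
      unfolding lborel_prod[symmetric] using chart c d sf lborel.sigma_finite_measure_axioms by (intro pair_measure_density) auto
    finally have eq: "density (m \<Otimes>\<^sub>M m) (\<lambda>(x, y). indicator (fst c) x * indicator (fst d) y) =
      distr (density lborel (\<lambda>(u, v). w c u * w d v)) (borel \<Otimes>\<^sub>M borel) ?Q" .
    have wm: "(\<lambda>(u, v). w c u * w d v) \<in> borel_measurable lborel" unfolding lborel_prod[symmetric] using chart c d by measurable
    have Qm: "?Q \<in> density lborel (\<lambda>(u, v). w c u * w d v) \<rightarrow>\<^sub>M borel \<Otimes>\<^sub>M borel"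
      using chart c d by (simp add: measurable_lborel1 flip: borel_prod)
    have "emeasure (m \<Otimes>\<^sub>M m) E = emeasure (density (m \<Otimes>\<^sub>M m) (\<lambda>(x, y). indicator (fst c) x * indicator (fst d) y)) E"
    proof -
      have "(\<lambda>(x, y). indicator (fst c) x * indicator (fst d) y :: ennreal) = indicator (fst c \<times> fst d)"
        by (auto simp: indicator_def)
      moreover have "fst c \<times> fst d \<in> sets (m \<Otimes>\<^sub>M m)" using cc(1) dd(1) sm by (intro pair_measureI) auto
      ultimately show ?thesis
        using emeasure_restricted[of "fst c \<times> fst d" "m \<Otimes>\<^sub>M m" E] E s2 by (simp add: Int_absorb1)
    qed
    also have "\<dots> = emeasure (density lborel (\<lambda>(u, v). w c u * w d v)) (?Q -` E)"
      unfolding eq using Qm Eb by (subst emeasure_distr) auto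
    also have "\<dots> = (\<integral>\<^sup>+z. (case z of (u, v) \<Rightarrow> w c u * w d v) * indicator (?Q -` E) z \<partial>lborel)"
      using wm measurable_sets[OF Qm Eb] by (subst emeasure_density) auto
    also have "\<dots> = (\<integral>\<^sup>+z\<in>snd ?q ` E. ennreal (\<epsilon> ?q (chart_inv ?q z)) \<partial>lborel)"
    proof (rule nn_integral_cong)
      fix z :: "'a \<times> 'a"
      obtain u v where z: "z = (u, v)" by fastforce
      have im: "z \<in> snd ?q ` E \<longleftrightarrow> (u \<in> snd c ` fst c \<and> v \<in> snd d ` fst d) \<and> (chart_inv c u, chart_inv d v) \<in> E"
        using chart_image_mem[OF AA qA, of z E] E(2) prod_atlas_charts[OF A A c(1) d(1), of u v]
        by (cases "u \<in> snd c ` fst c \<and> v \<in> snd d ` fst d") (auto simp: z prod_chart_image Int_absorb1)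
      show "(case z of (u, v) \<Rightarrow> w c u * w d v) * indicator (?Q -` E) z = ennreal (\<epsilon> ?q (chart_inv ?q z)) * indicator (snd ?q ` E) z"
      proof (cases "u \<in> snd c ` fst c \<and> v \<in> snd d ` fst d")
        case True
        then show ?thesis
          using cc(7)[of u] dd(7)[of v]
          by (simp only: indicator_def im) (simp add: z w_def q_def prod_atlas_charts[OF A A c(1) d(1)] prod[OF c(1) d(1)] ennreal_mult nn c d)
      next
        case False
        then show ?thesis by (simp only: indicator_def im) (auto simp: z w_def)
      qed
    qed
    also have "\<dots> = emeasure \<mu> E" using \<mu> qA E unfolding density_measure_def by simp
    finally show ?thesis by simp
  qed
  then show "\<exists>U. open U \<and> p \<in> U \<and> (\<forall>E\<in>sets borel. E \<subseteq> U \<longrightarrow> emeasure \<mu> E = emeasure (m \<Otimes>\<^sub>M m) E)"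
    using cc(1) dd(1) c d by (intro exI[of _ "fst c \<times> fst d"]) (auto intro: open_Times simp: mem_Times_iff)
qed

section \<open>The Riemannian measure of the group\<close>

definition (in liegroup) weight :: "('g, 'e) chart \<Rightarrow> 'g \<Rightarrow> real" where
  "weight c p = sqrt (basis_det (\<lambda>u v. pull_thetaL G c id p u \<bullet> pull_thetaL G c id p v))"

context liegroup begin

lemma theta_id: "c \<in> A0 \<Longrightarrow> p \<in> fst c \<Longrightarrow> cder (\<lambda>u. inv p \<otimes> chart_inv c u) (snd c p) (pull_thetaL G c id p)"
  using pull_thetaL_cder[OF atl, of id c p] sm_id by (simp add: id_def)

lemma weight_eq: "c \<in> A0 \<Longrightarrow> p \<in> fst c \<Longrightarrow> weight c p = \<bar>bdet (pull_thetaL G c id p)\<bar>"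
  unfolding weight_def using basis_det_gram[OF cder_linear[OF theta_id]] by simp

text \<open>In coordinates f becomes one function H, smooth on an open set. A derivative in the
  second variable, with the first as a parameter, is then a value of the derivative of H and so
  depends smoothly on the parameter. Forms, Ad and the smoothing kernel are all treated this
  way.\<close>

lemma two_variable_chart:
  assumes sm: "smooth_map (prod_atlas A0 A0) A0 (\<lambda>z. f (fst z) (snd z))" and c: "c \<in> A0" and d: "d \<in> A0"
  obtains \<Omega> H where "open \<Omega>" "smooth_on \<Omega> H"
    "\<And>u v. (u, v) \<in> \<Omega> \<longleftrightarrow> u \<in> snd c ` fst c \<and> v \<in> snd d ` fst d \<and> f (chart_inv c u) (chart_inv d v) \<in> fst (unit_chart G)"
    "\<And>u v. (u, v) \<in> \<Omega> \<Longrightarrow> H (u, v) = uc (f (chart_inv c u) (chart_inv d v))"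
    "\<And>u v. (u, v) \<in> \<Omega> \<Longrightarrow>
      frechet_derivative (\<lambda>w. uc (f (chart_inv c u) (chart_inv d w))) (at v) = (\<lambda>w. frechet_derivative H (at (u, v)) (0, w))"
proof -
  let ?q = "prod_chart c d" and ?f = "\<lambda>z. f (fst z) (snd z)" and ?I = "snd c ` fst c" and ?J = "snd d ` fst d"
  have q: "?q \<in> prod_atlas A0 A0" using c d unfolding prod_atlas_def by blast
  define \<Omega> where "\<Omega> = snd ?q ` (fst ?q \<inter> ?f -` fst (unit_chart G))"
  define H where "H z = uc (?f (chart_inv ?q z))" for z
  have o: "open \<Omega>" unfolding \<Omega>_def
    by (rule chart_image_open[OF atl2 q open_vimage[OF unit_chart_facts(1) smooth_mapD(1)[OF sm]]])
  have sH: "smooth_on \<Omega> H" unfolding H_def \<Omega>_def by (rule smooth_mapD(2)[OF sm q uca])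
  note qi = prod_atlas_charts[OF atl atl c d]
  have mem: "(u, v) \<in> \<Omega> \<longleftrightarrow> u \<in> ?I \<and> v \<in> ?J \<and> f (chart_inv c u) (chart_inv d v) \<in> fst (unit_chart G)" for u v
    unfolding \<Omega>_def chart_image_mem[OF atl2 q] using qi by (auto simp: prod_chart_image)
  have H: "H (u, v) = uc (f (chart_inv c u) (chart_inv d v))" if "(u, v) \<in> \<Omega>" for u v
    using that qi unfolding mem by (simp add: H_def)
  have "frechet_derivative (\<lambda>w. uc (f (chart_inv c u) (chart_inv d w))) (at v) = (\<lambda>w. frechet_derivative H (at (u, v)) (0, w))"
    if uv: "(u, v) \<in> \<Omega>" for u v
  proof (rule frechet_eq, rule has_derivative_transform_within_open)
    have "((\<lambda>w. (u, w)) has_derivative (\<lambda>w. (0, w))) (at v)" by (auto intro!: derivative_eq_intros)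
    from has_derivative_compose[OF this smooth_on_D[OF o sH uv]]
    show "((\<lambda>w. H (u, w)) has_derivative (\<lambda>w. frechet_derivative H (at (u, v)) (0, w))) (at v)" .
    show "open ((\<lambda>w. (u, w)) -` \<Omega>)" by (rule open_vimage[OF o]) (intro continuous_intros)
  qed (use uv H in auto)
  then show thesis using that[OF o sH mem H] by blast
qed

text \<open>The base point occurs both as the parameter of the translated map and as the point of
  differentiation, so the derivative of H is evaluated on the diagonal.\<close>

lemma continuous_theta:
  assumes c: "c \<in> A0"
  shows "continuous_on (snd c ` fst c) (\<lambda>u. pull_thetaL G c id (chart_inv c u) v)"
proof -
  have sm: "smooth_map (prod_atlas A0 A0) A0 (\<lambda>z. inv (fst z) \<otimes> snd z)" by (intro sm_mult sm_inv atl2 smooth_map_fst[OF atl atl])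
  obtain \<Omega> H where H: "open \<Omega>" "smooth_on \<Omega> H"
    "\<And>u v. (u, v) \<in> \<Omega> \<longleftrightarrow> u \<in> snd c ` fst c \<and> v \<in> snd c ` fst c \<and> inv (chart_inv c u) \<otimes> chart_inv c v \<in> fst (unit_chart G)"
    "\<And>u v. (u, v) \<in> \<Omega> \<Longrightarrow>
      frechet_derivative (\<lambda>w. uc (inv (chart_inv c u) \<otimes> chart_inv c w)) (at v) = (\<lambda>w. frechet_derivative H (at (u, v)) (0, w))"
    by (rule two_variable_chart[OF sm c c]) blast
  have diag: "(u, u) \<in> \<Omega>" if "u \<in> snd c ` fst c" for u using that by (simp add: H(3) one_uc)
  have "continuous_on (snd c ` fst c) (\<lambda>u. frechet_derivative H (at (u, u)) (0, v))"
    by (rule continuous_on_compose2[OF smooth_on_continuous[OF smooth_on_deriv[OF H(1,2)]]])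
      (intro continuous_intros, use diag in blast)
  then show ?thesis
    by (rule continuous_on_eq) (simp add: pull_thetaL_def H(4)[OF diag] atlas_chart(8)[OF atl c])
qed

lemma continuous_bdet:
  fixes A :: "'x::topological_space \<Rightarrow> 'c::euclidean_space \<Rightarrow> 'c"
  assumes "\<And>v. continuous_on S (\<lambda>x. A x v)"
  shows "continuous_on S (\<lambda>x. bdet (A x))"
  unfolding bdet_def basis_det_def by (intro continuous_intros assms)

lemma continuous_weight:
  assumes c: "c \<in> A0"
  shows "continuous_on (snd c ` fst c) (\<lambda>u. weight c (chart_inv c u))"
proof -
  have "continuous_on (snd c ` fst c) (\<lambda>u. \<bar>bdet (pull_thetaL G c id (chart_inv c u))\<bar>)"
    by (intro continuous_on_rabs continuous_bdet continuous_theta c)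
  then show ?thesis
    by (rule continuous_on_eq) (simp add: weight_eq[OF c atlas_chart(7)[OF atl c]])
qed

text \<open>Left invariance of the Maurer-Cartan form: the element g cancels in the product of the
  inverse of g p with g x.\<close>

lemma theta_translate:
  assumes c: "c \<in> A0" and d: "d \<in> A0" and p: "p \<in> fst c" "g \<otimes> p \<in> fst d"
    and der: "((\<lambda>u. snd d (g \<otimes> chart_inv c u)) has_derivative D) (at (snd c p))"
  shows "pull_thetaL G c id p = (\<lambda>v. pull_thetaL G d id (g \<otimes> p) (D v))"
proof -
  note ch = atlas_chart[OF atl c] and dh = atlas_chart[OF atl d]
  have q: "((\<lambda>u. uc (inv (g \<otimes> p) \<otimes> chart_inv d u)) has_derivative pull_thetaL G d id (g \<otimes> p)) (at (snd d (g \<otimes> p)))"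
    using theta_id[OF d p(2)] by (simp add: cder_def)
  have sm: "smooth_map A0 A0 (\<lambda>x. g \<otimes> x)" by (intro sm_mult sm_id smooth_map_const atl)
  have "open ((\<lambda>x. g \<otimes> x) -` fst d)" using smooth_mapD(1)[OF sm] dh(1) by (metis open_vimage)
  then have o: "open (snd c ` (fst c \<inter> (\<lambda>x. g \<otimes> x) -` fst d))" by (rule chart_image_open[OF atl c])
  have "((\<lambda>u. uc (inv (g \<otimes> p) \<otimes> chart_inv d (snd d (g \<otimes> chart_inv c u)))) has_derivative (\<lambda>v. pull_thetaL G d id (g \<otimes> p) (D v))) (at (snd c p))"
    using has_derivative_compose[OF der, of "\<lambda>u. uc (inv (g \<otimes> p) \<otimes> chart_inv d u)"] q ch(6)[OF p(1)] by simp
  then have "((\<lambda>u. uc (inv p \<otimes> chart_inv c u)) has_derivative (\<lambda>v. pull_thetaL G d id (g \<otimes> p) (D v))) (at (snd c p))"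
  proof (rule has_derivative_transform_within_open[OF _ o])
    show "snd c p \<in> snd c ` (fst c \<inter> (\<lambda>x. g \<otimes> x) -` fst d)" using p by auto
    fix u assume "u \<in> snd c ` (fst c \<inter> (\<lambda>x. g \<otimes> x) -` fst d)"
    then show "uc (inv (g \<otimes> p) \<otimes> chart_inv d (snd d (g \<otimes> chart_inv c u))) = uc (inv p \<otimes> chart_inv c u)"
      using dh(6) by (simp add: chart_image_mem[OF atl c])
  qed
  from frechet_eq[OF this] show ?thesis by (simp add: pull_thetaL_def)
qed

text \<open>In charts, left translation by \<open>g\<close> changes the weight by its Jacobian.\<close>

theorem riemannian_left_invariant:
  assumes m: "riemannian_measure G m"
  shows "distr m borel (\<lambda>x. g \<otimes> x) = m"
proof (rule measure_eq_local)
  have dm: "density_measure A0 weight m" using m unfolding riemannian_measure_def weight_def .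
  have sm: "sets m = sets borel" using dm by (simp add: density_measure_def)
  show "sets m = sets borel" by fact
  show "sets (distr m borel (\<lambda>x. g \<otimes> x)) = sets borel" by simp
  let ?h = "inv g"
  have smh: "smooth_map A0 A0 (\<lambda>x. ?h \<otimes> x)" by (intro sm_mult sm_id smooth_map_const atl)
  have meas: "(\<lambda>x. g \<otimes> x) \<in> borel_measurable m"
    unfolding measurable_cong_sets[OF sm refl]
    by (intro borel_measurable_continuous_onI continuous_intros continuous_on_id)
  fix p
  obtain c d where c: "c \<in> A0" "p \<in> fst c" and d: "d \<in> A0" "?h \<otimes> p \<in> fst d" using atlas_cover[OF atl] by metis
  note ch = atlas_chart[OF atl c(1)] and dh = atlas_chart[OF atl d(1)]
  define U where "U = fst c \<inter> (\<lambda>x. ?h \<otimes> x) -` fst d"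
  define V where "V = fst d \<inter> (\<lambda>x. g \<otimes> x) -` fst c"
  have ov: "open ((\<lambda>x. k \<otimes> x) -` fst e)" if "e \<in> A0" for e k
    by (rule open_vimage[OF atlas_chart(1)[OF atl that]]) (intro continuous_intros continuous_on_id)
  have oU: "open U" unfolding U_def by (intro open_Int ch(1) ov d(1))
  have oS: "open (snd c ` U)" "open (snd d ` V)" unfolding U_def V_def by (intro chart_image_open[OF atl] ov c d)+
  \<comment> \<open>Left translation by the inverse of g, read from chart c to chart d. The measure
    of the preimage of E is computed in d and transported to c along this map.\<close>
  define \<phi> where "\<phi> u = snd d (?h \<otimes> chart_inv c u)" for u
  define \<psi> where "\<psi> u = snd c (g \<otimes> chart_inv d u)" for u
  have \<phi>: "smooth_on (snd c ` U) \<phi>" unfolding \<phi>_def U_def by (rule smooth_mapD(2)[OF smh c(1) d(1)])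
  have \<psi>: "smooth_on (snd d ` V) \<psi>" unfolding \<psi>_def V_def
    by (rule smooth_mapD(2)[OF _ d(1) c(1)]) (intro sm_mult sm_id smooth_map_const atl)
  have hom: "homeomorphism (snd c ` U) (snd d ` V) \<phi> \<psi>"
  proof (rule homeomorphismI)
    show "continuous_on (snd c ` U) \<phi>" "continuous_on (snd d ` V) \<psi>" using \<phi> \<psi> smooth_on_continuous by blast+
    show "\<phi> ` snd c ` U \<subseteq> snd d ` V" "\<psi> ` snd d ` V \<subseteq> snd c ` U"
      using ch(6) dh(6) by (auto simp: U_def V_def \<phi>_def \<psi>_def)
    show "\<psi> (\<phi> u) = u" if "u \<in> snd c ` U" for u using that ch(6) dh(6) by (auto simp: U_def \<phi>_def \<psi>_def)
    show "\<phi> (\<psi> u) = u" if "u \<in> snd d ` V" for u using that ch(6) dh(6) by (auto simp: V_def \<phi>_def \<psi>_def)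
  qed
  have der: "(\<phi> has_derivative frechet_derivative \<phi> (at u)) (at u)" if "u \<in> snd c ` U" for u
    by (rule smooth_on_D[OF oS(1) \<phi> that])
  have "emeasure (distr m borel (\<lambda>x. g \<otimes> x)) E = emeasure m E" if E: "E \<in> sets borel" "E \<subseteq> U" for E
  proof -
    let ?E = "(\<lambda>x. g \<otimes> x) -` E"
    have E': "?E \<in> sets borel" using measurable_sets[OF meas E(1)] sm sets_eq_imp_space_eq[OF sm] by simp
    have im: "?E = (\<lambda>x. ?h \<otimes> x) ` E"
    proof (intro Set.set_eqI iffI)
      fix x assume "x \<in> ?E"
      then show "x \<in> (\<lambda>x. ?h \<otimes> x) ` E" by (intro image_eqI[of _ _ "g \<otimes> x"]) auto
    qed auto
    have Ed: "?E \<subseteq> fst d" using E(2) unfolding im U_def by auto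
    have imd: "snd d ` ?E = \<phi> ` (snd c ` E)"
      unfolding im image_image \<phi>_def using E(2) ch(6) by (intro image_cong) (auto simp: U_def)
    have Ec: "E \<subseteq> fst c" using E(2) by (auto simp: U_def)
    have cE: "snd c ` E \<in> sets borel" "snd c ` E \<subseteq> snd c ` U" using chart_image_borel[OF atl c(1) E(1) Ec] E(2) by auto
    have "emeasure (distr m borel (\<lambda>x. g \<otimes> x)) E = emeasure m ?E"
      using meas E(1) sets_eq_imp_space_eq[OF sm] by (subst emeasure_distr) auto
    also have "\<dots> = (\<integral>\<^sup>+v\<in>\<phi> ` (snd c ` E). ennreal (weight d (chart_inv d v)) \<partial>lborel)"
      using dm d(1) E' Ed unfolding density_measure_def imd[symmetric] by blast
    also have "\<dots> = (\<integral>\<^sup>+u\<in>snd c ` E. ennreal (\<bar>bdet (frechet_derivative \<phi> (at u))\<bar> * weight d (chart_inv d (\<phi> u))) \<partial>lborel)"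
    proof (rule nn_integral_diffeo_image[OF hom oS cE der])
      show "continuous_on (snd c ` U) (\<lambda>u. \<bar>bdet (frechet_derivative \<phi> (at u))\<bar>)"
        by (intro continuous_on_rabs continuous_bdet smooth_on_continuous[OF smooth_on_deriv[OF oS(1) \<phi>]])
      show "continuous_on (snd d ` V) (\<lambda>u. weight d (chart_inv d u))"
        by (rule continuous_on_subset[OF continuous_weight[OF d(1)]]) (auto simp: V_def)
      show "0 \<le> weight d (chart_inv d u)" if "u \<in> snd d ` V" for u using that dh(6) by (auto simp: V_def weight_eq[OF d(1)])
    qed
    also have "\<dots> = (\<integral>\<^sup>+u\<in>snd c ` E. ennreal (weight c (chart_inv c u)) \<partial>lborel)"
    proof (intro nn_integral_cong)
      fix u
      have "\<bar>bdet (frechet_derivative \<phi> (at u))\<bar> * weight d (chart_inv d (\<phi> u)) = weight c (chart_inv c u)" if "u \<in> snd c ` E"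
      proof -
        obtain q where q: "q \<in> E" "u = snd c q" using \<open>u \<in> snd c ` E\<close> by blast
        then have qU: "q \<in> fst c" "?h \<otimes> q \<in> fst d" using E(2) by (auto simp: U_def)
        have "pull_thetaL G c id q = (\<lambda>v. pull_thetaL G d id (?h \<otimes> q) (frechet_derivative \<phi> (at u) v))"
        proof (rule theta_translate[OF c(1) d(1) qU])
          have "\<phi> = (\<lambda>u. snd d (?h \<otimes> chart_inv c u))" by (simp add: \<phi>_def fun_eq_iff)
          then show "((\<lambda>u. snd d (?h \<otimes> chart_inv c u)) has_derivative frechet_derivative \<phi> (at u)) (at (snd c q))"
            using der[of u] q E(2) by auto
        qed
        from arg_cong[OF this, of bdet]
        have "bdet (pull_thetaL G c id q) = bdet (pull_thetaL G d id (?h \<otimes> q)) * bdet (frechet_derivative \<phi> (at u))"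
          by (rule trans) (rule bdet_compose[OF cder_linear[OF theta_id[OF d(1) qU(2)]]])
        then have w: "weight c q = \<bar>bdet (frechet_derivative \<phi> (at u))\<bar> * weight d (?h \<otimes> q)"
          unfolding weight_eq[OF c(1) qU(1)] weight_eq[OF d(1) qU(2)] by (simp only: abs_mult mult.commute)
        have cu: "chart_inv c u = q" using q(2) ch(6)[OF qU(1)] by simp
        have du: "chart_inv d (\<phi> u) = ?h \<otimes> q" unfolding \<phi>_def cu by (rule dh(6)[OF qU(2)])
        show ?thesis unfolding cu du w ..
      qed
      then show "ennreal (\<bar>bdet (frechet_derivative \<phi> (at u))\<bar> * weight d (chart_inv d (\<phi> u))) * indicator (snd c ` E) u
        = ennreal (weight c (chart_inv c u)) * indicator (snd c ` E) u" by (auto simp: indicator_def)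
    qed
    also have "\<dots> = emeasure m E" using dm c(1) E(1) Ec unfolding density_measure_def by simp
    finally show ?thesis .
  qed
  then show "\<exists>U. open U \<and> p \<in> U \<and> (\<forall>E\<in>sets borel. E \<subseteq> U \<longrightarrow> emeasure (distr m borel (\<lambda>x. g \<otimes> x)) E = emeasure m E)"
    using oU c d by (intro exI[of _ U]) (auto simp: U_def)
qed

end

section \<open>The Duistermaat-Heckman measures of the doubles\<close>

context twists begin

context
  fixes m :: "'a measure"
  assumes m: "riemannian_measure G m" and K: "compact (UNIV :: 'a set)"
begin

lemma dm: "density_measure A0 weight m"
  using m unfolding riemannian_measure_def weight_def .

lemma finite_riemannian: "finite_measure m"
  by (rule density_measure_finite[OF dm atl K continuous_weight])

lemma liouville_measure:
  assumes \<mu>: "density_measure (prod_atlas A0 A0) (\<lambda>c p. \<bar>\<Lambda> c p\<bar>) \<mu>"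
    and \<Lambda>: "\<And>c d x y. c \<in> A0 \<Longrightarrow> d \<in> A0 \<Longrightarrow> x \<in> fst c \<Longrightarrow> y \<in> fst d \<Longrightarrow>
      \<bar>\<Lambda> (prod_chart c d) (x, y)\<bar> = \<bar>bdet (pull_thetaL G c id x)\<bar> * \<bar>bdet (pull_thetaL G d id y)\<bar>"
  shows "\<mu> = m \<Otimes>\<^sub>M m"
proof (rule density_measure_prod[OF dm atl finite_riemannian continuous_weight _ \<mu>])
qed (simp_all add: \<Lambda> weight_eq)

theorem DH_double:
  assumes "DH_measure (prod_group G G) (map_prod (\<tau> \<circ> \<kappa>) (\<tau>' \<circ> \<kappa>')) (twisted_double G \<tau> \<kappa>) \<nu>"
  shows "\<nu> = distr (m \<Otimes>\<^sub>M m) borel (\<lambda>z. (Phi1 z, Phi2 z))"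
proof -
  obtain \<T> k \<mu> where T: "Ad_lift (prod_group G G) \<T>" and k: "pin_lift (lie_diff (prod_group G G) (map_prod (\<tau> \<circ> \<kappa>) (\<tau>' \<circ> \<kappa>'))) k"
    and \<mu>: "density_measure (prod_atlas A0 A0) (\<lambda>c p. \<bar>liouville_form (prod_group G G) \<T> k (twisted_double G \<tau> \<kappa>) c p\<bar>) \<mu>"
    and \<nu>: "\<nu> = distr \<mu> borel (\<lambda>z. (Phi1 z, Phi2 z))"
    using assms unfolding DH_measure_def moment_double by (auto simp: twisted_double_def)
  have "\<mu> = m \<Otimes>\<^sub>M m"
  proof (rule liouville_measure[OF \<mu>])
    fix c d x y assume "c \<in> A0" "d \<in> A0" "x \<in> fst c" "y \<in> fst d"
    then interpret double_point G \<tau> \<kappa> c d x y by unfold_locales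
    show "\<bar>liouville_form (prod_group G G) \<T> k (twisted_double G \<tau> \<kappa>) cc (x, y)\<bar> = \<bar>bdet th1\<bar> * \<bar>bdet th2\<bar>"
      by (rule liouville_double[OF T k])
  qed
  then show ?thesis by (simp only: \<nu>)
qed

theorem DH_fused:
  assumes "DH_measure G (\<tau> \<circ> \<kappa> \<circ> \<tau>' \<circ> \<kappa>') (fused_double G \<tau> \<kappa>) \<nu>"
  shows "\<nu> = distr (m \<Otimes>\<^sub>M m) borel (\<lambda>z. Phi1 z \<otimes> \<tau> (\<kappa> (Phi2 z)))"
proof -
  obtain \<T> k \<mu> where T: "Ad_lift G \<T>" and k: "pin_lift (lie_diff G (\<tau> \<circ> \<kappa> \<circ> \<tau>' \<circ> \<kappa>')) k"
    and \<mu>: "density_measure (prod_atlas A0 A0) (\<lambda>c p. \<bar>liouville_form G \<T> k (fused_double G \<tau> \<kappa>) c p\<bar>) \<mu>"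
    and \<nu>: "\<nu> = distr \<mu> borel (\<lambda>z. Phi1 z \<otimes> \<tau> (\<kappa> (Phi2 z)))"
    using assms unfolding DH_measure_def moment_fused by (auto simp: fused_double_def twisted_double_def Let_def)
  have "\<mu> = m \<Otimes>\<^sub>M m"
  proof (rule liouville_measure[OF \<mu>])
    fix c d x y assume "c \<in> A0" "d \<in> A0" "x \<in> fst c" "y \<in> fst d"
    then interpret double_point G \<tau> \<kappa> c d x y by unfold_locales
    show "\<bar>liouville_form G \<T> k (fused_double G \<tau> \<kappa>) cc (x, y)\<bar> = \<bar>bdet th1\<bar> * \<bar>bdet th2\<bar>"
      by (rule liouville_fused[OF T k])
  qed
  then show ?thesis by (simp only: \<nu>)
qed

end

end

section \<open>The Lie bracket\<close>

context liegroup begin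

lemma cder_compose_ui:
  assumes f: "((\<lambda>u. f (ui u)) has_derivative D) (at u0)" and q: "cder q a A"
  shows "((\<lambda>u. f (q u)) has_derivative (\<lambda>v. D (A v))) (at a)"
proof -
  have qa: "q a = \<one>" using q by (simp add: cder_def)
  have "((\<lambda>u. f (ui (uc (q u)))) has_derivative (\<lambda>v. D (A v))) (at a)"
    using has_derivative_compose[of "\<lambda>u. uc (q u)" A a UNIV "\<lambda>u. f (ui u)" D] q f by (simp add: cder_def qa)
  moreover have "\<forall>\<^sub>F u in at a. f (ui (uc (q u))) = f (q u)"
    using cder_near[OF q] unit_chart_facts(6) unfolding eventually_nhds_conv_at by (auto elim: eventually_mono)
  ultimately show ?thesis
    by (rule has_derivative_transform_eventually) (simp_all add: qa)
qed

lemma cder_unit_curve: "cder (unit_curve G \<xi>) 0 (\<lambda>s. s *\<^sub>R \<xi>)"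
proof -
  have line: "((\<lambda>s. u0 + s *\<^sub>R \<xi>) has_derivative (\<lambda>s. s *\<^sub>R \<xi>)) (at 0)" by (auto intro!: derivative_eq_intros)
  have "isCont ui u0" using cder_ui by (simp add: cder_def)
  then have "isCont (\<lambda>s. ui (u0 + s *\<^sub>R \<xi>)) 0"
    using isCont_o2[of 0 "\<lambda>s. u0 + s *\<^sub>R \<xi>" ui] by simp
  moreover have "((\<lambda>s. uc (ui (u0 + s *\<^sub>R \<xi>))) has_derivative (\<lambda>s. s *\<^sub>R \<xi>)) (at 0)"
    using has_derivative_compose[OF line, of "\<lambda>u. uc (ui u)" "\<lambda>v. v"] cder_ui by (simp add: cder_def)
  ultimately show ?thesis by (simp add: cder_def unit_curve_def[abs_def])
qed

text \<open>Ad is itself a derivative, in the second variable and at the unit, of the smooth map (g,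
  x) |-> g x g^-1. In coordinates it is a value of the derivative of H, which is smooth
  again.\<close>

lemma Ad_ui_differentiable: "(\<lambda>u. Ad G (ui u) \<zeta>) differentiable (at u0)"
proof -
  have sm: "smooth_map (prod_atlas A0 A0) A0 (\<lambda>z. fst z \<otimes> snd z \<otimes> inv (fst z))" by (intro sm_mult sm_inv atl2 smooth_map_fst[OF atl atl])
  obtain \<Omega> H where H: "open \<Omega>" "smooth_on \<Omega> H"
    "\<And>u v. (u, v) \<in> \<Omega> \<longleftrightarrow> u \<in> uc ` fst (unit_chart G) \<and> v \<in> uc ` fst (unit_chart G) \<and> ui u \<otimes> ui v \<otimes> inv (ui u) \<in> fst (unit_chart G)"
    "\<And>u v. (u, v) \<in> \<Omega> \<Longrightarrow>
      frechet_derivative (\<lambda>w. uc (ui u \<otimes> ui w \<otimes> inv (ui u))) (at v) = (\<lambda>w. frechet_derivative H (at (u, v)) (0, w))"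
    by (rule two_variable_chart[OF sm uca uca]) blast
  have diag: "(u, u0) \<in> \<Omega>" if "u \<in> uc ` fst (unit_chart G)" for u using that u0_mem by (simp add: H(3) one_uc)
  let ?F = "\<lambda>z. frechet_derivative H (at z) (0, \<zeta>)"
  have "((\<lambda>w. (w, u0)) has_derivative (\<lambda>w. (w, 0))) (at u0)" by (auto intro!: derivative_eq_intros)
  from has_derivative_compose[OF this smooth_on_D[OF H(1) smooth_on_deriv[OF H(1,2)] diag[OF u0_mem]]]
  have "((\<lambda>u. Ad G (ui u) \<zeta>) has_derivative (\<lambda>w. frechet_derivative ?F (at (u0, u0)) (w, 0))) (at u0)"
    by (rule has_derivative_transform_within_open[OF _ unit_chart_facts(2) u0_mem])
      (simp only: Ad_def lie_diff_def H(4)[OF diag])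
  then show ?thesis unfolding differentiable_def by blast
qed

text \<open>The bracket is defined with straight lines in the unit chart. By the chain rule, the
  derivative of Ad along any germ through the unit depends on the derivative of the germ
  alone.\<close>

lemma Ad_derivative:
  assumes "cder q a A"
  shows "((\<lambda>u. Ad G (q u) \<zeta>) has_derivative (\<lambda>v. lie_bracket G (A v) \<zeta>)) (at a)"
proof -
  obtain D where D: "((\<lambda>u. Ad G (ui u) \<zeta>) has_derivative D) (at u0)"
    using Ad_ui_differentiable unfolding differentiable_def by blast
  have "lie_bracket G \<xi> \<zeta> = D \<xi>" for \<xi>
  proof -
    have "((\<lambda>s. Ad G (unit_curve G \<xi> s) \<zeta>) has_vector_derivative D \<xi>) (at 0)"
      using cder_compose_ui[OF D cder_unit_curve[of \<xi>]] linear_scale[OF has_derivative_linear[OF D]]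
      by (simp add: has_vector_derivative_def)
    then show ?thesis unfolding lie_bracket_def by (rule vector_derivative_at)
  qed
  then show ?thesis using cder_compose_ui[OF D assms] by simp
qed

lemma bracket_linear1: "linear (\<lambda>\<xi>. lie_bracket G \<xi> \<zeta>)"
  using has_derivative_linear[OF Ad_derivative[OF cder_ui]] .

lemma bracket_vector_derivative:
  "((\<lambda>s. Ad G (unit_curve G \<xi> s) \<zeta>) has_vector_derivative lie_bracket G \<xi> \<zeta>) (at 0)"
  using Ad_derivative[OF cder_unit_curve[of \<xi>], of \<zeta>] linear_scale[OF bracket_linear1] by (simp add: has_vector_derivative_def)

lemma unit_curve_0 [simp]: "unit_curve G \<xi> 0 = \<one>"
  by (simp add: unit_curve_def)

lemma bracket_linear2: "linear (lie_bracket G \<xi>)"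
proof (rule linearI)
  fix a b r
  note d = bracket_vector_derivative[of \<xi>] and lin = Ad_linear
  show "lie_bracket G \<xi> (a + b) = lie_bracket G \<xi> a + lie_bracket G \<xi> b"
    using vector_derivative_unique_at[OF d[of "a + b"]] has_vector_derivative_add[OF d[of a] d[of b]]
    by (simp add: linear_add[OF lin])
  show "lie_bracket G \<xi> (r *\<^sub>R a) = r *\<^sub>R lie_bracket G \<xi> a"
    using vector_derivative_unique_at[OF d[of "r *\<^sub>R a"]] bounded_linear.has_vector_derivative[OF bounded_linear_scaleR_right d[of a], of r]
    by (simp add: linear_scale[OF lin])
qed

text \<open>Conjugating a curve by g before applying Ad, or applying Ad of g afterwards, gives the
  same vector; differentiate this at the unit.\<close>

lemma Ad_bracket: "Ad G g (lie_bracket G \<xi> \<zeta>) = lie_bracket G (Ad G g \<xi>) (Ad G g \<zeta>)"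
proof -
  have c: "cder (\<lambda>s. conj g (unit_curve G \<xi> s)) 0 (\<lambda>s. Ad G g (s *\<^sub>R \<xi>))"
    using cder_hom[OF sm_conj[of g] _ cder_unit_curve[of \<xi>]] by (simp add: Ad_conj)
  have "((\<lambda>s. Ad G (conj g (unit_curve G \<xi> s)) (Ad G g \<zeta>)) has_vector_derivative lie_bracket G (Ad G g \<xi>) (Ad G g \<zeta>)) (at 0)"
    using Ad_derivative[OF c, of "Ad G g \<zeta>"] linear_scale[OF bracket_linear1] linear_scale[OF Ad_linear]
    by (simp add: has_vector_derivative_def)
  moreover have "Ad G (conj g h) (Ad G g \<zeta>) = Ad G g (Ad G h \<zeta>)" for h
    by (simp add: conj_def flip: Ad_mult)
  moreover have "((\<lambda>s. Ad G g (Ad G (unit_curve G \<xi> s) \<zeta>)) has_vector_derivative Ad G g (lie_bracket G \<xi> \<zeta>)) (at 0)"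
    using bounded_linear.has_vector_derivative[OF _ bracket_vector_derivative[of \<xi> \<zeta>], of "Ad G g"] Ad_linear
    by (simp add: linear_conv_bounded_linear)
  ultimately show ?thesis using vector_derivative_unique_at[of "\<lambda>s. Ad G g (Ad G (unit_curve G \<xi> s) \<zeta>)"] by simp
qed

lemma bounded_bilinear_bracket: "bounded_bilinear (lie_bracket G)"
  by (rule bilinear_conv_bounded_bilinear[THEN iffD1])
    (simp add: bilinear_def bracket_linear1 bracket_linear2)

text \<open>The derivative of \<open>Ad_bracket\<close> at the unit, by the product rule for the
  bracket.\<close>

lemma jacobi: "lie_bracket G \<eta> (lie_bracket G \<xi> \<zeta>) = lie_bracket G (lie_bracket G \<eta> \<xi>) \<zeta> + lie_bracket G \<xi> (lie_bracket G \<eta> \<zeta>)"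
proof -
  have "((\<lambda>s. lie_bracket G (Ad G (unit_curve G \<eta> s) \<xi>) (Ad G (unit_curve G \<eta> s) \<zeta>)) has_vector_derivative
    lie_bracket G \<xi> (lie_bracket G \<eta> \<zeta>) + lie_bracket G (lie_bracket G \<eta> \<xi>) \<zeta>) (at 0)"
    using bounded_bilinear.has_vector_derivative[OF bounded_bilinear_bracket bracket_vector_derivative bracket_vector_derivative, of \<eta> \<xi> \<eta> \<zeta>]
    by simp
  then have "((\<lambda>s. Ad G (unit_curve G \<eta> s) (lie_bracket G \<xi> \<zeta>)) has_vector_derivative
    lie_bracket G \<xi> (lie_bracket G \<eta> \<zeta>) + lie_bracket G (lie_bracket G \<eta> \<xi>) \<zeta>) (at 0)"
    by (simp add: Ad_bracket)
  from vector_derivative_unique_at[OF bracket_vector_derivative this] show ?thesis by simp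
qed

end

lemma (in metric_liegroup) bracket_skew: "lie_bracket G \<xi> \<zeta> \<bullet> \<eta> = - (\<zeta> \<bullet> lie_bracket G \<xi> \<eta>)"
proof -
  have "((\<lambda>s. Ad G (unit_curve G \<xi> s) \<zeta> \<bullet> Ad G (unit_curve G \<xi> s) \<eta>) has_vector_derivative
    \<zeta> \<bullet> lie_bracket G \<xi> \<eta> + lie_bracket G \<xi> \<zeta> \<bullet> \<eta>) (at 0)"
    using bounded_bilinear.has_vector_derivative[OF bounded_bilinear_inner bracket_vector_derivative bracket_vector_derivative, of \<xi> \<zeta> \<xi> \<eta>]
    by simp
  moreover have "((\<lambda>s. Ad G (unit_curve G \<xi> s) \<zeta> \<bullet> Ad G (unit_curve G \<xi> s) \<eta>) has_vector_derivative 0) (at 0)"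
    by (simp add: Ad_inner)
  ultimately show ?thesis using vector_derivative_unique_at by fastforce
qed

section \<open>Root space decomposition\<close>

text \<open>Let x0 maximise x . S x on the unit sphere of M, with maximum c. Then the quadratic form
  Q is nonnegative on M and zero at x0, while a variation in the direction of the defect r = c x0 -
  S x0 would make it negative unless r = 0.\<close>

lemma symmetric_eigenvector:
  fixes S :: "'a::euclidean_space \<Rightarrow> 'a"
  assumes M: "subspace M" "M \<noteq> {0}" and S: "linear S" "\<And>x. x \<in> M \<Longrightarrow> S x \<in> M"
    and sym: "\<And>x y. S x \<bullet> y = x \<bullet> S y"
  obtains x c where "x \<in> M" "x \<noteq> 0" "S x = c *\<^sub>R x"
proof -
  let ?K = "M \<inter> sphere 0 1"
  obtain z where z: "z \<in> M" "z \<noteq> 0" using M subspace_0[OF M(1)] by blast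
  have "z /\<^sub>R norm z \<in> ?K" using z M(1) by (simp add: subspace_scale)
  moreover have "compact ?K" using closed_subspace[OF M(1)] by (simp add: closed_Int_compact)
  moreover have "continuous_on ?K (\<lambda>x. x \<bullet> S x)"
    by (intro continuous_intros linear_continuous_on) (use S(1) in \<open>simp add: linear_conv_bounded_linear\<close>)
  ultimately obtain x0 where x0: "x0 \<in> ?K" "\<And>y. y \<in> ?K \<Longrightarrow> y \<bullet> S y \<le> x0 \<bullet> S x0"
    using continuous_attains_sup[of ?K "\<lambda>x. x \<bullet> S x"] by (metis empty_iff)
  define c where "c = x0 \<bullet> S x0"
  define r where "r = c *\<^sub>R x0 - S x0"
  define Q where "Q y = c * (y \<bullet> y) - y \<bullet> S y" for y
  have Q: "0 \<le> Q y" if "y \<in> M" for y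
  proof (cases "y = 0")
    case False
    then have "y /\<^sub>R norm y \<in> ?K" using that M(1) by (simp add: subspace_scale)
    from x0(2)[OF this] have "(y \<bullet> S y) / (norm y)\<^sup>2 \<le> c"
      by (simp add: c_def linear_scale[OF S(1)] power2_eq_square divide_inverse mult_ac)
    then show ?thesis using False by (simp add: Q_def divide_le_eq power2_norm_eq_inner)
  qed (simp add: Q_def)
  have rM: "r \<in> M" unfolding r_def using x0(1) M(1) S(2) by (simp add: subspace_scale subspace_diff)
  have Qx0: "Q x0 = 0" using x0(1) by (simp add: Q_def c_def norm_eq_1)
  have exp: "Q (x0 + t *\<^sub>R r) = 2 * t * (r \<bullet> r) + t\<^sup>2 * Q r" for t
  proof -
    have "Q (x0 + t *\<^sub>R r) = Q x0 + 2 * t * (c * (x0 \<bullet> r) - S x0 \<bullet> r) + t\<^sup>2 * Q r"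
      using sym[of r x0] sym[of x0 r] unfolding Q_def
      by (simp add: inner_add_left inner_add_right linear_add[OF S(1)] linear_scale[OF S(1)] inner_commute algebra_simps power2_eq_square)
    also have "c * (x0 \<bullet> r) - S x0 \<bullet> r = r \<bullet> r" unfolding r_def by (simp add: inner_diff_left)
    finally show ?thesis using Qx0 by simp
  qed
  have "r \<bullet> r = 0"
  proof (rule ccontr)
    assume "r \<bullet> r \<noteq> 0"
    then have p: "0 < r \<bullet> r" by simp
    \<comment> \<open>Negative, and small enough that the quadratic term is at most half of the
      linear one in size.\<close>
    define t where "t = - (r \<bullet> r) / (1 + \<bar>Q r\<bar>)"
    have tn: "t < 0" using p by (simp add: t_def divide_neg_pos)
    have "t * (2 * (r \<bullet> r) + t * Q r) \<ge> 0"
      using Q[of "x0 + t *\<^sub>R r"] exp[of t] rM x0(1) M(1)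
      by (simp add: subspace_add subspace_scale power2_eq_square algebra_simps)
    then have "2 * (r \<bullet> r) + t * Q r \<le> 0" using tn by (simp add: zero_le_mult_iff)
    moreover have "t * Q r \<ge> - (r \<bullet> r)"
    proof -
      have "\<bar>t * Q r\<bar> = (r \<bullet> r) * (\<bar>Q r\<bar> / (1 + \<bar>Q r\<bar>))" using p by (simp add: t_def abs_mult)
      also have "\<dots> \<le> (r \<bullet> r) * 1" using p by (intro mult_left_mono) auto
      finally show ?thesis by linarith
    qed
    ultimately show False using p by linarith
  qed
  then have "S x0 = c *\<^sub>R x0" by (simp add: r_def)
  then show thesis using that[of x0 c] x0(1) by fastforce
qed

text \<open>In a nonzero invariant subspace of least dimension each operator has an eigenvector. The
  eigenspace is invariant under the other operators, since all commute, so it is the whole subspace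
  and every operator acts there as a scalar.\<close>

lemma joint_eigenvector:
  fixes S :: "'i \<Rightarrow> 'a::euclidean_space \<Rightarrow> 'a"
  assumes N: "subspace N" "N \<noteq> {0}" and S: "\<And>i. i \<in> I \<Longrightarrow> linear (S i)" "\<And>i x. i \<in> I \<Longrightarrow> x \<in> N \<Longrightarrow> S i x \<in> N"
    and sym: "\<And>i x y. i \<in> I \<Longrightarrow> S i x \<bullet> y = x \<bullet> S i y"
    and comm: "\<And>i j x. i \<in> I \<Longrightarrow> j \<in> I \<Longrightarrow> S i (S j x) = S j (S i x)"
  obtains x where "x \<in> N" "x \<noteq> 0" "\<And>i. i \<in> I \<Longrightarrow> \<exists>c. S i x = c *\<^sub>R x"
proof -
  define good where "good M \<longleftrightarrow> subspace M \<and> M \<noteq> {0} \<and> M \<subseteq> N \<and> (\<forall>i\<in>I. \<forall>x\<in>M. S i x \<in> M)" for M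
  have "good N" using N S by (auto simp: good_def)
  then obtain M where M: "good M" and min: "\<And>M'. good M' \<Longrightarrow> dim M \<le> dim M'"
    using arg_min_nat_lemma[of good N dim] by metis
  obtain x where x: "x \<in> M" "x \<noteq> 0" using M subspace_0[of M] unfolding good_def by blast
  show thesis
  proof (rule that[of x])
    show "x \<in> N" "x \<noteq> 0" using x M by (auto simp: good_def)
    fix i assume i: "i \<in> I"
    obtain y c where y: "y \<in> M" "y \<noteq> 0" "S i y = c *\<^sub>R y"
      by (rule symmetric_eigenvector[of M "S i"]) (use M S(1)[OF i] sym[OF i] i in \<open>auto simp: good_def\<close>)
    let ?E = "{z \<in> M. S i z = c *\<^sub>R z}"
    have "subspace ?E"
      using M S(1)[OF i] unfolding good_def
      by (intro subspaceI) (auto simp: subspace_0 subspace_add subspace_scale linear_0 linear_add linear_scale scaleR_add_right)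
    moreover have "S j z \<in> ?E" if "j \<in> I" "z \<in> ?E" for j z
      using that M comm[OF i that(1), of z] S(1)[OF that(1)] by (auto simp: good_def linear_scale)
    ultimately have "good ?E" using y M by (auto simp: good_def)
    from min[OF this] have "?E = M"
      using \<open>subspace ?E\<close> M subspace_dim_equal[of ?E M] by (auto simp: good_def)
    then show "\<exists>c. S i x = c *\<^sub>R x" using x by blast
  qed
qed

lemma subspace_orthogonal_complement: "subspace {x. \<forall>d\<in>D. x \<bullet> d = 0}"
  by (intro subspaceI) (auto simp: inner_add_left)

lemma inner_fst_snd: "(x :: 'a::real_inner \<times> 'b::real_inner) \<bullet> y = fst x \<bullet> fst y + snd x \<bullet> snd y"
  by (cases x, cases y) (simp add: inner_Pair)

text \<open>The operator \<open>S h\<close> is i times ad h on pairs x + i y. It is symmetric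
  because ad h is skew, and these operators commute because the Cartan subalgebra is abelian. If the
  span were proper, they would have a joint eigenvector in its orthogonal complement; but a joint
  eigenvector lies in a root space or, when all eigenvalues are zero, in \<tt> x \<tt> by maximality
  of \<tt>.\<close>

theorem (in metric_liegroup) root_decomposition:
  assumes t: "cartan_subalgebra G \<tt>"
  shows "span (\<tt> \<times> \<tt> \<union> (\<Union>\<alpha>\<in>roots G \<tt>. root_space G \<tt> \<alpha>)) = UNIV"
proof (rule ccontr)
  let ?B = "\<tt> \<times> \<tt> \<union> (\<Union>\<alpha>\<in>roots G \<tt>. root_space G \<tt> \<alpha>)"
  note lin = linear_add[OF bracket_linear2] linear_scale[OF bracket_linear2] linear_diff[OF bracket_linear2] linear_neg[OF bracket_linear2] linear_0[OF bracket_linear2]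
  have t_sub: "subspace \<tt>" and t_comm: "\<And>h k. h \<in> \<tt> \<Longrightarrow> k \<in> \<tt> \<Longrightarrow> lie_bracket G h k = 0"
    and t_max: "\<And>\<xi>. (\<And>h. h \<in> \<tt> \<Longrightarrow> lie_bracket G h \<xi> = 0) \<Longrightarrow> \<xi> \<in> \<tt>"
    using t unfolding cartan_subalgebra_def by blast+
  have ad_comm: "lie_bracket G h (lie_bracket G k \<xi>) = lie_bracket G k (lie_bracket G h \<xi>)" if "h \<in> \<tt>" "k \<in> \<tt>" for h k \<xi>
    using jacobi[of h k \<xi>] t_comm[OF that] linear_0[OF bracket_linear1] by simp
  define S where "S h e = (- lie_bracket G h (snd e), lie_bracket G h (fst e))" for h and e :: "'b \<times> 'b"
  define N where "N = {x. \<forall>d\<in>?B. x \<bullet> d = 0}"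
  assume "span ?B \<noteq> UNIV"
  then have "span ?B \<subset> span UNIV" by (simp add: psubset_eq)
  from orthogonal_to_subspace_exists_gen[OF this] obtain x where x: "x \<noteq> 0" "\<And>y. y \<in> span ?B \<Longrightarrow> orthogonal x y" by metis
  have Ns: "subspace N" unfolding N_def by (rule subspace_orthogonal_complement)
  have "x \<in> N" using x(2) span_base[of _ ?B] unfolding N_def orthogonal_def by blast
  then have Nne: "N \<noteq> {0}" using x(1) by blast
  have Slin: "linear (S h)" for h
    by (rule linearI) (simp_all add: S_def lin)
  have sym: "S h e \<bullet> f = e \<bullet> S h f" for h e f
    using bracket_skew[of h "snd e" "fst f"] bracket_skew[of h "fst e" "snd f"] by (simp add: S_def inner_fst_snd)
  have SN: "S h e \<in> N" if h: "h \<in> \<tt>" and e: "e \<in> N" for h e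
    unfolding N_def
  proof (intro CollectI ballI)
    fix d assume d: "d \<in> ?B"
    have "e \<bullet> S h d = 0"
    proof (cases "d \<in> \<tt> \<times> \<tt>")
      case True
      then have "S h d = 0" using t_comm[OF h] by (auto simp: S_def zero_prod_def)
      then show ?thesis by simp
    next
      case False
      then obtain \<alpha> where \<alpha>: "d \<in> root_space G \<tt> \<alpha>" using d by blast
      then have "cx_bracket G (h, 0) d = cx_scale (2 * pi * \<i> * of_real (\<alpha> \<bullet> h)) d" using h by (simp add: root_space_def)
      then have "S h d = (- (2 * pi * (\<alpha> \<bullet> h))) *\<^sub>R d"
        using linear_0[OF bracket_linear1] by (auto simp: S_def cx_bracket_def cx_scale_def prod_eq_iff)
      then show ?thesis using e d by (auto simp: N_def)
    qed
    then show "S h e \<bullet> d = 0" by (simp add: sym)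
  qed
  have SC: "S h (S k e) = S k (S h e)" if "h \<in> \<tt>" "k \<in> \<tt>" for h k e
    using ad_comm[OF that] by (simp add: S_def lin)
  obtain e where e: "e \<in> N" "e \<noteq> 0" "\<And>h. h \<in> \<tt> \<Longrightarrow> \<exists>c. S h e = c *\<^sub>R e"
    by (rule joint_eigenvector[OF Ns Nne Slin SN sym SC]) blast+
  \<comment> \<open>Normalised so that S h e = - 2 pi l(h) e, which is i times the equation of the
    root space. As l is linear it is given by a vector, whose component in \<tt> is the
    root.\<close>
  define l where "l h = - (S h e \<bullet> e) / (2 * pi * (e \<bullet> e))" for h
  have "S (h + k) e = S h e + S k e" "S (r *\<^sub>R h) e = r *\<^sub>R S h e" for h k r
    by (simp_all add: S_def linear_add[OF bracket_linear1] linear_scale[OF bracket_linear1])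
  then have "linear l"
    by (intro linearI) (simp_all add: l_def inner_add_left diff_divide_distrib)
  then have l: "l h = adjoint l 1 \<bullet> h" for h using adjoint_works[of l h 1] by (simp add: inner_commute)
  obtain \<alpha> z where \<alpha>: "\<alpha> \<in> \<tt>" and z: "\<And>h. h \<in> \<tt> \<Longrightarrow> z \<bullet> h = 0" and az: "adjoint l 1 = \<alpha> + z"
    using orthogonal_subspace_decomp_exists[of \<tt> "adjoint l 1"] t_sub by (metis orthogonal_def span_eq_iff)
  have S: "S h e = (- (2 * pi * (\<alpha> \<bullet> h))) *\<^sub>R e" if h: "h \<in> \<tt>" for h
  proof -
    obtain c where c: "S h e = c *\<^sub>R e" using e(3)[OF h] by blast
    have "l h = - c / (2 * pi)" using e(2) by (simp add: l_def c)
    moreover have "l h = \<alpha> \<bullet> h" using l[of h] az z[OF h] by (simp add: inner_add_left)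
    ultimately have "c = - (2 * pi * (\<alpha> \<bullet> h))" by simp
    then show ?thesis using c by simp
  qed
  have rs: "e \<in> root_space G \<tt> \<alpha>"
    unfolding root_space_def
  proof (intro CollectI ballI)
    fix h assume "h \<in> \<tt>"
    from S[OF this] show "cx_bracket G (h, 0) e = cx_scale (2 * pi * \<i> * of_real (\<alpha> \<bullet> h)) e"
      using linear_0[OF bracket_linear1] by (auto simp: S_def cx_bracket_def cx_scale_def prod_eq_iff)
  qed
  have "e \<in> ?B"
  proof (cases "\<alpha> = 0")
    case True
    have "lie_bracket G h (fst e) = 0" "lie_bracket G h (snd e) = 0" if "h \<in> \<tt>" for h
      using S[OF that] True by (auto simp: S_def prod_eq_iff)
    then have "e \<in> \<tt> \<times> \<tt>" using t_max by (auto simp: mem_Times_iff)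
    then show ?thesis by blast
  next
    case False
    then have "\<alpha> \<in> roots G \<tt>" using \<alpha> rs e(2) unfolding roots_def by blast
    then show ?thesis using rs by blast
  qed
  then have "e \<bullet> e = 0" using e(1) by (auto simp: N_def)
  then show False using e(2) by simp
qed

section \<open>Smoothing by convolution\<close>

text \<open>Squaring the positive part makes it continuously differentiable; the Leibniz rule below
  uses one derivative of the bump function.\<close>

lemma DERIV_max_sqr: "((\<lambda>t::real. (max 0 t)\<^sup>2) has_real_derivative 2 * max 0 t) (at t)"
proof -
  consider "t < 0" | "t = 0" | "t > 0" by linarith
  then show ?thesis
  proof cases
    case 1
    have "((\<lambda>t::real. 0) has_real_derivative 0) (at t)" by simp
    then show ?thesis
      using 1 by (subst DERIV_cong_ev[OF refl _ refl, where g = "\<lambda>_. 0"])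
        (auto intro!: eventually_mono[OF eventually_nhds_in_open[of "{..<0}"]])
  next
    case 2
    have "(\<lambda>h. ((max 0 h)\<^sup>2 - (max 0 0)\<^sup>2) / (h - 0)) \<midarrow>0\<rightarrow> (0::real)"
    proof (rule Lim_null_comparison)
      show "\<forall>\<^sub>F h in at 0. norm (((max 0 h)\<^sup>2 - (max 0 0)\<^sup>2) / (h - 0)) \<le> \<bar>h\<bar>"
        by (intro always_eventually allI) (auto simp: max_def power2_eq_square)
      show "(\<lambda>h::real. \<bar>h\<bar>) \<midarrow>0\<rightarrow> 0" using tendsto_rabs_zero[OF tendsto_ident_at] by simp
    qed
    then show ?thesis using 2 by (simp add: has_field_derivative_iff)
  next
    case 3
    have "((\<lambda>t::real. t\<^sup>2) has_real_derivative 2 * t) (at t)" by (auto intro!: derivative_eq_intros)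
    then show ?thesis
      using 3 by (subst DERIV_cong_ev[OF refl _ refl, where g = "\<lambda>t. t\<^sup>2"])
        (auto intro!: eventually_mono[OF eventually_nhds_in_open[of "{0<..}"]])
  qed
qed

definition bump :: "'a::euclidean_space \<Rightarrow> real \<Rightarrow> 'a \<Rightarrow> real" where
  "bump p s v = (max 0 (s\<^sup>2 - (v - p) \<bullet> (v - p)))\<^sup>2"

definition dbump :: "'a::euclidean_space \<Rightarrow> real \<Rightarrow> 'a \<Rightarrow> 'a \<Rightarrow> real" where
  "dbump p s v z = 2 * max 0 (s\<^sup>2 - (v - p) \<bullet> (v - p)) * (- (2 * ((v - p) \<bullet> z)))"

lemma bump_derivative: "(bump p s has_derivative dbump p s v) (at v)"
proof -
  have "((\<lambda>v. s\<^sup>2 - (v - p) \<bullet> (v - p)) has_derivative (\<lambda>z. - (2 * ((v - p) \<bullet> z)))) (at v)"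
    by (auto intro!: derivative_eq_intros simp: inner_commute)
  from has_derivative_compose[OF this has_field_derivative_imp_has_derivative[OF DERIV_max_sqr]]
  show ?thesis unfolding bump_def[abs_def] dbump_def[abs_def] by simp
qed

lemma bump_nonneg: "0 \<le> bump p s v" by (simp add: bump_def)

lemma bump_center: "0 < s \<Longrightarrow> 0 < bump p s p" by (simp add: bump_def max_def)

lemma bump_support: "0 < s \<Longrightarrow> v \<notin> ball p s \<Longrightarrow> bump p s v = 0"
  using power_mono[of s "norm (v - p)" 2]
  by (simp add: bump_def dist_norm norm_minus_commute[of p] flip: power2_norm_eq_inner)

lemma continuous_bump: "continuous_on S (bump p s)"
  unfolding bump_def by (intro continuous_intros)

context liegroup begin

text \<open>The integration variable is placed so that only the bump function has to be differentiated. The two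
  neighbourhoods of \<open>u0\<close> keep all points involved within one chart, so that the Leibniz rule applies there.\<close>

theorem smoothing_kernel:
  assumes m: "density_measure A0 weight m" and V: "open V" "\<one> \<in> V"
  obtains \<phi> :: "'g \<Rightarrow> real" where "continuous_on UNIV \<phi>" "\<And>g. 0 \<le> \<phi> g" "0 < \<phi> \<one>" "\<And>g. \<phi> g \<noteq> 0 \<Longrightarrow> g \<in> V"
    "\<And>f :: 'g \<Rightarrow> complex. continuous_on UNIV f \<Longrightarrow> (\<lambda>u. \<integral>g. \<phi> (inv (ui u) \<otimes> g) *\<^sub>R f g \<partial>m) differentiable (at u0)"
proof -
  let ?U = "fst (unit_chart G)" and ?I = "uc ` fst (unit_chart G)"
  note uf = unit_chart_facts
  have sm: "smooth_map (prod_atlas A0 A0) A0 (\<lambda>z. inv (fst z) \<otimes> snd z)" by (intro sm_mult sm_inv atl2 smooth_map_fst[OF atl atl])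
  obtain \<Omega> H where oO: "open \<Omega>" and sH: "smooth_on \<Omega> H"
    and \<Omega>: "\<And>u v. (u, v) \<in> \<Omega> \<longleftrightarrow> u \<in> ?I \<and> v \<in> ?I \<and> inv (ui u) \<otimes> ui v \<in> ?U"
    and H: "\<And>u v. (u, v) \<in> \<Omega> \<Longrightarrow> H (u, v) = uc (inv (ui u) \<otimes> ui v)"
    by (rule two_variable_chart[OF sm uca uca]) blast
  have "(u0, u0) \<in> \<Omega>" using u0_mem by (simp add: \<Omega> one_uc)
  \<comment> \<open>On A x B the translated point has coordinates given by the smooth function H. A
    box around \<open>u0\<close> inside B will be the fixed domain of integration.\<close>
  from open_prod_elim[OF oO this] obtain A B where AB0: "open A" "open B" "(u0, u0) \<in> A \<times> B" "A \<times> B \<subseteq> \<Omega>" .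
  then have AB: "open A" "open B" "u0 \<in> A" "u0 \<in> B" "A \<times> B \<subseteq> \<Omega>" by blast+
  obtain a b where ab: "cbox a b \<subseteq> B" "u0 \<in> box a b" using open_contains_cbox[OF AB(2,4)] by metis
  have boxI: "cbox a b \<subseteq> ?I" and AI: "A \<subseteq> ?I" using ab(1) AB(3-5) \<Omega> by blast+
  have "continuous_on (?I \<times> ?I) (\<lambda>z. ui (fst z) \<otimes> ui (snd z))"
    by (intro continuous_intros continuous_on_compose2[OF uf(5)]) auto
  then have oP: "open ((\<lambda>z. ui (fst z) \<otimes> ui (snd z)) -` (?U \<inter> uc -` box a b) \<inter> ?I \<times> ?I)" (is "open ?P")
  proof -
    assume c: "continuous_on (?I \<times> ?I) (\<lambda>z. ui (fst z) \<otimes> ui (snd z))"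
    have "open (?U \<inter> uc -` box a b)" by (rule continuous_open_preimage[OF uf(4,1) open_box])
    from continuous_open_preimage[OF c _ this] show ?thesis using uf(2) by (simp add: open_Times Int_commute)
  qed
  have "(u0, u0) \<in> ?P" using u0_mem one_uc ab(2) by simp
  \<comment> \<open>For u in C and v in D the product of the two group elements stays in the unit
    chart with coordinates in the box. This confines the support of the translated bump function to
    the domain of integration.\<close>
  from open_prod_elim[OF oP this] obtain C D where CD0: "open C" "open D" "(u0, u0) \<in> C \<times> D" "C \<times> D \<subseteq> ?P" .
  then have CD: "open C" "open D" "u0 \<in> C" "u0 \<in> D" "C \<times> D \<subseteq> ?P" by blast+
  have oV: "open (?I \<inter> ui -` V)" by (rule continuous_open_preimage[OF uf(5,2) V(1)])
  have "open (D \<inter> (?I \<inter> ui -` V))" "u0 \<in> D \<inter> (?I \<inter> ui -` V)" using CD(2,4) oV u0_mem V(2) by auto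
  then obtain s where s: "0 < s" "cball u0 s \<subseteq> D \<inter> (?I \<inter> ui -` V)" using open_contains_cball by blast
  have "open (C \<inter> A)" "u0 \<in> C \<inter> A" using CD AB by auto
  then obtain \<delta> where \<delta>: "0 < \<delta>" "ball u0 \<delta> \<subseteq> C \<inter> A" using open_contains_ball by blast
  define \<phi> where "\<phi> g = (if g \<in> ?U then bump u0 s (uc g) else 0)" for g
  have supp: "\<phi> g = 0" if "g \<notin> ui ` ball u0 s" for g
  proof (cases "g \<in> ?U")
    case True
    then have "uc g \<notin> ball u0 s" using that uf(6)[OF True] by (metis imageI)
    then show ?thesis using bump_support[OF s(1), of "uc g" u0] by (simp add: \<phi>_def)
  qed (simp add: \<phi>_def)
  have c\<phi>: "continuous_on UNIV \<phi>"
  proof -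
    let ?K = "ui ` cball u0 s"
    have "continuous_on (cball u0 s) ui" by (rule continuous_on_subset[OF uf(5)]) (use s(2) in blast)
    then have "compact ?K" by (intro compact_continuous_image) simp_all
    then have "open (- ?K)" by (intro open_Compl compact_imp_closed)
    moreover have "continuous_on (- ?K) \<phi>"
      by (rule continuous_on_eq[of _ "\<lambda>_. 0"]) (use supp in \<open>auto simp: ball_def cball_def image_iff\<close>)
    moreover have "continuous_on ?U \<phi>"
      by (rule continuous_on_eq[OF continuous_on_compose2[OF continuous_bump[of UNIV u0 s] uf(4)]]) (simp_all add: \<phi>_def)
    ultimately have "continuous_on (?U \<union> - ?K) \<phi>" using uf(1) by (intro continuous_on_open_Un)
    moreover have "?U \<union> - ?K = UNIV" using s(2) uf(7) by auto
    ultimately show ?thesis by simp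
  qed
  show thesis
  proof (rule that[of \<phi>])
    show "continuous_on UNIV \<phi>" by fact
    show "0 \<le> \<phi> g" for g by (simp add: \<phi>_def bump_nonneg)
    show "0 < \<phi> \<one>" by (simp add: \<phi>_def one_uc bump_center[OF s(1)])
    show "g \<in> V" if "\<phi> g \<noteq> 0" for g
    proof -
      have "g \<in> ui ` ball u0 s" using supp that by blast
      then obtain v where "v \<in> ball u0 s" "g = ui v" by blast
      moreover from this have "v \<in> ui -` V" using s(2) ball_subset_cball by blast
      ultimately show ?thesis by simp
    qed
    fix f :: "'g \<Rightarrow> complex" assume f: "continuous_on UNIV f"
    define w where "w z = weight (unit_chart G) (ui z) *\<^sub>R f (ui z)" for z
    have cw: "continuous_on ?I w"
      unfolding w_def by (intro continuous_intros continuous_weight uca continuous_on_compose2[OF f uf(5)]) auto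
    let ?S = "ball u0 \<delta>" and ?B = "cbox a b"
    have SI: "?S \<subseteq> ?I" using \<delta>(2) AI by blast
    have SB: "(u, z) \<in> \<Omega>" if "u \<in> ?S" "z \<in> ?B" for u z
      using that \<delta>(2) ab(1) AB(5) by blast
    have int: "(\<integral>g. \<phi> (inv (ui u) \<otimes> g) *\<^sub>R f g \<partial>m) = integral ?B (\<lambda>z. bump u0 s (H (u, z)) *\<^sub>R w z)" if u: "u \<in> ?S" for u
    proof -
      have uI: "u \<in> ?I" using u SI by blast
      have z: "g \<in> ?U \<and> uc g \<in> ?B" if "\<phi> (inv (ui u) \<otimes> g) \<noteq> 0" for g
      proof -
        have "inv (ui u) \<otimes> g \<in> ui ` ball u0 s" using supp that by metis
        then obtain v where v: "inv (ui u) \<otimes> g = ui v" "v \<in> ball u0 s" by (rule imageE)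
        have g: "g = ui u \<otimes> ui v" unfolding v(1)[symmetric] by simp
        have "u \<in> C" using u \<delta>(2) by blast
        moreover have "v \<in> D" using v(2) s(2) ball_subset_cball by blast
        ultimately have "(u, v) \<in> ?P" using CD(5) by blast
        then have "ui u \<otimes> ui v \<in> ?U" "uc (ui u \<otimes> ui v) \<in> box a b" by simp_all
        then show ?thesis unfolding g using box_subset_cbox by blast
      qed
      have cF: "continuous_on UNIV (\<lambda>g. \<phi> (inv (ui u) \<otimes> g) *\<^sub>R f g)"
        by (intro continuous_intros f continuous_on_compose2[OF c\<phi>] continuous_on_id) auto
      have "(\<integral>g. \<phi> (inv (ui u) \<otimes> g) *\<^sub>R f g \<partial>m) = (\<integral>z. indicator ?I z *\<^sub>R (weight (unit_chart G) (ui z) *\<^sub>R (\<phi> (inv (ui u) \<otimes> ui z) *\<^sub>R f (ui z))) \<partial>lborel)"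
      proof (rule integral_density_measure[OF m atl uca continuous_weight[OF uca]])
        show "(\<lambda>g. \<phi> (inv (ui u) \<otimes> g) *\<^sub>R f g) \<in> borel_measurable borel" using cF by (rule borel_measurable_continuous_onI)
        show "\<phi> (inv (ui u) \<otimes> g) *\<^sub>R f g = 0" if "g \<notin> ?U" for g using z that by auto
        show "0 \<le> weight (unit_chart G) g" if "g \<in> ?U" for g using weight_eq[OF uca that] by simp
      qed
      also have "\<dots> = (LINT z : ?B | lborel. bump u0 s (H (u, z)) *\<^sub>R w z)"
        unfolding set_lebesgue_integral_def
      proof (rule Bochner_Integration.integral_cong[OF refl])
        fix z
        show "indicator ?I z *\<^sub>R (weight (unit_chart G) (ui z) *\<^sub>R (\<phi> (inv (ui u) \<otimes> ui z) *\<^sub>R f (ui z))) = indicator ?B z *\<^sub>R (bump u0 s (H (u, z)) *\<^sub>R w z)"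
        proof (cases "z \<in> ?B")
          case True
          then have "z \<in> ?I" using boxI by blast
          moreover have "\<phi> (inv (ui u) \<otimes> ui z) = bump u0 s (H (u, z))"
            using SB[OF u True] H[OF SB[OF u True]] by (simp add: \<Omega> \<phi>_def)
          ultimately show ?thesis using True by (simp add: w_def)
        next
          case False
          then have "z \<in> ?I \<Longrightarrow> \<phi> (inv (ui u) \<otimes> ui z) = 0" using z[of "ui z"] uf(8) by auto
          then show ?thesis using False by (auto simp: indicator_def)
        qed
      qed
      also have "\<dots> = integral ?B (\<lambda>z. bump u0 s (H (u, z)) *\<^sub>R w z)"
      proof (rule set_borel_integral_eq_integral(2))
        have "continuous_on ?B (\<lambda>z. bump u0 s (H (u, z)) *\<^sub>R w z)"
          by (intro continuous_intros continuous_on_subset[OF cw boxI] continuous_on_compose2[OF continuous_bump[of UNIV]]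
              continuous_on_compose2[OF smooth_on_continuous[OF sH]]) (use SB[OF u] in auto)
        then show "set_integrable lborel ?B (\<lambda>z. bump u0 s (H (u, z)) *\<^sub>R w z)"
          unfolding set_integrable_def by (rule borel_integrable_compact[OF compact_cbox])
      qed
      finally show ?thesis .
    qed
    define fx where "fx u z = Blinfun (\<lambda>\<xi>. dbump u0 s (H (u, z)) (frechet_derivative H (at (u, z)) (\<xi>, 0)) *\<^sub>R w z)" for u z
    have dH: "(H has_derivative frechet_derivative H (at p)) (at p)" if "p \<in> \<Omega>" for p
      by (rule smooth_on_D[OF oO sH that])
    have der: "((\<lambda>u. bump u0 s (H (u, z)) *\<^sub>R w z) has_derivative
        (\<lambda>\<xi>. dbump u0 s (H (u, z)) (frechet_derivative H (at (u, z)) (\<xi>, 0)) *\<^sub>R w z)) (at u)" if "u \<in> ?S" "z \<in> ?B" for u z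
    proof -
      have "((\<lambda>u. (u, z)) has_derivative (\<lambda>\<xi>. (\<xi>, 0))) (at u)" by (auto intro!: derivative_eq_intros)
      from has_derivative_compose[OF this dH[OF SB[OF that]]]
      have "((\<lambda>u. H (u, z)) has_derivative (\<lambda>\<xi>. frechet_derivative H (at (u, z)) (\<xi>, 0))) (at u)" .
      from has_derivative_scaleR_left[OF has_derivative_compose[OF this bump_derivative]] show ?thesis .
    qed
    have fx: "blinfun_apply (fx u z) = (\<lambda>\<xi>. dbump u0 s (H (u, z)) (frechet_derivative H (at (u, z)) (\<xi>, 0)) *\<^sub>R w z)" if "u \<in> ?S" "z \<in> ?B" for u z
      unfolding fx_def using has_derivative_bounded_linear[OF der[OF that]] by (rule bounded_linear_Blinfun_apply)
    have "((\<lambda>u. integral ?B (\<lambda>z. bump u0 s (H (u, z)) *\<^sub>R w z)) has_derivative integral ?B (fx u0)) (at u0 within ?S)"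
    proof (rule leibniz_rule)
      show "((\<lambda>u. bump u0 s (H (u, z)) *\<^sub>R w z) has_derivative blinfun_apply (fx u z)) (at u within ?S)" if "u \<in> ?S" "z \<in> ?B" for u z
        unfolding fx[OF that] using der[OF that] by (rule has_derivative_at_withinI)
      show "(\<lambda>z. bump u0 s (H (u, z)) *\<^sub>R w z) integrable_on ?B" if "u \<in> ?S" for u
        by (intro integrable_continuous continuous_intros continuous_on_subset[OF cw boxI] continuous_on_compose2[OF continuous_bump[of UNIV]]
              continuous_on_compose2[OF smooth_on_continuous[OF sH]]) (use SB[OF that] in auto)
      show "continuous_on (?S \<times> ?B) (\<lambda>(u, z). fx u z)"
      proof (rule continuous_on_blinfun_componentwise)
        fix i :: 'e
        have cH: "continuous_on (?S \<times> ?B) H" by (rule continuous_on_subset[OF smooth_on_continuous[OF sH]]) (use SB in auto)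
        have cD: "continuous_on (?S \<times> ?B) (\<lambda>p. frechet_derivative H (at p) (i, 0))"
          by (rule continuous_on_subset[OF smooth_on_continuous[OF smooth_on_deriv[OF oO sH]]]) (use SB in auto)
        have "continuous_on (?S \<times> ?B) (\<lambda>p. dbump u0 s (H p) (frechet_derivative H (at p) (i, 0)) *\<^sub>R w (snd p))"
          unfolding dbump_def by (intro continuous_intros cH cD continuous_on_compose2[OF cw]) (use boxI in auto)
        then show "continuous_on (?S \<times> ?B) (\<lambda>p. blinfun_apply (case p of (u, z) \<Rightarrow> fx u z) i)"
          by (rule continuous_on_eq) (auto simp: fx)
      qed
    qed (use \<delta>(1) in auto)
    then have "((\<lambda>u. integral ?B (\<lambda>z. bump u0 s (H (u, z)) *\<^sub>R w z)) has_derivative integral ?B (fx u0)) (at u0)"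
      using at_within_open[of u0 ?S] \<delta>(1) by simp
    then have "((\<lambda>u. \<integral>g. \<phi> (inv (ui u) \<otimes> g) *\<^sub>R f g \<partial>m) has_derivative integral ?B (fx u0)) (at u0)"
      by (rule has_derivative_transform_within_open[where s = ?S]) (use int \<delta>(1) in simp_all)
    then show "(\<lambda>u. \<integral>g. \<phi> (inv (ui u) \<otimes> g) *\<^sub>R f g \<partial>m) differentiable (at u0)"
      unfolding differentiable_def by fast
  qed
qed

end

section \<open>Unitary representations\<close>

text \<open>Vectors are sequences that vanish from n on, so that representations of different
  dimensions and the maps between them live on one type.\<close>

definition cvecs :: "nat \<Rightarrow> (nat \<Rightarrow> complex) set" where
  "cvecs n = {x. \<forall>i\<ge>n. x i = 0}"

definition rapp :: "nat \<Rightarrow> nat \<Rightarrow> (nat \<Rightarrow> nat \<Rightarrow> complex) \<Rightarrow> (nat \<Rightarrow> complex) \<Rightarrow> nat \<Rightarrow> complex" where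
  "rapp n k A x i = (if i < n then \<Sum>j<k. A i j * x j else 0)"

abbreviation "app n \<equiv> rapp n n"

definition cip :: "nat \<Rightarrow> (nat \<Rightarrow> complex) \<Rightarrow> (nat \<Rightarrow> complex) \<Rightarrow> complex" where
  "cip n x y = (\<Sum>i<n. cnj (x i) * y i)"

lemma cvecs_simps [simp]: "(\<lambda>_. 0) \<in> cvecs n" "x \<in> cvecs n \<Longrightarrow> y \<in> cvecs n \<Longrightarrow> (\<lambda>i. x i + y i) \<in> cvecs n"
  "x \<in> cvecs n \<Longrightarrow> (\<lambda>i. z * x i) \<in> cvecs n" "rapp n k A x \<in> cvecs n"
  by (auto simp: cvecs_def rapp_def)

lemma rapp_add: "rapp n k A (\<lambda>i. x i + y i) = (\<lambda>i. rapp n k A x i + rapp n k A y i)"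
  and rapp_scale: "rapp n k A (\<lambda>i. z * x i) = (\<lambda>i. z * rapp n k A x i)"
  and rapp_zero: "rapp n k A (\<lambda>_. 0) = (\<lambda>_. 0)"
  by (auto simp: rapp_def distrib_left sum.distrib sum_distrib_left mult.left_commute)

lemma app_app:
  assumes "\<And>i k. i < n \<Longrightarrow> k < n \<Longrightarrow> C i k = (\<Sum>j<n. A i j * B j k)"
  shows "app n A (app n B x) = app n C x"
proof
  fix i
  have "(\<Sum>j<n. A i j * (\<Sum>k<n. B j k * x k)) = (\<Sum>k<n. (\<Sum>j<n. A i j * B j k) * x k)"
    unfolding sum_distrib_left sum_distrib_right mult.assoc by (rule sum.swap)
  then show "app n A (app n B x) i = app n C x i"
    by (auto simp: rapp_def assms)
qed

lemma cip_app:
  assumes "\<And>i j. i < n \<Longrightarrow> j < n \<Longrightarrow> B i j = cnj (A j i)"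
  shows "cip n (app n A x) y = cip n x (app n B y)"
proof -
  have "cip n (app n A x) y = (\<Sum>i<n. \<Sum>j<n. cnj (A i j) * cnj (x j) * y i)"
    by (simp add: cip_def rapp_def sum_distrib_right)
  also have "\<dots> = (\<Sum>j<n. \<Sum>i<n. cnj (A i j) * cnj (x j) * y i)" by (rule sum.swap)
  also have "\<dots> = cip n x (app n B y)"
    by (simp add: cip_def rapp_def sum_distrib_left assms mult_ac)
  finally show ?thesis .
qed

lemma cip_add: "cip n x (\<lambda>i. y i + z i) = cip n x y + cip n x z"
  and cip_add_left: "cip n (\<lambda>i. y i + z i) x = cip n y x + cip n z x"
  and cip_scale: "cip n x (\<lambda>i. c * y i) = c * cip n x y"
  and cip_scale_left: "cip n (\<lambda>i. c * x i) y = cnj c * cip n x y"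
  and cip_cnj: "cip n x y = cnj (cip n y x)"
  and cip_zero: "cip n x (\<lambda>_. 0) = 0" "cip n (\<lambda>_. 0) x = 0"
  by (simp_all add: cip_def algebra_simps sum.distrib sum_distrib_left)

lemma cip_self_zero:
  assumes "x \<in> cvecs n" "cip n x x = 0"
  shows "x = (\<lambda>_. 0)"
proof -
  have "cip n x x = of_real (\<Sum>i<n. (cmod (x i))\<^sup>2)"
    unfolding cip_def of_real_sum
    by (intro sum.cong refl) (metis complex_norm_square mult.commute)
  then have "(\<Sum>i<n. (cmod (x i))\<^sup>2) = 0" using assms(2) by (metis of_real_eq_0_iff)
  then have "\<forall>i<n. x i = 0" by (simp add: sum_nonneg_eq_0_iff)
  then show ?thesis using assms(1) unfolding cvecs_def by (auto simp: fun_eq_iff) (metis not_le)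
qed

lemma bdet_bij:
  fixes A :: "'a::euclidean_space \<Rightarrow> 'a"
  assumes "linear A" "bij A"
  shows "bdet A \<noteq> 0"
proof -
  have "bdet (\<lambda>x. A (inv_into UNIV A x)) = bdet A * bdet (inv_into UNIV A)" by (rule bdet_compose[OF assms(1)])
  moreover have "(\<lambda>x. A (inv_into UNIV A x)) = (\<lambda>x. x)" using assms(2) by (simp add: bij_is_surj surj_f_inv_f)
  ultimately show ?thesis using bdet_id[where 'a='a] by auto
qed

context liegroup begin

lemma weight_pos: "c \<in> A0 \<Longrightarrow> p \<in> fst c \<Longrightarrow> 0 < weight c p"
  using weight_eq bdet_bij[OF cder_linear[OF theta_id] pull_thetaL_bij] by simp

text \<open>The density is positive in every chart, so an open null set would have a nonempty open
  image of Lebesgue measure zero. This keeps the smoothed vector in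
  \<open>act_differentiable\<close> from being zero.\<close>

lemma riemannian_open_pos:
  assumes m: "density_measure A0 weight m" and E: "open E" "E \<noteq> {}"
  shows "emeasure m E \<noteq> 0"
proof
  assume "emeasure m E = 0"
  obtain p where p: "p \<in> E" using E by blast
  obtain c where c: "c \<in> A0" "p \<in> fst c" using atlas_cover[OF atl] by blast
  note ch = atlas_chart[OF atl c(1)]
  let ?E = "fst c \<inter> E" let ?T = "snd c ` ?E"
  have sm: "sets m = sets borel" using m by (simp add: density_measure_def)
  have oE: "open ?E" using ch(1) E(1) by blast
  have oT: "open ?T" by (rule chart_image_open[OF atl c(1) E(1)])
  have "emeasure m ?E \<le> emeasure m E" using E(1) by (intro emeasure_mono) (auto simp: sm)
  then have "emeasure m ?E = 0" using \<open>emeasure m E = 0\<close> by simp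
  then have "(\<integral>\<^sup>+u\<in>?T. ennreal (weight c (chart_inv c u)) \<partial>lborel) = 0"
    using m c(1) borel_open[OF oE] unfolding density_measure_def by simp
  moreover have "(\<lambda>u. ennreal (weight c (chart_inv c u)) * indicator ?T u) \<in> borel_measurable borel"
    by (rule borel_restrict_ennreal[OF continuous_weight[OF c(1)]]) (use oT in auto)
  ultimately have "AE u in lborel. ennreal (weight c (chart_inv c u)) * indicator ?T u = 0"
    by (subst (asm) nn_integral_0_iff_AE) auto
  then have "AE u in lborel. u \<notin> ?T"
  proof eventually_elim
    case (elim u)
    show ?case
    proof
      assume u: "u \<in> ?T"
      then have "chart_inv c u \<in> fst c" using ch(6) by auto
      then have "0 < weight c (chart_inv c u)" by (rule weight_pos[OF c(1)])
      then show False using elim u by simp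
    qed
  qed
  then have "?T \<in> null_sets lborel" using oT by (subst AE_iff_null_sets) auto
  then have "negligible ?T" by (simp add: negligible_iff_null_sets null_sets_completionI)
  moreover have "?T \<noteq> {}" using p c(2) by blast
  ultimately show False using open_not_negligible[OF oT] by metis
qed

end

locale haar = liegroup +
  fixes m :: "'a measure"
  assumes riemannian: "riemannian_measure G m" and compactG: "compact (UNIV :: 'a set)"
begin

lemma dens: "density_measure A0 weight m"
  using riemannian unfolding riemannian_measure_def weight_def .

lemma sets_m [simp]: "sets m = sets borel" and space_m [simp]: "space m = UNIV"
  using dens sets_eq_imp_space_eq[of m borel] by (simp_all add: density_measure_def)

lemma meas_cont: "continuous_on UNIV f \<Longrightarrow> f \<in> borel_measurable m"
  unfolding measurable_cong_sets[OF sets_m refl] by (rule borel_measurable_continuous_onI)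

sublocale finite_measure m
  by (rule density_measure_finite[OF dens atl compactG continuous_weight])

lemma integrable_continuous_m:
  fixes f :: "'a \<Rightarrow> 'c::{banach, second_countable_topology}"
  assumes "continuous_on UNIV f"
  shows "integrable m f"
proof -
  have "bounded (range f)" using compact_continuous_image[OF assms compactG] by (rule compact_imp_bounded)
  then obtain B where "\<And>x. norm (f x) \<le> B" unfolding bounded_iff by blast
  then show ?thesis by (intro integrable_const_bound[of _ B] meas_cont assms) auto
qed

lemma integral_translate:
  fixes f :: "'a \<Rightarrow> 'c::{banach, second_countable_topology}"
  assumes "continuous_on UNIV f"
  shows "(\<integral>x. f (g \<otimes> x) \<partial>m) = (\<integral>x. f x \<partial>m)"
proof -
  have "(\<integral>x. f x \<partial>m) = (\<integral>x. f x \<partial>distr m borel (\<lambda>x. g \<otimes> x))" by (simp only: riemannian_left_invariant[OF riemannian])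
  also have "\<dots> = (\<integral>x. f (g \<otimes> x) \<partial>m)"
    by (intro integral_distr meas_cont continuous_intros continuous_on_id borel_measurable_continuous_onI assms)
  finally show ?thesis by simp
qed

end

locale irrep = haar +
  fixes n :: nat and r :: "'a \<Rightarrow> nat \<Rightarrow> nat \<Rightarrow> complex"
  assumes n_pos: "0 < n"
    and r_mult: "i < n \<Longrightarrow> k < n \<Longrightarrow> r (g \<otimes> h) i k = (\<Sum>j<n. r g i j * r h j k)"
    and r_inv: "i < n \<Longrightarrow> j < n \<Longrightarrow> r (inv g) i j = cnj (r g j i)"
    and r_one: "i < n \<Longrightarrow> j < n \<Longrightarrow> r \<one> i j = (if i = j then 1 else 0)"
    and r_cont: "i < n \<Longrightarrow> j < n \<Longrightarrow> continuous_on UNIV (\<lambda>g. r g i j)"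
    and irr: "W \<subseteq> cvecs n \<Longrightarrow> (\<lambda>_. 0) \<in> W \<Longrightarrow> (\<And>x y. x \<in> W \<Longrightarrow> y \<in> W \<Longrightarrow> (\<lambda>i. x i + y i) \<in> W) \<Longrightarrow>
      (\<And>z x. x \<in> W \<Longrightarrow> (\<lambda>i. z * x i) \<in> W) \<Longrightarrow> (\<And>g x. x \<in> W \<Longrightarrow> app n (r g) x \<in> W) \<Longrightarrow>
      W = {\<lambda>_. 0} \<or> W = cvecs n"
begin

abbreviation act :: "'a \<Rightarrow> (nat \<Rightarrow> complex) \<Rightarrow> nat \<Rightarrow> complex" where
  "act g \<equiv> app n (r g)"

lemma act_mult: "act (g \<otimes> h) x = act g (act h x)"
  by (rule app_app[symmetric]) (rule r_mult)

lemma act_one: "x \<in> cvecs n \<Longrightarrow> act \<one> x = x"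
  by (auto simp: rapp_def cvecs_def r_one if_distrib[of "\<lambda>z. z * _"] fun_eq_iff cong: if_cong)

lemma act_cont: "continuous_on UNIV (\<lambda>g. act g x i)"
  unfolding rapp_def by (cases "i < n") (auto intro!: continuous_intros r_cont)

text \<open>The differentiable vectors form an invariant subspace, which is nonzero by smoothing.\<close>

lemma act_differentiable:
  assumes x: "x \<in> cvecs n"
  shows "(\<lambda>u. act (ui u) x i) differentiable (at u0)"
proof -
  define W where "W = {x \<in> cvecs n. \<forall>i. (\<lambda>u. act (ui u) x i) differentiable (at u0)}"
  \<comment> \<open>Here the first diagonal coefficient has positive real part, so averaging over V
    cannot annihilate the first unit vector e.\<close>
  define V where "V = {g. 0 < Re (r g 0 0)}"
  define e where "e = (\<lambda>i. if i = (0::nat) then 1 else 0 :: complex)"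
  have e: "e \<in> cvecs n" using n_pos by (auto simp: e_def cvecs_def)
  have V: "open V" "\<one> \<in> V"
    unfolding V_def using n_pos by (auto intro!: open_Collect_less continuous_intros r_cont simp: r_one)
  obtain \<phi> where \<phi>: "continuous_on UNIV \<phi>" "\<And>g. 0 \<le> \<phi> g" "0 < \<phi> \<one>" "\<And>g. \<phi> g \<noteq> 0 \<Longrightarrow> g \<in> V"
    "\<And>f :: 'a \<Rightarrow> complex. continuous_on UNIV f \<Longrightarrow> (\<lambda>u. \<integral>g. \<phi> (inv (ui u) \<otimes> g) *\<^sub>R f g \<partial>m) differentiable (at u0)"
    using smoothing_kernel[OF dens V] by blast
  have int: "integrable m (\<lambda>g. \<phi> g *\<^sub>R act g y i)" for y i
    by (intro integrable_continuous_m continuous_intros \<phi>(1) act_cont)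
  define x' where "x' i = (\<integral>g. \<phi> g *\<^sub>R act g e i \<partial>m)" for i
  have "W = {\<lambda>_. 0} \<or> W = cvecs n"
  proof (rule irr)
    fix h x assume "x \<in> W"
    then have x: "x \<in> cvecs n" "\<And>i. (\<lambda>u. act (ui u) x i) differentiable (at u0)" by (auto simp: W_def)
    have "(\<lambda>u. act (ui u) (act h x) i) differentiable (at u0)" for i
    proof -
      \<comment> \<open>Moving h to the left replaces the germ by its conjugate, which again passes
        through the unit. Hence h preserves the differentiable vectors.\<close>
      have "ui u \<otimes> h = h \<otimes> conj (inv h) (ui u)" for u by (simp add: conj_def)
      then have "act (ui u) (act h x) = act h (act (conj (inv h) (ui u)) x)" for u
        by (simp flip: act_mult del: m_simps(1))
      moreover have "(\<lambda>u. act (conj (inv h) (ui u)) x j) differentiable (at u0)" for j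
        using x(2)[of j] cder_compose_ui[OF _ cder_hom[OF sm_conj conj_one(2) cder_ui], of "\<lambda>g. act g x j"]
        unfolding differentiable_def by blast
      ultimately show ?thesis
        by (cases "i < n") (simp_all add: rapp_def[of n n "r h"])
    qed
    then show "act h x \<in> W" by (simp add: W_def)
  qed (auto simp: W_def rapp_add rapp_scale rapp_zero cvecs_def)
  moreover have "x' \<in> W"
  proof -
    have x': "x' \<in> cvecs n" by (auto simp: x'_def cvecs_def rapp_def)
    \<comment> \<open>Left invariance shifts h from the representation to the kernel \<phi>, where
      it can be differentiated.\<close>
    have "act h x' i = (\<integral>g. \<phi> (inv h \<otimes> g) *\<^sub>R act g e i \<partial>m)" for h i
    proof (cases "i < n")
      case True
      have "act h x' i = (\<Sum>j<n. \<integral>g. r h i j * (\<phi> g *\<^sub>R act g e j) \<partial>m)"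
        using True int by (simp only: rapp_def[of n n "r h"] x'_def if_True integral_mult_right_zero)
      also have "\<dots> = (\<integral>g. (\<Sum>j<n. r h i j * (\<phi> g *\<^sub>R act g e j)) \<partial>m)"
        by (intro Bochner_Integration.integral_sum[symmetric] integrable_mult_right int)
      also have "\<dots> = (\<integral>g. \<phi> (inv h \<otimes> (h \<otimes> g)) *\<^sub>R act (h \<otimes> g) e i \<partial>m)"
        using True by (simp add: act_mult rapp_def[of n n "r h"] scaleR_sum_right)
      also have "\<dots> = (\<integral>g. \<phi> (inv h \<otimes> g) *\<^sub>R act g e i \<partial>m)"
        by (rule integral_translate[of "\<lambda>g. \<phi> (inv h \<otimes> g) *\<^sub>R act g e i"])
          (intro continuous_intros act_cont continuous_on_compose2[OF \<phi>(1)] continuous_on_id subset_UNIV)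
      finally show ?thesis .
    qed (simp add: rapp_def)
    then show ?thesis using x' \<phi>(5)[OF act_cont] by (simp add: W_def)
  qed
  moreover have "x' \<noteq> (\<lambda>_. 0)"
  proof
    assume "x' = (\<lambda>_. 0)"
    then have "Re (\<integral>g. \<phi> g *\<^sub>R act g e 0 \<partial>m) = 0" unfolding x'_def by (metis zero_complex.simps(1))
    then have 0: "(\<integral>g. Re (\<phi> g *\<^sub>R act g e 0) \<partial>m) = 0" using int by (subst integral_Re) auto
    have re: "Re (\<phi> g *\<^sub>R act g e 0) = \<phi> g * Re (r g 0 0)" for g
      using n_pos by (simp add: rapp_def e_def if_distrib[of "\<lambda>z. _ * z"] cong: if_cong)
    have cont: "continuous_on UNIV (\<lambda>g. \<phi> g * Re (r g 0 0))" using n_pos by (intro continuous_intros \<phi>(1) r_cont)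
    have pos: "0 \<le> \<phi> g * Re (r g 0 0)" for g using \<phi>(2,4)[of g] by (cases "\<phi> g = 0") (auto simp: V_def)
    have "AE g in m. \<phi> g * Re (r g 0 0) = 0"
      using integral_nonneg_eq_0_iff_AE[OF integrable_continuous_m[OF cont]] pos 0 unfolding re by simp
    then have "AE g in m. g \<notin> {g. 0 < \<phi> g * Re (r g 0 0)}" by (rule eventually_mono) auto
    moreover have o: "open {g. 0 < \<phi> g * Re (r g 0 0)}" by (intro open_Collect_less continuous_on_const cont)
    ultimately have "{g. 0 < \<phi> g * Re (r g 0 0)} \<in> null_sets m" by (subst AE_iff_null_sets) auto
    then have "emeasure m {g. 0 < \<phi> g * Re (r g 0 0)} = 0" by blast
    moreover have "\<one> \<in> {g. 0 < \<phi> g * Re (r g 0 0)}" using \<phi>(3) V(2) by (simp add: V_def)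
    ultimately show False using riemannian_open_pos[OF dens o] by blast
  qed
  ultimately have "W = cvecs n" by blast
  then show ?thesis using x by (auto simp: W_def)
qed

end

section \<open>The differentiated representation\<close>

context irrep begin

definition rd :: "'b \<Rightarrow> nat \<Rightarrow> nat \<Rightarrow> complex" where
  "rd \<xi> i j = vector_derivative (\<lambda>s. r (unit_curve G \<xi> s) i j) (at 0)"

abbreviation "D \<xi> \<equiv> app n (rd \<xi>)"

lemma r_derivative:
  assumes ij: "i < n" "j < n" and q: "cder q a A"
  shows "((\<lambda>u. r (q u) i j) has_derivative (\<lambda>v. rd (A v) i j)) (at a)"
proof -
  define e where "e = (\<lambda>k. if k = j then 1 else 0 :: complex)"
  have e: "e \<in> cvecs n" using ij by (auto simp: e_def cvecs_def)
  have "act g e i = r g i j" for g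
    using ij by (simp add: rapp_def e_def if_distrib[of "\<lambda>z. _ * z"] cong: if_cong)
  then obtain L where L: "((\<lambda>u. r (ui u) i j) has_derivative L) (at u0)"
    using act_differentiable[OF e, of i] unfolding differentiable_def by auto
  have "rd \<xi> i j = L \<xi>" for \<xi>
  proof -
    have "((\<lambda>s. r (unit_curve G \<xi> s) i j) has_vector_derivative L \<xi>) (at 0)"
      using cder_compose_ui[of "\<lambda>g. r g i j", OF L cder_unit_curve[of \<xi>]] linear_scale[OF has_derivative_linear[OF L]]
      by (simp add: has_vector_derivative_def)
    then show ?thesis unfolding rd_def by (rule vector_derivative_at)
  qed
  then show ?thesis using cder_compose_ui[of "\<lambda>g. r g i j", OF L q] by simp
qed

lemma rd_linear: "i < n \<Longrightarrow> j < n \<Longrightarrow> linear (\<lambda>\<xi>. rd \<xi> i j)"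
  using has_derivative_linear[OF r_derivative[OF _ _ cder_ui]] .

lemma D_add: "D (\<xi> + \<eta>) x i = D \<xi> x i + D \<eta> x i"
  and D_scale: "D (c *\<^sub>R \<xi>) x i = c * D \<xi> x i"
  and D_zero: "D 0 x i = 0"
  by (simp_all add: rapp_def linear_add[OF rd_linear] linear_scale[OF rd_linear] linear_0[OF rd_linear]
      distrib_right sum.distrib sum_distrib_left scaleR_conv_of_real mult.assoc)

lemma D_neg: "D (- \<xi>) x i = - D \<xi> x i"
  using D_scale[of "-1" \<xi> x i] by simp

lemma act_derivative:
  assumes "cder q a A"
  shows "((\<lambda>u. act (q u) x i) has_derivative (\<lambda>v. D (A v) x i)) (at a)"
proof (cases "i < n")
  case True
  have "((\<lambda>u. \<Sum>j<n. r (q u) i j * x j) has_derivative (\<lambda>v. \<Sum>j<n. rd (A v) i j * x j)) (at a)"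
    by (intro has_derivative_sum has_derivative_mult_left r_derivative True assms) simp
  then show ?thesis using True by (simp add: rapp_def)
qed (simp add: rapp_def)

lemma act_vector_derivative:
  assumes "cder q 0 (\<lambda>s. s *\<^sub>R \<xi>)"
  shows "((\<lambda>s. act (q s) x i) has_vector_derivative D \<xi> x i) (at 0)"
  using act_derivative[OF assms, of x i] by (simp add: has_vector_derivative_def D_scale scaleR_conv_of_real)

lemma rapp_derivative:
  assumes "\<And>j. ((\<lambda>s. f s j) has_derivative (\<lambda>v. f' v j)) (at a)"
  shows "((\<lambda>s. rapp n' k A (f s) i) has_derivative (\<lambda>v. rapp n' k A (f' v) i)) (at a)"
  using assms by (cases "i < n'") (auto simp: rapp_def intro!: has_derivative_sum has_derivative_mult_right)

lemma rapp_vector_derivative: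
  assumes "\<And>j. ((\<lambda>s. f s j) has_vector_derivative f' j) (at a)"
  shows "((\<lambda>s. rapp n' k A (f s) i) has_vector_derivative rapp n' k A f' i) (at a)"
  using rapp_derivative[of f "\<lambda>v j. v *\<^sub>R f' j" a n' k A i] assms
  by (simp add: has_vector_derivative_def scaleR_conv_of_real rapp_scale)

lemma D_Ad: "act g (D \<xi> x) = D (Ad G g \<xi>) (act g x)"
proof
  fix i
  have c: "cder (\<lambda>s. conj g (unit_curve G \<xi> s)) 0 (\<lambda>s. s *\<^sub>R Ad G g \<xi>)"
    using cder_hom[OF sm_conj[of g] _ cder_unit_curve[of \<xi>]] by (simp add: Ad_conj[symmetric] linear_scale[OF Ad_linear])
  have "conj g h \<otimes> g = g \<otimes> h" for h by (simp add: conj_def)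
  then have "act (conj g h) (act g x) = act g (act h x)" for h
    by (simp flip: act_mult)
  moreover have "((\<lambda>s. act g (act (unit_curve G \<xi> s) x) i) has_vector_derivative act g (D \<xi> x) i) (at 0)"
    by (rule rapp_vector_derivative) (rule act_vector_derivative[OF cder_unit_curve])
  ultimately show "act g (D \<xi> x) i = D (Ad G g \<xi>) (act g x) i"
    using vector_derivative_unique_at[OF act_vector_derivative[OF c, of "act g x" i]] by simp
qed

text \<open>Differentiate \<open>D_Ad\<close> along a curve in the direction \<eta>. The product
  rule yields the bracket from the moving Ad, and the iterated action from the moving
  vector.\<close>

lemma D_bracket:
  assumes x: "x \<in> cvecs n"
  shows "D \<eta> (D \<xi> x) i = D (lie_bracket G \<eta> \<xi>) x i + D \<xi> (D \<eta> x) i"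
proof (cases "i < n")
  case True
  let ?\<gamma> = "unit_curve G \<eta>"
  have 1: "((\<lambda>s. act (?\<gamma> s) (D \<xi> x) i) has_vector_derivative D \<eta> (D \<xi> x) i) (at 0)"
    by (rule act_vector_derivative[OF cder_unit_curve])
  have 2: "((\<lambda>s. rd (Ad G (?\<gamma> s) \<xi>) i j) has_vector_derivative rd (lie_bracket G \<eta> \<xi>) i j) (at 0)" if "j < n" for j
    using bounded_linear.has_vector_derivative[OF _ bracket_vector_derivative, of "\<lambda>\<xi>. rd \<xi> i j"] rd_linear[OF True that]
    by (simp add: linear_conv_bounded_linear)
  have "((\<lambda>s. \<Sum>j<n. rd (Ad G (?\<gamma> s) \<xi>) i j * act (?\<gamma> s) x j) has_vector_derivative
    (\<Sum>j<n. rd (Ad G (?\<gamma> 0) \<xi>) i j * D \<eta> x j + rd (lie_bracket G \<eta> \<xi>) i j * act (?\<gamma> 0) x j)) (at 0)"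
    by (intro has_vector_derivative_sum has_vector_derivative_mult 2 act_vector_derivative[OF cder_unit_curve]) simp
  then have "((\<lambda>s. act (?\<gamma> s) (D \<xi> x) i) has_vector_derivative D \<xi> (D \<eta> x) i + D (lie_bracket G \<eta> \<xi>) x i) (at 0)"
    using True x by (simp add: D_Ad rapp_def[of n n "rd _"] act_one sum.distrib)
  from vector_derivative_unique_at[OF 1 this] show ?thesis by simp
qed (simp add: rapp_def)

lemma rd_skew:
  assumes "i < n" "j < n"
  shows "rd \<xi> i j = - cnj (rd \<xi> j i)"
proof -
  have "((\<lambda>s. r (unit_curve G \<xi> s) j i) has_vector_derivative rd \<xi> j i) (at 0)"
    using r_derivative[OF assms(2,1) cder_unit_curve] linear_scale[OF rd_linear[OF assms(2,1)]]
    by (simp add: has_vector_derivative_def)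
  then have 1: "((\<lambda>s. cnj (r (unit_curve G \<xi> s) j i)) has_vector_derivative cnj (rd \<xi> j i)) (at 0)"
    by (rule has_vector_derivative_cnj)
  have "((\<lambda>s. r (inv (unit_curve G \<xi> s)) i j) has_vector_derivative - rd \<xi> i j) (at 0)"
    using r_derivative[OF assms cder_inv[OF cder_unit_curve]] linear_scale[OF rd_linear[OF assms]] linear_neg[OF rd_linear[OF assms]]
    by (simp add: has_vector_derivative_def)
  then have "- rd \<xi> i j = cnj (rd \<xi> j i)"
    using vector_derivative_unique_at[OF 1] by (simp add: r_inv assms)
  then show ?thesis by (metis minus_minus)
qed

text \<open>The complex-linear extension of the action to the complexified Lie algebra.\<close>

definition cop :: "'b \<times> 'b \<Rightarrow> (nat \<Rightarrow> complex) \<Rightarrow> nat \<Rightarrow> complex" where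
  "cop e = app n (\<lambda>i j. rd (fst e) i j + \<i> * rd (snd e) i j)"

lemma cop_D: "cop e x i = D (fst e) x i + \<i> * D (snd e) x i"
  by (simp add: cop_def rapp_def distrib_right sum.distrib sum_distrib_left mult.assoc)

lemma cop_add: "cop (e + f) x = (\<lambda>i. cop e x i + cop f x i)"
  and cop_scale: "cop (c *\<^sub>R e) x = (\<lambda>i. of_real c * cop e x i)"
  by (simp_all add: fun_eq_iff cop_D D_add D_scale algebra_simps)

lemma cop_real: "cop (\<xi>, 0) x = D \<xi> x"
  by (simp add: fun_eq_iff cop_D D_zero)

lemma cop_bracket:
  assumes "x \<in> cvecs n"
  shows "cop e (cop f x) = (\<lambda>i. cop f (cop e x) i + cop (cx_bracket G e f) x i)"
proof
  fix i
  have ex: "cop e (cop f x) i = D (fst e) (D (fst f) x) i + \<i> * D (fst e) (D (snd f) x) i + \<i> * D (snd e) (D (fst f) x) i - D (snd e) (D (snd f) x) i" for e f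
  proof -
    have "cop f x = (\<lambda>i. D (fst f) x i + \<i> * D (snd f) x i)" by (simp add: fun_eq_iff cop_D)
    then show ?thesis by (simp add: cop_D rapp_add rapp_scale algebra_simps)
  qed
  have "cop (cx_bracket G e f) x i =
    (D (lie_bracket G (fst e) (fst f)) x i - D (lie_bracket G (snd e) (snd f)) x i)
    + \<i> * (D (lie_bracket G (fst e) (snd f)) x i + D (lie_bracket G (snd e) (fst f)) x i)"
    using D_add[of "lie_bracket G (fst e) (fst f)" "- lie_bracket G (snd e) (snd f)" x i]
    by (simp add: cop_D cx_bracket_def D_add D_neg)
  then show "cop e (cop f x) i = cop f (cop e x) i + cop (cx_bracket G e f) x i"
    unfolding ex[of e f] ex[of f e] D_bracket[OF assms, of "fst e" "fst f"] D_bracket[OF assms, of "fst e" "snd f"]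
      D_bracket[OF assms, of "snd e" "fst f"] D_bracket[OF assms, of "snd e" "snd f"]
    by (simp add: algebra_simps)
qed

text \<open>Real elements act by skew-hermitian operators, so the adjoint of a complex element is
  the action of minus its conjugate. With \<open>root_space_conj\<close>, raising and lowering
  operators are adjoint to each other.\<close>

lemma cop_adj: "cip n (cop e x) y = cip n x (cop (- cx_cnj e) y)"
  unfolding cop_def
proof (rule cip_app)
  fix i j assume ij: "i < n" "j < n"
  show "rd (fst (- cx_cnj e)) i j + \<i> * rd (snd (- cx_cnj e)) i j = cnj (rd (fst e) j i + \<i> * rd (snd e) j i)"
    using rd_skew[OF ij, of "fst e"] rd_skew[OF ij, of "snd e"]
    by (simp add: cx_cnj_def linear_neg[OF rd_linear[OF ij]])
qed

lemma D_skew: "cip n (D \<xi> x) y = - cip n x (D \<xi> y)"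
proof -
  have "cip n (D \<xi> x) y = cip n x (app n (\<lambda>i j. - rd \<xi> i j) y)" by (rule cip_app) (subst rd_skew, simp_all)
  then show ?thesis by (simp add: cip_def rapp_def sum_negf)
qed

section \<open>Highest weight vectors\<close>

definition hw :: "'b pinning \<Rightarrow> 'b \<Rightarrow> (nat \<Rightarrow> complex) \<Rightarrow> bool" where
  "hw P lam v \<longleftrightarrow> v \<in> cvecs n \<and> v \<noteq> (\<lambda>_. 0) \<and>
    (\<forall>h\<in>cartan P. D h v = (\<lambda>i. (2 * pi * \<i> * of_real (lam \<bullet> h)) * v i)) \<and>
    (\<forall>\<alpha>\<in>positive_roots G P. \<forall>e\<in>root_space G (cartan P) \<alpha>. cop e v = (\<lambda>_. 0))"

text \<open>Linear combinations of words in negative root vectors applied to v. For a highest weight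
  vector v this is the submodule it generates; see \<open>lowered_stable\<close>.\<close>

inductive_set lowered for P v where
  base: "v \<in> lowered P v"
| add: "x \<in> lowered P v \<Longrightarrow> y \<in> lowered P v \<Longrightarrow> (\<lambda>i. x i + y i) \<in> lowered P v"
| scale: "x \<in> lowered P v \<Longrightarrow> (\<lambda>i. z * x i) \<in> lowered P v"
| lower: "\<alpha> \<in> positive_roots G P \<Longrightarrow> f \<in> root_space G (cartan P) (- \<alpha>) \<Longrightarrow> x \<in> lowered P v \<Longrightarrow> cop f x \<in> lowered P v"

lemma lowered_cvecs: "x \<in> lowered P v \<Longrightarrow> v \<in> cvecs n \<Longrightarrow> x \<in> cvecs n"
  by (induction rule: lowered.induct) (auto simp: cvecs_def cop_def rapp_def)

end

lemma (in liegroup) root_space_conj: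
  assumes "e \<in> root_space G \<tt> (- \<alpha>)"
  shows "- cx_cnj e \<in> root_space G \<tt> \<alpha>"
  unfolding root_space_def
proof (intro CollectI ballI)
  fix h assume "h \<in> \<tt>"
  then have "cx_bracket G (h, 0) e = cx_scale (2 * pi * \<i> * of_real (- \<alpha> \<bullet> h)) e" using assms by (simp add: root_space_def)
  then show "cx_bracket G (h, 0) (- cx_cnj e) = cx_scale (2 * pi * \<i> * of_real (\<alpha> \<bullet> h)) (- cx_cnj e)"
    using linear_0[OF bracket_linear1] linear_neg[OF bracket_linear2]
    by (auto simp: cx_bracket_def cx_scale_def cx_cnj_def prod_eq_iff)
qed

locale metric_irrep = irrep + metric_liegroup

context metric_irrep begin

text \<open>For v itself, the root space decomposition splits e into parts that scale, kill or lower
  v. A lowered vector f x is treated with e f = f e + [e, f], for which the induction hypothesis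
  must hold for all e at once.\<close>

lemma lowered_stable:
  assumes P: "is_pinning G P" and v: "hw P lam v" and x: "x \<in> lowered P v"
  shows "cop e x \<in> lowered P v"
  using x
proof (induction arbitrary: e)
  case base
  let ?t = "cartan P"
  have vc: "v \<in> cvecs n" using v by (simp add: hw_def)
  have t: "cartan_subalgebra G ?t" using P by (simp add: is_pinning_def)
  have zero: "(\<lambda>_. 0) \<in> lowered P v" using lowered.scale[OF lowered.base, of 0 v P] by simp
  have mem: "e \<in> span (?t \<times> ?t \<union> (\<Union>\<alpha>\<in>roots G ?t. root_space G ?t \<alpha>))" using root_decomposition[OF t] by simp
  have sub: "subspace {e. cop e v \<in> lowered P v}"
  proof (rule subspaceI)
    show "0 \<in> {e. cop e v \<in> lowered P v}" using zero cop_scale[of 0 0 v] by simp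
  qed (simp_all add: cop_add cop_scale lowered.add lowered.scale)
  have "?t \<times> ?t \<union> (\<Union>\<alpha>\<in>roots G ?t. root_space G ?t \<alpha>) \<subseteq> {e. cop e v \<in> lowered P v}"
  proof
    fix e assume "e \<in> ?t \<times> ?t \<union> (\<Union>\<alpha>\<in>roots G ?t. root_space G ?t \<alpha>)"
    then consider "e \<in> ?t \<times> ?t" | \<alpha> where "\<alpha> \<in> roots G ?t" "e \<in> root_space G ?t \<alpha>" by blast
    then show "e \<in> {e. cop e v \<in> lowered P v}"
    proof cases
      case 1
      then have "cop e v = (\<lambda>i. (2 * pi * \<i> * of_real (lam \<bullet> fst e) + \<i> * (2 * pi * \<i> * of_real (lam \<bullet> snd e))) * v i)"
        using v by (auto simp: fun_eq_iff cop_D hw_def algebra_simps)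
      then show ?thesis using lowered.scale[OF lowered.base, of _ v P] by simp
    next
      case 2
      then consider "\<alpha> \<in> positive_roots G P" | "- \<alpha> \<in> positive_roots G P" using P by (auto simp: is_pinning_def)
      then show ?thesis
      proof cases
        case 1
        then show ?thesis using v 2 zero by (simp add: hw_def)
      next
        case neg: 2
        then show ?thesis using lowered.lower[OF neg _ lowered.base, of e v] 2 by simp
      qed
    qed
  qed
  from subsetD[OF span_minimal[OF this sub] mem] show ?case by simp
next
  case (add x y)
  then show ?case unfolding cop_def rapp_add by (intro lowered.add)
next
  case (scale x z)
  then show ?case unfolding cop_def rapp_scale by (intro lowered.scale)
next
  case (lower \<alpha> f x)
  have "x \<in> cvecs n" using lowered_cvecs[OF lower.hyps(3)] v by (simp add: hw_def)
  from lowered.add[OF lowered.lower[OF lower.hyps(1,2) lower.IH[of e]] lower.IH[of "cx_bracket G e f"]]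
  show ?case unfolding cop_bracket[OF \<open>x \<in> cvecs n\<close>, of e f] .
qed

text \<open>In the inner product with w, a lowering operator moves over as a raising operator, which
  kills w.\<close>

lemma lowered_orthogonal:
  assumes v: "hw P lam v" and w: "hw P mu w" and ne: "cip n w v = 0" and x: "x \<in> lowered P v"
  shows "cip n w x = 0"
  using x
proof induction
  case (lower \<alpha> f x)
  have "cip n w (cop f x) = cnj (cip n x (cop (- cx_cnj f) w))"
    by (subst cip_cnj) (simp only: cop_adj)
  moreover have "cop (- cx_cnj f) w = (\<lambda>_. 0)"
    using root_space_conj[OF lower.hyps(2)] lower.hyps(1) w by (auto simp: hw_def)
  ultimately show ?case by (simp add: cip_zero)
qed (simp_all add: ne cip_add cip_scale)

lemma hw_orthogonal:
  assumes v: "hw P lam v" and w: "hw P mu w" and h: "h \<in> cartan P" "lam \<bullet> h \<noteq> mu \<bullet> h"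
  shows "cip n w v = 0"
proof -
  have "cip n (D h w) v = - cip n w (D h v)" by (rule D_skew)
  moreover have "D h w = (\<lambda>i. (2 * pi * \<i> * of_real (mu \<bullet> h)) * w i)" "D h v = (\<lambda>i. (2 * pi * \<i> * of_real (lam \<bullet> h)) * v i)"
    using v w h(1) by (simp_all add: hw_def)
  ultimately have "2 * pi * \<i> * (of_real (lam \<bullet> h) - of_real (mu \<bullet> h)) * cip n w v = 0"
    by (simp only: cip_scale cip_scale_left) (auto simp: algebra_simps)
  then show ?thesis using h(2) by auto
qed

end

lemma app_rank_one:
  assumes "e \<in> cvecs n"
  shows "app n (\<lambda>i j. A i j + e i * (c * cnj (e j))) x = (\<lambda>i. app n A x i + (c * cip n e x) * e i)"
  using assms by (auto simp: rapp_def cvecs_def cip_def ring_distribs sum.distrib sum_distrib_left sum_distrib_right mult_ac fun_eq_iff)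

text \<open>Gram-Schmidt along the coordinates: the projection for the vectors of W with vanishing
  last coordinate is corrected by a rank one term along a vector e of W orthogonal to them. The
  result is a matrix, so it can be applied under derivatives.\<close>

lemma orthogonal_projection_exists:
  assumes "W \<subseteq> cvecs n" "(\<lambda>_. 0) \<in> W" "\<And>x y. x \<in> W \<Longrightarrow> y \<in> W \<Longrightarrow> (\<lambda>i. x i + y i) \<in> W"
    and "\<And>z x. x \<in> W \<Longrightarrow> (\<lambda>i. z * x i) \<in> W"
  shows "\<exists>P. (\<forall>x. app n P x \<in> W) \<and> (\<forall>w\<in>W. \<forall>x. cip n w (app n P x) = cip n w x)"
proof -
  have "\<exists>P. (\<forall>x. app n P x \<in> W) \<and> (\<forall>w\<in>W. \<forall>x. cip n w (app n P x) = cip n w x)"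
    if "\<And>x i. x \<in> W \<Longrightarrow> k \<le> i \<Longrightarrow> x i = 0" for k
    using assms that
  proof (induction k arbitrary: W)
    case 0
    have "w = (\<lambda>_. 0)" if "w \<in> W" for w using 0(5)[OF that] by (simp add: fun_eq_iff)
    then have "W = {\<lambda>_. 0}" using 0(2) by blast
    then show ?case by (intro exI[of _ "\<lambda>_ _. 0"]) (auto simp: rapp_def cip_zero)
  next
    case (Suc k)
    note W = Suc.prems(1-4)
    let ?W = "{x \<in> W. x k = 0}"
    have "\<exists>P. (\<forall>x. app n P x \<in> ?W) \<and> (\<forall>w\<in>?W. \<forall>x. cip n w (app n P x) = cip n w x)"
    proof (rule Suc.IH)
      show "?W \<subseteq> cvecs n" using W(1) by blast
      show "x i = 0" if "x \<in> ?W" "k \<le> i" for x i using that Suc.prems(5)[of x i] by (cases "i = k") auto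
    qed (use W in simp_all)
    then obtain P where P: "\<And>x. app n P x \<in> ?W" "\<And>w x. w \<in> ?W \<Longrightarrow> cip n w (app n P x) = cip n w x" by blast
    show ?case
    proof (cases "W = ?W")
      case True
      then show ?thesis using P by metis
    next
      case False
      then obtain y where y: "y \<in> W" "y k \<noteq> 0" by blast
      define e where "e = (\<lambda>i. y i + (- 1) * app n P y i)"
      have e: "e \<in> W" "e k \<noteq> 0" using P(1)[of y] y W(3)[OF y(1) W(4), of "app n P y" "- 1"] by (auto simp: e_def)
      have ec: "e \<in> cvecs n" and e0: "cip n e e \<noteq> 0" using e W(1) cip_self_zero[of e n] by auto
      have o: "cip n w e = 0" if "w \<in> ?W" for w
        using P(2)[OF that, of y] unfolding e_def cip_add cip_scale by simp
      have o': "cip n e (app n P x) = 0" for x using o[OF P(1)[of x]] cip_cnj[of n e "app n P x"] by simp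
      define c where "c = 1 / cip n e e"
      have c: "c * cip n e e = 1" using e0 by (simp add: c_def)
      note r = app_rank_one[OF ec, of P c]
      show ?thesis
      proof (intro exI[of _ "\<lambda>i j. P i j + e i * (c * cnj (e j))"] conjI allI ballI)
        fix x show "app n (\<lambda>i j. P i j + e i * (c * cnj (e j))) x \<in> W"
          unfolding r using P(1)[of x] e(1) by (intro W(3,4)) auto
        fix w assume w: "w \<in> W"
        define a where "a = w k / e k"
        define w' where "w' = (\<lambda>i. w i + (- a) * e i)"
        have w': "w' \<in> ?W" using W(3)[OF w W(4)[OF e(1)], of "- a"] e(2) by (simp add: w'_def a_def)
        have "w = (\<lambda>i. w' i + a * e i)" by (simp add: w'_def)
        then show "cip n w (app n (\<lambda>i j. P i j + e i * (c * cnj (e j))) x) = cip n w x"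
          unfolding r by (simp add: c cip_add cip_add_left cip_scale cip_scale_left P(2)[OF w'] o[OF w'] o')
      qed
    qed
  qed
  from this[of n] show ?thesis using assms(1) by (auto simp: cvecs_def)
qed

text \<open>The orthogonal projection onto a Lie algebra invariant subspace commutes with the Lie algebra, hence the derivative
  of its conjugates by the group vanishes.\<close>

theorem (in irrep) lie_irreducible:
  assumes conn: "connected (UNIV :: 'a set)" and W: "W \<subseteq> cvecs n" "(\<lambda>_. 0) \<in> W" "\<And>x y. x \<in> W \<Longrightarrow> y \<in> W \<Longrightarrow> (\<lambda>i. x i + y i) \<in> W"
      "\<And>z x. x \<in> W \<Longrightarrow> (\<lambda>i. z * x i) \<in> W" and D: "\<And>\<xi> x. x \<in> W \<Longrightarrow> D \<xi> x \<in> W"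
  shows "W = {\<lambda>_. 0} \<or> W = cvecs n"
proof (rule irr[OF W])
  fix h x assume x: "x \<in> W"
  obtain P where P: "\<And>x. app n P x \<in> W" "\<And>w x. w \<in> W \<Longrightarrow> cip n w (app n P x) = cip n w x"
    using orthogonal_projection_exists[OF W] by blast
  \<comment> \<open>The projection of x is characterised within W by its inner products with
    W.\<close>
  have eq: "app n P x = y" if "y \<in> W" "\<And>w. w \<in> W \<Longrightarrow> cip n w y = cip n w x" for x y
  proof -
    let ?d = "\<lambda>i. app n P x i + (- 1) * y i"
    have d: "?d \<in> W" using that(1) P(1) by (intro W(3,4))
    moreover have "cip n ?d ?d = 0" unfolding cip_add[of n ?d] cip_scale[of n ?d] P(2)[OF d] that(2)[OF d] by simp
    ultimately have "?d = (\<lambda>_. 0)" using cip_self_zero[of ?d n] W(1) by blast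
    then show ?thesis by (auto simp: fun_eq_iff)
  qed
  have PD: "app n P (D \<xi> x) = D \<xi> (app n P x)" for \<xi> x
  proof (rule eq[OF D[OF P(1)]])
    fix w assume w: "w \<in> W"
    have "cip n w (D \<xi> y) = - cip n (D \<xi> w) y" for y by (simp add: D_skew)
    then show "cip n w (D \<xi> (app n P x)) = cip n w (D \<xi> x)" by (simp only: P(2)[OF D[OF w]])
  qed
  define F where "F g = act g (app n P (act (inv g) x))" for g
  \<comment> \<open>The product rule at the unit gives the commutator of the projection with the Lie
    algebra, which is zero by \<open>PD\<close>.\<close>
  have dq: "((\<lambda>u. act (q u) (app n P (act (inv (q u)) z)) i) has_derivative (\<lambda>_. 0)) (at a)" if q: "cder q a A" and z: "z \<in> cvecs n" for q a A z i
  proof (cases "i < n")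
    case True
    have qa: "q a = \<one>" using q by (simp add: cder_def)
    have "((\<lambda>u. \<Sum>j<n. r (q u) i j * app n P (act (inv (q u)) z) j) has_derivative
      (\<lambda>v. \<Sum>j<n. r (q a) i j * app n P (D (- A v) z) j + rd (A v) i j * app n P (act (inv (q a)) z) j)) (at a)"
      by (intro has_derivative_sum has_derivative_mult r_derivative[OF True _ q] rapp_derivative act_derivative cder_inv q) simp
    moreover have "(\<Sum>j<n. r (q a) i j * app n P (D (- A v) z) j + rd (A v) i j * app n P (act (inv (q a)) z) j) = 0" for v
    proof -
      have "(\<Sum>j<n. r (q a) i j * app n P (D (- A v) z) j + rd (A v) i j * app n P (act (inv (q a)) z) j)
        = act (q a) (app n P (D (- A v) z)) i + D (A v) (app n P (act (inv (q a)) z)) i"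
        using True by (simp add: rapp_def[of n n "r _"] rapp_def[of n n "rd _"] sum.distrib)
      also have "\<dots> = 0" by (simp add: qa act_one z PD D_neg)
      finally show ?thesis .
    qed
    ultimately show ?thesis using True by (simp add: rapp_def[of n n "r _"])
  qed (simp add: rapp_def)
  obtain \<rho> where \<rho>: "0 < \<rho>" "ball u0 \<rho> \<subseteq> uc ` fst (unit_chart G)"
    using unit_chart_facts(2) u0_mem open_contains_ball by blast
  define N where "N = fst (unit_chart G) \<inter> uc -` ball u0 \<rho>"
  have N: "open N" "\<one> \<in> N"
    using continuous_open_preimage[OF unit_chart_facts(4,1) open_ball] one_uc \<rho>(1) by (simp_all add: N_def)
  \<comment> \<open>At a nearby point g (ui u) the chart is shifted to a germ through the unit, to
    which \<open>dq\<close> applies; so the derivative of F vanishes throughout a ball in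
    coordinates.\<close>
  have loc: "F (g \<otimes> k) = F g" if k: "k \<in> N" for g k
  proof
    fix i
    have "((\<lambda>w. F (g \<otimes> ui w) i) has_derivative (\<lambda>_. 0)) (at u)" if "u \<in> ball u0 \<rho>" for u
    proof -
      have u: "u \<in> uc ` fst (unit_chart G)" using that \<rho>(2) by blast
      let ?q = "\<lambda>w. inv (ui u) \<otimes> ui w" and ?h = "g \<otimes> ui u"
      have c: "cder ?q u (pull_thetaL G (unit_chart G) id (ui u))"
        using theta_id[OF uca unit_chart_facts(7)[OF u]] by (simp add: unit_chart_facts(8)[OF u])
      have "F (g \<otimes> ui w) = act ?h (act (?q w) (app n P (act (inv (?q w)) (act (inv ?h) x))))" for w
        by (simp add: F_def flip: act_mult)
      moreover have "((\<lambda>w. act ?h (act (?q w) (app n P (act (inv (?q w)) (act (inv ?h) x)))) i) has_derivative (\<lambda>_. act ?h (\<lambda>_. 0) i)) (at u)"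
        by (rule rapp_derivative) (rule dq[OF c cvecs_simps(4)])
      ultimately show ?thesis by (simp add: rapp_zero)
    qed
    then have "F (g \<otimes> ui (uc k)) i = F (g \<otimes> ui u0) i"
      using k \<rho>(1) by (intro has_derivative_zero_unique_connected[of "ball u0 \<rho>" "\<lambda>w. F (g \<otimes> ui w) i"])
        (auto simp: N_def)
    then show "F (g \<otimes> k) i = F g i" using k unit_chart_facts(6) by (simp add: N_def)
  qed
  \<comment> \<open>Being locally constant, F is constant. At the inverse of h this says that the
    projection of h x is h applied to the projection of x, and x is its own projection.\<close>
  have "F (inv h) = F \<one>"
  proof (rule connected_local_const[OF conn UNIV_I UNIV_I], intro ballI)
    fix g
    have "open ((\<lambda>h. inv g \<otimes> h) -` N)" by (rule open_vimage[OF N(1)]) (intro continuous_intros continuous_on_id)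
    then have "\<forall>\<^sub>F h in nhds g. h \<in> (\<lambda>h. inv g \<otimes> h) -` N" by (rule eventually_nhds_in_open) (simp add: N)
    then have "\<forall>\<^sub>F h in at g. h \<in> (\<lambda>h. inv g \<otimes> h) -` N" by (simp add: eventually_at_filter eventually_mono)
    then show "\<forall>\<^sub>F h in at g. F g = F h"
      by (rule eventually_mono) (use loc[of "inv g \<otimes> _" g] in auto)
  qed
  then have "act h (F (inv h)) = act h (app n P x)" using x W(1) by (simp add: F_def act_one subsetD)
  moreover have "app n P x = x" using x by (intro eq) simp_all
  ultimately have "act h x = app n P (act h x)" by (simp add: F_def act_one flip: act_mult)
  then show "act h x \<in> W" using P(1) by metis
qed

text \<open>By irreducibility under the Lie algebra, the vectors lowered from v fill the space. If
  the weights differed, w would be orthogonal to v, hence to all these vectors and so to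
  itself.\<close>

theorem (in metric_irrep) highest_weight_unique:
  assumes conn: "connected (UNIV :: 'a set)" and P: "is_pinning G P"
    and v: "hw P lam v" and w: "hw P mu w" and lm: "lam \<in> cartan P" "mu \<in> cartan P"
  shows "lam = mu"
proof (rule ccontr)
  assume ne: "lam \<noteq> mu"
  let ?W = "lowered P v"
  have t: "subspace (cartan P)" using P by (simp add: is_pinning_def cartan_subalgebra_def)
  have vc: "v \<in> cvecs n" "v \<noteq> (\<lambda>_. 0)" and wc: "w \<in> cvecs n" "w \<noteq> (\<lambda>_. 0)" using v w by (auto simp: hw_def)
  \<comment> \<open>The difference of the weights is an element of the Cartan subalgebra on which
    they take different values.\<close>
  have "lam \<bullet> (lam - mu) \<noteq> mu \<bullet> (lam - mu)" using ne by (metis inner_diff_left inner_eq_zero_iff right_minus_eq)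
  then have wv: "cip n w v = 0" by (rule hw_orthogonal[OF v w subspace_diff[OF t lm]])
  have "?W = {\<lambda>_. 0} \<or> ?W = cvecs n"
  proof (rule lie_irreducible[OF conn])
    show "?W \<subseteq> cvecs n" using lowered_cvecs vc by blast
    show "(\<lambda>_. 0) \<in> ?W" using lowered.scale[OF lowered.base, of 0 v P] by simp
    show "D \<xi> x \<in> ?W" if "x \<in> ?W" for \<xi> x
      using lowered_stable[OF P v that, of "(\<xi>, 0)"] by (simp add: cop_real)
  qed (rule lowered.add lowered.scale; assumption)+
  then have "w \<in> ?W" using vc wc lowered.base[of v P] by auto
  from lowered_orthogonal[OF v w wv this] show False using cip_self_zero wc by blast
qed

section \<open>Schur orthogonality\<close>

lemma app_eigenvector:
  assumes "0 < n"
  obtains a x where "x \<in> cvecs n" "x \<noteq> (\<lambda>_. 0)" "app n S x = (\<lambda>i. a * x i)"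
proof -
  define A where "A = Matrix.mat n n (\<lambda>(i, j). S i j)"
  have A: "A \<in> carrier_mat n n" by (simp add: A_def)
  obtain as where as: "char_poly A = (\<Prod>a\<leftarrow>as. [:- a, 1:])" "length as = n" using char_poly_factorized[OF A] by blast
  then obtain a where "a \<in> set as" using assms by (cases as) auto
  then have "poly (char_poly A) a = 0" unfolding as(1) by (auto simp: poly_prod_list prod_list_zero_iff)
  then have "eigenvalue A a" using eigenvalue_root_char_poly[OF A] by blast
  then obtain v where v: "v \<in> carrier_vec n" "v \<noteq> 0\<^sub>v n" "A *\<^sub>v v = a \<cdot>\<^sub>v v"
    using A unfolding eigenvalue_def eigenvector_def by auto
  define x where "x = (\<lambda>i. if i < n then vec_index v i else 0)"
  show thesis
  proof (rule that[of x a])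
    show "x \<in> cvecs n" by (simp add: x_def cvecs_def)
    show "x \<noteq> (\<lambda>_. 0)"
    proof
      assume "x = (\<lambda>_. 0)"
      then have "vec_index v i = 0" if "i < n" for i using that by (metis x_def)
      then have "v = 0\<^sub>v n" using v(1) by (intro eq_vecI) auto
      then show False using v(2) by simp
    qed
    show "app n S x = (\<lambda>i. a * x i)"
    proof
      fix i
      show "app n S x i = a * x i"
      proof (cases "i < n")
        case True
        have "vec_index (A *\<^sub>v v) i = a * vec_index v i" using v(1,3) True by simp
        then show ?thesis using True v(1) A by (simp add: rapp_def x_def A_def Matrix.scalar_prod_def lessThan_atLeast0)
      qed (simp add: rapp_def x_def)
    qed
  qed
qed

definition unit_cvec :: "nat \<Rightarrow> nat \<Rightarrow> complex" where
  "unit_cvec j = (\<lambda>i. if i = j then 1 else 0)"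

lemma unit_cvec [simp]: "j < n \<Longrightarrow> unit_cvec j \<in> cvecs n"
  by (auto simp: unit_cvec_def cvecs_def)

lemma rapp_unit: "i < n \<Longrightarrow> j < k \<Longrightarrow> rapp n k T (unit_cvec j) i = T i j"
  by (simp add: rapp_def unit_cvec_def if_distrib[of "\<lambda>z. _ * z"] cong: if_cong)

lemma (in irrep) schur_scalar:
  assumes S: "\<And>g x. x \<in> cvecs n \<Longrightarrow> app n S (act g x) = act g (app n S x)"
  obtains c where "\<And>i j. i < n \<Longrightarrow> j < n \<Longrightarrow> S i j = (if i = j then c else 0)"
proof -
  obtain a x where x: "x \<in> cvecs n" "x \<noteq> (\<lambda>_. 0)" "app n S x = (\<lambda>i. a * x i)" by (rule app_eigenvector[OF n_pos])
  define W where "W = {x \<in> cvecs n. app n S x = (\<lambda>i. a * x i)}"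
  have "W = {\<lambda>_. 0} \<or> W = cvecs n"
    by (rule irr) (auto simp: W_def rapp_add rapp_scale rapp_zero S distrib_left mult.left_commute)
  moreover have "x \<in> W" using x by (simp add: W_def)
  ultimately have W: "W = cvecs n" using x(2) by blast
  have "S i j = (if i = j then a else 0)" if "i < n" "j < n" for i j
  proof -
    have "unit_cvec j \<in> W" unfolding W using that(2) by simp
    then have "app n S (unit_cvec j) = (\<lambda>i. a * unit_cvec j i)" by (simp add: W_def)
    from fun_cong[OF this, of i] show ?thesis using rapp_unit[OF that, of S] by (auto simp: unit_cvec_def)
  qed
  then show thesis using that by blast
qed

text \<open>The kernel of an intertwiner is invariant, so a nonzero one is injective.
  Differentiating the intertwining relation along curves shows that it maps a highest weight vector
  to one of the same weight, against \<open>highest_weight_unique\<close>.\<close>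

lemma (in metric_irrep) intertwiner_zero:
  assumes B: "metric_irrep G m k s" and conn: "connected (UNIV :: 'a set)" and P: "is_pinning G P"
    and v: "hw P lam v" and w: "irrep.hw G k s P mu w" and lm: "lam \<in> cartan P" "mu \<in> cartan P" "lam \<noteq> mu"
    and T: "\<And>g x. x \<in> cvecs k \<Longrightarrow> rapp n k T (app k (s g) x) = act g (rapp n k T x)"
    and ij: "i < n" "j < k"
  shows "T i j = 0"
proof (rule ccontr)
  assume nz: "T i j \<noteq> 0"
  interpret B: metric_irrep G m k s by fact
  define W where "W = {x \<in> cvecs k. rapp n k T x = (\<lambda>_. 0)}"
  have "W = {\<lambda>_. 0} \<or> W = cvecs k"
    by (rule B.irr) (auto simp: W_def rapp_add rapp_scale T rapp_zero)
  moreover have "unit_cvec j \<notin> W" using nz rapp_unit[OF ij, of T] by (auto simp: W_def dest: fun_cong[of _ _ i])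
  ultimately have W: "W = {\<lambda>_. 0}" using unit_cvec[OF ij(2)] by blast
  have wc: "w \<in> cvecs k" "w \<noteq> (\<lambda>_. 0)" using w by (auto simp: B.hw_def)
  let ?w = "rapp n k T w"
  have D: "D \<xi> (rapp n k T x) = rapp n k T (B.D \<xi> x)" if x: "x \<in> cvecs k" for \<xi> x
  proof
    fix i
    have "((\<lambda>s. act (unit_curve G \<xi> s) (rapp n k T x) i) has_vector_derivative D \<xi> (rapp n k T x) i) (at 0)"
      by (rule act_vector_derivative[OF cder_unit_curve])
    moreover have "((\<lambda>t. rapp n k T (B.act (unit_curve G \<xi> t) x) i) has_vector_derivative rapp n k T (B.D \<xi> x) i) (at 0)"
      by (rule rapp_vector_derivative) (rule B.act_vector_derivative[OF cder_unit_curve])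
    ultimately show "D \<xi> (rapp n k T x) i = rapp n k T (B.D \<xi> x) i"
      using vector_derivative_unique_at by (simp add: T[OF x]) blast
  qed
  have C: "cop e ?w = rapp n k T (B.cop e w)" for e
  proof -
    have e: "B.cop e w = (\<lambda>i. B.D (fst e) w i + \<i> * B.D (snd e) w i)" by (simp add: fun_eq_iff B.cop_D)
    have "cop e ?w i = rapp n k T (\<lambda>i. B.D (fst e) w i + \<i> * B.D (snd e) w i) i" for i
      by (simp add: cop_D D[OF wc(1)] rapp_add rapp_scale)
    then show ?thesis unfolding e by (rule HOL.ext)
  qed
  have "hw P mu ?w"
    unfolding hw_def
  proof (intro conjI ballI)
    show "?w \<noteq> (\<lambda>_. 0)" using W wc by (auto simp: W_def)
    show "D h ?w = (\<lambda>i. 2 * pi * \<i> * of_real (mu \<bullet> h) * ?w i)" if "h \<in> cartan P" for h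
      using w that by (simp only: D[OF wc(1)] B.hw_def rapp_scale)
    show "cop e ?w = (\<lambda>_. 0)" if "\<alpha> \<in> positive_roots G P" "e \<in> root_space G (cartan P) \<alpha>" for \<alpha> e
    proof -
      have "B.cop e w = (\<lambda>_. 0)" using w that by (simp add: B.hw_def)
      then show ?thesis by (simp add: C) (simp add: rapp_def fun_eq_iff)
    qed
  qed simp
  from highest_weight_unique[OF conn P v this lm(1,2)] lm(3) show False by blast
qed

text \<open>T is the integral over y of r(y) E times the adjoint of s(y), with E the matrix unit at
  (a, b). Translating y by g shows that it intertwines.\<close>

lemma (in irrep) averaged_intertwiner:
  assumes B: "irrep G m k s" and ab: "a < n" "b < k" and x: "x \<in> cvecs k"
  defines "T \<equiv> \<lambda>i j. \<integral>y. r y i a * cnj (s y j b) \<partial>m"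
  shows "rapp n k T (app k (s g) x) = act g (rapp n k T x)"
proof
  fix i
  interpret B: irrep G m k s by fact
  have cont: "continuous_on UNIV (\<lambda>y. r y i a * cnj (s y j b))" if "i < n" "j < k" for i j
    using that ab by (intro continuous_intros r_cont B.r_cont)
  note int = integrable_continuous_m[OF cont]
  have Tt: "T i j = (\<Sum>p<n. \<Sum>q<k. r g i p * cnj (s g j q) * T p q)" if ij: "i < n" "j < k" for i j
  proof -
    have "T i j = (\<integral>y. r (g \<otimes> y) i a * cnj (s (g \<otimes> y) j b) \<partial>m)"
      unfolding T_def using integral_translate[OF cont[OF ij], of g] by simp
    also have "\<dots> = (\<integral>y. (\<Sum>p<n. \<Sum>q<k. (r g i p * cnj (s g j q)) * (r y p a * cnj (s y q b))) \<partial>m)"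
      using ij ab by (intro Bochner_Integration.integral_cong refl) (simp add: r_mult B.r_mult sum_product mult_ac)
    also have "\<dots> = (\<Sum>p<n. \<Sum>q<k. \<integral>y. (r g i p * cnj (s g j q)) * (r y p a * cnj (s y q b)) \<partial>m)"
    proof -
      have "(\<integral>y. (\<Sum>q<k. (r g i p * cnj (s g j q)) * (r y p a * cnj (s y q b))) \<partial>m) = (\<Sum>q<k. \<integral>y. (r g i p * cnj (s g j q)) * (r y p a * cnj (s y q b)) \<partial>m)"
        if "p < n" for p
        using that int by (intro Bochner_Integration.integral_sum integrable_mult_right) simp
      moreover have "(\<integral>y. (\<Sum>p<n. \<Sum>q<k. (r g i p * cnj (s g j q)) * (r y p a * cnj (s y q b))) \<partial>m)
        = (\<Sum>p<n. \<integral>y. (\<Sum>q<k. (r g i p * cnj (s g j q)) * (r y p a * cnj (s y q b))) \<partial>m)"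
        using int by (intro Bochner_Integration.integral_sum Bochner_Integration.integrable_sum integrable_mult_right) simp
      ultimately show ?thesis by simp
    qed
    also have "\<dots> = (\<Sum>p<n. \<Sum>q<k. r g i p * cnj (s g j q) * T p q)"
      unfolding T_def by (simp only: integral_mult_right_zero)
    finally show ?thesis .
  qed
  have uni: "(\<Sum>j<k. cnj (s g j q) * s g j l) = (if q = l then 1 else 0)" if "q < k" "l < k" for q l
  proof -
    have "(if q = l then 1 else 0) = (\<Sum>j<k. s (inv g) q j * s g j l)" using B.r_mult[OF that, of "inv g" g] by (simp add: B.r_one that)
    then show ?thesis using that by (simp add: B.r_inv)
  qed
  have Ts: "(\<Sum>j<k. T i j * s g j l) = (\<Sum>p<n. r g i p * T p l)" if i: "i < n" and l: "l < k" for l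
  proof -
    have "(\<Sum>j<k. T i j * s g j l) = (\<Sum>j<k. \<Sum>p<n. \<Sum>q<k. r g i p * T p q * (cnj (s g j q) * s g j l))"
      using i by (intro sum.cong refl) (simp add: Tt[of i] sum_distrib_left sum_distrib_right mult_ac)
    also have "\<dots> = (\<Sum>p<n. \<Sum>q<k. \<Sum>j<k. r g i p * T p q * (cnj (s g j q) * s g j l))"
      by (subst sum.swap) (intro sum.cong refl sum.swap)
    also have "\<dots> = (\<Sum>p<n. \<Sum>q<k. r g i p * T p q * (if q = l then 1 else 0))"
      using l by (intro sum.cong refl) (simp add: uni flip: sum_distrib_left)
    also have "\<dots> = (\<Sum>p<n. r g i p * T p l)" using l by (simp add: if_distrib[of "\<lambda>z. _ * z"] cong: if_cong)
    finally show ?thesis .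
  qed
  show "rapp n k T (app k (s g) x) i = act g (rapp n k T x) i"
  proof (cases "i < n")
    case True
    have "rapp n k T (app k (s g) x) i = (\<Sum>l<k. (\<Sum>j<k. T i j * s g j l) * x l)"
      using True by (simp add: rapp_def rapp_def sum_distrib_left sum_distrib_right mult.assoc) (rule sum.swap)
    also have "\<dots> = (\<Sum>l<k. (\<Sum>p<n. r g i p * T p l) * x l)" using True by (simp add: Ts)
    also have "\<dots> = act g (rapp n k T x) i"
      using True by (simp add: rapp_def rapp_def sum_distrib_left sum_distrib_right mult.assoc) (rule sum.swap)
    finally show ?thesis .
  qed (simp add: rapp_def rapp_def)
qed

lemma (in metric_irrep) schur_orthogonality_distinct:
  assumes B: "metric_irrep G m k s" and conn: "connected (UNIV :: 'a set)" and P: "is_pinning G P"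
    and v: "hw P lam v" and w: "irrep.hw G k s P mu w" and lm: "lam \<in> cartan P" "mu \<in> cartan P" "lam \<noteq> mu"
    and ij: "i < n" "a < n" "j < k" "b < k"
  shows "(\<integral>y. r y i a * cnj (s y j b) \<partial>m) = 0"
proof -
  interpret B: metric_irrep G m k s by fact
  show ?thesis
    by (rule intertwiner_zero[OF B conn P v w lm averaged_intertwiner ij(1,3),
        OF B.irrep_axioms ij(2,4)])
qed

text \<open>The averaged operator is a scalar c by Schur's lemma. Its trace can be taken under the
  integral, where unitarity makes it constant, and this determines c.\<close>

lemma (in irrep) schur_orthogonality:
  assumes ij: "i < n" "a < n" "j < n" "b < n"
  shows "(\<integral>y. r y i a * cnj (r y j b) \<partial>m) = (if i = j \<and> a = b then measure m UNIV / n else 0)"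
proof -
  define T where "T = (\<lambda>i j. \<integral>y. r y i a * cnj (r y j b) \<partial>m)"
  obtain c where c: "\<And>i j. i < n \<Longrightarrow> j < n \<Longrightarrow> T i j = (if i = j then c else 0)"
    using schur_scalar[of T] averaged_intertwiner[OF irrep_axioms ij(2,4)] unfolding T_def by blast
  have uni: "(\<Sum>i<n. r y i a * cnj (r y i b)) = (if a = b then 1 else 0)" for y
  proof -
    have "(\<Sum>i<n. r y i a * cnj (r y i b)) = (\<Sum>i<n. r (inv y) b i * r y i a)"
      using ij by (intro sum.cong refl) (simp add: r_inv)
    also have "\<dots> = r \<one> b a" using r_mult[OF ij(4,2), of "inv y" y] by simp
    finally show ?thesis using ij by (auto simp: r_one)
  qed
  have "of_nat n * c = (\<Sum>i<n. T i i)" by (simp add: c)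
  also have "\<dots> = (\<integral>y. (\<Sum>i<n. r y i a * cnj (r y i b)) \<partial>m)"
    unfolding T_def using ij by (intro Bochner_Integration.integral_sum[symmetric] integrable_continuous_m continuous_intros r_cont) auto
  also have "\<dots> = (if a = b then measure m UNIV else 0)" by (simp add: uni scaleR_conv_of_real)
  finally have "c = (if a = b then measure m UNIV / n else 0)" using n_pos by (auto simp: field_simps split: if_splits)
  then show ?thesis using c[OF ij(1,3)] by (simp add: T_def)
qed

section \<open>Twining characters\<close>

lemma mat_adjoint_dim [simp]: "dim_row (mat_adjoint A) = dim_col A" "dim_col (mat_adjoint A) = dim_row A"
  by (simp_all add: mat_adjoint_def)

lemma mat_adjoint_carrier [simp]: "A \<in> carrier_mat n n \<Longrightarrow> mat_adjoint A \<in> carrier_mat n n"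
  by (intro carrier_matI) auto

lemma mat_adjoint_index:
  fixes A :: "complex Matrix.mat"
  assumes "A \<in> carrier_mat n n" "i < n" "j < n"
  shows "mat_adjoint A $$ (i, j) = cnj (A $$ (j, i))"
  using assms by (simp add: mat_adjoint_def mat_of_rows_index)

lemma mat_mult_index:
  assumes "A \<in> carrier_mat n n" "B \<in> carrier_mat n n" "i < n" "j < n"
  shows "(A * B) $$ (i, j) = (\<Sum>k<n. A $$ (i, k) * B $$ (k, j))"
  using assms by (simp add: Matrix.scalar_prod_def lessThan_atLeast0)

lemma mat_adjoint_adjoint:
  fixes A :: "complex Matrix.mat"
  assumes "A \<in> carrier_mat n n"
  shows "mat_adjoint (mat_adjoint A) = A"
  by (rule eq_matI) (use assms in \<open>auto simp: mat_adjoint_index[of _ n]\<close>)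

lemma mat_adjoint_mult:
  fixes A B :: "complex Matrix.mat"
  assumes A: "A \<in> carrier_mat n n" and B: "B \<in> carrier_mat n n"
  shows "mat_adjoint (A * B) = mat_adjoint B * mat_adjoint A"
proof (rule eq_matI)
  have AB: "A * B \<in> carrier_mat n n" using A B by simp
  fix i j assume "i < dim_row (mat_adjoint B * mat_adjoint A)" "j < dim_col (mat_adjoint B * mat_adjoint A)"
  then have ij: "i < n" "j < n" using A B by auto
  show "mat_adjoint (A * B) $$ (i, j) = (mat_adjoint B * mat_adjoint A) $$ (i, j)"
    unfolding mat_adjoint_index[OF AB ij] mat_mult_index[OF A B ij(2,1)] mat_mult_index[OF mat_adjoint_carrier[OF B] mat_adjoint_carrier[OF A] ij]
    using ij by (simp add: mat_adjoint_index[OF A] mat_adjoint_index[OF B] mult.commute)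
qed simp_all

lemma mat_trace_mult:
  assumes "A \<in> carrier_mat n n" "B \<in> carrier_mat n n"
  shows "mat_trace (A * B) = (\<Sum>i<n. \<Sum>j<n. A $$ (i, j) * B $$ (j, i))"
proof -
  have "mat_trace (A * B) = (\<Sum>i<n. (A * B) $$ (i, i))" using assms by (simp add: mat_trace_def)
  then show ?thesis using mat_mult_index[OF assms] by simp
qed

lemma mat_trace_comm:
  assumes "A \<in> carrier_mat n n" "B \<in> carrier_mat n n"
  shows "mat_trace (A * B) = mat_trace (B * A)"
  unfolding mat_trace_mult[OF assms] mat_trace_mult[OF assms(2,1)]
  by (subst sum.swap) (simp add: mult.commute)

lemma mat_trace_adjoint:
  assumes "A \<in> carrier_mat n n"
  shows "mat_trace (mat_adjoint A) = cnj (mat_trace A)"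
  using assms mat_adjoint_carrier[OF assms] by (auto simp: mat_trace_def mat_adjoint_index[OF assms])

lemma mat_trace_one: "mat_trace (1\<^sub>m n) = of_nat n"
  by (simp add: mat_trace_def)

lemma unitary_matD:
  assumes "unitary_mat n A"
  shows "A \<in> carrier_mat n n" "mat_adjoint A \<in> carrier_mat n n" "mat_adjoint A * A = 1\<^sub>m n" "A * mat_adjoint A = 1\<^sub>m n"
proof -
  show A: "A \<in> carrier_mat n n" "mat_adjoint A * A = 1\<^sub>m n" using assms by (auto simp: unitary_mat_def)
  then show A': "mat_adjoint A \<in> carrier_mat n n" by simp
  from mat_mult_left_right_inverse[OF A'(1) A(1) A(2)] show "A * mat_adjoint A = 1\<^sub>m n" .
qed

lemma unitary_mat_cancel:
  assumes "unitary_mat n A" "X \<in> carrier_mat n n"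
  shows "mat_adjoint A * (A * X) = X" "A * (mat_adjoint A * X) = X"
  using assms unitary_matD[OF assms(1)] by (simp_all flip: assoc_mult_mat[of _ n n _ n _ n])

lemma unitary_mat_mult:
  assumes A: "unitary_mat n A" and B: "unitary_mat n B"
  shows "unitary_mat n (A * B)"
  unfolding unitary_mat_def
  using unitary_matD[OF A] unitary_matD[OF B] unitary_mat_cancel(1)[OF A, of B]
  by (simp add: mat_adjoint_mult[of _ n] assoc_mult_mat[of _ n n _ n _ n])

lemma unitary_mat_adjoint:
  assumes "unitary_mat n A"
  shows "unitary_mat n (mat_adjoint A)"
  unfolding unitary_mat_def using unitary_matD[OF assms] by (simp add: mat_adjoint_adjoint[of _ n])

context
  fixes G :: "('g::{t2_space, second_countable_topology}, 'e::euclidean_space) lie_group" and n \<rho>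
  assumes lie: "is_lie_group G" and rep: "unitary_rep G n \<rho>"
begin

interpretation liegroup G using lie by unfold_locales

lemma unitary_repD: "unitary_mat n (\<rho> g)" "\<rho> (g \<otimes>\<^bsub>G\<^esub> h) = \<rho> g * \<rho> h" "\<rho> g \<in> carrier_mat n n"
  "i < n \<Longrightarrow> j < n \<Longrightarrow> continuous_on UNIV (\<lambda>g. \<rho> g $$ (i, j))"
  using rep unfolding unitary_rep_def unitary_mat_def by blast+

lemma unitary_rep_one: "\<rho> \<one>\<^bsub>G\<^esub> = 1\<^sub>m n"
proof -
  have "\<rho> \<one>\<^bsub>G\<^esub> * \<rho> \<one>\<^bsub>G\<^esub> = \<rho> \<one>\<^bsub>G\<^esub>" by (simp flip: unitary_repD(2))
  then show ?thesis
    using unitary_mat_cancel(1)[OF unitary_repD(1) unitary_repD(3), of "\<one>\<^bsub>G\<^esub>" "\<one>\<^bsub>G\<^esub>"] unitary_matD(3)[OF unitary_repD(1), of "\<one>\<^bsub>G\<^esub>"] by simp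
qed

lemma unitary_rep_inv: "\<rho> (inv\<^bsub>G\<^esub> g) = mat_adjoint (\<rho> g)"
proof -
  have "\<rho> g * \<rho> (inv\<^bsub>G\<^esub> g) = 1\<^sub>m n" by (simp flip: unitary_repD(2) add: unitary_rep_one)
  then have "mat_adjoint (\<rho> g) * (\<rho> g * \<rho> (inv\<^bsub>G\<^esub> g)) = mat_adjoint (\<rho> g)"
    using right_mult_one_mat[OF unitary_matD(2)[OF unitary_repD(1)]] by simp
  then show ?thesis using unitary_mat_cancel(1)[OF unitary_repD(1) unitary_repD(3)] by simp
qed

lemma rep_mult_vec:
  assumes "x \<in> cvecs n"
  shows "\<rho> g *\<^sub>v Matrix.vec n x = Matrix.vec n (app n (\<lambda>i j. \<rho> g $$ (i, j)) x)"
  by (rule eq_vecI) (use unitary_repD(3)[of g] in \<open>auto simp: rapp_def Matrix.scalar_prod_def lessThan_atLeast0\<close>)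

end

lemma vec_inj_cvecs: "x \<in> cvecs n \<Longrightarrow> y \<in> cvecs n \<Longrightarrow> Matrix.vec n x = Matrix.vec n y \<Longrightarrow> x = y"
  unfolding cvecs_def by (rule HOL.ext) (metis (mono_tags) index_vec mem_Collect_eq not_le)

definition fun_of_vec :: "nat \<Rightarrow> complex Matrix.vec \<Rightarrow> nat \<Rightarrow> complex" where
  "fun_of_vec n v i = (if i < n then vec_index v i else 0)"

lemma fun_of_vec: "fun_of_vec n v \<in> cvecs n" "v \<in> carrier_vec n \<Longrightarrow> Matrix.vec n (fun_of_vec n v) = v"
  by (auto simp: fun_of_vec_def cvecs_def)

section \<open>The chosen irreducible representations\<close>

locale compact_lie = haar + metric_liegroup +
  fixes P :: "'b pinning" and R :: "('a, 'b) irreps"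
  assumes conn: "connected (UNIV :: 'a set)" and pinning: "is_pinning G P" and irreps: "is_irreps G P R"
begin

abbreviation "\<Lambda> \<equiv> dominant_weights G P"

lemma irrepsD:
  assumes "lam \<in> \<Lambda>"
  shows "unitary_rep G (rdim R lam) (rep R lam)" "irreducible_rep (rdim R lam) (rep R lam)"
    "highest_weight_vector G P lam (rdim R lam) (rep R lam) (hvec R lam)"
    "\<kappa> \<in> lie_Out G P \<Longrightarrow> lam \<in> fixed_weights G P \<kappa> \<Longrightarrow> twist_operator (rdim R lam) (rep R lam) (hvec R lam) \<kappa> (twist R \<kappa> lam)"
  using irreps assms unfolding is_irreps_def by blast+

lemma metric_irrep_lam:
  assumes lam: "lam \<in> \<Lambda>"
  shows "metric_irrep G m (rdim R lam) (\<lambda>g i j. rep R lam g $$ (i, j))"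
proof -
  let ?n = "rdim R lam" and ?\<rho> = "rep R lam"
  note u = irrepsD(1)[OF lam]
  note ud = unitary_repD[OF lie u] and uo = unitary_rep_one[OF lie u] and ui = unitary_rep_inv[OF lie u]
  show ?thesis
  proof unfold_locales
    show "0 < ?n" using irrepsD(2)[OF lam] by (simp add: irreducible_rep_def)
    show "?\<rho> (g \<otimes> h) $$ (i, k) = (\<Sum>j<?n. ?\<rho> g $$ (i, j) * ?\<rho> h $$ (j, k))" if "i < ?n" "k < ?n" for g h i k
      unfolding ud(2) by (rule mat_mult_index[OF ud(3) ud(3) that])
    show "?\<rho> (inv g) $$ (i, j) = cnj (?\<rho> g $$ (j, i))" if "i < ?n" "j < ?n" for g i j
      unfolding ui by (rule mat_adjoint_index[OF ud(3) that])
    show "?\<rho> \<one> $$ (i, j) = (if i = j then 1 else 0)" if "i < ?n" "j < ?n" for i j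
      using that by (simp add: uo)
    show "continuous_on UNIV (\<lambda>g. ?\<rho> g $$ (i, j))" if "i < ?n" "j < ?n" for i j
      by (rule ud(4)[OF that])
    fix W :: "(nat \<Rightarrow> complex) set"
    assume W: "W \<subseteq> cvecs ?n" "(\<lambda>_. 0) \<in> W" "\<And>x y. x \<in> W \<Longrightarrow> y \<in> W \<Longrightarrow> (\<lambda>i. x i + y i) \<in> W"
      "\<And>z x. x \<in> W \<Longrightarrow> (\<lambda>i. z * x i) \<in> W" "\<And>g x. x \<in> W \<Longrightarrow> app ?n (\<lambda>i j. ?\<rho> g $$ (i, j)) x \<in> W"
    let ?W = "Matrix.vec ?n ` W"
    have "?W \<subseteq> carrier_vec ?n \<and> 0\<^sub>v ?n \<in> ?W \<and> (\<forall>v\<in>?W. \<forall>w\<in>?W. v + w \<in> ?W) \<and> (\<forall>z. \<forall>w\<in>?W. z \<cdot>\<^sub>v w \<in> ?W) \<and> (\<forall>g. \<forall>w\<in>?W. ?\<rho> g *\<^sub>v w \<in> ?W)"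
    proof (intro conjI ballI allI)
      show "0\<^sub>v ?n \<in> ?W" by (rule image_eqI[OF _ W(2)]) auto
      show "v + w \<in> ?W" if "v \<in> ?W" "w \<in> ?W" for v w
      proof -
        obtain x y where xy: "x \<in> W" "y \<in> W" "v = Matrix.vec ?n x" "w = Matrix.vec ?n y" using \<open>v \<in> ?W\<close> \<open>w \<in> ?W\<close> by blast
        show ?thesis by (rule image_eqI[OF _ W(3)[OF xy(1,2)]]) (auto simp: xy(3,4))
      qed
      show "z \<cdot>\<^sub>v w \<in> ?W" if "w \<in> ?W" for z w
      proof -
        obtain x where x: "x \<in> W" "w = Matrix.vec ?n x" using \<open>w \<in> ?W\<close> by blast
        show ?thesis by (rule image_eqI[OF _ W(4)[OF x(1), of z]]) (auto simp: x(2))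
      qed
      show "?\<rho> g *\<^sub>v w \<in> ?W" if "w \<in> ?W" for g w
      proof -
        obtain x where x: "x \<in> W" "w = Matrix.vec ?n x" using \<open>w \<in> ?W\<close> by blast
        show ?thesis unfolding x(2) using rep_mult_vec[OF lie u, of x g] x(1) W(1,5) by blast
      qed
    qed auto
    then have "?W = {0\<^sub>v ?n} \<or> ?W = carrier_vec ?n" using irrepsD(2)[OF lam] unfolding irreducible_rep_def by blast
    then show "W = {\<lambda>_. 0} \<or> W = cvecs ?n"
    proof
      assume W0: "?W = {0\<^sub>v ?n}"
      have "x = (\<lambda>_. 0)" if "x \<in> W" for x
      proof (rule vec_inj_cvecs)
        show "x \<in> cvecs ?n" "(\<lambda>_. 0) \<in> cvecs ?n" using that W(1) by auto
        show "Matrix.vec ?n x = Matrix.vec ?n (\<lambda>_. 0)" using W0 that W(2) by (metis image_eqI singletonD)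
      qed
      then show ?thesis using W(2) by blast
    next
      assume Wc: "?W = carrier_vec ?n"
      have "x \<in> W" if x: "x \<in> cvecs ?n" for x
      proof -
        have "Matrix.vec ?n x \<in> ?W" unfolding Wc by simp
        then obtain y where "y \<in> W" "Matrix.vec ?n x = Matrix.vec ?n y" by blast
        then show ?thesis using vec_inj_cvecs[OF x] W(1) by blast
      qed
      then show ?thesis using W(1) by blast
    qed
  qed
qed

lemma hw_lam:
  assumes lam: "lam \<in> \<Lambda>"
  shows "irrep.hw G (rdim R lam) (\<lambda>g i j. rep R lam g $$ (i, j)) P lam (fun_of_vec (rdim R lam) (hvec R lam))"
proof -
  let ?n = "rdim R lam" and ?\<rho> = "rep R lam" and ?v = "hvec R lam"
  interpret I: metric_irrep G m ?n "\<lambda>g i j. ?\<rho> g $$ (i, j)" by (rule metric_irrep_lam[OF lam])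
  have v: "?v \<in> carrier_vec ?n" "?v \<noteq> 0\<^sub>v ?n"
    and h: "\<And>h. h \<in> cartan P \<Longrightarrow> rep_diff G ?n ?\<rho> h *\<^sub>v ?v = (2 * pi * \<i> * of_real (lam \<bullet> h)) \<cdot>\<^sub>v ?v"
    and e: "\<And>\<alpha> e. \<alpha> \<in> positive_roots G P \<Longrightarrow> e \<in> root_space G (cartan P) \<alpha> \<Longrightarrow>
      rep_diff G ?n ?\<rho> (fst e) *\<^sub>v ?v + \<i> \<cdot>\<^sub>v (rep_diff G ?n ?\<rho> (snd e) *\<^sub>v ?v) = 0\<^sub>v ?n"
    using irrepsD(3)[OF lam] unfolding highest_weight_vector_def by blast+
  have D: "I.D \<xi> (fun_of_vec ?n ?v) = fun_of_vec ?n (rep_diff G ?n ?\<rho> \<xi> *\<^sub>v ?v)" for \<xi>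
    using v(1) by (auto simp: fun_eq_iff rapp_def fun_of_vec_def rep_diff_def I.rd_def Matrix.scalar_prod_def lessThan_atLeast0)
  show ?thesis
    unfolding I.hw_def
  proof (intro conjI ballI)
    show "fun_of_vec ?n ?v \<in> cvecs ?n" by (rule fun_of_vec)
    show "fun_of_vec ?n ?v \<noteq> (\<lambda>_. 0)"
    proof
      assume "fun_of_vec ?n ?v = (\<lambda>_. 0)"
      then have "?v = Matrix.vec ?n (\<lambda>_. 0)" using fun_of_vec(2)[OF v(1)] by metis
      also have "\<dots> = 0\<^sub>v ?n" by auto
      finally show False using v(2) by blast
    qed
    show "I.D h (fun_of_vec ?n ?v) = (\<lambda>i. 2 * pi * \<i> * of_real (lam \<bullet> h) * fun_of_vec ?n ?v i)" if "h \<in> cartan P" for h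
      unfolding D h[OF that] using v(1) by (auto simp: fun_of_vec_def)
    show "I.cop e (fun_of_vec ?n ?v) = (\<lambda>_. 0)" if "\<alpha> \<in> positive_roots G P" "e \<in> root_space G (cartan P) \<alpha>" for \<alpha> e
    proof
      fix i
      have "I.cop e (fun_of_vec ?n ?v) i = fun_of_vec ?n (rep_diff G ?n ?\<rho> (fst e) *\<^sub>v ?v + \<i> \<cdot>\<^sub>v (rep_diff G ?n ?\<rho> (snd e) *\<^sub>v ?v)) i"
        using v(1) by (simp add: I.cop_D D fun_of_vec_def rep_diff_def)
      then show "I.cop e (fun_of_vec ?n ?v) i = 0" unfolding e[OF that] by (simp add: fun_of_vec_def)
    qed
  qed
qed

lemma dominant_cartan: "lam \<in> \<Lambda> \<Longrightarrow> lam \<in> cartan P"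
  by (simp add: dominant_weights_def)

lemma schur_matrix:
  assumes lam: "lam \<in> \<Lambda>" and K: "K \<in> carrier_mat (rdim R lam) (rdim R lam)"
    and comm: "\<And>g. K * rep R lam g = rep R lam g * K"
  obtains c where "K = c \<cdot>\<^sub>m 1\<^sub>m (rdim R lam)"
proof -
  let ?n = "rdim R lam" and ?\<rho> = "rep R lam"
  interpret I: metric_irrep G m ?n "\<lambda>g i j. ?\<rho> g $$ (i, j)" by (rule metric_irrep_lam[OF lam])
  note \<rho> = unitary_repD(3)[OF lie irrepsD(1)[OF lam]]
  have S: "app ?n (\<lambda>i j. K $$ (i, j)) (I.act g x) = I.act g (app ?n (\<lambda>i j. K $$ (i, j)) x)" for g x
    using app_app[of ?n "\<lambda>i j. (K * ?\<rho> g) $$ (i, j)", OF mat_mult_index[OF K \<rho>]]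
      app_app[of ?n "\<lambda>i j. (K * ?\<rho> g) $$ (i, j)", OF mat_mult_index[OF \<rho> K, of _ _ g, folded comm]] by simp
  obtain c where c: "\<And>i j. i < ?n \<Longrightarrow> j < ?n \<Longrightarrow> K $$ (i, j) = (if i = j then c else 0)"
    by (rule I.schur_scalar[of "\<lambda>i j. K $$ (i, j)", OF S]) blast
  have "K = c \<cdot>\<^sub>m 1\<^sub>m ?n" by (rule eq_matI) (use K c in auto)
  then show thesis by (rule that)
qed

end

lemma (in haar) integral_double_sum:
  fixes F H :: "_ \<Rightarrow> 'a \<Rightarrow> complex"
  assumes "\<And>p. p \<in> I \<Longrightarrow> continuous_on UNIV (F p)" "\<And>q. q \<in> J \<Longrightarrow> continuous_on UNIV (H q)"
  shows "(\<integral>x. (\<Sum>p\<in>I. \<Sum>q\<in>J. c p q * (F p x * cnj (H q x))) \<partial>m) = (\<Sum>p\<in>I. \<Sum>q\<in>J. c p q * (\<integral>x. F p x * cnj (H q x) \<partial>m))"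
proof -
  have int: "integrable m (\<lambda>x. c p q * (F p x * cnj (H q x)))" if "p \<in> I" "q \<in> J" for p q
    using that by (intro integrable_continuous_m continuous_intros assms)
  have "(\<integral>x. (\<Sum>p\<in>I. \<Sum>q\<in>J. c p q * (F p x * cnj (H q x))) \<partial>m) = (\<Sum>p\<in>I. \<integral>x. (\<Sum>q\<in>J. c p q * (F p x * cnj (H q x))) \<partial>m)"
    by (intro Bochner_Integration.integral_sum Bochner_Integration.integrable_sum int)
  also have "\<dots> = (\<Sum>p\<in>I. \<Sum>q\<in>J. \<integral>x. c p q * (F p x * cnj (H q x)) \<partial>m)"
    by (intro sum.cong refl Bochner_Integration.integral_sum int)
  finally show ?thesis by simp
qed

context compact_lie begin

abbreviation "vol \<equiv> measure m UNIV"

lemma rep_continuous: "lam \<in> \<Lambda> \<Longrightarrow> i < rdim R lam \<Longrightarrow> j < rdim R lam \<Longrightarrow> continuous_on UNIV (\<lambda>x. rep R lam x $$ (i, j))"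
  using unitary_repD(4)[OF lie irrepsD(1)] .

lemma matrix_orthogonality:
  assumes lam: "lam \<in> \<Lambda>" and mu: "mu \<in> \<Lambda>" and p: "p \<in> {..<rdim R lam} \<times> {..<rdim R lam}" and q: "q \<in> {..<rdim R mu} \<times> {..<rdim R mu}"
  shows "(\<integral>x. rep R lam x $$ p * cnj (rep R mu x $$ q) \<partial>m) = (if lam = mu \<and> p = q then of_real (vol / rdim R lam) else 0)"
proof -
  interpret I: metric_irrep G m "rdim R lam" "\<lambda>g i j. rep R lam g $$ (i, j)" by (rule metric_irrep_lam[OF lam])
  obtain i a j b where ij: "p = (i, a)" "q = (j, b)" by (cases p, cases q)
  then have lt: "i < rdim R lam" "a < rdim R lam" "j < rdim R mu" "b < rdim R mu" using p q by auto
  show ?thesis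
  proof (cases "lam = mu")
    case True
    show ?thesis using I.schur_orthogonality[of i a j b] lt True by (simp add: ij)
  next
    case False
    show ?thesis
      using I.schur_orthogonality_distinct[OF metric_irrep_lam[OF mu] conn pinning hw_lam[OF lam] hw_lam[OF mu] dominant_cartan[OF lam] dominant_cartan[OF mu] False lt]
        False by (simp add: ij)
  qed
qed

text \<open>Both traces are linear combinations of matrix coefficients. Orthogonality leaves only
  the pairing of the coefficients of M with those of N.\<close>

lemma integral_trace_trace:
  assumes lam: "lam \<in> \<Lambda>" and mu: "mu \<in> \<Lambda>" and M: "M \<in> carrier_mat (rdim R lam) (rdim R lam)" and N: "N \<in> carrier_mat (rdim R mu) (rdim R mu)"
  shows "(\<integral>x. mat_trace (M * rep R lam x) * cnj (mat_trace (N * rep R mu x)) \<partial>m)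
    = (if lam = mu then vol / rdim R lam * mat_trace (M * mat_adjoint N) else 0)"
proof -
  let ?n = "rdim R lam" and ?k = "rdim R mu"
  let ?I = "{..<?n} \<times> {..<?n}" and ?J = "{..<?k} \<times> {..<?k}"
  note \<rho> = unitary_repD(3)[OF lie irrepsD(1)]
  have tr: "mat_trace (A * rep R l x) = (\<Sum>p\<in>{..<rdim R l} \<times> {..<rdim R l}. A $$ (snd p, fst p) * rep R l x $$ p)"
    if "l \<in> \<Lambda>" "A \<in> carrier_mat (rdim R l) (rdim R l)" for A l x
    unfolding mat_trace_mult[OF that(2) \<rho>[OF that(1)]] sum.cartesian_product' by (subst sum.swap) simp
  have "(\<integral>x. mat_trace (M * rep R lam x) * cnj (mat_trace (N * rep R mu x)) \<partial>m)
    = (\<integral>x. (\<Sum>p\<in>?I. \<Sum>q\<in>?J. (M $$ (snd p, fst p) * cnj (N $$ (snd q, fst q))) * (rep R lam x $$ p * cnj (rep R mu x $$ q))) \<partial>m)"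
    unfolding tr[OF lam M] tr[OF mu N]
    by (intro Bochner_Integration.integral_cong refl) (simp add: sum_product mult_ac)
  also have "\<dots> = (\<Sum>p\<in>?I. \<Sum>q\<in>?J. (M $$ (snd p, fst p) * cnj (N $$ (snd q, fst q))) * (\<integral>x. rep R lam x $$ p * cnj (rep R mu x $$ q) \<partial>m))"
    using rep_continuous[OF lam] rep_continuous[OF mu] by (intro integral_double_sum) auto
  also have "\<dots> = (\<Sum>p\<in>?I. \<Sum>q\<in>?J. (M $$ (snd p, fst p) * cnj (N $$ (snd q, fst q))) * (if lam = mu \<and> p = q then of_real (vol / ?n) else 0))"
    by (intro sum.cong refl) (simp only: matrix_orthogonality[OF lam mu])
  also have "\<dots> = (if lam = mu then vol / ?n * mat_trace (M * mat_adjoint N) else 0)"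
  proof (cases "lam = mu")
    case True
    have "(\<Sum>q\<in>?J. (M $$ (snd p, fst p) * cnj (N $$ (snd q, fst q))) * (if lam = mu \<and> p = q then of_real (vol / ?n) else 0))
      = of_real (vol / ?n) * (M $$ (snd p, fst p) * cnj (N $$ (snd p, fst p)))" if "p \<in> ?I" for p
      using that True by (simp add: if_distrib[of "\<lambda>z. _ * z"] cong: if_cong)
    moreover have "mat_trace (M * mat_adjoint N) = (\<Sum>p\<in>?I. M $$ (snd p, fst p) * cnj (N $$ (snd p, fst p)))"
      using M N True unfolding sum.cartesian_product' by (subst sum.swap) (simp add: mat_trace_mult[of _ ?n] mat_adjoint_index[of _ ?n])
    ultimately show ?thesis using True by (simp add: sum_distrib_left)
  qed simp
  finally show ?thesis .
qed

text \<open>The integral of \<rho>(x) M times the adjoint of \<rho>(x) is the scalar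
  \<open>vol\<close> tr(M) / dim; here this is carried out on matrix coefficients.\<close>

lemma integral_trace_conj:
  assumes lam: "lam \<in> \<Lambda>" and M: "M \<in> carrier_mat (rdim R lam) (rdim R lam)" and N: "N \<in> carrier_mat (rdim R lam) (rdim R lam)"
  shows "(\<integral>x. mat_trace ((rep R lam x * M) * (mat_adjoint (rep R lam x) * N)) \<partial>m) = vol / rdim R lam * (mat_trace M * mat_trace N)"
proof -
  let ?n = "rdim R lam"
  let ?I = "{..<?n} \<times> {..<?n}"
  note \<rho> = unitary_repD(3)[OF lie irrepsD(1)[OF lam]]
  have tr: "mat_trace ((rep R lam x * M) * (mat_adjoint (rep R lam x) * N))
    = (\<Sum>p\<in>?I. \<Sum>q\<in>?I. (M $$ (snd p, snd q) * N $$ (fst q, fst p)) * (rep R lam x $$ p * cnj (rep R lam x $$ q)))" for x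
  proof -
    let ?r = "rep R lam x"
    have "mat_trace ((?r * M) * (mat_adjoint ?r * N)) = (\<Sum>i<?n. \<Sum>b<?n. (\<Sum>a<?n. ?r $$ (i, a) * M $$ (a, b)) * (\<Sum>j<?n. cnj (?r $$ (j, b)) * N $$ (j, i)))"
      unfolding mat_trace_mult[OF mult_carrier_mat[OF \<rho> M] mult_carrier_mat[OF mat_adjoint_carrier[OF \<rho>] N]]
      by (intro sum.cong refl arg_cong2[where f = "(*)"])
        (auto simp: mat_mult_index[OF \<rho> M] mat_mult_index[OF mat_adjoint_carrier[OF \<rho>] N] mat_adjoint_index[OF \<rho>] simp del: index_mult_mat intro!: sum.cong)
    also have "\<dots> = (\<Sum>i<?n. \<Sum>b<?n. \<Sum>a<?n. \<Sum>j<?n. (M $$ (a, b) * N $$ (j, i)) * (?r $$ (i, a) * cnj (?r $$ (j, b))))"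
      by (simp add: sum_product mult_ac)
    also have "\<dots> = (\<Sum>i<?n. \<Sum>a<?n. \<Sum>b<?n. \<Sum>j<?n. (M $$ (a, b) * N $$ (j, i)) * (?r $$ (i, a) * cnj (?r $$ (j, b))))"
      by (intro sum.cong refl sum.swap)
    also have "\<dots> = (\<Sum>i<?n. \<Sum>a<?n. \<Sum>j<?n. \<Sum>b<?n. (M $$ (a, b) * N $$ (j, i)) * (?r $$ (i, a) * cnj (?r $$ (j, b))))"
      by (intro sum.cong refl sum.swap)
    finally show ?thesis by (simp add: sum.cartesian_product')
  qed
  have "(\<integral>x. mat_trace ((rep R lam x * M) * (mat_adjoint (rep R lam x) * N)) \<partial>m)
    = (\<Sum>p\<in>?I. \<Sum>q\<in>?I. (M $$ (snd p, snd q) * N $$ (fst q, fst p)) * (\<integral>x. rep R lam x $$ p * cnj (rep R lam x $$ q) \<partial>m))"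
    unfolding tr using rep_continuous[OF lam] by (intro integral_double_sum) auto
  also have "\<dots> = (\<Sum>p\<in>?I. \<Sum>q\<in>?I. (M $$ (snd p, snd q) * N $$ (fst q, fst p)) * (if p = q then of_real (vol / ?n) else 0))"
    by (intro sum.cong refl) (simp add: matrix_orthogonality[OF lam lam] del: mem_Sigma_iff)
  also have "\<dots> = (\<Sum>p\<in>?I. vol / ?n * (M $$ (snd p, snd p) * N $$ (fst p, fst p)))"
    by (intro sum.cong refl) (simp add: if_distrib[of "\<lambda>z. _ * z"] if_distrib[of complex_of_real] cong: if_cong)
  also have "\<dots> = vol / ?n * (\<Sum>i<?n. \<Sum>a<?n. M $$ (a, a) * N $$ (i, i))"
    by (simp add: sum_distrib_left sum.cartesian_product case_prod_beta)
  also have "(\<Sum>i<?n. \<Sum>a<?n. M $$ (a, a) * N $$ (i, i)) = mat_trace M * mat_trace N"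
    using M N by (simp add: mat_trace_def sum_product) (rule sum.swap)
  finally show ?thesis .
qed

end

section \<open>The group of diagram automorphisms\<close>

context liegroup begin

lemma lie_Out_Aut: "\<alpha> \<in> lie_Out G P \<Longrightarrow> \<alpha> \<in> lie_Aut G"
  by (simp add: lie_Out_def)

lemma lie_Out_comp:
  assumes "\<alpha> \<in> lie_Out G P" "\<beta> \<in> lie_Out G P"
  shows "\<alpha> \<circ> \<beta> \<in> lie_Out G P"
proof -
  let ?S = "simple_roots P"
  note A = lie_Out_Aut[OF assms(1)] lie_Out_Aut[OF assms(2)]
  obtain p where p: "bij_betw p ?S ?S" "\<And>\<alpha> \<beta>. \<alpha> \<in> ?S \<Longrightarrow> \<beta> \<in> ?S \<Longrightarrow> coroot (p \<alpha>) \<bullet> p \<beta> = coroot \<alpha> \<bullet> \<beta>"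
    "\<And>\<gamma>. \<gamma> \<in> ?S \<Longrightarrow> map_prod (lie_diff G \<alpha>) (lie_diff G \<alpha>) (e_plus P \<gamma>) = e_plus P (p \<gamma>)"
    "\<And>\<gamma>. \<gamma> \<in> ?S \<Longrightarrow> map_prod (lie_diff G \<alpha>) (lie_diff G \<alpha>) (e_minus P \<gamma>) = e_minus P (p \<gamma>)"
    using assms(1) unfolding lie_Out_def by blast
  obtain q where q: "bij_betw q ?S ?S" "\<And>\<alpha> \<beta>. \<alpha> \<in> ?S \<Longrightarrow> \<beta> \<in> ?S \<Longrightarrow> coroot (q \<alpha>) \<bullet> q \<beta> = coroot \<alpha> \<bullet> \<beta>"
    "\<And>\<gamma>. \<gamma> \<in> ?S \<Longrightarrow> map_prod (lie_diff G \<beta>) (lie_diff G \<beta>) (e_plus P \<gamma>) = e_plus P (q \<gamma>)"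
    "\<And>\<gamma>. \<gamma> \<in> ?S \<Longrightarrow> map_prod (lie_diff G \<beta>) (lie_diff G \<beta>) (e_minus P \<gamma>) = e_minus P (q \<gamma>)"
    using assms(2) unfolding lie_Out_def by blast
  have qS: "q \<gamma> \<in> ?S" if "\<gamma> \<in> ?S" for \<gamma> using q(1) that by (meson bij_betwE)
  have "map_prod (lie_diff G (\<alpha> \<circ> \<beta>)) (lie_diff G (\<alpha> \<circ> \<beta>)) e = map_prod (lie_diff G \<alpha>) (lie_diff G \<alpha>) (map_prod (lie_diff G \<beta>) (lie_diff G \<beta>) e)" for e
    by (cases e) (simp add: lie_diff_Aut_comp[OF A])
  then show ?thesis
    unfolding lie_Out_def
    by (intro CollectI conjI lie_Aut_comp[OF A] exI[of _ "p \<circ> q"] bij_betw_trans[OF q(1) p(1)] ballI) (simp_all add: p q qS)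
qed

lemma lie_Out_inv:
  assumes "\<alpha> \<in> lie_Out G P"
  shows "inv_into UNIV \<alpha> \<in> lie_Out G P"
proof -
  let ?S = "simple_roots P" and ?i = "inv_into UNIV \<alpha>"
  note A = lie_Out_Aut[OF assms]
  obtain p where p: "bij_betw p ?S ?S" "\<And>\<alpha> \<beta>. \<alpha> \<in> ?S \<Longrightarrow> \<beta> \<in> ?S \<Longrightarrow> coroot (p \<alpha>) \<bullet> p \<beta> = coroot \<alpha> \<bullet> \<beta>"
    "\<And>\<gamma>. \<gamma> \<in> ?S \<Longrightarrow> map_prod (lie_diff G \<alpha>) (lie_diff G \<alpha>) (e_plus P \<gamma>) = e_plus P (p \<gamma>)"
    "\<And>\<gamma>. \<gamma> \<in> ?S \<Longrightarrow> map_prod (lie_diff G \<alpha>) (lie_diff G \<alpha>) (e_minus P \<gamma>) = e_minus P (p \<gamma>)"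
    using assms unfolding lie_Out_def by blast
  let ?q = "inv_into ?S p"
  have q: "?q \<gamma> \<in> ?S" "p (?q \<gamma>) = \<gamma>" if "\<gamma> \<in> ?S" for \<gamma>
    using p(1) that by (auto simp: bij_betw_def inv_into_into f_inv_into_f)
  have inv: "map_prod (lie_diff G ?i) (lie_diff G ?i) (map_prod (lie_diff G \<alpha>) (lie_diff G \<alpha>) e) = e" for e
    by (cases e) (simp add: lie_diff_inv[OF A])
  have "map_prod (lie_diff G ?i) (lie_diff G ?i) (e_plus P \<gamma>) = e_plus P (?q \<gamma>)"
    "map_prod (lie_diff G ?i) (lie_diff G ?i) (e_minus P \<gamma>) = e_minus P (?q \<gamma>)" if "\<gamma> \<in> ?S" for \<gamma>
    using inv[of "e_plus P (?q \<gamma>)"] inv[of "e_minus P (?q \<gamma>)"] p(3,4)[OF q(1)[OF that]] q(2)[OF that] by simp_all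
  moreover have "coroot (?q \<gamma>) \<bullet> ?q \<delta> = coroot \<gamma> \<bullet> \<delta>" if "\<gamma> \<in> ?S" "\<delta> \<in> ?S" for \<gamma> \<delta>
    using p(2)[OF q(1)[OF that(1)] q(1)[OF that(2)]] q(2) that by simp
  ultimately show ?thesis
    unfolding lie_Out_def by (intro CollectI conjI lie_Aut_inv[OF A] exI[of _ ?q] bij_betw_inv_into[OF p(1)]) blast+
qed

lemma fixed_weights_comp:
  "\<alpha> \<in> lie_Aut G \<Longrightarrow> \<beta> \<in> lie_Aut G \<Longrightarrow> lam \<in> fixed_weights G P \<alpha> \<Longrightarrow> lam \<in> fixed_weights G P \<beta> \<Longrightarrow> lam \<in> fixed_weights G P (\<alpha> \<circ> \<beta>)"
  by (simp add: fixed_weights_def lie_diff_Aut_comp)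

lemma fixed_weights_inv:
  "\<alpha> \<in> lie_Aut G \<Longrightarrow> lam \<in> fixed_weights G P \<alpha> \<Longrightarrow> lam \<in> fixed_weights G P (inv_into UNIV \<alpha>)"
  unfolding fixed_weights_def using lie_diff_inv(1)[of \<alpha> lam] by simp

end

lemma square_mult_carrier [simp]: "A \<in> carrier_mat n n \<Longrightarrow> B \<in> carrier_mat n n \<Longrightarrow> A * B \<in> carrier_mat n n"
  by (rule mult_carrier_mat)

lemma twist_operatorD:
  assumes "twist_operator n \<rho> v \<kappa> K"
  shows "unitary_mat n K" "\<rho> (\<kappa> g) = K * \<rho> g * mat_adjoint K" "K *\<^sub>v v = v"
  using assms by (auto simp: twist_operator_def)

lemma twist_operator_comp:
  assumes A: "twist_operator n \<rho> v \<alpha> A" and B: "twist_operator n \<rho> v \<beta> B" and \<rho>: "\<And>g. \<rho> g \<in> carrier_mat n n" and v: "v \<in> carrier_vec n"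
  shows "twist_operator n \<rho> v (\<alpha> \<circ> \<beta>) (A * B)"
proof -
  note a = twist_operatorD[OF A] and b = twist_operatorD[OF B]
  note c = unitary_matD(1,2)[OF a(1)] unitary_matD(1,2)[OF b(1)] \<rho>
  show ?thesis
    unfolding twist_operator_def
    using c v by (simp add: unitary_mat_mult a b mat_adjoint_mult[of _ n] assoc_mult_mat[of _ n n _ n _ n])
qed

lemma twist_operator_inv:
  assumes A: "twist_operator n \<rho> v \<alpha> A" and \<rho>: "\<And>g. \<rho> g \<in> carrier_mat n n" and v: "v \<in> carrier_vec n" and \<alpha>: "\<And>x. \<alpha> (\<beta> x) = x"
  shows "twist_operator n \<rho> v \<beta> (mat_adjoint A)"
proof -
  note a = twist_operatorD[OF A]
  note c = unitary_matD[OF a(1)] \<rho>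
  have "\<rho> (\<beta> g) = mat_adjoint A * \<rho> g * mat_adjoint (mat_adjoint A)" for g
    using a(2)[of "\<beta> g"] c unitary_mat_cancel(1)[OF a(1), of "\<rho> (\<beta> g)"] right_mult_one_mat[OF \<rho>]
    by (simp add: \<alpha> mat_adjoint_adjoint[of _ n] assoc_mult_mat[of _ n n _ n _ n])
  moreover have "mat_adjoint A *\<^sub>v v = mat_adjoint A *\<^sub>v (A *\<^sub>v v)" by (simp only: a(3))
  then have "mat_adjoint A *\<^sub>v v = v" using c v by (simp flip: assoc_mult_mat_vec[of _ n n _ n])
  ultimately show ?thesis by (simp add: twist_operator_def unitary_mat_adjoint[OF a(1)])
qed

context compact_lie begin

lemma hvec_carrier: "lam \<in> \<Lambda> \<Longrightarrow> hvec R lam \<in> carrier_vec (rdim R lam)" "lam \<in> \<Lambda> \<Longrightarrow> hvec R lam \<noteq> 0\<^sub>v (rdim R lam)"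
  using irrepsD(3)[of lam] by (simp_all add: highest_weight_vector_def)

text \<open>Schur's lemma: two twist operators differ by a scalar, which is one on the highest weight vector.\<close>

lemma twist_operator_unique:
  assumes lam: "lam \<in> \<Lambda>" and A: "twist_operator (rdim R lam) (rep R lam) (hvec R lam) \<kappa> A" and B: "twist_operator (rdim R lam) (rep R lam) (hvec R lam) \<kappa> B"
  shows "A = B"
proof -
  let ?n = "rdim R lam" and ?v = "hvec R lam"
  note a = twist_operatorD[OF A] and b = twist_operatorD[OF B] and \<rho> = unitary_repD(3)[OF lie irrepsD(1)[OF lam]]
  note ca = unitary_matD[OF a(1)] and cb = unitary_matD[OF b(1)]
  note v = hvec_carrier[OF lam]
  note assoc = assoc_mult_mat[of _ ?n ?n _ ?n _ ?n]
  \<comment> \<open>The quotient of the two operators, which commutes with the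
    representation.\<close>
  let ?L = "mat_adjoint B * A"
  have L: "?L \<in> carrier_mat ?n ?n" using ca cb by simp
  have "?L * rep R lam g = rep R lam g * ?L" for g
  proof -
    let ?r = "rep R lam g"
    have r: "?r \<in> carrier_mat ?n ?n" by (rule \<rho>)
    have e: "A * ?r * mat_adjoint A = B * ?r * mat_adjoint B" using a(2)[of g] b(2)[of g] by simp
    have "?L * ?r = mat_adjoint B * ((A * ?r * mat_adjoint A) * A)"
      using ca cb r by (simp add: assoc)
    also have "\<dots> = ?r * ?L"
      unfolding e using ca cb r unitary_mat_cancel(1)[OF b(1), of "?r * (mat_adjoint B * A)"] by (simp add: assoc)
    finally show ?thesis .
  qed
  from schur_matrix[OF lam L this] obtain c where c: "?L = c \<cdot>\<^sub>m 1\<^sub>m ?n" by blast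
  have "?L *\<^sub>v ?v = mat_adjoint B *\<^sub>v (A *\<^sub>v ?v)" using ca cb v(1) by (simp add: assoc_mult_mat_vec[of _ ?n ?n _ ?n])
  also have "\<dots> = mat_adjoint B *\<^sub>v (B *\<^sub>v ?v)" by (simp only: a(3) b(3))
  also have "\<dots> = ?v" using cb v(1) by (simp flip: assoc_mult_mat_vec[of _ ?n ?n _ ?n])
  finally have cv: "(c \<cdot>\<^sub>m 1\<^sub>m ?n) *\<^sub>v ?v = ?v" unfolding c .
  obtain i where i: "i < ?n" "vec_index ?v i \<noteq> 0"
    using v by (metis eq_vecI carrier_vecD index_zero_vec(1) index_zero_vec(2))
  have "vec_index ((c \<cdot>\<^sub>m 1\<^sub>m ?n) *\<^sub>v ?v) i = c * vec_index ?v i"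
  proof -
    have "vec_index ((c \<cdot>\<^sub>m 1\<^sub>m ?n) *\<^sub>v ?v) i = (\<Sum>j<?n. (if i = j then c else 0) * vec_index ?v j)"
      using i(1) v(1) by (auto simp: Matrix.scalar_prod_def lessThan_atLeast0 intro!: sum.cong)
    then show ?thesis using i(1) by (simp add: if_distrib[of "\<lambda>z. z * _"] cong: if_cong)
  qed
  then have "c = 1" using cv i(2) by simp
  then have "?L = 1\<^sub>m ?n" using c by (auto intro!: eq_matI)
  then have "B * ?L = B" using cb by simp
  then show ?thesis using unitary_mat_cancel(2)[OF b(1) ca(1)] by simp
qed

text \<open>The product of the operators implements the composite and fixes the highest weight
  vector, so \<open>twist_operator_unique\<close> identifies it.\<close>

lemma twist_comp:
  assumes "\<alpha> \<in> lie_Out G P" "\<beta> \<in> lie_Out G P" "lam \<in> fixed_weights G P \<alpha>" "lam \<in> fixed_weights G P \<beta>"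
  shows "twist R (\<alpha> \<circ> \<beta>) lam = twist R \<alpha> lam * twist R \<beta> lam"
proof -
  have lam: "lam \<in> \<Lambda>" using assms(3) by (simp add: fixed_weights_def)
  show ?thesis
    by (rule twist_operator_unique[OF lam irrepsD(4)[OF lam lie_Out_comp[OF assms(1,2)] fixed_weights_comp[OF lie_Out_Aut[OF assms(1)] lie_Out_Aut[OF assms(2)] assms(3,4)]]
          twist_operator_comp[OF irrepsD(4)[OF lam assms(1,3)] irrepsD(4)[OF lam assms(2,4)] unitary_repD(3)[OF lie irrepsD(1)[OF lam]] hvec_carrier(1)[OF lam]]])
qed

lemma twist_inv:
  assumes "\<alpha> \<in> lie_Out G P" "lam \<in> fixed_weights G P \<alpha>"
  shows "twist R (inv_into UNIV \<alpha>) lam = mat_adjoint (twist R \<alpha> lam)"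
proof -
  have lam: "lam \<in> \<Lambda>" using assms(2) by (simp add: fixed_weights_def)
  show ?thesis
    by (rule twist_operator_unique[OF lam irrepsD(4)[OF lam lie_Out_inv[OF assms(1)] fixed_weights_inv[OF lie_Out_Aut[OF assms(1)] assms(2)]]
          twist_operator_inv[OF irrepsD(4)[OF lam assms] unitary_repD(3)[OF lie irrepsD(1)[OF lam]] hvec_carrier(1)[OF lam] lie_AutD(5)[OF lie_Out_Aut[OF assms(1)]]]])
qed

lemma twining_character_continuous:
  assumes "\<alpha> \<in> lie_Out G P" "lam \<in> fixed_weights G P \<alpha>"
  shows "continuous_on UNIV (twining_character R \<alpha> lam)"
proof -
  have lam: "lam \<in> \<Lambda>" using assms(2) by (simp add: fixed_weights_def)
  have "twining_character R \<alpha> lam = (\<lambda>g. \<Sum>i<rdim R lam. \<Sum>j<rdim R lam. twist R \<alpha> lam $$ (i, j) * rep R lam g $$ (j, i))"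
    unfolding twining_character_def
    using mat_trace_mult[OF unitary_matD(1)[OF twist_operatorD(1)[OF irrepsD(4)[OF lam assms]]] unitary_repD(3)[OF lie irrepsD(1)[OF lam]]] by (rule HOL.ext)
  then show ?thesis using rep_continuous[OF lam] by (auto intro!: continuous_intros)
qed

end

section \<open>Traces of the integrands and the Fourier coefficients\<close>

lemma mat_trace_unitary_conj:
  assumes "unitary_mat n U" "S \<in> carrier_mat n n"
  shows "mat_trace (U * (S * mat_adjoint U)) = mat_trace S"
proof -
  note u = unitary_matD[OF assms(1)]
  have "mat_trace (U * (S * mat_adjoint U)) = mat_trace ((S * mat_adjoint U) * U)"
    by (rule mat_trace_comm[OF u(1)]) (rule square_mult_carrier[OF assms(2) u(2)])
  also have "(S * mat_adjoint U) * U = S" using u assms(2) right_mult_one_mat[OF assms(2)] by (simp add: assoc_mult_mat[of _ n n _ n _ n])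
  finally show ?thesis .
qed

context
  fixes n and T K X Y :: "complex Matrix.mat"
  assumes T: "unitary_mat n T" and K: "unitary_mat n K" and X: "X \<in> carrier_mat n n" and Y: "Y \<in> carrier_mat n n"
begin

lemmas tc = unitary_matD(1,2)[OF T] unitary_matD(1,2)[OF K] X Y
  mat_adjoint_carrier[OF X] mat_adjoint_carrier[OF Y] unitary_mat_cancel[OF T] unitary_mat_cancel[OF K]
  mat_adjoint_mult[of _ n] mat_adjoint_adjoint[of _ n] assoc_mult_mat[of _ n n _ n _ n]

text \<open>X and Y stand for the matrices of x and y, T and K for the twist operators of \<tau> and
  \<kappa>. The conjugation by T that the first moment component brings with it drops out.\<close>

lemma trace_double1: "mat_trace (T * K * (X * (T * Y * mat_adjoint T))) = mat_trace ((T * Y * K) * X)"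
proof -
  have "T * K * (X * (T * Y * mat_adjoint T)) = T * (((K * X) * (T * Y)) * mat_adjoint T)" by (simp add: tc)
  then have "mat_trace (T * K * (X * (T * Y * mat_adjoint T))) = mat_trace ((K * X) * (T * Y))"
    using mat_trace_unitary_conj[OF T, of "(K * X) * (T * Y)"] by (simp add: tc)
  also have "\<dots> = mat_trace ((T * Y) * (K * X))" by (rule mat_trace_comm[of _ n]) (simp_all add: tc)
  finally show ?thesis by (simp add: tc)
qed

text \<open>Up to a unitary conjugation and cyclic permutation, the second moment component produces
  the adjoint of the matrix in \<open>trace_double1\<close>. So the two characters for one weight
  are complex conjugate.\<close>

lemma trace_double2:
  "mat_trace (mat_adjoint T * mat_adjoint K * (mat_adjoint T * (mat_adjoint X * (mat_adjoint K * mat_adjoint Y * K)) * T))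
    = cnj (mat_trace ((T * Y * K) * X))"
proof -
  let ?Z = "mat_adjoint T * (mat_adjoint X * (mat_adjoint K * mat_adjoint Y))"
  let ?U = "mat_adjoint T * mat_adjoint K"
  have U: "unitary_mat n ?U" by (intro unitary_mat_mult unitary_mat_adjoint T K)
  have "mat_adjoint T * mat_adjoint K * (mat_adjoint T * (mat_adjoint X * (mat_adjoint K * mat_adjoint Y * K)) * T) = ?U * (?Z * mat_adjoint ?U)"
    by (simp add: tc)
  then have "mat_trace (mat_adjoint T * mat_adjoint K * (mat_adjoint T * (mat_adjoint X * (mat_adjoint K * mat_adjoint Y * K)) * T)) = mat_trace ?Z"
    using mat_trace_unitary_conj[OF U, of ?Z] by (simp add: tc)
  also have "\<dots> = mat_trace ((mat_adjoint X * (mat_adjoint K * mat_adjoint Y)) * mat_adjoint T)"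
    by (rule mat_trace_comm[of _ n]) (simp_all add: tc)
  also have "\<dots> = mat_trace (mat_adjoint ((T * Y * K) * X))" by (simp add: tc)
  also have "\<dots> = cnj (mat_trace ((T * Y * K) * X))" by (rule mat_trace_adjoint[of _ n]) (simp add: tc)
  finally show ?thesis .
qed

text \<open>The factors on the right end coming from the moment map are the adjoint of the
  commutator twist, which therefore acts by conjugation only. In what remains x enters only through
  X and its adjoint, the shape of \<open>integral_trace_conj\<close>.\<close>

lemma trace_fused:
  "mat_trace (T * K * mat_adjoint T * mat_adjoint K * ((X * (T * Y * mat_adjoint T)) *
      (T * (K * (mat_adjoint T * (mat_adjoint X * (mat_adjoint K * mat_adjoint Y * K)) * T) * mat_adjoint K) * mat_adjoint T)))
    = mat_trace ((X * (T * Y * (K * mat_adjoint T))) * (mat_adjoint X * (mat_adjoint K * mat_adjoint Y)))"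
proof -
  let ?U = "T * K * mat_adjoint T * mat_adjoint K" and ?S = "(X * (T * Y * (K * mat_adjoint T))) * (mat_adjoint X * (mat_adjoint K * mat_adjoint Y))"
  have U: "unitary_mat n ?U" by (intro unitary_mat_mult unitary_mat_adjoint T K)
  have "T * K * mat_adjoint T * mat_adjoint K * ((X * (T * Y * mat_adjoint T)) *
      (T * (K * (mat_adjoint T * (mat_adjoint X * (mat_adjoint K * mat_adjoint Y * K)) * T) * mat_adjoint K) * mat_adjoint T)) = ?U * (?S * mat_adjoint ?U)"
    by (simp add: tc)
  then show ?thesis using mat_trace_unitary_conj[OF U, of ?S] by (simp add: tc)
qed

end

text \<open>The first variable is integrated first: the integrands are arranged so that
  orthogonality applies in x, with y as a parameter.\<close>

lemma (in haar) integral_prod_continuous: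
  fixes f :: "'a \<times> 'a \<Rightarrow> complex"
  assumes f: "continuous_on UNIV f"
  shows "(\<integral>z. f z \<partial>(m \<Otimes>\<^sub>M m)) = (\<integral>y. \<integral>x. f (x, y) \<partial>m \<partial>m)"
proof -
  interpret pair_sigma_finite m m by unfold_locales
  interpret mm: finite_measure "m \<Otimes>\<^sub>M m" by (rule finite_measure_pair_measure[OF finite_measure_axioms finite_measure_axioms])
  have s: "sets (m \<Otimes>\<^sub>M m) = sets borel" using sets_pair_measure_cong[OF sets_m sets_m] borel_prod by metis
  have meas: "f \<in> borel_measurable (m \<Otimes>\<^sub>M m)"
    unfolding measurable_cong_sets[OF s refl] using f by (rule borel_measurable_continuous_onI)
  have "compact (UNIV :: ('a \<times> 'a) set)" using compact_Times[OF compactG compactG] by simp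
  then have "bounded (range f)" using f by (intro compact_imp_bounded compact_continuous_image)
  then obtain B where "\<And>z. norm (f z) \<le> B" unfolding bounded_iff by blast
  then have "integrable (m \<Otimes>\<^sub>M m) f" by (intro mm.integrable_const_bound[of _ B] meas) auto
  then show ?thesis using integral_snd[of "\<lambda>x y. f (x, y)"] by (simp add: case_prod_eta)
qed

locale dh = compact_lie + twists +
  assumes tau_Out: "\<tau> \<in> lie_Out G P" and kappa_Out: "\<kappa> \<in> lie_Out G P"
begin

abbreviation "FW \<equiv> fixed_weights G P \<kappa> \<inter> fixed_weights G P \<tau>"

lemma FW_dominant: "lam \<in> FW \<Longrightarrow> lam \<in> \<Lambda>"
  by (simp add: fixed_weights_def)

lemmas tau'_Out = lie_Out_inv[OF tau_Out] and kappa'_Out = lie_Out_inv[OF kappa_Out]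

lemma FW_inv: "lam \<in> FW \<Longrightarrow> lam \<in> fixed_weights G P \<tau>'" "lam \<in> FW \<Longrightarrow> lam \<in> fixed_weights G P \<kappa>'"
  using fixed_weights_inv[OF tau, of lam P] fixed_weights_inv[OF kappa, of lam P] by auto

lemma Phi_continuous: "continuous_on UNIV Phi1" "continuous_on UNIV Phi2"
  using smooth_mapD(1)[OF sm_Phi(1)] smooth_mapD(1)[OF sm_Phi(2)] by auto

definition dtrace :: "'b \<Rightarrow> 'a \<Rightarrow> 'a \<Rightarrow> complex" where
  "dtrace lam x y = mat_trace ((twist R \<tau> lam * rep R lam y * twist R \<kappa> lam) * rep R lam x)"

context
  fixes lam
  assumes lam: "lam \<in> FW"
begin

abbreviation (input) "nn \<equiv> rdim R lam"
abbreviation (input) "\<rho> \<equiv> rep R lam"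
abbreviation (input) "T \<equiv> twist R \<tau> lam"
abbreviation (input) "K \<equiv> twist R \<kappa> lam"

lemma lamD: "lam \<in> \<Lambda>" "lam \<in> fixed_weights G P \<tau>" "lam \<in> fixed_weights G P \<kappa>"
    "lam \<in> fixed_weights G P \<tau>'" "lam \<in> fixed_weights G P \<kappa>'"
  using lam FW_dominant[OF lam] FW_inv[OF lam] by auto

lemmas tw_T = irrepsD(4)[OF lamD(1) tau_Out lamD(2)] and tw_K = irrepsD(4)[OF lamD(1) kappa_Out lamD(3)]

lemmas ops = twist_operatorD(1)[OF tw_T] twist_operatorD(1)[OF tw_K] unitary_repD(3)[OF lie irrepsD(1)[OF lamD(1)]]

lemma rep_twist: "\<rho> (\<tau> g) = T * \<rho> g * mat_adjoint T" "\<rho> (\<kappa> g) = K * \<rho> g * mat_adjoint K"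
  "\<rho> (\<tau>' g) = mat_adjoint T * \<rho> g * T" "\<rho> (\<kappa>' g) = mat_adjoint K * \<rho> g * K"
  using twist_operatorD(2)[OF tw_T, of g] twist_operatorD(2)[OF tw_K, of g]
    twist_operatorD(2)[OF irrepsD(4)[OF lamD(1) tau'_Out lamD(4)], of g] twist_operatorD(2)[OF irrepsD(4)[OF lamD(1) kappa'_Out lamD(5)], of g]
  unfolding twist_inv[OF tau_Out lamD(2)] twist_inv[OF kappa_Out lamD(3)]
  by (simp_all add: mat_adjoint_adjoint[OF unitary_matD(1)[OF ops(1)]] mat_adjoint_adjoint[OF unitary_matD(1)[OF ops(2)]])

lemma rep_mult: "\<rho> (g \<otimes> h) = \<rho> g * \<rho> h"
  by (rule unitary_repD(2)[OF lie irrepsD(1)[OF lamD(1)]])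

lemma rep_inv: "\<rho> (inv g) = mat_adjoint (\<rho> g)"
  by (rule unitary_rep_inv[OF lie irrepsD(1)[OF lamD(1)]])

lemma rep_Phi1: "\<rho> (Phi1 (x, y)) = \<rho> x * (T * \<rho> y * mat_adjoint T)"
  unfolding Phi1_def by (simp add: rep_mult rep_twist)

lemma rep_Phi2: "\<rho> (Phi2 (x, y)) = mat_adjoint T * (mat_adjoint (\<rho> x) * (mat_adjoint K * mat_adjoint (\<rho> y) * K)) * T"
  unfolding Phi2_def fst_conv snd_conv rep_twist rep_mult rep_inv ..

lemma twining_Phi1: "twining_character R (\<tau> \<circ> \<kappa>) lam (Phi1 (x, y)) = dtrace lam x y"
  unfolding twining_character_def dtrace_def twist_comp[OF tau_Out kappa_Out lamD(2,3)] rep_Phi1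
  by (rule trace_double1[OF ops ops(3)])

lemma twining_Phi2: "twining_character R (\<tau>' \<circ> \<kappa>') lam (Phi2 (x, y)) = cnj (dtrace lam x y)"
  unfolding twining_character_def dtrace_def twist_comp[OF tau'_Out kappa'_Out lamD(4,5)] twist_inv[OF tau_Out lamD(2)] twist_inv[OF kappa_Out lamD(3)] rep_Phi2
  by (rule trace_double2[OF ops ops(3)])

lemma commutator_Out: "\<tau> \<circ> \<kappa> \<circ> \<tau>' \<circ> \<kappa>' \<in> lie_Out G P"
  by (intro lie_Out_comp tau_Out kappa_Out tau'_Out kappa'_Out)

lemma commutator_fixed: "lam \<in> fixed_weights G P (\<tau> \<circ> \<kappa>)" "lam \<in> fixed_weights G P (\<tau> \<circ> \<kappa> \<circ> \<tau>')" "lam \<in> fixed_weights G P (\<tau> \<circ> \<kappa> \<circ> \<tau>' \<circ> \<kappa>')"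
  by (intro fixed_weights_comp lie_Aut_comp tau kappa tau' kappa' lamD)+

lemma twist_commutator: "twist R (\<tau> \<circ> \<kappa> \<circ> \<tau>' \<circ> \<kappa>') lam = T * K * mat_adjoint T * mat_adjoint K"
  unfolding twist_comp[OF lie_Out_comp[OF lie_Out_comp[OF tau_Out kappa_Out] tau'_Out] kappa'_Out commutator_fixed(2) lamD(5)]
    twist_comp[OF lie_Out_comp[OF tau_Out kappa_Out] tau'_Out commutator_fixed(1) lamD(4)]
    twist_comp[OF tau_Out kappa_Out lamD(2,3)] twist_inv[OF tau_Out lamD(2)] twist_inv[OF kappa_Out lamD(3)] ..

lemma twining_fused: "twining_character R (\<tau> \<circ> \<kappa> \<circ> \<tau>' \<circ> \<kappa>') lam (Phi1 (x, y) \<otimes> \<tau> (\<kappa> (Phi2 (x, y))))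
    = mat_trace ((\<rho> x * (T * \<rho> y * (K * mat_adjoint T))) * (mat_adjoint (\<rho> x) * (mat_adjoint K * mat_adjoint (\<rho> y))))"
  unfolding twining_character_def twist_commutator rep_mult rep_twist(1)[of "\<kappa> _"] rep_twist(2)[of "Phi2 _"] rep_Phi1 rep_Phi2
  by (rule trace_fused[OF ops ops(3)])

lemma dim_pos: "nn \<noteq> 0"
  using irrepsD(2)[OF lamD(1)] by (simp add: irreducible_rep_def)

text \<open>\<open>integral_trace_conj\<close> splits the trace into two, and conjugation removes T
  from the first. The two traces are complex conjugate, so a squared modulus is left for the
  integral over y, which \<open>integral_trace_trace\<close> evaluates.\<close>

lemma fused_inner:
  "(\<integral>x. twining_character R (\<tau> \<circ> \<kappa> \<circ> \<tau>' \<circ> \<kappa>') lam (Phi1 (x, y) \<otimes> \<tau> (\<kappa> (Phi2 (x, y)))) \<partial>m)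
    = vol / nn * (mat_trace (K * \<rho> y) * cnj (mat_trace (K * \<rho> y)))"
proof -
  note c = unitary_matD(1,2)[OF ops(1)] unitary_matD(1,2)[OF ops(2)] ops(3)[of y] mat_adjoint_carrier[OF ops(3)[of y]]
  have "mat_trace (T * \<rho> y * (K * mat_adjoint T)) = mat_trace (T * ((\<rho> y * K) * mat_adjoint T))"
    using c by (simp add: assoc_mult_mat[of _ nn nn _ nn _ nn])
  also have "\<dots> = mat_trace (\<rho> y * K)" by (rule mat_trace_unitary_conj[OF ops(1)]) (simp add: c)
  also have "\<dots> = mat_trace (K * \<rho> y)" by (rule mat_trace_comm[of _ nn]) (simp_all add: c)
  finally have 1: "mat_trace (T * \<rho> y * (K * mat_adjoint T)) = mat_trace (K * \<rho> y)" .
  have "mat_trace (mat_adjoint K * mat_adjoint (\<rho> y)) = mat_trace (mat_adjoint (\<rho> y) * mat_adjoint K)"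
    by (rule mat_trace_comm[of _ nn]) (simp_all add: c)
  also have "\<dots> = mat_trace (mat_adjoint (K * \<rho> y))" using c by (simp add: mat_adjoint_mult[of _ nn])
  also have "\<dots> = cnj (mat_trace (K * \<rho> y))" by (rule mat_trace_adjoint[of _ nn]) (simp add: c)
  finally have 2: "mat_trace (mat_adjoint K * mat_adjoint (\<rho> y)) = cnj (mat_trace (K * \<rho> y))" .
  show ?thesis
    unfolding twining_fused by (subst integral_trace_conj[OF lamD(1)]) (simp_all add: c 1 2)
qed

lemma fused_coefficient:
  assumes \<nu>: "DH_measure G (\<tau> \<circ> \<kappa> \<circ> \<tau>' \<circ> \<kappa>') (fused_double G \<tau> \<kappa>) \<nu>"
  shows "(\<integral>g. twining_character R (\<tau> \<circ> \<kappa> \<circ> \<tau>' \<circ> \<kappa>') lam g \<partial>\<nu>) = of_real (vol\<^sup>2) / of_nat nn"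
proof -
  let ?\<chi> = "twining_character R (\<tau> \<circ> \<kappa> \<circ> \<tau>' \<circ> \<kappa>') lam" and ?\<Phi> = "\<lambda>z. Phi1 z \<otimes> \<tau> (\<kappa> (Phi2 z))"
  have c\<chi>: "continuous_on UNIV ?\<chi>" by (rule twining_character_continuous[OF commutator_Out commutator_fixed(3)])
  have c\<Phi>: "continuous_on UNIV ?\<Phi>"
    by (intro continuous_intros Phi_continuous continuous_on_compose2[OF smooth_mapD(1)[OF lie_AutD(2)[OF tau]]]
        continuous_on_compose2[OF smooth_mapD(1)[OF lie_AutD(2)[OF kappa]]]) auto
  have s: "sets (m \<Otimes>\<^sub>M m) = sets borel" using sets_pair_measure_cong[OF sets_m sets_m] borel_prod by metis
  have "(\<integral>g. ?\<chi> g \<partial>\<nu>) = (\<integral>z. ?\<chi> (?\<Phi> z) \<partial>(m \<Otimes>\<^sub>M m))"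
    unfolding DH_fused[OF riemannian compactG \<nu>]
    by (rule integral_distr) (simp_all add: measurable_cong_sets[OF s refl] borel_measurable_continuous_onI c\<chi> c\<Phi>)
  also have "\<dots> = (\<integral>y. \<integral>x. ?\<chi> (?\<Phi> (x, y)) \<partial>m \<partial>m)"
    by (rule integral_prod_continuous) (rule continuous_on_compose2[OF c\<chi> c\<Phi>], simp)
  also have "\<dots> = (\<integral>y. vol / nn * (mat_trace (K * \<rho> y) * cnj (mat_trace (K * \<rho> y))) \<partial>m)"
    by (simp only: fused_inner)
  also have "\<dots> = vol / nn * (\<integral>y. mat_trace (K * \<rho> y) * cnj (mat_trace (K * \<rho> y)) \<partial>m)" by (rule integral_mult_right_zero)
  also have "(\<integral>y. mat_trace (K * \<rho> y) * cnj (mat_trace (K * \<rho> y)) \<partial>m) = vol"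
    using integral_trace_trace[OF lamD(1,1) unitary_matD(1)[OF ops(2)] unitary_matD(1)[OF ops(2)]] dim_pos
    by (simp add: unitary_matD(4)[OF ops(2)] mat_trace_one)
  finally have e: "(\<integral>g. ?\<chi> g \<partial>\<nu>) = of_real (vol / nn) * of_real vol" .
  show ?thesis unfolding e by (simp add: power2_eq_square)
qed

end

text \<open>For fixed y the matrix T \<rho>(y) K is unitary, so for equal weights the integral over
  x is \<open>vol\<close> times the trace of the identity divided by the dimension. The result does
  not depend on y, and the integral over y adds the second factor \<open>vol\<close>.\<close>

lemma double_coefficient:
  assumes lam: "lam \<in> FW" and mu: "mu \<in> FW"
    and \<nu>: "DH_measure (prod_group G G) (map_prod (\<tau> \<circ> \<kappa>) (\<tau>' \<circ> \<kappa>')) (twisted_double G \<tau> \<kappa>) \<nu>"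
  shows "(\<integral>z. twining_character R (\<tau> \<circ> \<kappa>) lam (fst z) * twining_character R (\<tau>' \<circ> \<kappa>') mu (snd z) \<partial>\<nu>)
    = (if lam = mu then 1 else 0) * of_real (vol\<^sup>2)"
proof -
  let ?f = "\<lambda>z. twining_character R (\<tau> \<circ> \<kappa>) lam (fst z) * twining_character R (\<tau>' \<circ> \<kappa>') mu (snd z)" and ?\<Phi> = "\<lambda>z. (Phi1 z, Phi2 z)"
  let ?M = "\<lambda>lam y. twist R \<tau> lam * rep R lam y * twist R \<kappa> lam"
  note l = lamD[OF lam] and k = lamD[OF mu]
  have M: "unitary_mat (rdim R lam) (?M lam y)" "?M lam y \<in> carrier_mat (rdim R lam) (rdim R lam)" if "lam \<in> FW" for lam y
  proof -
    show "unitary_mat (rdim R lam) (?M lam y)" using ops(1,2)[OF that] unitary_repD(1)[OF lie irrepsD(1)[OF FW_dominant[OF that]]] by (intro unitary_mat_mult)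
    then show "?M lam y \<in> carrier_mat (rdim R lam) (rdim R lam)" by (rule unitary_matD)
  qed
  have c1: "continuous_on UNIV (twining_character R (\<tau> \<circ> \<kappa>) lam)"
    by (rule twining_character_continuous[OF lie_Out_comp[OF tau_Out kappa_Out] commutator_fixed(1)[OF lam]])
  have c2: "continuous_on UNIV (twining_character R (\<tau>' \<circ> \<kappa>') mu)"
    by (rule twining_character_continuous[OF lie_Out_comp[OF tau'_Out kappa'_Out] fixed_weights_comp[OF tau' kappa' k(4,5)]])
  have cf: "continuous_on UNIV ?f"
    by (intro continuous_intros continuous_on_compose2[OF c1] continuous_on_compose2[OF c2]) auto
  have c\<Phi>: "continuous_on UNIV ?\<Phi>" by (intro continuous_intros Phi_continuous)
  have s: "sets (m \<Otimes>\<^sub>M m) = sets borel" using sets_pair_measure_cong[OF sets_m sets_m] borel_prod by metis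
  have "(\<integral>z. ?f z \<partial>\<nu>) = (\<integral>z. ?f (?\<Phi> z) \<partial>(m \<Otimes>\<^sub>M m))"
    unfolding DH_double[OF riemannian compactG \<nu>]
    by (rule integral_distr) (simp_all add: measurable_cong_sets[OF s refl] borel_measurable_continuous_onI cf c\<Phi>)
  also have "\<dots> = (\<integral>y. \<integral>x. ?f (?\<Phi> (x, y)) \<partial>m \<partial>m)"
    by (rule integral_prod_continuous) (rule continuous_on_compose2[OF cf c\<Phi>], simp)
  also have "\<dots> = (\<integral>y. \<integral>x. mat_trace (?M lam y * rep R lam x) * cnj (mat_trace (?M mu y * rep R mu x)) \<partial>m \<partial>m)"
    by (simp only: fst_conv snd_conv twining_Phi1[OF lam] twining_Phi2[OF mu] dtrace_def)
  also have "\<dots> = (\<integral>y. (if lam = mu then of_real vol else 0) \<partial>m)"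
  proof (rule Bochner_Integration.integral_cong[OF refl])
    fix y
    show "(\<integral>x. mat_trace (?M lam y * rep R lam x) * cnj (mat_trace (?M mu y * rep R mu x)) \<partial>m) = (if lam = mu then of_real vol else 0)"
      using integral_trace_trace[OF l(1) k(1) M(2)[OF lam] M(2)[OF mu], of y y] unitary_matD(4)[OF M(1)[OF lam, of y]] dim_pos[OF lam]
      by (auto simp: mat_trace_one)
  qed
  also have "\<dots> = (if lam = mu then 1 else 0) * of_real (vol\<^sup>2)"
    by (simp add: power2_eq_square scaleR_conv_of_real)
  finally show ?thesis .
qed

end

theorem proposition2p12:
  fixes G :: "('g::{t2_space, second_countable_topology}, 'e::euclidean_space) lie_group"
    and P :: "'e pinning"
    and R :: "('g, 'e) irreps"
    and \<tau> \<kappa> :: "'g \<Rightarrow> 'g"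
    and m :: "'g measure"
    and \<nu>D :: "('g \<times> 'g) measure"
    and \<nu>F :: "'g measure"
  assumes "is_lie_group G"
    and "compact (UNIV :: 'g set)"
    and "connected (UNIV :: 'g set)"
    and "simply_connected (UNIV :: 'g set)"
    and "simple_lie_algebra G"
    and "Aut_invariant_inner G"
    and "is_pinning G P"
    and "is_irreps G P R"
    and "\<tau> \<in> lie_Out G P"
    and "\<kappa> \<in> lie_Out G P"
    and "riemannian_measure G m"
    and "DH_measure (prod_group G G) (map_prod (\<tau> \<circ> \<kappa>) (inv_into UNIV \<tau> \<circ> inv_into UNIV \<kappa>)) (twisted_double G \<tau> \<kappa>) \<nu>D"
    and "DH_measure G (\<tau> \<circ> \<kappa> \<circ> inv_into UNIV \<tau> \<circ> inv_into UNIV \<kappa>) (fused_double G \<tau> \<kappa>) \<nu>F"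
  shows "(\<forall>lam \<in> fixed_weights G P \<kappa> \<inter> fixed_weights G P \<tau>.
          \<forall>mu \<in> fixed_weights G P \<kappa> \<inter> fixed_weights G P \<tau>.
            (LINT (g, h)|\<nu>D.
               twining_character R (\<tau> \<circ> \<kappa>) lam g * twining_character R (inv_into UNIV \<tau> \<circ> inv_into UNIV \<kappa>) mu h)
            = (if lam = mu then 1 else 0) * of_real ((measure m UNIV)\<^sup>2)) \<and>
         (\<forall>lam \<in> fixed_weights G P \<kappa> \<inter> fixed_weights G P \<tau>.
            (LINT g|\<nu>F. twining_character R (\<tau> \<circ> \<kappa> \<circ> inv_into UNIV \<tau> \<circ> inv_into UNIV \<kappa>) lam g)
            = of_real ((measure m UNIV)\<^sup>2) / of_nat (rdim R lam))"
proof -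
  have lie: "liegroup G" using assms(1) by unfold_locales
  interpret dh G m P R \<tau> \<kappa>
    using assms liegroup.lie_Out_Aut[OF lie] by unfold_locales auto
  show ?thesis
    unfolding case_prod_beta' by (intro conjI ballI double_coefficient[OF _ _ assms(12)] fused_coefficient[OF _ assms(13)])
qed

end
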